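(* Let $\widehat{\mathbb{G}}$ be a discrete quantum group, dual to the compact quantum group $\mathbb{G}$. Then $\widehat{\mathbb{G}}$ has property $(\mathrm{T})$ if and only if the trivial representation $\varepsilon$ (the counit) is an isolated point of $\mathrm{Spec}(\mathrm{C}(\mathbb{G}_{\max}))$.
   Context: Conventions: $C^*$-algebras (other than multiplier algebras) and Hilbert spaces are separable, tensor products of $C^*$-algebras are spatial, representations are $*$-representations. $\mathbb{G}$ is a compact quantum group; $\mathrm{Pol}(\mathbb{G})$ is the Hopf $*$-algebra spanned by matrix elements of finite-dimensional corepresentations of $\mathbb{G}$, with comultiplication $\Delta$ and counit $\varepsilon$; $\mathrm{Irr}(\mathbb{G})$ is the set of classes of irreducible corepresentations and $u^\alpha=(u^\alpha_{i,j})\in M_{n_\alpha}(\mathbb{C})\otimes\mathrm{Pol}(\mathbb{G})$ is a fixed unitary representative of $\alpha$. $\mathrm{C}(\mathbb{G}_{\max})$ is the universal enveloping $C^*$-algebra of $\mathrm{Pol}(\mathbb{G})$; $\varepsilon$ extends to a character of it. $L^2(\mathbb{G})$ is the GNS space of the Haar state. The dual discrete quantum group $\widehat{\mathbb{G}}$ is given by $\mathrm{c}_0(\widehat{\mathbb{G}})=\bigoplus_\alpha M_{n_\alpha}(\mathbb{C})$, which acts on $L^2(\mathbb{G})=\bigoplus_\alpha H^\alpha$, $H^\alpha=\mathrm{span}\{u^\alpha_{i,j}\}$, by $e^\alpha_{i,j}u^\alpha_{r,l}=\delta_{j,l}u^\alpha_{r,i}$ (matrix units $e^\alpha_{i,j}$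 act as $0$ on $H^\beta$, $\beta\ne\alpha$). Its comultiplication $\widehat\Delta$ is determined by $(\widehat\Delta\otimes\mathrm{id})w=w_{23}w_{13}$, where $w=\bigoplus_\alpha u^\alpha\in\mathrm{M}(\mathrm{c}_0(\widehat{\mathbb{G}})\otimes\mathrm{C}(\mathbb{G}_{\max}))$. A (unitary) corepresentation of $\widehat{\mathbb{G}}$ on $H_V$ is a unitary $V\in\mathrm{M}(\mathrm{c}_0(\widehat{\mathbb{G}})\otimes\mathcal{K}(H_V))$ with $(\widehat\Delta\otimes\mathrm{id})V=V_{23}V_{13}$; these are exactly $V=(\mathrm{id}\otimes\pi_V)w$ for (unique) representations $\pi_V$ of $\mathrm{C}(\mathbb{G}_{\max})$ on $H_V$. Put $V^\alpha=(\mathrm{id}\otimes\pi_V)u^\alpha$. Property $(\mathrm{T})$ (Fima): for finite $E\subset\mathrm{Irr}(\mathbb{G})$ and $\delta>0$, a vector $\xi\in H_V$ is $(E,\delta)$-invariant if $\|V^\alpha(\eta\otimes\xi)-\eta\otimes\xi\|<\delta\|\eta\|\|\xi\|$ for all $\alpha\in E$ and all non-zero $\eta\in H^\alpha$. $V$ has almost invariant vectors if such $\xi$ exists for all $E,\delta$. A vector $\xi$ is invariant if $V^\alpha(\eta\otimes\xi)=\eta\otimes\xi$ for all $\alpha$, $\eta\in H^\alpha$. $\widehat{\mathbb{G}}$ has property $(\mathrm{T})$ if every corepresentation with almost invariant vectors has a non-zero invariant vector. Equivalently (a known fact): every representation $\pi:\mathrm{C}(\mathbb{G}_{\max})\to\mathrm{B}(H)$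 admitting unit vectors $\xi_n$ with $\|\pi(a)\xi_n-\varepsilon(a)\xi_n\|\to0$ for all $a\in\mathrm{C}(\mathbb{G}_{\max})$ admits a unit vector $\xi$ with $\pi(a)\xi=\varepsilon(a)\xi$ for all $a$. $\mathrm{Spec}(\mathrm{C}(\mathbb{G}_{\max}))$ is the set of equivalence classes of irreducible representations of $\mathrm{C}(\mathbb{G}_{\max})$ with the Jacobson topology. *)

theory Defs
  imports "HOL-Analysis.Analysis"
begin

section \<open>Complex star-algebras and C*-algebras\<close>

class complex_vector = ab_group_add +
  fixes scaleC :: "complex \<Rightarrow> 'a \<Rightarrow> 'a" (infixr \<open>*\<^sub>C\<close> 75)
  assumes scaleC_add_right: "c *\<^sub>C (x + y) = c *\<^sub>C x + c *\<^sub>C y"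
    and scaleC_add_left: "(c + d) *\<^sub>C x = c *\<^sub>C x + d *\<^sub>C x"
    and scaleC_scaleC: "c *\<^sub>C (d *\<^sub>C x) = (c * d) *\<^sub>C x"
    and scaleC_one: "1 *\<^sub>C x = x"

class complex_star_algebra = complex_vector + ring_1 +
  fixes star :: "'a \<Rightarrow> 'a"
  assumes mult_scaleC_left: "(c *\<^sub>C x) * y = c *\<^sub>C (x * y)"
    and mult_scaleC_right: "x * (c *\<^sub>C y) = c *\<^sub>C (x * y)"
    and star_add: "star (x + y) = star x + star y"
    and star_scaleC: "star (c *\<^sub>C x) = cnj c *\<^sub>C star x"
    and star_mult: "star (x * y) = star y * star x"
    and star_star: "star (star x) = x"

text \<open>Unital C*-algebras.\<close>

class cstar_algebra = complex_star_algebra + real_normed_algebra_1 + complete_space +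
  assumes scaleR_scaleC: "scaleR r x = complex_of_real r *\<^sub>C x"
    and norm_scaleC: "norm (c *\<^sub>C x) = cmod c * norm x"
    and cstar_identity: "norm (star x * x) = norm x ^ 2"

instantiation complex :: complex_vector
begin
definition scaleC_complex_def: "scaleC (c::complex) (x::complex) = c * x"
instance by standard (simp_all add: scaleC_complex_def algebra_simps)
end

definition clinear :: "('a::complex_vector \<Rightarrow> 'b::complex_vector) \<Rightarrow> bool" where
  "clinear f \<longleftrightarrow> (\<forall>x y. f (x + y) = f x + f y) \<and> (\<forall>c x. f (c *\<^sub>C x) = c *\<^sub>C f x)"

definition csubspace :: "'a::complex_vector set \<Rightarrow> bool" where
  "csubspace S \<longleftrightarrow>
     0 \<in> S \<and> (\<forall>x\<in>S. \<forall>y\<in>S. x + y \<in> S) \<and> (\<forall>c. \<forall>x\<in>S. c *\<^sub>C x \<in> S)"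

definition cspan :: "'a::complex_vector set \<Rightarrow> 'a set" where
  "cspan S = csubspace hull S"


section \<open>The Hilbert space of square-summable sequences\<close>

typedef ell2 = "{x :: nat \<Rightarrow> complex. summable (\<lambda>n. (cmod (x n))\<^sup>2)}"
  morphisms ell2_nth Abs_ell2
  by (rule exI[of _ "\<lambda>_. 0"]) simp

lemma ell2_summable: "summable (\<lambda>n. (cmod (ell2_nth x n))\<^sup>2)"
  using ell2_nth[of x] by simp

lemma ell2_eqI: "(\<And>n. ell2_nth x n = ell2_nth y n) \<Longrightarrow> x = y"
  by (metis ell2_nth_inject ext)

lemma ell2_nth_Abs:
  "summable (\<lambda>n. (cmod (f n))\<^sup>2) \<Longrightarrow> ell2_nth (Abs_ell2 f) = f"
  by (simp add: Abs_ell2_inverse)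

lemma cmod_mult_le_sq: "cmod a * cmod b \<le> (cmod a)\<^sup>2 + (cmod b)\<^sup>2"
proof -
  have "0 \<le> (cmod a - cmod b)\<^sup>2" by simp
  then have "2 * (cmod a * cmod b) \<le> (cmod a)\<^sup>2 + (cmod b)\<^sup>2"
    by (simp add: power2_diff algebra_simps)
  moreover have "0 \<le> cmod a * cmod b" by simp
  ultimately show ?thesis by linarith
qed

lemma cmod_add_sq: "(cmod (a + b))\<^sup>2 \<le> 2 * (cmod a)\<^sup>2 + 2 * (cmod b)\<^sup>2"
proof -
  have "(cmod (a + b))\<^sup>2 \<le> (cmod a + cmod b)\<^sup>2"
    by (simp add: norm_triangle_ineq power_mono)
  moreover have "0 \<le> (cmod a - cmod b)\<^sup>2" by simp
  ultimately show ?thesis by (simp add: power2_sum power2_diff)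
qed

lemma ell2_summable_add:
  assumes "summable (\<lambda>n. (cmod (f n))\<^sup>2)" "summable (\<lambda>n. (cmod (g n))\<^sup>2)"
  shows "summable (\<lambda>n. (cmod (f n + g n))\<^sup>2)"
proof (rule summable_comparison_test')
  show "summable (\<lambda>n. 2 * (cmod (f n))\<^sup>2 + 2 * (cmod (g n))\<^sup>2)"
    by (intro summable_add summable_mult assms)
  show "norm ((cmod (f n + g n))\<^sup>2) \<le> 2 * (cmod (f n))\<^sup>2 + 2 * (cmod (g n))\<^sup>2" if "n \<ge> 0" for n
    using cmod_add_sq by simp
qed

lemma ell2_summable_scale:
  assumes "summable (\<lambda>n. (cmod (f n))\<^sup>2)"
  shows "summable (\<lambda>n. (cmod (c * f n))\<^sup>2)"
  using summable_mult[OF assms, of "(cmod c)\<^sup>2"] by (simp add: norm_mult power_mult_distrib)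

instantiation ell2 :: complex_vector
begin
definition "0 = Abs_ell2 (\<lambda>_. 0)"
definition "x + y = Abs_ell2 (\<lambda>n. ell2_nth x n + ell2_nth y n)"
definition "- x = Abs_ell2 (\<lambda>n. - ell2_nth x n)"
definition "x - y = Abs_ell2 (\<lambda>n. ell2_nth x n - ell2_nth y n)"
definition "scaleC c x = Abs_ell2 (\<lambda>n. c * ell2_nth x n)"

lemma ell2_nth_zero [simp]: "ell2_nth 0 n = 0"
  unfolding zero_ell2_def by (subst ell2_nth_Abs) simp_all

lemma ell2_nth_add [simp]: "ell2_nth (x + y) n = ell2_nth x n + ell2_nth y n"
  unfolding plus_ell2_def by (subst ell2_nth_Abs) (simp_all add: ell2_summable_add ell2_summable)

lemma ell2_nth_uminus [simp]: "ell2_nth (- x) n = - ell2_nth x n"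
  unfolding uminus_ell2_def by (subst ell2_nth_Abs) (simp_all add: ell2_summable)

lemma ell2_nth_diff [simp]: "ell2_nth (x - y) n = ell2_nth x n - ell2_nth y n"
proof -
  have "summable (\<lambda>n. (cmod (ell2_nth x n + ell2_nth (- y) n))\<^sup>2)"
    by (rule ell2_summable_add) (rule ell2_summable)+
  then have "summable (\<lambda>n. (cmod (ell2_nth x n - ell2_nth y n))\<^sup>2)" by simp
  from ell2_nth_Abs[OF this] show ?thesis unfolding minus_ell2_def by simp
qed

lemma ell2_nth_scaleC [simp]: "ell2_nth (c *\<^sub>C x) n = c * ell2_nth x n"
  unfolding scaleC_ell2_def by (subst ell2_nth_Abs) (simp_all add: ell2_summable_scale ell2_summable)

instance
  by standard (rule ell2_eqI; simp add: algebra_simps)+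
end

text \<open>The inner product is conjugate-linear in the first variable.\<close>

definition cinner :: "ell2 \<Rightarrow> ell2 \<Rightarrow> complex" where
  "cinner x y = (\<Sum>n. cnj (ell2_nth x n) * ell2_nth y n)"

lemma summable_cinner: "summable (\<lambda>n. cnj (ell2_nth x n) * ell2_nth y n)"
proof (rule summable_norm_cancel, rule summable_comparison_test')
  show "summable (\<lambda>n. (cmod (ell2_nth x n))\<^sup>2 + (cmod (ell2_nth y n))\<^sup>2)"
    by (intro summable_add ell2_summable)
  show "norm (norm (cnj (ell2_nth x n) * ell2_nth y n))
      \<le> (cmod (ell2_nth x n))\<^sup>2 + (cmod (ell2_nth y n))\<^sup>2" if "n \<ge> 0" for n
    using cmod_mult_le_sq by (simp add: norm_mult)
qed

lemma cinner_add_left: "cinner (x + y) z = cinner x z + cinner y z"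
  unfolding cinner_def
  by (simp add: suminf_add[OF summable_cinner summable_cinner] distrib_left distrib_right)

lemma cinner_add_right: "cinner z (x + y) = cinner z x + cinner z y"
  unfolding cinner_def
  by (simp add: suminf_add[OF summable_cinner summable_cinner] distrib_left distrib_right)

lemma cinner_scaleC_right: "cinner x (c *\<^sub>C y) = c * cinner x y"
  unfolding cinner_def
  by (subst suminf_mult[OF summable_cinner, symmetric]) (simp add: mult_ac)

lemma cinner_scaleC_left: "cinner (c *\<^sub>C x) y = cnj c * cinner x y"
  unfolding cinner_def
  by (subst suminf_mult[OF summable_cinner, symmetric]) (simp add: mult_ac)

lemma cinner_commute: "cinner x y = cnj (cinner y x)"
proof -
  have "(\<lambda>n. cnj (cnj (ell2_nth y n) * ell2_nth x n)) sums cnj (cinner y x)"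
    unfolding cinner_def by (simp only: sums_cnj summable_sums summable_cinner)
  then show ?thesis unfolding cinner_def by (simp add: sums_iff mult.commute)
qed

lemma cinner_self: "cinner x x = complex_of_real (\<Sum>n. (cmod (ell2_nth x n))\<^sup>2)"
proof -
  have "(\<lambda>n. complex_of_real ((cmod (ell2_nth x n))\<^sup>2))
      sums complex_of_real (\<Sum>n. (cmod (ell2_nth x n))\<^sup>2)"
    by (intro sums_of_real summable_sums ell2_summable)
  moreover have "complex_of_real ((cmod z)\<^sup>2) = cnj z * z" for z
    by (subst complex_norm_square) (simp add: mult.commute)
  ultimately show ?thesis unfolding cinner_def by (simp add: sums_iff)
qed

instantiation ell2 :: real_vector
begin
definition "scaleR r (x::ell2) = complex_of_real r *\<^sub>C x"
instance
  unfolding scaleR_ell2_def by standard (rule ell2_eqI; simp add: scaleR_ell2_def algebra_simps)+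
end

instantiation ell2 :: real_inner
begin
definition "inner x y = Re (cinner x y)"
definition "norm (x::ell2) = sqrt (inner x x)"
definition "dist x y = norm (x - y :: ell2)"
definition "sgn (x::ell2) = x /\<^sub>R norm x"
definition "(uniformity :: (ell2 \<times> ell2) filter) =
  (INF e\<in>{0 <..}. principal {(x, y). dist x y < e})"
definition "open U \<longleftrightarrow> (\<forall>x\<in>U. eventually (\<lambda>(x', y). x' = x \<longrightarrow> y \<in> U) (uniformity :: (ell2 \<times> ell2) filter))"

instance
proof
  fix x y z :: ell2 and r :: real
  show "inner x y = inner y x"
    unfolding inner_ell2_def by (subst cinner_commute) simp
  show "inner (x + y) z = inner x z + inner y z"
    unfolding inner_ell2_def by (simp add: cinner_add_left)
  show "inner (r *\<^sub>R x) y = r * inner x y"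
    unfolding inner_ell2_def scaleR_ell2_def by (simp add: cinner_scaleC_left)
  show "0 \<le> inner x x"
    unfolding inner_ell2_def cinner_self by (simp add: suminf_nonneg[OF ell2_summable])
  show "inner x x = 0 \<longleftrightarrow> x = 0"
  proof
    assume "inner x x = 0"
    then have "(\<Sum>n. (cmod (ell2_nth x n))\<^sup>2) = 0"
      unfolding inner_ell2_def cinner_self by simp
    then have "\<forall>n. (cmod (ell2_nth x n))\<^sup>2 = 0"
      using suminf_eq_zero_iff[OF ell2_summable, of x] by simp
    then show "x = 0" by (intro ell2_eqI) simp
  next
    assume "x = 0" then show "inner x x = 0"
      unfolding inner_ell2_def cinner_self by simp
  qed
qed (simp_all add: dist_ell2_def norm_ell2_def sgn_ell2_def uniformity_ell2_def open_ell2_def)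
end

lemma ell2_norm_sq: "(norm x)\<^sup>2 = (\<Sum>n. (cmod (ell2_nth x n))\<^sup>2)"
proof -
  have "(norm x)\<^sup>2 = inner x x" by (simp add: power2_norm_eq_inner)
  then show ?thesis unfolding inner_ell2_def cinner_self by simp
qed

lemma ell2_partial_le: "(\<Sum>n<M. (cmod (ell2_nth x n))\<^sup>2) \<le> (norm x)\<^sup>2"
  unfolding ell2_norm_sq by (rule sum_le_suminf[OF ell2_summable]) simp_all

lemma ell2_nth_le: "cmod (ell2_nth x n) \<le> norm x"
proof -
  have "(cmod (ell2_nth x n))\<^sup>2 \<le> (\<Sum>k<Suc n. (cmod (ell2_nth x k))\<^sup>2)"
    by (simp add: sum_nonneg)
  also have "\<dots> \<le> (norm x)\<^sup>2" by (rule ell2_partial_le)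
  finally show ?thesis by (simp add: power2_le_iff_abs_le)
qed

instance ell2 :: complete_space
proof
  fix X :: "nat \<Rightarrow> ell2" assume C: "Cauchy X"
  have "Cauchy (\<lambda>k. ell2_nth (X k) n)" for n
  proof (rule metric_CauchyI)
    fix e :: real assume "e > 0"
    then obtain N where N: "\<forall>m\<ge>N. \<forall>k\<ge>N. dist (X m) (X k) < e"
      using C unfolding Cauchy_def by blast
    have "dist (ell2_nth (X m) n) (ell2_nth (X k) n) \<le> dist (X m) (X k)" for m k
      using ell2_nth_le[of "X m - X k" n] by (simp add: dist_norm)
    then show "\<exists>N. \<forall>m\<ge>N. \<forall>k\<ge>N. dist (ell2_nth (X m) n) (ell2_nth (X k) n) < e"
      using N by (meson le_less_trans)
  qed
  then have "\<forall>n. \<exists>l. (\<lambda>k. ell2_nth (X k) n) \<longlonglongrightarrow> l"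
    using Cauchy_convergent convergent_def by blast
  then obtain l where l: "\<And>n. (\<lambda>k. ell2_nth (X k) n) \<longlonglongrightarrow> l n" by metis
  have part: "\<exists>N. \<forall>m\<ge>N. \<forall>M. (\<Sum>n<M. (cmod (ell2_nth (X m) n - l n))\<^sup>2) \<le> e\<^sup>2" if "e > 0" for e
  proof -
    obtain N where N: "\<forall>m\<ge>N. \<forall>k\<ge>N. dist (X m) (X k) < e"
      using C \<open>e > 0\<close> unfolding Cauchy_def by blast
    have "(\<Sum>n<M. (cmod (ell2_nth (X m) n - l n))\<^sup>2) \<le> e\<^sup>2" if "m \<ge> N" for m M
    proof (rule LIMSEQ_le_const2)
      show "(\<lambda>k. \<Sum>n<M. (cmod (ell2_nth (X m) n - ell2_nth (X k) n))\<^sup>2)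
          \<longlonglongrightarrow> (\<Sum>n<M. (cmod (ell2_nth (X m) n - l n))\<^sup>2)"
        by (intro tendsto_intros l)
      have "(\<Sum>n<M. (cmod (ell2_nth (X m) n - ell2_nth (X k) n))\<^sup>2) \<le> e\<^sup>2" if "k \<ge> N" for k
      proof -
        have "(\<Sum>n<M. (cmod (ell2_nth (X m) n - ell2_nth (X k) n))\<^sup>2) \<le> (norm (X m - X k))\<^sup>2"
          using ell2_partial_le[where x = "X m - X k"] by simp
        also have "\<dots> \<le> e\<^sup>2"
          using N \<open>m \<ge> N\<close> \<open>k \<ge> N\<close> by (intro power_mono) (auto simp: dist_norm less_imp_le)
        finally show ?thesis .
      qed
      then show "\<exists>K. \<forall>k\<ge>K. (\<Sum>n<M. (cmod (ell2_nth (X m) n - ell2_nth (X k) n))\<^sup>2) \<le> e\<^sup>2"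
        by blast
    qed
    then show ?thesis by blast
  qed
  have sm: "summable (\<lambda>n. (cmod (ell2_nth (X m) n - l n))\<^sup>2)"
    if "\<forall>M. (\<Sum>n<M. (cmod (ell2_nth (X m) n - l n))\<^sup>2) \<le> B" for m B
    using that by (intro summableI_nonneg_bounded[where x = B]) auto
  obtain N1 where "\<forall>m\<ge>N1. \<forall>M. (\<Sum>n<M. (cmod (ell2_nth (X m) n - l n))\<^sup>2) \<le> 1\<^sup>2"
    using part[of 1] by auto
  then have "summable (\<lambda>n. (cmod (ell2_nth (X N1) n - l n))\<^sup>2)" using sm by blast
  then have "summable (\<lambda>n. (cmod (l n - ell2_nth (X N1) n))\<^sup>2)"
    by (simp add: norm_minus_commute)
  from ell2_summable_add[OF this ell2_summable[of "X N1"]]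
  have "summable (\<lambda>n. (cmod (l n))\<^sup>2)" by simp
  from ell2_nth_Abs[OF this] obtain L where L: "ell2_nth L = l" by blast
  have "X \<longlonglongrightarrow> L"
  proof (rule metric_LIMSEQ_I)
    fix e :: real assume "e > 0"
    then obtain N where N: "\<forall>m\<ge>N. \<forall>M. (\<Sum>n<M. (cmod (ell2_nth (X m) n - l n))\<^sup>2) \<le> (e/2)\<^sup>2"
      using part[of "e/2"] by auto
    have "dist (X m) L < e" if "m \<ge> N" for m
    proof -
      have "(norm (X m - L))\<^sup>2 \<le> (e/2)\<^sup>2"
        unfolding ell2_norm_sq using N \<open>m \<ge> N\<close>
        by (intro suminf_le_const[OF ell2_summable]) (auto simp: L)
      then have "norm (X m - L) \<le> e/2"
        using \<open>e > 0\<close> by (simp add: power2_le_iff_abs_le)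
      then show ?thesis using \<open>e > 0\<close> by (simp add: dist_norm)
    qed
    then show "\<exists>N. \<forall>m\<ge>N. dist (X m) L < e" by blast
  qed
  then show "convergent X" by (auto simp: convergent_def)
qed

definition ell2_e0 :: ell2 where
  "ell2_e0 = Abs_ell2 (\<lambda>n. if n = 0 then 1 else 0)"


section \<open>Representations\<close>

text \<open>
  Every separable Hilbert space is unitarily isomorphic to a closed subspace of ell2, so closed
  subspaces of ell2 serve as the separable Hilbert spaces. An operator on such a subspace H is
  given by a function on ell2 of which only the values on H matter.
\<close>

definition hilbert_subspace :: "ell2 set \<Rightarrow> bool" where
  "hilbert_subspace H \<longleftrightarrow> csubspace H \<and> closed H"

definition bounded_operator_on :: "ell2 set \<Rightarrow> (ell2 \<Rightarrow> ell2) \<Rightarrow> bool" where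
  "bounded_operator_on H T \<longleftrightarrow>
     (\<forall>\<xi>\<in>H. T \<xi> \<in> H) \<and>
     (\<forall>\<xi>\<in>H. \<forall>\<zeta>\<in>H. T (\<xi> + \<zeta>) = T \<xi> + T \<zeta>) \<and>
     (\<forall>c. \<forall>\<xi>\<in>H. T (c *\<^sub>C \<xi>) = c *\<^sub>C T \<xi>) \<and>
     (\<exists>K. \<forall>\<xi>\<in>H. norm (T \<xi>) \<le> K * norm \<xi>)"

text \<open>Unital star-representations by bounded operators.\<close>

definition star_rep :: "ell2 set \<Rightarrow> ('a::complex_star_algebra \<Rightarrow> ell2 \<Rightarrow> ell2) \<Rightarrow> bool" where
  "star_rep H \<pi> \<longleftrightarrow>
     hilbert_subspace H \<and>
     (\<forall>x. bounded_operator_on H (\<pi> x)) \<and>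
     (\<forall>\<xi>\<in>H.
        \<pi> 1 \<xi> = \<xi> \<and>
        (\<forall>x y. \<pi> (x + y) \<xi> = \<pi> x \<xi> + \<pi> y \<xi>) \<and>
        (\<forall>c x. \<pi> (c *\<^sub>C x) \<xi> = c *\<^sub>C \<pi> x \<xi>) \<and>
        (\<forall>x y. \<pi> (x * y) \<xi> = \<pi> x (\<pi> y \<xi>)) \<and>
        (\<forall>\<zeta>\<in>H. \<forall>x. cinner (\<pi> (star x) \<xi>) \<zeta> = cinner \<xi> (\<pi> x \<zeta>)))"

definition irreducible_rep :: "ell2 set \<Rightarrow> ('a::complex_star_algebra \<Rightarrow> ell2 \<Rightarrow> ell2) \<Rightarrow> bool" where
  "irreducible_rep H \<pi> \<longleftrightarrow>
     star_rep H \<pi> \<and> H \<noteq> {0} \<and>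
     (\<forall>K. hilbert_subspace K \<and> K \<subseteq> H \<and> (\<forall>x. \<forall>\<xi>\<in>K. \<pi> x \<xi> \<in> K) \<longrightarrow> K = {0} \<or> K = H)"

definition unitarily_equivalent ::
  "ell2 set \<Rightarrow> ('a \<Rightarrow> ell2 \<Rightarrow> ell2) \<Rightarrow> ell2 set \<Rightarrow> ('a \<Rightarrow> ell2 \<Rightarrow> ell2) \<Rightarrow> bool" where
  "unitarily_equivalent H \<pi> K \<rho> \<longleftrightarrow>
     (\<exists>U. bij_betw U H K \<and>
        (\<forall>\<xi>\<in>H. \<forall>\<zeta>\<in>H. U (\<xi> + \<zeta>) = U \<xi> + U \<zeta>) \<and>
        (\<forall>c. \<forall>\<xi>\<in>H. U (c *\<^sub>C \<xi>) = c *\<^sub>C U \<xi>) \<and>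
        (\<forall>\<xi>\<in>H. \<forall>\<zeta>\<in>H. cinner (U \<xi>) (U \<zeta>) = cinner \<xi> \<zeta>) \<and>
        (\<forall>x. \<forall>\<xi>\<in>H. U (\<pi> x \<xi>) = \<rho> x (U \<xi>)))"

definition rep_kernel :: "ell2 set \<Rightarrow> ('a \<Rightarrow> ell2 \<Rightarrow> ell2) \<Rightarrow> 'a set" where
  "rep_kernel H \<pi> = {x. \<forall>\<xi>\<in>H. \<pi> x \<xi> = 0}"


section \<open>The spectrum of a separable C*-algebra\<close>

type_synonym 'c rep = "ell2 set \<times> ('c \<Rightarrow> ell2 \<Rightarrow> ell2)"

definition irreps :: "'c::cstar_algebra rep set" where
  "irreps = {(H, \<pi>). irreducible_rep H \<pi>}"

definition irrep_equiv :: "('c::cstar_algebra rep \<times> 'c rep) set" where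
  "irrep_equiv = {((H, \<pi>), (K, \<rho>)).
     irreducible_rep H \<pi> \<and> irreducible_rep K \<rho> \<and> unitarily_equivalent H \<pi> K \<rho>}"

definition spectrum :: "'c::cstar_algebra rep set set" where
  "spectrum = irreps // irrep_equiv"

text \<open>All representations in a point of the spectrum have the same kernel.\<close>

definition point_kernel :: "'c::cstar_algebra rep set \<Rightarrow> 'c set" where
  "point_kernel C = (\<Inter>(H, \<pi>)\<in>C. rep_kernel H \<pi>)"

text \<open>
  The Jacobson (hull-kernel) topology: the closure of S consists of the points whose kernel
  contains the intersection of the kernels of all points of S.
\<close>

definition jacobson_closure :: "'c::cstar_algebra rep set set \<Rightarrow> 'c rep set set" where
  "jacobson_closure S = {C \<in> spectrum. (\<Inter>D\<in>S. point_kernel D) \<subseteq> point_kernel C}"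

definition jacobson_open :: "'c::cstar_algebra rep set set \<Rightarrow> bool" where
  "jacobson_open U \<longleftrightarrow> U \<subseteq> spectrum \<and> jacobson_closure (spectrum - U) = spectrum - U"

definition jacobson_topology :: "'c::cstar_algebra rep set topology" where
  "jacobson_topology = topology jacobson_open"

lemma scaleC_minus_one: "(-1) *\<^sub>C (x::'a::complex_vector) = - x"
proof -
  have "0 *\<^sub>C x + 0 *\<^sub>C x = 0 *\<^sub>C x" by (simp flip: scaleC_add_left)
  then have "0 *\<^sub>C x = 0" by simp
  moreover have "(-1) *\<^sub>C x + x = ((-1) + 1) *\<^sub>C x"
    by (simp only: scaleC_add_left scaleC_one)
  ultimately show ?thesis by (simp add: eq_neg_iff_add_eq_0)
qed

lemma rep_kernel_ideal:
  assumes "star_rep H \<pi>" "x \<in> rep_kernel H \<pi>"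
  shows "x * y \<in> rep_kernel H \<pi>" "y * x \<in> rep_kernel H \<pi>"
proof -
  have H: "0 \<in> H" and op: "\<And>z \<xi>. \<xi> \<in> H \<Longrightarrow> \<pi> z \<xi> \<in> H"
    and mult: "\<And>z w \<xi>. \<xi> \<in> H \<Longrightarrow> \<pi> (z * w) \<xi> = \<pi> z (\<pi> w \<xi>)"
    and add: "\<And>z. \<pi> z (0 + 0) = \<pi> z 0 + \<pi> z 0"
    using assms(1)
    unfolding star_rep_def hilbert_subspace_def csubspace_def bounded_operator_on_def by blast+
  have "\<pi> y 0 = 0" using add[of y] by simp
  then show "x * y \<in> rep_kernel H \<pi>" "y * x \<in> rep_kernel H \<pi>"
    using assms(2) by (simp_all add: rep_kernel_def op mult)
qed

lemma rep_kernel_prime: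
  assumes irr: "irreducible_rep H \<pi>" and ideal: "\<And>x y. x \<in> I \<Longrightarrow> x * y \<in> I"
    and J: "\<And>x y. x \<in> J \<Longrightarrow> y * x \<in> J"
    and sub: "I \<inter> J \<subseteq> rep_kernel H \<pi>"
  shows "I \<subseteq> rep_kernel H \<pi> \<or> J \<subseteq> rep_kernel H \<pi>"
proof (rule ccontr)
  assume neg: "\<not> ?thesis"
  have rep: "star_rep H \<pi>" using irr by (simp add: irreducible_rep_def)
  then have cs: "csubspace H" and cl: "closed H" and bo: "\<And>x. bounded_operator_on H (\<pi> x)"
    and mult: "\<And>z w \<xi>. \<xi> \<in> H \<Longrightarrow> \<pi> (z * w) \<xi> = \<pi> z (\<pi> w \<xi>)"
    unfolding star_rep_def hilbert_subspace_def by blast+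
  have inH: "\<And>x \<xi>. \<xi> \<in> H \<Longrightarrow> \<pi> x \<xi> \<in> H"
    and add: "\<And>x \<xi> \<zeta>. \<xi> \<in> H \<Longrightarrow> \<zeta> \<in> H \<Longrightarrow> \<pi> x (\<xi> + \<zeta>) = \<pi> x \<xi> + \<pi> x \<zeta>"
    and scale: "\<And>x c \<xi>. \<xi> \<in> H \<Longrightarrow> \<pi> x (c *\<^sub>C \<xi>) = c *\<^sub>C \<pi> x \<xi>"
    using bo unfolding bounded_operator_on_def by blast+
  have H0: "0 \<in> H" and Hadd: "\<And>\<xi> \<zeta>. \<xi> \<in> H \<Longrightarrow> \<zeta> \<in> H \<Longrightarrow> \<xi> + \<zeta> \<in> H"
    and Hsc: "\<And>c \<xi>. \<xi> \<in> H \<Longrightarrow> c *\<^sub>C \<xi> \<in> H"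
    using cs unfolding csubspace_def by blast+
  have sc0: "c *\<^sub>C (0::ell2) = 0" for c by (rule ell2_eqI) simp
  have zero: "\<pi> x 0 = 0" for x using add[OF H0 H0, of x] by simp
  define K where "K = {\<zeta> \<in> H. \<forall>x\<in>I. \<pi> x \<zeta> = 0}"
  have "closed K"
  proof (rule closed_sequential_limits[THEN iffD2], intro allI impI)
    fix X :: "nat \<Rightarrow> ell2" and l assume "(\<forall>n. X n \<in> K) \<and> X \<longlonglongrightarrow> l"
    then have X: "\<And>n. X n \<in> K" and lim: "X \<longlonglongrightarrow> l" by auto
    then have XH: "\<And>n. X n \<in> H" by (auto simp: K_def)
    then have lH: "l \<in> H" using cl lim closed_sequentially by blast
    have "\<pi> x l = 0" if "x \<in> I" for x
    proof -
      obtain B where B: "\<And>\<xi>. \<xi> \<in> H \<Longrightarrow> norm (\<pi> x \<xi>) \<le> B * norm \<xi>"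
        using bo[of x] unfolding bounded_operator_on_def by blast
      have "norm (\<pi> x l) \<le> B * norm (l - X n)" for n
      proof -
        have mem: "l - X n \<in> H"
          using Hadd[OF lH Hsc[OF XH, of "-1" n]] by (simp add: scaleC_minus_one)
        have "\<pi> x l = \<pi> x ((l - X n) + X n)" by simp
        also have "\<dots> = \<pi> x (l - X n) + \<pi> x (X n)" by (rule add[OF mem XH])
        also have "\<pi> x (X n) = 0" using X[of n] \<open>x \<in> I\<close> by (simp add: K_def)
        finally show ?thesis using B[OF mem] by simp
      qed
      moreover have "(\<lambda>n. B * norm (l - X n)) \<longlonglongrightarrow> B * norm (l - l)"
        by (intro tendsto_intros lim)
      ultimately have "norm (\<pi> x l) \<le> B * norm (l - l)"
        by (intro LIMSEQ_le_const) auto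
      then show ?thesis by simp
    qed
    then show "l \<in> K" using lH by (simp add: K_def)
  qed
  moreover have "csubspace K"
    unfolding csubspace_def K_def by (auto simp: H0 zero Hadd add Hsc scale sc0)
  moreover have "\<forall>x. \<forall>\<xi>\<in>K. \<pi> x \<xi> \<in> K"
  proof (intro allI ballI)
    fix x \<xi> assume \<xi>: "\<xi> \<in> K"
    then have "\<pi> y (\<pi> x \<xi>) = 0" if "y \<in> I" for y
      using ideal[OF that, of x] mult[of \<xi> y x] by (simp add: K_def)
    then show "\<pi> x \<xi> \<in> K" using \<xi> by (simp add: K_def inH)
  qed
  moreover have "K \<subseteq> H" by (auto simp: K_def)
  ultimately have "K = {0} \<or> K = H"
    using irr unfolding irreducible_rep_def hilbert_subspace_def by blast
  moreover obtain j \<xi> where j: "j \<in> J" "\<xi> \<in> H" "\<pi> j \<xi> \<noteq> 0"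
    using neg by (auto simp: rep_kernel_def)
  have "\<pi> x (\<pi> j \<xi>) = 0" if "x \<in> I" for x
  proof -
    have "x * j \<in> rep_kernel H \<pi>" using sub ideal J that j(1) by blast
    then show ?thesis using j(2) by (simp add: rep_kernel_def mult)
  qed
  then have "\<pi> j \<xi> \<in> K" using j inH by (simp add: K_def)
  ultimately have "K = H" using j(3) by blast
  then have "I \<subseteq> rep_kernel H \<pi>" by (auto simp: K_def rep_kernel_def)
  then show False using neg by blast
qed

lemma unitarily_equivalent_refl: "unitarily_equivalent H \<pi> H \<pi>"
  unfolding unitarily_equivalent_def by (rule exI[of _ "\<lambda>\<xi>. \<xi>"]) (simp add: bij_betw_def)

lemma unitarily_equivalent_kernel:
  assumes "star_rep H \<pi>" "star_rep K \<rho>" "unitarily_equivalent H \<pi> K \<rho>"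
  shows "rep_kernel H \<pi> = rep_kernel K \<rho>"
proof -
  obtain U where U: "bij_betw U H K"
    and add: "\<And>\<xi> \<zeta>. \<xi> \<in> H \<Longrightarrow> \<zeta> \<in> H \<Longrightarrow> U (\<xi> + \<zeta>) = U \<xi> + U \<zeta>"
    and tw: "\<And>x \<xi>. \<xi> \<in> H \<Longrightarrow> U (\<pi> x \<xi>) = \<rho> x (U \<xi>)"
    using assms(3) unfolding unitarily_equivalent_def by blast
  have H0: "0 \<in> H" and inH: "\<And>x \<xi>. \<xi> \<in> H \<Longrightarrow> \<pi> x \<xi> \<in> H"
    using assms(1)
    unfolding star_rep_def hilbert_subspace_def csubspace_def bounded_operator_on_def by blast+
  have U0: "U 0 = 0" using add[OF H0 H0] by simp
  have "\<pi> x \<xi> = 0 \<longleftrightarrow> \<rho> x (U \<xi>) = 0" if "\<xi> \<in> H" for x \<xi>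
    using inj_on_eq_iff[OF bij_betw_imp_inj_on[OF U] inH[OF that, of x] H0] tw[OF that, of x] U0
    by simp
  moreover have "K = U ` H" using U by (simp add: bij_betw_def)
  ultimately show ?thesis by (auto simp: rep_kernel_def)
qed

lemma spectrum_point:
  assumes "C \<in> spectrum"
  obtains H \<pi> where "irreducible_rep H \<pi>" "(H, \<pi>) \<in> C" "point_kernel C = rep_kernel H \<pi>"
proof -
  obtain H \<pi> where irr: "irreducible_rep H \<pi>" and C: "C = irrep_equiv `` {(H, \<pi>)}"
    using assms by (auto simp: spectrum_def quotient_def irreps_def)
  have mem: "(H, \<pi>) \<in> C"
    using irr by (simp add: C irrep_equiv_def unitarily_equivalent_refl)
  have "rep_kernel K \<rho> = rep_kernel H \<pi>" if "(K, \<rho>) \<in> C" for K \<rho>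
    using that irr unitarily_equivalent_kernel[of H \<pi> K \<rho>]
    by (auto simp: C irrep_equiv_def irreducible_rep_def)
  then have "point_kernel C = rep_kernel H \<pi>"
    using mem unfolding point_kernel_def by blast
  then show ?thesis using that irr mem by blast
qed

lemma point_kernel_ideal:
  assumes "C \<in> spectrum" "x \<in> point_kernel C"
  shows "x * y \<in> point_kernel C" "y * x \<in> point_kernel C"
proof -
  obtain H \<pi> where irr: "irreducible_rep H \<pi>" and k: "point_kernel C = rep_kernel H \<pi>"
    by (rule spectrum_point[OF assms(1)])
  then have "star_rep H \<pi>" by (simp add: irreducible_rep_def)
  from rep_kernel_ideal[OF this] assms(2) show "x * y \<in> point_kernel C" "y * x \<in> point_kernel C"
    by (simp_all add: k)
qed

lemma jacobson_closure_subset: "S \<subseteq> spectrum \<Longrightarrow> S \<subseteq> jacobson_closure S"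
  unfolding jacobson_closure_def by blast

lemma istopology_jacobson: "istopology (jacobson_open :: 'c::cstar_algebra rep set set \<Rightarrow> bool)"
  unfolding istopology_def
proof (intro conjI allI impI)
  fix U V :: "'c rep set set" assume U: "jacobson_open U" and V: "jacobson_open V"
  define I where "I = (\<Inter>D\<in>spectrum - U. point_kernel D)"
  define J where "J = (\<Inter>D\<in>spectrum - V. point_kernel D)"
  have "C \<in> spectrum - (U \<inter> V)" if C: "C \<in> jacobson_closure (spectrum - (U \<inter> V))" for C
  proof -
    have Cs: "C \<in> spectrum" using C by (simp add: jacobson_closure_def)
    obtain H \<pi> where irr: "irreducible_rep H \<pi>" and k: "point_kernel C = rep_kernel H \<pi>"
      by (rule spectrum_point[OF Cs])
    have sub: "I \<inter> J \<subseteq> rep_kernel H \<pi>"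
      using C unfolding k[symmetric] jacobson_closure_def I_def J_def by blast
    have "I \<subseteq> point_kernel C \<or> J \<subseteq> point_kernel C"
      unfolding k
    proof (rule rep_kernel_prime[OF irr])
      show "x * y \<in> I" if "x \<in> I" for x y
        using that point_kernel_ideal(1) unfolding I_def by blast
      show "y * x \<in> J" if "x \<in> J" for x y
        using that point_kernel_ideal(2) unfolding J_def by blast
    qed (rule sub)
    then have "C \<in> jacobson_closure (spectrum - U) \<or> C \<in> jacobson_closure (spectrum - V)"
      using Cs by (simp add: jacobson_closure_def I_def J_def)
    then show ?thesis using U V unfolding jacobson_open_def by blast
  qed
  moreover have "spectrum - (U \<inter> V) \<subseteq> jacobson_closure (spectrum - (U \<inter> V))"
    by (rule jacobson_closure_subset) blast
  moreover have "U \<inter> V \<subseteq> spectrum" using U unfolding jacobson_open_def by blast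
  ultimately show "jacobson_open (U \<inter> V)" unfolding jacobson_open_def by blast
next
  fix \<U> :: "'c rep set set set" assume *: "\<forall>U\<in>\<U>. jacobson_open U"
  have "C \<in> spectrum - \<Union>\<U>" if C: "C \<in> jacobson_closure (spectrum - \<Union>\<U>)" for C
  proof -
    have "C \<in> jacobson_closure (spectrum - U)" if "U \<in> \<U>" for U
      using C that unfolding jacobson_closure_def by blast
    then have "C \<in> spectrum - U" if "U \<in> \<U>" for U
      using * that unfolding jacobson_open_def by blast
    then show ?thesis using C unfolding jacobson_closure_def by blast
  qed
  moreover have "spectrum - \<Union>\<U> \<subseteq> jacobson_closure (spectrum - \<Union>\<U>)"
    by (rule jacobson_closure_subset) blast
  moreover have "\<Union>\<U> \<subseteq> spectrum" using * unfolding jacobson_open_def by blast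
  ultimately show "jacobson_open (\<Union>\<U>)" unfolding jacobson_open_def by blast
qed

lemma openin_jacobson: "openin jacobson_topology = jacobson_open"
  unfolding jacobson_topology_def using istopology_jacobson by (rule topology_inverse')


section \<open>Compact quantum groups\<close>

text \<open>
  An element of the algebraic tensor square of a complex vector space is written as a finite list
  of pairs, standing for the sum of the corresponding elementary tensors. Two lists represent the
  same tensor iff every bilinear form takes the same value on them.
\<close>

definition sweedler :: "('a \<Rightarrow> 'a \<Rightarrow> 'b::comm_monoid_add) \<Rightarrow> ('a \<times> 'a) list \<Rightarrow> 'b" where
  "sweedler f t = (\<Sum>(x, y)\<leftarrow>t. f x y)"

definition bilinear_form :: "('a::complex_vector \<Rightarrow> 'a \<Rightarrow> complex) \<Rightarrow> bool" where
  "bilinear_form B \<longleftrightarrow> (\<forall>x. clinear (B x)) \<and> (\<forall>y. clinear (\<lambda>x. B x y))"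

definition trilinear_form :: "('a::complex_vector \<Rightarrow> 'a \<Rightarrow> 'a \<Rightarrow> complex) \<Rightarrow> bool" where
  "trilinear_form T \<longleftrightarrow>
     (\<forall>x. bilinear_form (T x)) \<and> (\<forall>y z. clinear (\<lambda>x. T x y z))"

definition tensor_eq :: "('a::complex_vector \<times> 'a) list \<Rightarrow> ('a \<times> 'a) list \<Rightarrow> bool"
    (infix \<open>=\<^sub>\<otimes>\<close> 50) where
  "s =\<^sub>\<otimes> t \<longleftrightarrow> (\<forall>B. bilinear_form B \<longrightarrow> sweedler B s = sweedler B t)"

text \<open>
  An n-dimensional corepresentation is an n by n matrix v with
  comult (v i j) = (SUM k<n. v i k tensor v k j); only the entries with indices below n matter.
\<close>

definition unitary_corep ::
  "('a::complex_star_algebra \<Rightarrow> ('a \<times> 'a) list) \<Rightarrow> nat \<Rightarrow> (nat \<Rightarrow> nat \<Rightarrow> 'a) \<Rightarrow> bool" where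
  "unitary_corep comult n v \<longleftrightarrow>
     (\<forall>i<n. \<forall>j<n. comult (v i j) =\<^sub>\<otimes> map (\<lambda>k. (v i k, v k j)) [0..<n]) \<and>
     (\<forall>i<n. \<forall>j<n. (\<Sum>k<n. star (v k i) * v k j) = (if i = j then 1 else 0)) \<and>
     (\<forall>i<n. \<forall>j<n. (\<Sum>k<n. v i k * star (v j k)) = (if i = j then 1 else 0))"

text \<open>
  A compact quantum group is presented by its Hopf star-algebra Pol(G), which is spanned by the
  matrix elements of finite-dimensional unitary corepresentations, together with its Haar state.
\<close>

locale compact_quantum_group =
  fixes comult :: "'a::complex_star_algebra \<Rightarrow> ('a \<times> 'a) list"
    and counit :: "'a \<Rightarrow> complex"
    and antipode :: "'a \<Rightarrow> 'a"
    and haar :: "'a \<Rightarrow> complex"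
  assumes comult_add: "comult (x + y) =\<^sub>\<otimes> comult x @ comult y"
    and comult_scaleC: "comult (c *\<^sub>C x) =\<^sub>\<otimes> map (\<lambda>(a, b). (c *\<^sub>C a, b)) (comult x)"
    and comult_one: "comult 1 =\<^sub>\<otimes> [(1, 1)]"
    and comult_mult:
      "comult (x * y) =\<^sub>\<otimes> [(a * a', b * b'). (a, b) \<leftarrow> comult x, (a', b') \<leftarrow> comult y]"
    and comult_star: "comult (star x) =\<^sub>\<otimes> map (\<lambda>(a, b). (star a, star b)) (comult x)"
    and coassoc: "trilinear_form T \<Longrightarrow>
      sweedler (\<lambda>a b. sweedler (\<lambda>a1 a2. T a1 a2 b) (comult a)) (comult x) =
      sweedler (\<lambda>a b. sweedler (\<lambda>b1 b2. T a b1 b2) (comult b)) (comult x)"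
    and counit_linear: "clinear counit"
    and counit_one: "counit 1 = 1"
    and counit_mult: "counit (x * y) = counit x * counit y"
    and counit_left: "sweedler (\<lambda>a b. counit a *\<^sub>C b) (comult x) = x"
    and counit_right: "sweedler (\<lambda>a b. counit b *\<^sub>C a) (comult x) = x"
    and antipode_linear: "clinear antipode"
    and antipode_left: "sweedler (\<lambda>a b. antipode a * b) (comult x) = counit x *\<^sub>C 1"
    and antipode_right: "sweedler (\<lambda>a b. a * antipode b) (comult x) = counit x *\<^sub>C 1"
    and spanned: "cspan {v i j |n v i j. unitary_corep comult n v \<and> i < n \<and> j < n} = UNIV"
    and haar_linear: "clinear haar"
    and haar_one: "haar 1 = 1"
    and haar_positive: "haar (star x * x) \<in> \<real>\<^sub>\<ge>\<^sub>0"
    and haar_left_invariant: "sweedler (\<lambda>a b. haar b *\<^sub>C a) (comult x) = haar x *\<^sub>C 1"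
    and haar_right_invariant: "sweedler (\<lambda>a b. haar a *\<^sub>C b) (comult x) = haar x *\<^sub>C 1"

text \<open>
  A subspace W of C^n (sequences vanishing from n on) is invariant under v iff v maps W into the
  algebraic tensor product of W and Pol(G), i.e. iff W is preserved by all slices of v by linear
  functionals.
\<close>

definition irreducible_corep ::
  "('a::complex_star_algebra \<Rightarrow> ('a \<times> 'a) list) \<Rightarrow> nat \<Rightarrow> (nat \<Rightarrow> nat \<Rightarrow> 'a) \<Rightarrow> bool" where
  "irreducible_corep comult n v \<longleftrightarrow>
     unitary_corep comult n v \<and> n > 0 \<and>
     (\<forall>W \<subseteq> {w :: nat \<Rightarrow> complex. \<forall>i\<ge>n. w i = 0}.
        (\<lambda>_. 0) \<in> W \<and>
        (\<forall>w\<in>W. \<forall>z\<in>W. (\<lambda>i. w i + z i) \<in> W) \<and>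
        (\<forall>c. \<forall>w\<in>W. (\<lambda>i. c * w i) \<in> W) \<and>
        (\<forall>f. clinear f \<longrightarrow>
           (\<forall>w\<in>W. (\<lambda>i. if i < n then \<Sum>j<n. f (v i j) * w j else 0) \<in> W))
        \<longrightarrow> W = {\<lambda>_. 0} \<or> W = {w. \<forall>i\<ge>n. w i = 0})"

definition equivalent_coreps ::
  "nat \<Rightarrow> (nat \<Rightarrow> nat \<Rightarrow> 'a::complex_vector) \<Rightarrow> nat \<Rightarrow> (nat \<Rightarrow> nat \<Rightarrow> 'a) \<Rightarrow> bool" where
  "equivalent_coreps n v m w \<longleftrightarrow>
     n = m \<and>
     (\<exists>X Y :: nat \<Rightarrow> nat \<Rightarrow> complex.
        (\<forall>i<n. \<forall>j<n. (\<Sum>k<n. X i k * Y k j) = (if i = j then 1 else 0)) \<and>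
        (\<forall>i<n. \<forall>j<n. (\<Sum>k<n. Y i k * X k j) = (if i = j then 1 else 0)) \<and>
        (\<forall>i<n. \<forall>j<n. (\<Sum>k<n. X i k *\<^sub>C v k j) = (\<Sum>k<n. X k j *\<^sub>C w i k)))"

text \<open>
  Irr indexes the equivalence classes of irreducible corepresentations; the matrix u \<alpha> of
  size N \<alpha> is the chosen unitary representative of the class \<alpha>. Separability of C(G) amounts to
  countability of Irr.
\<close>

definition irr_representatives ::
  "('a::complex_star_algebra \<Rightarrow> ('a \<times> 'a) list) \<Rightarrow>
   'i set \<Rightarrow> ('i \<Rightarrow> nat) \<Rightarrow> ('i \<Rightarrow> nat \<Rightarrow> nat \<Rightarrow> 'a) \<Rightarrow> bool" where
  "irr_representatives comult Irr N u \<longleftrightarrow>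
     (\<forall>\<alpha>\<in>Irr. irreducible_corep comult (N \<alpha>) (u \<alpha>)) \<and>
     (\<forall>\<alpha>\<in>Irr. \<forall>\<beta>\<in>Irr. equivalent_coreps (N \<alpha>) (u \<alpha>) (N \<beta>) (u \<beta>) \<longrightarrow> \<alpha> = \<beta>) \<and>
     (\<forall>n v. irreducible_corep comult n v \<longrightarrow>
        (\<exists>\<alpha>\<in>Irr. equivalent_coreps n v (N \<alpha>) (u \<alpha>)))"


section \<open>The universal C*-algebra and its trivial representation\<close>

text \<open>
  The pair of the C*-algebra 'c and the map \<iota> is the universal enveloping C*-algebra of 'a.
  If 'a has countable dimension, as Pol(G) does for separable C(G), then its cyclic representations
  are separable, so that it suffices to test on separable Hilbert spaces.
\<close>

definition universal_enveloping ::
  "('a::complex_star_algebra \<Rightarrow> 'c::cstar_algebra) \<Rightarrow> bool" where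
  "universal_enveloping \<iota> \<longleftrightarrow>
     clinear \<iota> \<and> \<iota> 1 = 1 \<and> (\<forall>x y. \<iota> (x * y) = \<iota> x * \<iota> y) \<and> (\<forall>x. \<iota> (star x) = star (\<iota> x)) \<and>
     closure (range \<iota>) = UNIV \<and>
     (\<forall>H \<pi>. star_rep H \<pi> \<longrightarrow> (\<exists>\<rho>. star_rep H \<rho> \<and> (\<forall>x. \<forall>\<xi>\<in>H. \<rho> (\<iota> x) \<xi> = \<pi> x \<xi>)))"

text \<open>The extension of the counit to a character of the universal C*-algebra.\<close>

definition counit_max ::
  "('a::complex_star_algebra \<Rightarrow> complex) \<Rightarrow> ('a \<Rightarrow> 'c::cstar_algebra) \<Rightarrow> 'c \<Rightarrow> complex" where
  "counit_max counit \<iota> = (THE f.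
     clinear f \<and> (\<forall>x y. f (x * y) = f x * f y) \<and> (\<forall>x. f (star x) = cnj (f x)) \<and>
     continuous_on UNIV f \<and> (\<forall>a. f (\<iota> a) = counit a))"

definition trivial_rep ::
  "('a::complex_star_algebra \<Rightarrow> complex) \<Rightarrow> ('a \<Rightarrow> 'c::cstar_algebra) \<Rightarrow> 'c rep" where
  "trivial_rep counit \<iota> = (range (\<lambda>c. c *\<^sub>C ell2_e0), \<lambda>x \<xi>. counit_max counit \<iota> x *\<^sub>C \<xi>)"

definition trivial_point ::
  "('a::complex_star_algebra \<Rightarrow> complex) \<Rightarrow> ('a \<Rightarrow> 'c::cstar_algebra) \<Rightarrow> 'c rep set" where
  "trivial_point counit \<iota> = irrep_equiv `` {trivial_rep counit \<iota>}"


section \<open>Corepresentations of the dual and property (T)\<close>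

text \<open>The coordinates of an element of Pol(G) in the basis of all u \<alpha> i j.\<close>

definition irr_index :: "'i set \<Rightarrow> ('i \<Rightarrow> nat) \<Rightarrow> ('i \<times> nat \<times> nat) set" where
  "irr_index Irr N = {(\<alpha>, i, j). \<alpha> \<in> Irr \<and> i < N \<alpha> \<and> j < N \<alpha>}"

definition pol_coord ::
  "'i set \<Rightarrow> ('i \<Rightarrow> nat) \<Rightarrow> ('i \<Rightarrow> nat \<Rightarrow> nat \<Rightarrow> 'a::complex_star_algebra) \<Rightarrow>
   'a \<Rightarrow> 'i \<times> nat \<times> nat \<Rightarrow> complex" where
  "pol_coord Irr N u x = (THE c.
     finite {p. c p \<noteq> 0} \<and> {p. c p \<noteq> 0} \<subseteq> irr_index Irr N \<and>
     x = (\<Sum>(\<gamma>, i, j) | c (\<gamma>, i, j) \<noteq> 0. c (\<gamma>, i, j) *\<^sub>C u \<gamma> i j))"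

text \<open>
  dual_comult Irr N u p (\<alpha>, a, b) (\<beta>, c, d) is the coefficient of the elementary tensor of the
  matrix units e \<alpha> a b and e \<beta> c d in the dual comultiplication of the matrix unit e p. Comparing
  coefficients in the defining relation (dual_comult tensor id) w = w_23 w_13, where w is the sum
  of all e \<gamma> i j tensor u \<gamma> i j, gives (SUM (\<gamma>, i, j). coefficient * u \<gamma> i j) = u \<beta> c d * u \<alpha> a b.
\<close>

definition dual_comult ::
  "'i set \<Rightarrow> ('i \<Rightarrow> nat) \<Rightarrow> ('i \<Rightarrow> nat \<Rightarrow> nat \<Rightarrow> 'a::complex_star_algebra) \<Rightarrow>
   'i \<times> nat \<times> nat \<Rightarrow> 'i \<times> nat \<times> nat \<Rightarrow> 'i \<times> nat \<times> nat \<Rightarrow> complex" where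
  "dual_comult Irr N u p = (\<lambda>(\<alpha>, a, b) (\<beta>, c, d).
     pol_coord Irr N u (u \<beta> c d * u \<alpha> a b) p)"

text \<open>
  The multiplier algebra of the tensor product of c_0 of the dual and the compact operators on H
  consists of the bounded families of matrices V \<alpha> of size N \<alpha> with entries in B(H). Such a
  family is unitary iff each V \<alpha> is a unitary operator on the direct sum of N \<alpha> copies of H.
\<close>

definition unitary_block :: "ell2 set \<Rightarrow> nat \<Rightarrow> (nat \<Rightarrow> nat \<Rightarrow> ell2 \<Rightarrow> ell2) \<Rightarrow> bool" where
  "unitary_block H n V \<longleftrightarrow>
     (\<forall>i<n. \<forall>j<n. bounded_operator_on H (V i j)) \<and>
     (\<forall>\<zeta> \<eta>. (\<forall>j<n. \<zeta> j \<in> H \<and> \<eta> j \<in> H) \<longrightarrow>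
        (\<Sum>i<n. cinner (\<Sum>j<n. V i j (\<zeta> j)) (\<Sum>j<n. V i j (\<eta> j))) = (\<Sum>j<n. cinner (\<zeta> j) (\<eta> j))) \<and>
     (\<forall>\<eta>. (\<forall>j<n. \<eta> j \<in> H) \<longrightarrow>
        (\<exists>\<zeta>. (\<forall>j<n. \<zeta> j \<in> H) \<and> (\<forall>i<n. (\<Sum>j<n. V i j (\<zeta> j)) = \<eta> i)))"

text \<open>
  The last conjunct is (dual_comult tensor id) V = V_23 V_13, entry by entry. For given \<alpha>, a, b,
  \<beta>, c, d only finitely many coefficients of the dual comultiplication are non-zero.
\<close>

definition dual_corep ::
  "'i set \<Rightarrow> ('i \<Rightarrow> nat) \<Rightarrow> ('i \<Rightarrow> nat \<Rightarrow> nat \<Rightarrow> 'a::complex_star_algebra) \<Rightarrow>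
   ell2 set \<Rightarrow> ('i \<Rightarrow> nat \<Rightarrow> nat \<Rightarrow> ell2 \<Rightarrow> ell2) \<Rightarrow> bool" where
  "dual_corep Irr N u H V \<longleftrightarrow>
     hilbert_subspace H \<and>
     (\<forall>\<alpha>\<in>Irr. unitary_block H (N \<alpha>) (V \<alpha>)) \<and>
     (\<forall>(\<alpha>, a, b) \<in> irr_index Irr N. \<forall>(\<beta>, c, d) \<in> irr_index Irr N. \<forall>\<xi>\<in>H.
        (\<Sum>(\<gamma>, i, j) | dual_comult Irr N u (\<gamma>, i, j) (\<alpha>, a, b) (\<beta>, c, d) \<noteq> 0.
           dual_comult Irr N u (\<gamma>, i, j) (\<alpha>, a, b) (\<beta>, c, d) *\<^sub>C V \<gamma> i j \<xi>)
        = V \<beta> c d (V \<alpha> a b \<xi>))"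

text \<open>
  The space H^\<alpha> has basis u \<alpha> r l (r, l < N \<alpha>) and the inner product haar (star x * y) of the GNS
  space of the Haar state. A vector of H^\<alpha> is given by its coefficient matrix, and a vector of the
  Hilbert tensor product of H^\<alpha> and H by the matrix T of vectors of H for which it is the sum of
  all u \<alpha> r i tensor T r i.
\<close>

definition isotypic_vector ::
  "('i \<Rightarrow> nat) \<Rightarrow> ('i \<Rightarrow> nat \<Rightarrow> nat \<Rightarrow> 'a::complex_star_algebra) \<Rightarrow>
   'i \<Rightarrow> (nat \<Rightarrow> nat \<Rightarrow> complex) \<Rightarrow> 'a" where
  "isotypic_vector N u \<alpha> \<eta> = (\<Sum>r<N \<alpha>. \<Sum>l<N \<alpha>. \<eta> r l *\<^sub>C u \<alpha> r l)"

definition haar_norm :: "('a::complex_star_algebra \<Rightarrow> complex) \<Rightarrow> 'a \<Rightarrow> real" where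
  "haar_norm haar x = sqrt (Re (haar (star x * x)))"

definition tensor_norm ::
  "('a::complex_star_algebra \<Rightarrow> complex) \<Rightarrow> ('i \<Rightarrow> nat) \<Rightarrow> ('i \<Rightarrow> nat \<Rightarrow> nat \<Rightarrow> 'a) \<Rightarrow>
   'i \<Rightarrow> (nat \<Rightarrow> nat \<Rightarrow> ell2) \<Rightarrow> real" where
  "tensor_norm haar N u \<alpha> T = sqrt (Re (
     \<Sum>r<N \<alpha>. \<Sum>i<N \<alpha>. \<Sum>r'<N \<alpha>. \<Sum>i'<N \<alpha>.
       haar (star (u \<alpha> r i) * u \<alpha> r' i') * cinner (T r i) (T r' i')))"

definition elementary_tensor ::
  "(nat \<Rightarrow> nat \<Rightarrow> complex) \<Rightarrow> ell2 \<Rightarrow> nat \<Rightarrow> nat \<Rightarrow> ell2" where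
  "elementary_tensor \<eta> \<xi> r i = \<eta> r i *\<^sub>C \<xi>"

text \<open>
  V \<alpha> is the sum of all e \<alpha> i j tensor V \<alpha> i j, and e \<alpha> i j sends u \<alpha> r l to u \<alpha> r i if l = j and
  to 0 otherwise. Hence V \<alpha> sends the tensor of u \<alpha> r l and \<xi> to the sum over i of
  u \<alpha> r i tensor V \<alpha> i l \<xi>.
\<close>

definition corep_apply ::
  "('i \<Rightarrow> nat) \<Rightarrow> ('i \<Rightarrow> nat \<Rightarrow> nat \<Rightarrow> ell2 \<Rightarrow> ell2) \<Rightarrow>
   'i \<Rightarrow> (nat \<Rightarrow> nat \<Rightarrow> complex) \<Rightarrow> ell2 \<Rightarrow> nat \<Rightarrow> nat \<Rightarrow> ell2" where
  "corep_apply N V \<alpha> \<eta> \<xi> r i = (\<Sum>l<N \<alpha>. \<eta> r l *\<^sub>C V \<alpha> i l \<xi>)"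

definition approx_invariant ::
  "('a::complex_star_algebra \<Rightarrow> complex) \<Rightarrow> ('i \<Rightarrow> nat) \<Rightarrow> ('i \<Rightarrow> nat \<Rightarrow> nat \<Rightarrow> 'a) \<Rightarrow>
   ('i \<Rightarrow> nat \<Rightarrow> nat \<Rightarrow> ell2 \<Rightarrow> ell2) \<Rightarrow> 'i set \<Rightarrow> real \<Rightarrow> ell2 \<Rightarrow> bool" where
  "approx_invariant haar N u V E \<delta> \<xi> \<longleftrightarrow>
     (\<forall>\<alpha>\<in>E. \<forall>\<eta>. isotypic_vector N u \<alpha> \<eta> \<noteq> 0 \<longrightarrow>
        tensor_norm haar N u \<alpha>
          (\<lambda>r i. corep_apply N V \<alpha> \<eta> \<xi> r i - elementary_tensor \<eta> \<xi> r i)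
        < \<delta> * haar_norm haar (isotypic_vector N u \<alpha> \<eta>) * norm \<xi>)"

definition has_almost_invariant_vectors ::
  "('a::complex_star_algebra \<Rightarrow> complex) \<Rightarrow> 'i set \<Rightarrow> ('i \<Rightarrow> nat) \<Rightarrow>
   ('i \<Rightarrow> nat \<Rightarrow> nat \<Rightarrow> 'a) \<Rightarrow> ell2 set \<Rightarrow> ('i \<Rightarrow> nat \<Rightarrow> nat \<Rightarrow> ell2 \<Rightarrow> ell2) \<Rightarrow> bool" where
  "has_almost_invariant_vectors haar Irr N u H V \<longleftrightarrow>
     (\<forall>E \<delta>. finite E \<and> E \<subseteq> Irr \<and> \<delta> > 0 \<longrightarrow> (\<exists>\<xi>\<in>H. approx_invariant haar N u V E \<delta> \<xi>))"

definition invariant_vector ::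
  "'i set \<Rightarrow> ('i \<Rightarrow> nat) \<Rightarrow> ('i \<Rightarrow> nat \<Rightarrow> nat \<Rightarrow> ell2 \<Rightarrow> ell2) \<Rightarrow> ell2 \<Rightarrow> bool" where
  "invariant_vector Irr N V \<xi> \<longleftrightarrow>
     (\<forall>\<alpha>\<in>Irr. \<forall>\<eta>. \<forall>r<N \<alpha>. \<forall>i<N \<alpha>.
        corep_apply N V \<alpha> \<eta> \<xi> r i = elementary_tensor \<eta> \<xi> r i)"

definition dual_property_T ::
  "('a::complex_star_algebra \<Rightarrow> complex) \<Rightarrow> 'i set \<Rightarrow> ('i \<Rightarrow> nat) \<Rightarrow>
   ('i \<Rightarrow> nat \<Rightarrow> nat \<Rightarrow> 'a) \<Rightarrow> bool" where
  "dual_property_T haar Irr N u \<longleftrightarrow>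
     (\<forall>H V. dual_corep Irr N u H V \<and> has_almost_invariant_vectors haar Irr N u H V \<longrightarrow>
        (\<exists>\<xi>\<in>H. \<xi> \<noteq> 0 \<and> invariant_vector Irr N V \<xi>))"

end

theory Submission
  imports Defs "Jordan_Normal_Form.Char_Poly"
begin

text \<open>
  Corepresentations V of the dual are the same as star-representations \<pi> of Pol(G), and hence
  as representations of the universal C*-algebra, through V \<alpha> i j = \<pi> (u \<alpha> i j)
  (star_rep_dual_corep, dual_corep_star_rep). In these terms everything is measured by the defects
  V \<alpha> i l \<xi> - \<epsilon>(u \<alpha> i l) \<xi>, where \<epsilon> is the counit: \<xi>
  is invariant iff all defects vanish, iff the whole C*-algebra acts on \<xi> by \<epsilon>, and
  \<xi> is almost invariant iff finitely many blocks of defects are small relative to \<xi>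
  (approx_invariantI, approx_invariantD).

  If the trivial point is isolated, some j lies in the kernel of every other irreducible
  representation, while \<epsilon>(j) is not 0. For every x the element x j - \<epsilon>(x) j lies
  in the kernel of all irreducible representations, the trivial one included, so it acts as 0 in
  every representation \<rho>. Hence every vector \<rho>(j)\<xi> is invariant, and it is not 0 if
  \<xi> is sufficiently invariant, because then \<rho>(j)\<xi> is close to \<epsilon>(j)\<xi>.
  This is isolated_imp_property_T.

  If property (T) holds, there are a finite set E of classes and \<delta> > 0 such that the sum of
  the squares of the defects over E is at least \<delta> times the square of the norm, for all
  vectors of all irreducible representations outside the trivial point (property_T_uniform_gap).
  Otherwise countably many counterexamples would have a direct sum with almost invariant vectors,
  and a component of a non-zero invariant vector would make one of the summands trivial. The sum
  of squares is the quadratic form of an element h with \<epsilon>(h) = 0. So h - \<delta>/2 is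
  positive in all irreducible representations but the trivial one, where it is negative, and z =
  |h - \<delta>/2| - (h - \<delta>/2) is killed by all of them except the trivial one. This is
  property_T_imp_isolated.

  Two bodies of theory carry these arguments. On the C*-algebra side, square roots are limits of a
  polynomial iteration (cstar_sqrt); they give absolute values and contractivity, and pure states
  together with the GNS construction give enough irreducible representations
  (irreducible_reps_separate). On the quantum group side, the correspondence between V and \<pi>
  requires the coefficients u \<alpha> i j to be a basis of Pol(G). They span by complete
  reducibility (coefficients_span), and they are independent by Schur orthogonality and the
  invertibility of the Gram matrices of the Haar state (row_gram_invertible).
\<close>

section \<open>Complex vector spaces and star-algebras\<close>

interpretation complex_vs: vector_space "scaleC :: complex \<Rightarrow> 'a::complex_vector \<Rightarrow> 'a"
  by standard (simp_all add: scaleC_add_right scaleC_add_left scaleC_scaleC scaleC_one)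

lemma csubspace_iff_subspace: "csubspace S \<longleftrightarrow> complex_vs.subspace S"
  unfolding csubspace_def complex_vs.subspace_def by auto

lemma cspan_eq_span: "cspan S = complex_vs.span S"
  unfolding cspan_def complex_vs.span_def
  by (rule arg_cong[of _ _ "\<lambda>P. P hull S"]) (simp add: fun_eq_iff csubspace_iff_subspace)

lemma clinear_add: "clinear f \<Longrightarrow> f (x + y) = f x + f y"
  and clinear_scaleC: "clinear f \<Longrightarrow> f (c *\<^sub>C x) = c *\<^sub>C f x"
  unfolding clinear_def by blast+

lemma clinear_zero: "clinear f \<Longrightarrow> f 0 = 0"
  using clinear_add[of f 0 0] by simp

lemma clinear_uminus: "clinear f \<Longrightarrow> f (- x) = - f x"
  using clinear_add[of f x "- x"] by (simp add: clinear_zero eq_neg_iff_add_eq_0 add.commute)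

lemma clinear_diff: "clinear f \<Longrightarrow> f (x - y) = f x - f y"
  using clinear_add[of f x "- y"] by (simp add: clinear_uminus)

lemma clinear_sum: "clinear f \<Longrightarrow> f (sum g A) = (\<Sum>a\<in>A. f (g a))"
  by (induction A rule: infinite_finite_induct) (simp_all add: clinear_zero clinear_add)

lemma clinear_sum_list: "clinear f \<Longrightarrow> f (sum_list xs) = sum_list (map f xs)"
  by (induction xs) (simp_all add: clinear_zero clinear_add)

lemma scaleC_complex [simp]: "c *\<^sub>C (z::complex) = c * z"
  by (simp add: scaleC_complex_def)

text \<open>
  Equality of tensors is tested by scalar bilinear forms only. Identities with vector values are
  reduced to them by composing with linear functionals, which exist in abundance by extending a
  basis.
\<close>

lemma clinear_functional_separates:
  fixes x :: "'a::complex_vector"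
  assumes "x \<noteq> 0"
  obtains f :: "'a \<Rightarrow> complex" where "clinear f" "f x \<noteq> 0"
proof -
  interpret vector_space_pair "scaleC :: complex \<Rightarrow> 'a \<Rightarrow> 'a" "scaleC :: complex \<Rightarrow> complex \<Rightarrow> complex" ..
  have "complex_vs.independent {x}"
    using assms by simp
  from linear_independent_extend[OF this, of "\<lambda>_. 1"] obtain g where
    g: "Vector_Spaces.linear scaleC scaleC g" "g x = (1::complex)" by auto
  interpret Vector_Spaces.linear "scaleC :: complex \<Rightarrow> 'a \<Rightarrow> 'a" "scaleC :: complex \<Rightarrow> complex \<Rightarrow> complex" g by fact
  have "clinear g" unfolding clinear_def by (simp add: add scale)
  then show thesis using that g(2) by simp
qed

lemma clinear_functionals_eqI:
  fixes x y :: "'a::complex_vector"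
  assumes "\<And>f :: 'a \<Rightarrow> complex. clinear f \<Longrightarrow> f x = f y"
  shows "x = y"
proof (rule ccontr)
  assume "x \<noteq> y"
  then obtain f :: "'a \<Rightarrow> complex" where "clinear f" "f (x - y) \<noteq> 0"
    using clinear_functional_separates[of "x - y"] by auto
  then show False using assms by (simp add: clinear_diff)
qed

lemma star_zero [simp]: "star (0::'a::complex_star_algebra) = 0"
  using star_add[of "0::'a" 0] by simp

lemma star_one [simp]: "star (1::'a::complex_star_algebra) = 1"
  by (metis mult.left_neutral mult.right_neutral star_mult star_star)

lemma star_uminus: "star (- x) = - star (x::'a::complex_star_algebra)"
  using star_add[of x "- x"] by (simp add: eq_neg_iff_add_eq_0 add.commute)

lemma star_diff: "star (x - y) = star x - star (y::'a::complex_star_algebra)"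
  using star_add[of x "- y"] by (simp add: star_uminus)

lemma star_sum: "star (sum g A) = (\<Sum>a\<in>A. star (g a :: 'a::complex_star_algebra))"
  by (induction A rule: infinite_finite_induct) (simp_all add: star_add)

lemma clinear_conj_star:
  fixes f :: "'a::complex_star_algebra \<Rightarrow> complex"
  assumes "clinear f"
  shows "clinear (\<lambda>x. cnj (f (star x)))"
  using assms unfolding clinear_def by (simp add: star_add star_scaleC)

lemma clinear_mult_left: "clinear f \<Longrightarrow> clinear (\<lambda>x. f (a * (x::'a::complex_star_algebra)))"
  unfolding clinear_def by (simp add: distrib_left mult_scaleC_right)

lemma clinear_mult_right: "clinear f \<Longrightarrow> clinear (\<lambda>x. f ((x::'a::complex_star_algebra) * a))"
  unfolding clinear_def by (simp add: distrib_right mult_scaleC_left)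

subsection \<open>Positive functionals\<close>

definition positive_functional :: "('a::complex_star_algebra \<Rightarrow> complex) \<Rightarrow> bool" where
  "positive_functional f \<longleftrightarrow> clinear f \<and> (\<forall>x. f (star x * x) \<in> \<real>\<^sub>\<ge>\<^sub>0)"

context
  fixes f :: "'a::complex_star_algebra \<Rightarrow> complex"
  assumes pos: "positive_functional f"
begin

lemma positive_functional_clinear: "clinear f"
  using pos by (simp add: positive_functional_def)

lemma positive_functional_square:
  "0 \<le> Re (f (star x * x))" "Im (f (star x * x)) = 0"
  using pos by (auto simp: positive_functional_def complex_nonneg_Reals_iff)

lemma positive_functional_expand:
  "f (star (x + c *\<^sub>C y) * (x + c *\<^sub>C y)) =
     f (star x * x) + c * f (star x * y) + cnj c * f (star y * x) + (cnj c * c) * f (star y * y)"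
  using positive_functional_clinear
  by (simp add: star_add star_scaleC distrib_left distrib_right mult_scaleC_left mult_scaleC_right
      clinear_add clinear_scaleC algebra_simps)

text \<open>
  Polarisation: f takes real values on the squares of x + y and of x + \<i> y.
\<close>

lemma positive_functional_hermitian: "f (star y * x) = cnj (f (star x * y))"
proof -
  define p q where "p = f (star x * y)" and "q = f (star y * x)"
  have "Im (p + q) = 0"
    using positive_functional_square(2)[of "x + 1 *\<^sub>C y"] positive_functional_square(2)[of x]
      positive_functional_square(2)[of y]
    by (simp only: positive_functional_expand) (simp add: p_def q_def)
  moreover have "Im (\<i> * p - \<i> * q) = 0"
    using positive_functional_square(2)[of "x + \<i> *\<^sub>C y"] positive_functional_square(2)[of x]
      positive_functional_square(2)[of y]
    by (simp only: positive_functional_expand) (simp add: p_def q_def)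
  ultimately show ?thesis by (simp add: complex_eq_iff flip: p_def q_def)
qed

text \<open>
  The usual discriminant argument, with the complex scalar chosen as a real multiple of the
  conjugate of f (star x * y) so that only a real quadratic polynomial remains.
\<close>

lemma positive_functional_Cauchy_Schwarz:
  "(cmod (f (star x * y)))\<^sup>2 \<le> Re (f (star x * x)) * Re (f (star y * y))"
proof -
  define a b p where "a = Re (f (star x * x))" and "b = Re (f (star y * y))" and "p = f (star x * y)"
  have a: "f (star x * x) = of_real a" and b: "f (star y * y) = of_real b" and nonneg: "a \<ge> 0" "b \<ge> 0"
    using positive_functional_square by (simp_all add: a_def b_def complex_eq_iff)
  have quadratic: "0 \<le> a - 2 * t * (cmod p)\<^sup>2 + t\<^sup>2 * (cmod p)\<^sup>2 * b" for t
  proof -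
    have "Re (f (star (x + (- of_real t * cnj p) *\<^sub>C y) * (x + (- of_real t * cnj p) *\<^sub>C y)))
        = a - 2 * t * (cmod p)\<^sup>2 + t\<^sup>2 * (cmod p)\<^sup>2 * b"
      unfolding positive_functional_expand positive_functional_hermitian[of y x] a b p_def[symmetric]
        cmod_power2
      by (simp add: power2_eq_square algebra_simps)
    then show ?thesis using positive_functional_square(1)[of "x + (- of_real t * cnj p) *\<^sub>C y"] by simp
  qed
  show ?thesis
  proof (cases "b = 0")
    case True
    show ?thesis
    proof (cases "(cmod p)\<^sup>2 = 0")
      case False
      then show ?thesis using quadratic[of "(a + 1) / (2 * (cmod p)\<^sup>2)"] True by (simp add: field_simps)
    qed (use nonneg in \<open>simp add: p_def a_def b_def\<close>)
  next
    case False
    then have "0 \<le> a - (cmod p)\<^sup>2 / b"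
      using quadratic[of "1 / b"] by (simp add: power2_eq_square field_simps)
    then show ?thesis using False nonneg by (simp add: p_def a_def b_def field_simps)
  qed
qed

lemma positive_functional_null_left:
  assumes "f (star y * y) = 0" shows "f (x * y) = 0"
  using positive_functional_Cauchy_Schwarz[of "star x" y] assms by (simp add: star_star)

end

section \<open>Square roots and absolute values in C*-algebras\<close>

lemma norm_star [simp]: "norm (star (x::'c::cstar_algebra)) = norm x"
proof -
  have le: "norm y \<le> norm (star y)" for y :: 'c
  proof (cases "norm y = 0")
    case False
    have "norm y * norm y \<le> norm (star y) * norm y"
      using norm_mult_ineq[of "star y" y] by (simp add: cstar_identity power2_eq_square)
    then show ?thesis using False by simp
  qed simp
  show ?thesis using le[of x] le[of "star x"] by (simp add: star_star)
qed

lemma tendsto_star: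
  assumes "X \<longlonglongrightarrow> (l::'c::cstar_algebra)" shows "(\<lambda>n. star (X n)) \<longlonglongrightarrow> star l"
proof -
  have "norm (star (X n) - star l) = norm (X n - l)" for n
    by (simp flip: star_diff)
  then show ?thesis using assms
    unfolding LIMSEQ_iff by simp
qed

lemma star_scaleR: "star (r *\<^sub>R (x::'c::cstar_algebra)) = r *\<^sub>R star x"
  by (simp add: scaleR_scaleC star_scaleC)

text \<open>
  A fixed point t of the iterated map satisfies 2 t = y + t^2, so 1 - t is a square root of 1 - y.
\<close>

definition sqrt_iter :: "'c::cstar_algebra \<Rightarrow> nat \<Rightarrow> 'c" where
  "sqrt_iter y n = ((\<lambda>t. (1/2) *\<^sub>R (y + t * t)) ^^ n) 0"

lemma sqrt_iter_simps [simp]: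
  "sqrt_iter y 0 = 0" "sqrt_iter y (Suc n) = (1/2) *\<^sub>R (y + sqrt_iter y n * sqrt_iter y n)"
  by (simp_all add: sqrt_iter_def)

text \<open>
  The same iteration for the number y = 1.
\<close>

primrec sqrt_bound :: "nat \<Rightarrow> real" where
  "sqrt_bound 0 = 0"
| "sqrt_bound (Suc n) = (1 + (sqrt_bound n)\<^sup>2) / 2"

lemma sqrt_bound_range: "0 \<le> sqrt_bound n \<and> sqrt_bound n \<le> 1"
  by (induction n) (auto simp: power_le_one)

lemma sqrt_bound_mono: "sqrt_bound n \<le> sqrt_bound (Suc n)"
  using zero_le_power2[of "1 - sqrt_bound n"] by (simp add: power2_eq_square algebra_simps)

lemma sqrt_iter_commute: "z * y = y * z \<Longrightarrow> z * sqrt_iter y n = sqrt_iter y n * z"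
proof (induction n)
  case (Suc n)
  have "z * (sqrt_iter y n * sqrt_iter y n) = (sqrt_iter y n * sqrt_iter y n) * z"
    using Suc by (metis mult.assoc)
  then show ?case using Suc.prems by (simp add: algebra_simps)
qed simp

lemma norm_sqrt_iter: "norm y \<le> 1 \<Longrightarrow> norm (sqrt_iter y n) \<le> sqrt_bound n"
proof (induction n)
  case (Suc n)
  have "norm (sqrt_iter y n * sqrt_iter y n) \<le> sqrt_bound n * sqrt_bound n"
    using Suc sqrt_bound_range[of n] by (intro order_trans[OF norm_mult_ineq] mult_mono) auto
  then have "norm (y + sqrt_iter y n * sqrt_iter y n) \<le> 1 + (sqrt_bound n)\<^sup>2"
    using norm_triangle_ineq[of y "sqrt_iter y n * sqrt_iter y n"] Suc.prems
    by (simp add: power2_eq_square)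
  then show ?case by simp
qed simp

text \<open>
  All iterates are polynomials in y and commute, so consecutive differences factor as s^2 - t^2 =
  (s - t) (s + t). Hence the differences are dominated by those of the scalar iteration, which is
  monotone and bounded; this includes the critical case norm y = 1, where the iterated map is not
  a strict contraction.
\<close>

lemma norm_sqrt_iter_step:
  "norm y \<le> 1 \<Longrightarrow> norm (sqrt_iter y (Suc n) - sqrt_iter y n) \<le> sqrt_bound (Suc n) - sqrt_bound n"
proof (induction n)
  case 0 then show ?case by simp
next
  case (Suc n)
  define s t where "s = sqrt_iter y (Suc n)" and "t = sqrt_iter y n"
  define a b where "a = sqrt_bound (Suc n)" and "b = sqrt_bound n"
  have "s * y = y * s" "t * y = y * t"
    unfolding s_def t_def using sqrt_iter_commute[of y y] by metis+
  then have "s * t = t * s"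
    unfolding s_def by (metis sqrt_iter_commute t_def)
  then have eq: "s * s - t * t = (s - t) * (s + t)"
    by (simp add: algebra_simps)
  have st: "norm (s + t) \<le> a + b"
    using norm_sqrt_iter[OF Suc.prems, of "Suc n"] norm_sqrt_iter[OF Suc.prems, of n]
      norm_triangle_ineq[of s t]
    unfolding s_def t_def a_def b_def by linarith
  have "norm (s - t) \<le> a - b" "b \<le> a"
    using Suc.IH[OF Suc.prems] sqrt_bound_mono[of n] unfolding s_def t_def a_def b_def .
  then have "norm (s * s - t * t) \<le> (a - b) * (a + b)"
    unfolding eq using st by (intro order_trans[OF norm_mult_ineq] mult_mono) auto
  moreover have "sqrt_iter y (Suc (Suc n)) - sqrt_iter y (Suc n) = (1/2) *\<^sub>R (s * s - t * t)"
    using sqrt_iter_simps(2)[of y "Suc n"] sqrt_iter_simps(2)[of y n]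
    by (simp del: sqrt_iter_simps add: scaleR_diff_right flip: s_def t_def) (simp add: algebra_simps)
  moreover have "sqrt_bound (Suc (Suc n)) - sqrt_bound (Suc n) = ((a - b) * (a + b)) / 2"
    using sqrt_bound.simps(2)[of "Suc n"] sqrt_bound.simps(2)[of n]
    by (simp del: sqrt_bound.simps flip: a_def b_def) (simp add: power2_eq_square field_simps)
  ultimately show ?case by simp
qed

lemma norm_sqrt_iter_diff:
  assumes "norm y \<le> 1" "m \<le> n"
  shows "norm (sqrt_iter y n - sqrt_iter y m) \<le> sqrt_bound n - sqrt_bound m"
  using assms(2)
proof (induction rule: dec_induct)
  case (step n)
  then show ?case
    using norm_sqrt_iter_step[OF assms(1), of n]
      norm_triangle_ineq[of "sqrt_iter y (Suc n) - sqrt_iter y n" "sqrt_iter y n - sqrt_iter y m"]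
    by (simp del: sqrt_iter_simps sqrt_bound.simps)
qed simp

text \<open>
  The root commutes with whatever commutes with y, since every iterate does.
\<close>

lemma cstar_sqrt:
  fixes y :: "'c::cstar_algebra"
  assumes y: "star y = y" "norm y \<le> 1"
  obtains t where "star t = t" "norm t \<le> 1" "(1 - t) * (1 - t) = 1 - y"
    "\<And>z. z * y = y * z \<Longrightarrow> z * t = t * z"
proof -
  have "convergent sqrt_bound"
    using Bseq_mono_convergent[of sqrt_bound] sqrt_bound_range sqrt_bound_mono
    by (intro Bseq_mono_convergent BseqI'[where K = 1]) (auto simp: incseq_def lift_Suc_mono_le)
  then have "Cauchy sqrt_bound" by (simp add: Cauchy_convergent_iff)
  have "Cauchy (sqrt_iter y)"
  proof (rule CauchyI)
    fix e :: real assume "e > 0"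
    then obtain M where M: "\<And>m n. m \<ge> M \<Longrightarrow> n \<ge> M \<Longrightarrow> norm (sqrt_bound m - sqrt_bound n) < e"
      using CauchyD[OF \<open>Cauchy sqrt_bound\<close>] by blast
    have "norm (sqrt_iter y m - sqrt_iter y n) < e" if "m \<ge> M" "n \<ge> M" for m n
      using norm_sqrt_iter_diff[OF y(2), of m n] norm_sqrt_iter_diff[OF y(2), of n m] M[OF that]
        M[OF that(2,1)]
      by (cases "m \<le> n") (auto simp: norm_minus_commute)
    then show "\<exists>M. \<forall>m\<ge>M. \<forall>n\<ge>M. norm (sqrt_iter y m - sqrt_iter y n) < e" by blast
  qed
  then obtain t where t: "sqrt_iter y \<longlonglongrightarrow> t"
    by (auto simp: Cauchy_convergent_iff convergent_def)
  have "star (sqrt_iter y n) = sqrt_iter y n" for n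
    by (induction n) (simp_all add: star_scaleR star_add star_mult y)
  then have "sqrt_iter y \<longlonglongrightarrow> star t" using tendsto_star[OF t] by simp
  then have "star t = t" using t by (rule LIMSEQ_unique)
  moreover have "norm t \<le> 1"
  proof (rule LIMSEQ_le_const2[OF tendsto_norm[OF t]], intro exI[of _ 0] allI impI)
    show "norm (sqrt_iter y n) \<le> 1" for n
      using norm_sqrt_iter[OF y(2), of n] sqrt_bound_range[of n] by linarith
  qed
  moreover have "(1 - t) * (1 - t) = 1 - y"
  proof -
    have "(\<lambda>n. sqrt_iter y (Suc n)) \<longlonglongrightarrow> (1/2) *\<^sub>R (y + t * t)"
      unfolding sqrt_iter_simps by (intro tendsto_intros t)
    then have "t = (1/2) *\<^sub>R (y + t * t)"
      using LIMSEQ_Suc[OF t] LIMSEQ_unique by blast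
    then have "2 *\<^sub>R t = 2 *\<^sub>R ((1/2) *\<^sub>R (y + t * t))" by (rule arg_cong)
    then have "2 *\<^sub>R t = y + t * t" by simp
    then show ?thesis by (simp add: algebra_simps scaleR_2)
  qed
  moreover have "z * t = t * z" if "z * y = y * z" for z
  proof (rule LIMSEQ_unique)
    show "(\<lambda>n. z * sqrt_iter y n) \<longlonglongrightarrow> z * t" by (intro tendsto_intros t)
    show "(\<lambda>n. z * sqrt_iter y n) \<longlonglongrightarrow> t * z"
      unfolding sqrt_iter_commute[OF that] by (intro tendsto_intros t)
  qed
  ultimately show thesis by (rule that)
qed

text \<open>
  If s is the square root of 1 - k^2, then k + \<i> s is unitary, and s is its imaginary part. So
  s is a contraction, and so is its square.
\<close>

lemma norm_one_minus_square_le: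
  fixes k :: "'c::cstar_algebra"
  assumes k: "star k = k" "norm k \<le> 1"
  shows "norm (1 - k * k) \<le> 1"
proof -
  have "norm (k * k) \<le> 1" using k cstar_identity[of k] by (simp add: power_le_one)
  then obtain t where t: "star t = t" "(1 - t) * (1 - t) = 1 - k * k"
    "k * t = t * k" using k by (metis cstar_sqrt mult.assoc star_mult)
  define s where "s = 1 - t"
  have s: "star s = s" "s * s = 1 - k * k" "k * s = s * k"
    using t by (simp_all add: s_def star_diff algebra_simps)
  define v where "v = k + \<i> *\<^sub>C s"
  have vstar: "star v = k - \<i> *\<^sub>C s"
    by (simp add: v_def star_add star_scaleC s k)
  have "star v * v = 1"
    unfolding vstar unfolding v_def
    using s by (simp add: algebra_simps mult_scaleC_left mult_scaleC_right)
  then have v1: "norm v = 1" using cstar_identity[of v]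
    by (simp add: power2_eq_1_iff) (metis norm_ge_zero not_one_le_zero neg_0_le_iff_le)
  have "v - star v = (2 * \<i>) *\<^sub>C s"
    unfolding vstar unfolding v_def by (simp flip: complex_vs.scale_left_distrib)
  then have "norm ((2 * \<i>) *\<^sub>C s) \<le> norm v + norm (star v)"
    by (metis norm_triangle_ineq4)
  then have "norm s \<le> 1"
    using v1 by (simp add: norm_scaleC norm_mult)
  then show ?thesis
    using cstar_identity[of s] s by (simp add: power_le_one)
qed

text \<open>
  The square root of k^2 = 1 - (1 - k^2). In place of positivity of g, the bound on the norm of 1
  - g is recorded: it passes to every contractive image of g and forces the real part of the
  numerical range to be nonnegative.
\<close>

lemma cstar_absolute_value:
  fixes k :: "'c::cstar_algebra"
  assumes k: "star k = k" "norm k \<le> 1"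
  obtains g where "norm (1 - g) \<le> 1" "g * g = k * k" "g * k = k * g"
proof -
  have "star (1 - k * k) = 1 - k * k" by (simp add: star_diff star_mult k)
  then obtain t where t: "norm t \<le> 1" "(1 - t) * (1 - t) = 1 - (1 - k * k)"
    "\<And>z. z * (1 - k * k) = (1 - k * k) * z \<Longrightarrow> z * t = t * z"
    using cstar_sqrt norm_one_minus_square_le[OF k] by metis
  have "k * t = t * k" by (rule t(3)) (simp add: algebra_simps)
  then show thesis using t(1,2) by (intro that[of "1 - t"]) (simp_all add: algebra_simps)
qed

text \<open>
  This is the source of all contractivity statements: a positive functional takes a nonnegative
  value on the square on the right.
\<close>

lemma cstar_norm_square_minus:
  fixes x :: "'c::cstar_algebra"
  obtains s where "star s = s" "star s * s = of_real ((norm x)\<^sup>2) *\<^sub>C 1 - star x * x"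
proof (cases "x = 0")
  case True
  then show ?thesis by (intro that[of 0]) simp_all
next
  case False
  define r where "r = norm x"
  have r: "r > 0" using False by (simp add: r_def)
  define y where "y = complex_of_real (1 / r\<^sup>2) *\<^sub>C (star x * x)"
  have "star y = y" by (simp add: y_def star_scaleC star_mult star_star)
  moreover have "norm y \<le> 1"
    using r by (simp add: y_def norm_scaleC norm_divide norm_power cstar_identity flip: r_def)
  ultimately obtain t where t: "star t = t" "(1 - t) * (1 - t) = 1 - y"
    using cstar_sqrt by metis
  define s where "s = complex_of_real r *\<^sub>C (1 - t)"
  have "star s * s = complex_of_real (r\<^sup>2) *\<^sub>C (1 - y)"
    using t by (simp add: s_def star_scaleC star_diff mult_scaleC_left mult_scaleC_right power2_eq_square)
  also have "\<dots> = of_real ((norm x)\<^sup>2) *\<^sub>C 1 - star x * x"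
    using r by (simp add: y_def complex_vs.scale_right_diff_distrib flip: r_def of_real_power)
  finally show ?thesis using t by (intro that[of s]) (simp_all add: s_def star_scaleC star_diff)
qed

subsection \<open>Contractivity\<close>

lemma positive_functional_bound:
  fixes f :: "'c::cstar_algebra \<Rightarrow> complex"
  assumes "positive_functional f"
  shows "Re (f (star (x * y) * (x * y))) \<le> (norm x)\<^sup>2 * Re (f (star y * y))"
proof -
  obtain s where s: "star s = s" "star s * s = of_real ((norm x)\<^sup>2) *\<^sub>C 1 - star x * x"
    by (rule cstar_norm_square_minus)
  have "star (s * y) * (s * y) = star y * (star s * s) * y" by (simp add: star_mult mult.assoc)
  also have "\<dots> = of_real ((norm x)\<^sup>2) *\<^sub>C (star y * y) - star (x * y) * (x * y)"
    by (simp only: s(2)) (simp add: star_mult mult.assoc algebra_simps mult_scaleC_left mult_scaleC_right)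
  finally have "f (star (s * y) * (s * y))
      = of_real ((norm x)\<^sup>2) * f (star y * y) - f (star (x * y) * (x * y))"
    using positive_functional_clinear[OF assms] by (simp add: clinear_diff clinear_scaleC)
  then have "Re (f (star (s * y) * (s * y)))
      = (norm x)\<^sup>2 * Re (f (star y * y)) - Re (f (star (x * y) * (x * y)))"
    by (simp add: Re_complex_of_real flip: of_real_power)
  then show ?thesis using positive_functional_square(1)[OF assms, of "s * y"] by simp
qed

lemma state_norm_le:
  fixes f :: "'c::cstar_algebra \<Rightarrow> complex"
  assumes "positive_functional f" "f 1 = 1"
  shows "cmod (f x) \<le> norm x"
proof -
  have "(cmod (f x))\<^sup>2 \<le> Re (f (star x * x))"
    using positive_functional_Cauchy_Schwarz[OF assms(1), of 1 x] assms(2) by simp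
  also have "\<dots> \<le> (norm x)\<^sup>2"
    using positive_functional_bound[OF assms(1), of x 1] assms(2) by simp
  finally show ?thesis by (simp add: power2_le_iff_abs_le)
qed

section \<open>Hilbert space geometry\<close>

lemma cinner_self_norm: "cinner x x = of_real ((norm x)\<^sup>2)"
  by (simp add: cinner_self ell2_norm_sq)

lemma norm_scaleC_ell2: "norm (c *\<^sub>C (x::ell2)) = cmod c * norm x"
proof -
  have "cinner (c *\<^sub>C x) (c *\<^sub>C x) = of_real ((cmod c * norm x)\<^sup>2)"
    unfolding cinner_scaleC_left cinner_scaleC_right cinner_self_norm[of x] power_mult_distrib of_real_mult
    by (simp only: complex_norm_square[of c] mult_ac)
  then have "(norm (c *\<^sub>C x))\<^sup>2 = (cmod c * norm x)\<^sup>2"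
    unfolding cinner_self_norm of_real_eq_iff .
  then show ?thesis by (rule power2_eq_imp_eq) simp_all
qed

lemma cinner_eq_inner: "cinner x y = Complex (inner x y) (inner (\<i> *\<^sub>C x) y)"
  by (simp add: inner_ell2_def cinner_scaleC_left complex_eq_iff)

lemma clinear_cinner_right: "clinear (cinner x)"
  by (simp add: clinear_def cinner_add_right cinner_scaleC_right)

lemmas cinner_zero_right [simp] = clinear_zero[OF clinear_cinner_right]
  and cinner_diff_right = clinear_diff[OF clinear_cinner_right]
  and cinner_sum_right = clinear_sum[OF clinear_cinner_right]

lemma cinner_zero_left [simp]: "cinner 0 x = 0"
  by (subst cinner_commute) simp

lemma cinner_diff_left: "cinner (x - y) z = cinner x z - cinner y z"
  by (subst (1 2 3) cinner_commute) (simp add: cinner_diff_right)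

lemma cinner_sum_left: "cinner (sum f A) z = (\<Sum>a\<in>A. cinner (f a) z)"
  by (subst cinner_commute) (simp add: cinner_sum_right, subst cinner_commute, simp)

lemma LIMSEQ_norm_boundI:
  fixes X :: "nat \<Rightarrow> 'v::real_normed_vector"
  assumes "g \<longlonglongrightarrow> 0" "\<And>n. norm (X n - l) \<le> g n"
  shows "X \<longlonglongrightarrow> l"
  using Lim_null_comparison[OF always_eventually assms(1), of "\<lambda>n. X n - l"] assms(2)
  by (simp add: LIM_zero_iff)

lemma tendsto_scaleC_ell2:
  assumes "X \<longlonglongrightarrow> (l::ell2)" shows "(\<lambda>n. c *\<^sub>C X n) \<longlonglongrightarrow> c *\<^sub>C l"
proof -
  have "(\<lambda>n. cmod c * norm (X n - l)) \<longlonglongrightarrow> 0"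
    using assms by (intro tendsto_mult_right_zero) (simp add: LIM_zero tendsto_norm_zero)
  then have "(\<lambda>n. norm (c *\<^sub>C X n - c *\<^sub>C l)) \<longlonglongrightarrow> 0"
    by (simp add: norm_scaleC_ell2 flip: complex_vs.scale_right_diff_distrib)
  then show ?thesis using LIM_zero_cancel tendsto_norm_zero_iff by blast
qed

lemma tendsto_cinner:
  assumes "X \<longlonglongrightarrow> l" "Y \<longlonglongrightarrow> m"
  shows "(\<lambda>n. cinner (X n) (Y n)) \<longlonglongrightarrow> cinner l m"
  unfolding cinner_eq_inner by (intro tendsto_Complex tendsto_inner tendsto_scaleC_ell2 assms)

lemma scaleR_half_ell2: "(1/2) *\<^sub>R (x::ell2) = complex_of_real (1/2) *\<^sub>C x"
  by (simp add: scaleR_ell2_def)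

lemma csubspace_diff: "csubspace K \<Longrightarrow> x \<in> K \<Longrightarrow> y \<in> K \<Longrightarrow> x - y \<in> K"
  by (simp add: csubspace_iff_subspace complex_vs.subspace_diff)

lemma csubspace_sum: "csubspace K \<Longrightarrow> (\<And>a. a \<in> A \<Longrightarrow> f a \<in> K) \<Longrightarrow> sum f A \<in> K"
  by (simp add: csubspace_iff_subspace complex_vs.subspace_sum)

lemma Pythagoras: "cinner x y = 0 \<Longrightarrow> (norm (x + y))\<^sup>2 = (norm x)\<^sup>2 + (norm y)\<^sup>2"
  unfolding power2_norm_eq_inner inner_add_left inner_add_right inner_commute[of y x]
  by (simp add: inner_ell2_def)

text \<open>A minimising sequence for the distance to K is Cauchy by the parallelogram law.\<close>

lemma hilbert_projection:
  assumes "hilbert_subspace K"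
  obtains p where "p \<in> K" "\<And>z. z \<in> K \<Longrightarrow> cinner z (\<xi> - p) = 0"
proof -
  have cs: "csubspace K" and "closed K" using assms by (simp_all add: hilbert_subspace_def)
  then have K0: "0 \<in> K" and add: "\<And>x y. x \<in> K \<Longrightarrow> y \<in> K \<Longrightarrow> x + y \<in> K"
    and scale: "\<And>c x. x \<in> K \<Longrightarrow> c *\<^sub>C x \<in> K"
    by (simp_all add: csubspace_def)
  define d where "d = infdist \<xi> K"
  have d: "d \<ge> 0" "\<And>x. x \<in> K \<Longrightarrow> d \<le> norm (\<xi> - x)"
    by (simp_all add: d_def infdist_nonneg infdist_le flip: dist_norm)
  have "\<exists>x\<in>K. norm (\<xi> - x) < d + 1 / (real n + 1)" for n
  proof -
    have "infdist \<xi> K < d + 1 / (real n + 1)" by (simp add: d_def)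
    then show ?thesis
      using K0 cInf_lessD[of "dist \<xi> ` K" "d + 1 / (real n + 1)"]
      by (auto simp: infdist_def dist_norm d_def split: if_splits)
  qed
  then obtain X where X: "\<And>n. X n \<in> K" "\<And>n. norm (\<xi> - X n) < d + 1 / (real n + 1)" by metis
  have "(\<lambda>n. norm (\<xi> - X n)) \<longlonglongrightarrow> d"
  proof (rule tendsto_sandwich[OF _ _ tendsto_const])
    have "(\<lambda>n. d + 1 / (real n + 1)) \<longlonglongrightarrow> d + 0"
      using LIMSEQ_inverse_real_of_nat by (intro tendsto_add tendsto_const) (simp add: inverse_eq_divide add.commute)
    then show "(\<lambda>n. d + 1 / (real n + 1)) \<longlonglongrightarrow> d" by simp
  qed (use d X in \<open>auto simp: less_imp_le\<close>)
  then have sq: "(\<lambda>n. (norm (\<xi> - X n))\<^sup>2) \<longlonglongrightarrow> d\<^sup>2" by (rule tendsto_power)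
  have para: "(norm (X m - X n))\<^sup>2 \<le> 2 * ((norm (\<xi> - X m))\<^sup>2 - d\<^sup>2) + 2 * ((norm (\<xi> - X n))\<^sup>2 - d\<^sup>2)" for m n
  proof -
    define a b where "a = \<xi> - X m" and "b = \<xi> - X n"
    have "(1/2) *\<^sub>R (X m + X n) \<in> K"
      unfolding scaleR_half_ell2 using X by (intro scale add)
    then have "d \<le> norm (\<xi> - (1/2) *\<^sub>R (X m + X n))" by (rule d)
    also have "\<xi> - (1/2) *\<^sub>R (X m + X n) = (1/2) *\<^sub>R (a + b)"
    proof -
      have "a + b = 2 *\<^sub>R \<xi> - (X m + X n)" by (simp add: a_def b_def scaleR_2)
      then show ?thesis by (simp add: scaleR_diff_right)
    qed
    finally have "2 * d \<le> norm (a + b)" by simp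
    then have "(2 * d)\<^sup>2 \<le> (norm (a + b))\<^sup>2" using d by (intro power_mono) auto
    moreover have "(norm (a - b))\<^sup>2 + (norm (a + b))\<^sup>2 = 2 * (norm a)\<^sup>2 + 2 * (norm b)\<^sup>2"
      unfolding power2_norm_eq_inner by (simp add: inner_diff_left inner_diff_right inner_add_left inner_add_right)
    moreover have "norm (X m - X n) = norm (a - b)" by (simp add: a_def b_def norm_minus_commute)
    ultimately show ?thesis by (simp add: a_def b_def power_mult_distrib)
  qed
  have "Cauchy X"
  proof (rule CauchyI)
    fix e :: real assume "e > 0"
    then have "eventually (\<lambda>n. (norm (\<xi> - X n))\<^sup>2 < d\<^sup>2 + e\<^sup>2 / 4) sequentially"
      by (intro order_tendstoD(2)[OF sq]) simp
    then obtain M where M: "\<And>n. n \<ge> M \<Longrightarrow> (norm (\<xi> - X n))\<^sup>2 < d\<^sup>2 + e\<^sup>2 / 4"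
      by (auto simp: eventually_sequentially)
    have "norm (X m - X n) < e" if "m \<ge> M" "n \<ge> M" for m n
    proof -
      have "2 * ((norm (\<xi> - X m))\<^sup>2 - d\<^sup>2) + 2 * ((norm (\<xi> - X n))\<^sup>2 - d\<^sup>2) < 2 * (e\<^sup>2 / 4) + 2 * (e\<^sup>2 / 4)"
        using M[OF that(1)] M[OF that(2)] by (intro add_strict_mono mult_strict_left_mono) auto
      then have "(norm (X m - X n))\<^sup>2 < e\<^sup>2" using para[of m n] by simp
      then show ?thesis using \<open>e > 0\<close> by (simp add: power2_less_imp_less)
    qed
    then show "\<exists>M. \<forall>m\<ge>M. \<forall>n\<ge>M. norm (X m - X n) < e" by blast
  qed
  then obtain p where p: "X \<longlonglongrightarrow> p" by (auto simp: Cauchy_convergent_iff convergent_def)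
  have pK: "p \<in> K" using closed_sequentially[OF \<open>closed K\<close> _ p] X by blast
  have "(\<lambda>n. (norm (\<xi> - X n))\<^sup>2) \<longlonglongrightarrow> (norm (\<xi> - p))\<^sup>2" by (intro tendsto_intros p)
  then have pd: "(norm (\<xi> - p))\<^sup>2 = d\<^sup>2" using sq LIMSEQ_unique by blast
  have orth: "inner z (\<xi> - p) = 0" if "z \<in> K" for z
  proof -
    have "0 \<le> - 2 * t * inner z (\<xi> - p) + t\<^sup>2 * inner z z" for t
    proof -
      have "p + t *\<^sub>R z \<in> K" using pK that by (simp add: scaleR_ell2_def add scale)
      then have "d\<^sup>2 \<le> (norm (\<xi> - (p + t *\<^sub>R z)))\<^sup>2" using d by (intro power_mono) auto
      also have "\<dots> = (norm (\<xi> - p))\<^sup>2 - 2 * t * inner z (\<xi> - p) + t\<^sup>2 * inner z z"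
        unfolding power2_norm_eq_inner diff_diff_eq[symmetric] inner_diff_left[of "\<xi> - p"]
          inner_diff_right[of _ "\<xi> - p"] inner_commute[of "\<xi> - p" "t *\<^sub>R z"]
        by (simp add: power2_eq_square)
      finally show ?thesis using pd by simp
    qed
    \<comment> \<open>The minimising value of t.\<close>
    from this[of "inner z (\<xi> - p) / inner z z"] show ?thesis
    proof (cases "z = 0")
      case False
      define a b where "a = inner z (\<xi> - p)" and "b = inner z z"
      have "b > 0" using False by (simp add: b_def)
      have "0 \<le> - 2 * (a / b) * a + (a / b)\<^sup>2 * b" unfolding a_def b_def by fact
      also have "\<dots> = - (a\<^sup>2 / b)" using \<open>b > 0\<close> by (simp add: power2_eq_square)
      finally have "a\<^sup>2 \<le> 0" using \<open>b > 0\<close> by (simp add: divide_le_0_iff)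
      then show ?thesis by (simp add: a_def)
    qed simp
  qed
  have "cinner z (\<xi> - p) = 0" if "z \<in> K" for z
    unfolding cinner_eq_inner using orth[OF that] orth[OF scale[OF that], of \<i>] by (simp add: complex_eq_iff)
  then show thesis using that pK by blast
qed

section \<open>Representations\<close>

locale representation =
  fixes H :: "ell2 set" and \<pi> :: "'a::complex_star_algebra \<Rightarrow> ell2 \<Rightarrow> ell2"
  assumes star_rep: "star_rep H \<pi>"
begin

lemma subspace: "csubspace H" and closed: "closed H" and hilbert: "hilbert_subspace H"
  using star_rep by (simp_all add: star_rep_def hilbert_subspace_def)

lemma zero_mem: "0 \<in> H"
  and add_mem: "x \<in> H \<Longrightarrow> y \<in> H \<Longrightarrow> x + y \<in> H"
  and scale_mem: "x \<in> H \<Longrightarrow> c *\<^sub>C x \<in> H"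
  using subspace by (simp_all add: csubspace_def)

lemmas diff_mem = csubspace_diff[OF subspace]
  and sum_mem = csubspace_sum[OF subspace]

lemma bounded: "bounded_operator_on H (\<pi> a)"
  using star_rep by (simp add: star_rep_def)

lemma op_mem: "x \<in> H \<Longrightarrow> \<pi> a x \<in> H"
  and op_add: "x \<in> H \<Longrightarrow> y \<in> H \<Longrightarrow> \<pi> a (x + y) = \<pi> a x + \<pi> a y"
  and op_scale: "x \<in> H \<Longrightarrow> \<pi> a (c *\<^sub>C x) = c *\<^sub>C \<pi> a x"
  using bounded[of a] by (simp_all add: bounded_operator_on_def)

lemma op_zero: "\<pi> a 0 = 0"
  using op_add[OF zero_mem zero_mem, of a] by simp

lemma op_diff: "x \<in> H \<Longrightarrow> y \<in> H \<Longrightarrow> \<pi> a (x - y) = \<pi> a x - \<pi> a y"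
  using op_add[of "x - y" y a] diff_mem[of x y] by simp

lemma op_sum: "(\<And>i. i \<in> A \<Longrightarrow> f i \<in> H) \<Longrightarrow> \<pi> a (sum f A) = (\<Sum>i\<in>A. \<pi> a (f i))"
  by (induction A rule: infinite_finite_induct) (simp_all add: op_zero op_add sum_mem)

lemma rep_one: "x \<in> H \<Longrightarrow> \<pi> 1 x = x"
  and rep_add: "x \<in> H \<Longrightarrow> \<pi> (a + b) x = \<pi> a x + \<pi> b x"
  and rep_scale: "x \<in> H \<Longrightarrow> \<pi> (c *\<^sub>C a) x = c *\<^sub>C \<pi> a x"
  and rep_mult: "x \<in> H \<Longrightarrow> \<pi> (a * b) x = \<pi> a (\<pi> b x)"
  and rep_star: "x \<in> H \<Longrightarrow> y \<in> H \<Longrightarrow> cinner (\<pi> (star a) x) y = cinner x (\<pi> a y)"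
  using star_rep by (simp_all add: star_rep_def)

lemma rep_clinear: "x \<in> H \<Longrightarrow> clinear (\<lambda>a. \<pi> a x)"
  by (simp add: clinear_def rep_add rep_scale)

lemmas rep_zero = clinear_zero[OF rep_clinear]
  and rep_diff = clinear_diff[OF rep_clinear]
  and rep_sum = clinear_sum[OF rep_clinear]

lemma rep_star': "x \<in> H \<Longrightarrow> y \<in> H \<Longrightarrow> cinner (\<pi> a x) y = cinner x (\<pi> (star a) y)"
  using rep_star[of x y "star a"] by (simp add: star_star)

lemma rep_square: "x \<in> H \<Longrightarrow> cinner x (\<pi> (star a * a) x) = of_real ((norm (\<pi> a x))\<^sup>2)"
  by (simp only: rep_mult op_mem rep_star'[symmetric] cinner_self_norm)

lemma vector_functional: "x \<in> H \<Longrightarrow> positive_functional (\<lambda>a. cinner x (\<pi> a x))"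
  unfolding positive_functional_def clinear_def
  by (simp add: rep_add rep_scale cinner_add_right cinner_scaleC_right rep_square
      complex_nonneg_Reals_iff del: of_real_power)

end

text \<open>
  Apply the bound for positive functionals to the vector functional of \<xi>.
\<close>

lemma star_rep_contractive:
  fixes \<pi> :: "'c::cstar_algebra \<Rightarrow> ell2 \<Rightarrow> ell2"
  assumes "star_rep H \<pi>" "\<xi> \<in> H"
  shows "norm (\<pi> a \<xi>) \<le> norm a * norm \<xi>"
proof -
  interpret representation H \<pi> by unfold_locales (rule assms(1))
  have "(norm (\<pi> a \<xi>))\<^sup>2 \<le> (norm a)\<^sup>2 * (norm \<xi>)\<^sup>2"
    using positive_functional_bound[OF vector_functional[OF assms(2)], of a 1] assms(2)
    by (simp add: rep_square rep_one cinner_self_norm flip: of_real_power)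
  then have "(norm (\<pi> a \<xi>))\<^sup>2 \<le> (norm a * norm \<xi>)\<^sup>2" by (simp add: power_mult_distrib)
  then show ?thesis by (rule power2_le_imp_le) simp
qed

lemma star_rep_tendsto:
  fixes \<pi> :: "'c::cstar_algebra \<Rightarrow> ell2 \<Rightarrow> ell2"
  assumes "star_rep H \<pi>" "\<xi> \<in> H" "a \<longlonglongrightarrow> l"
  shows "(\<lambda>n. \<pi> (a n) \<xi>) \<longlonglongrightarrow> \<pi> l \<xi>"
proof -
  interpret representation H \<pi> by unfold_locales (rule assms(1))
  have "(\<lambda>n. norm (a n - l) * norm \<xi>) \<longlonglongrightarrow> 0"
    using assms(3) by (intro tendsto_mult_left_zero) (simp add: LIM_zero tendsto_norm_zero)
  moreover have "norm (\<pi> (a n) \<xi> - \<pi> l \<xi>) \<le> norm (a n - l) * norm \<xi>" for n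
    using star_rep_contractive[OF assms(1,2), of "a n - l"] assms(2) by (simp add: rep_diff)
  ultimately show ?thesis by (rule LIMSEQ_norm_boundI)
qed

section \<open>The GNS construction\<close>

text \<open>
  Orthonormalisation of the sequence a for the semidefinite form \<phi> (star x * y). If the
  residual r has length 0, division by 0 makes the new vector 0, so null vectors need no separate
  case in the recursion.
\<close>

function gram_schmidt :: "('a::complex_star_algebra \<Rightarrow> complex) \<Rightarrow> (nat \<Rightarrow> 'a) \<Rightarrow> nat \<Rightarrow> 'a" where
  "gram_schmidt \<phi> a n =
     (let r = a n - (\<Sum>k<n. \<phi> (star (gram_schmidt \<phi> a k) * a n) *\<^sub>C gram_schmidt \<phi> a k)
      in complex_of_real (1 / sqrt (Re (\<phi> (star r * r)))) *\<^sub>C r)"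
  by pat_completeness auto
termination by (relation "Wellfounded.measure (\<lambda>(\<phi>, a, n). n)") auto

declare gram_schmidt.simps [simp del]

context
  fixes \<phi> :: "'a::complex_star_algebra \<Rightarrow> complex" and a :: "nat \<Rightarrow> 'a"
  assumes pos: "positive_functional \<phi>"
begin

abbreviation "gs \<equiv> gram_schmidt \<phi> a"

lemmas phi_linear = positive_functional_clinear[OF pos]

lemma phi_sum_scale: "\<phi> (x * (\<Sum>k\<in>A. c k *\<^sub>C y k)) = (\<Sum>k\<in>A. c k * \<phi> (x * y k))"
  by (simp add: sum_distrib_left mult_scaleC_right clinear_sum[OF phi_linear] clinear_scaleC[OF phi_linear])

lemma gram_schmidt_orthonormal:
  "(\<forall>i<n. \<phi> (star (gs i) * gs n) = 0) \<and> (gs n = 0 \<or> \<phi> (star (gs n) * gs n) = 1)"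
proof (induction n rule: less_induct)
  case (less n)
  define r where "r = a n - (\<Sum>k<n. \<phi> (star (gs k) * a n) *\<^sub>C gs k)"
  define q where "q = Re (\<phi> (star r * r))"
  have q: "\<phi> (star r * r) = of_real q" "q \<ge> 0"
    using positive_functional_square[OF pos, of r] by (simp_all add: q_def complex_eq_iff)
  have gs: "gs n = complex_of_real (1 / sqrt q) *\<^sub>C r"
    unfolding r_def q_def by (subst gram_schmidt.simps) (simp add: Let_def)
  have "\<phi> (star (gs i) * r) = 0" if "i < n" for i
  proof -
    have zero: "\<phi> (star (gs i) * gs k) = 0" if "k < n" "k \<noteq> i" for k
    proof (cases "k < i")
      case True
      then show ?thesis using less[OF \<open>i < n\<close>]
        by (subst positive_functional_hermitian[OF pos]) simp
    next
      case False
      then show ?thesis using less[OF \<open>k < n\<close>] that by simp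
    qed
    have "\<phi> (star (gs i) * r) = \<phi> (star (gs i) * a n)
        - (\<Sum>k<n. \<phi> (star (gs k) * a n) * \<phi> (star (gs i) * gs k))"
      unfolding r_def by (simp add: right_diff_distrib clinear_diff[OF phi_linear] phi_sum_scale)
    also have "(\<Sum>k<n. \<phi> (star (gs k) * a n) * \<phi> (star (gs i) * gs k))
        = (\<Sum>k<n. if k = i then \<phi> (star (gs i) * a n) * \<phi> (star (gs i) * gs i) else 0)"
      by (rule sum.cong) (use zero in auto)
    also have "\<dots> = \<phi> (star (gs i) * a n) * \<phi> (star (gs i) * gs i)"
      using \<open>i < n\<close> by simp
    finally show ?thesis
      using less[OF \<open>i < n\<close>] by (auto simp: clinear_zero[OF phi_linear])
  qed
  then have "\<forall>i<n. \<phi> (star (gs i) * gs n) = 0"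
    unfolding gs by (simp add: mult_scaleC_right clinear_scaleC[OF phi_linear])
  moreover have "gs n = 0 \<or> \<phi> (star (gs n) * gs n) = 1"
  proof (cases "q = 0")
    case False
    define c where "c = complex_of_real (1 / sqrt q)"
    have "cnj c = c" by (simp add: c_def)
    then have "\<phi> (star (gs n) * gs n) = c * c * of_real q"
      unfolding gs c_def[symmetric]
      by (simp add: star_scaleC mult_scaleC_left mult_scaleC_right clinear_scaleC[OF phi_linear] q)
    also have "\<dots> = of_real ((1 / sqrt q) * (1 / sqrt q) * q)"
      unfolding c_def of_real_mult ..
    also have "(1 / sqrt q) * (1 / sqrt q) * q = 1"
      using q(2) False by (simp add: field_simps)
    finally show ?thesis by simp
  qed (simp add: gs)
  ultimately show ?case by blast
qed

lemma gram_schmidt_orthogonal: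
  assumes "i \<noteq> n" shows "\<phi> (star (gs i) * gs n) = 0"
proof (cases "i < n")
  case True
  then show ?thesis using gram_schmidt_orthonormal[of n] by blast
next
  case False
  then have "\<phi> (star (gs n) * gs i) = 0" using assms gram_schmidt_orthonormal[of i] by simp
  then show ?thesis
    by (subst positive_functional_hermitian[OF pos]) simp
qed

text \<open>
  This covers the two possible lengths 0 and 1 at once.
\<close>

lemma gram_schmidt_coefficient:
  "\<phi> (star (gs n) * gs n) * \<phi> (star (gs n) * x) = \<phi> (star (gs n) * x)"
proof (cases "gs n = 0")
  case False
  then show ?thesis using gram_schmidt_orthonormal[of n] by simp
qed (simp add: clinear_zero[OF phi_linear])

lemma gram_schmidt_Bessel_identity:
  defines "p M x \<equiv> \<Sum>k<M. \<phi> (star (gs k) * x) *\<^sub>C gs k"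
  shows "Re (\<phi> (star (x - p M x) * (x - p M x)))
     = Re (\<phi> (star x * x)) - (\<Sum>k<M. (cmod (\<phi> (star (gs k) * x)))\<^sup>2)"
proof (induction M)
  case (Suc M)
  define c y where "c = \<phi> (star (gs M) * x)" and "y = x - p M x"
  have "\<phi> (star (gs M) * y) = c - (\<Sum>k<M. \<phi> (star (gs k) * x) * \<phi> (star (gs M) * gs k))"
    unfolding y_def p_def c_def by (simp add: right_diff_distrib clinear_diff[OF phi_linear] phi_sum_scale)
  also have "(\<Sum>k<M. \<phi> (star (gs k) * x) * \<phi> (star (gs M) * gs k)) = 0"
    by (rule sum.neutral) (simp add: gram_schmidt_orthogonal)
  finally have c: "\<phi> (star (gs M) * y) = c" "\<phi> (star y * gs M) = cnj c"
    using positive_functional_hermitian[OF pos, where x = "gs M" and y = y] by simp_all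
  have "\<phi> (star (gs M) * gs M) * c = c"
    unfolding c_def by (rule gram_schmidt_coefficient)
  then have n: "cnj (- c) * (- c) * \<phi> (star (gs M) * gs M) = cnj c * c" by (simp add: mult_ac)
  have "x - p (Suc M) x = y + (- c) *\<^sub>C gs M" by (simp add: p_def y_def c_def)
  then have "Re (\<phi> (star (x - p (Suc M) x) * (x - p (Suc M) x))) = Re (\<phi> (star y * y)) - Re (cnj c * c)"
    using n c by (simp only: positive_functional_expand[OF pos]) (simp add: algebra_simps)
  also have "Re (cnj c * c) = (cmod c)\<^sup>2" by (simp only: cmod_power2) (simp add: power2_eq_square)
  finally show ?case using Suc by (simp add: y_def c_def)
qed (simp add: p_def)

lemma gram_schmidt_Bessel:
  "(\<Sum>k<M. (cmod (\<phi> (star (gs k) * x)))\<^sup>2) \<le> Re (\<phi> (star x * x))"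
proof -
  let ?y = "x - (\<Sum>k<M. \<phi> (star (gs k) * x) *\<^sub>C gs k)"
  have "0 \<le> Re (\<phi> (star ?y * ?y))" by (rule positive_functional_square(1)[OF pos])
  then show ?thesis unfolding gram_schmidt_Bessel_identity by simp
qed

text \<open>
  The GNS space is realised inside ell2: x is represented by its Fourier coefficients with respect
  to the orthonormalised sequence.
\<close>

definition gns_map :: "'a \<Rightarrow> ell2" where
  "gns_map x = Abs_ell2 (\<lambda>k. \<phi> (star (gs k) * x))"

lemma gns_map_summable: "summable (\<lambda>k. (cmod (\<phi> (star (gs k) * x)))\<^sup>2)"
  by (rule summableI_nonneg_bounded[OF _ gram_schmidt_Bessel]) simp

lemma gns_map_nth: "ell2_nth (gns_map x) k = \<phi> (star (gs k) * x)"
  unfolding gns_map_def by (subst ell2_nth_Abs) (rule gns_map_summable, rule refl)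

lemma gns_map_linear: "clinear gns_map"
  unfolding clinear_def
proof (intro conjI allI)
  show "gns_map (x + y) = gns_map x + gns_map y" for x y
    by (rule ell2_eqI) (simp add: gns_map_nth distrib_left clinear_add[OF phi_linear])
  show "gns_map (c *\<^sub>C x) = c *\<^sub>C gns_map x" for c x
    by (rule ell2_eqI) (simp add: gns_map_nth mult_scaleC_right clinear_scaleC[OF phi_linear])
qed

lemma norm_gns_map_le: "(norm (gns_map x))\<^sup>2 \<le> Re (\<phi> (star x * x))"
  unfolding ell2_norm_sq gns_map_nth
  by (rule suminf_le_const[OF gns_map_summable]) (rule gram_schmidt_Bessel)

text \<open>
  The part of the squared length of x which the coefficients do not see. It vanishes on the dense
  subspace spanned by a, and then everywhere (gns_defect_zero).
\<close>

definition gns_defect :: "'a \<Rightarrow> real" where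
  "gns_defect x = Re (\<phi> (star x * x)) - (norm (gns_map x))\<^sup>2"

lemma gns_defect_nonneg: "0 \<le> gns_defect x"
  using norm_gns_map_le by (simp add: gns_defect_def)

lemma gns_defect_parallelogram:
  "gns_defect (x + y) + gns_defect (x - y) = 2 * gns_defect x + 2 * gns_defect y"
proof -
  have "(norm (gns_map (x + y)))\<^sup>2 + (norm (gns_map (x - y)))\<^sup>2
      = 2 * (norm (gns_map x))\<^sup>2 + 2 * (norm (gns_map y))\<^sup>2"
    unfolding clinear_add[OF gns_map_linear] clinear_diff[OF gns_map_linear] power2_norm_eq_inner
    by (simp add: inner_add_left inner_add_right inner_diff_left inner_diff_right)
  moreover have "Re (\<phi> (star (x + y) * (x + y))) + Re (\<phi> (star (x - y) * (x - y)))
      = 2 * Re (\<phi> (star x * x)) + 2 * Re (\<phi> (star y * y))"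
    by (simp add: star_add star_diff algebra_simps clinear_add[OF phi_linear] clinear_diff[OF phi_linear])
  ultimately show ?thesis by (simp add: gns_defect_def)
qed

text \<open>
  The defect is a nonnegative quadratic form, as it satisfies the parallelogram identity; so its
  zero set is closed under sums.
\<close>

lemma gns_defect_subspace: "csubspace {x. gns_defect x = 0}"
  unfolding csubspace_def
proof (intro conjI ballI allI)
  show "0 \<in> {x. gns_defect x = 0}"
    by (simp add: gns_defect_def clinear_zero[OF gns_map_linear] clinear_zero[OF phi_linear])
next
  fix x y assume "x \<in> {x. gns_defect x = 0}" "y \<in> {x. gns_defect x = 0}"
  then show "x + y \<in> {x. gns_defect x = 0}"
    using gns_defect_parallelogram[of x y] gns_defect_nonneg[of "x + y"] gns_defect_nonneg[of "x - y"] by simp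
next
  fix c x assume "x \<in> {x. gns_defect x = 0}"
  moreover have "\<phi> (star (c *\<^sub>C x) * (c *\<^sub>C x)) = of_real ((cmod c)\<^sup>2) * \<phi> (star x * x)"
    by (simp add: star_scaleC mult_scaleC_left mult_scaleC_right clinear_scaleC[OF phi_linear]
        complex_norm_square mult_ac del: of_real_power)
  ultimately show "c *\<^sub>C x \<in> {x. gns_defect x = 0}"
    by (simp add: gns_defect_def clinear_scaleC[OF gns_map_linear] norm_scaleC_ell2 power_mult_distrib
        del: of_real_power)
qed

lemma gns_defect_generators: "gns_defect (a n) = 0"
proof -
  define r where "r = a n - (\<Sum>k<n. \<phi> (star (gs k) * a n) *\<^sub>C gs k)"
  define q where "q = Re (\<phi> (star r * r))"
  have gs: "gs n = complex_of_real (1 / sqrt q) *\<^sub>C r"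
    unfolding r_def q_def by (subst gram_schmidt.simps) (simp add: Let_def)
  have e: "gns_defect (gs k) = 0" for k
  proof (cases "gs k = 0")
    case False
    then have one: "\<phi> (star (gs k) * gs k) = 1" using gram_schmidt_orthonormal[of k] by auto
    have "1 \<le> norm (gns_map (gs k))"
      using ell2_nth_le[of "gns_map (gs k)" k] one by (simp add: gns_map_nth)
    then have "1 \<le> (norm (gns_map (gs k)))\<^sup>2" by simp
    then show ?thesis using gns_defect_nonneg[of "gs k"] by (simp add: gns_defect_def one)
  qed (use gns_defect_subspace in \<open>simp add: csubspace_def\<close>)
  \<comment> \<open>A residual of length 0 has defect 0 because the defect lies between 0 and the squared length.\<close>
  have "gns_defect r = 0"
  proof (cases "q = 0")
    case True
    then show ?thesis
      using gns_defect_nonneg[of r] by (simp add: gns_defect_def q_def)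
  next
    case False
    then have "q > 0" using positive_functional_square(1)[OF pos, of r] by (simp add: q_def)
    then have "r = complex_of_real (sqrt q) *\<^sub>C gs n"
      by (simp add: gs scaleC_one flip: of_real_mult)
    then show ?thesis using gns_defect_subspace e[of n] unfolding csubspace_def by simp
  qed
  moreover have "(\<Sum>k<n. \<phi> (star (gs k) * a n) *\<^sub>C gs k) \<in> {x. gns_defect x = 0}"
    by (rule csubspace_sum[OF gns_defect_subspace]) (use gns_defect_subspace e in \<open>simp add: csubspace_def\<close>)
  ultimately have "r + (\<Sum>k<n. \<phi> (star (gs k) * a n) *\<^sub>C gs k) \<in> {x. gns_defect x = 0}"
    using gns_defect_subspace by (simp add: csubspace_def)
  then show ?thesis by (simp add: r_def)
qed

end

context
  fixes \<phi> :: "'c::cstar_algebra \<Rightarrow> complex" and a :: "nat \<Rightarrow> 'c"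
  assumes pos: "positive_functional \<phi>" and one: "\<phi> 1 = 1" and dense: "closure (cspan (range a)) = UNIV"
begin

abbreviation "J \<equiv> gns_map \<phi> a"

lemmas J_linear = gns_map_linear[OF pos, of a]

text \<open>
  For X n in the span of a, the parallelogram identity bounds the defect of x by twice the defect
  of x - X n, which is at most twice the squared norm of x - X n.
\<close>

lemma gns_defect_zero: "gns_defect \<phi> a x = 0"
proof -
  let ?Z = "{x. gns_defect \<phi> a x = 0}"
  have "cspan (range a) \<subseteq> ?Z"
    unfolding cspan_def using gns_defect_subspace[OF pos] gns_defect_generators[OF pos]
    by (intro hull_minimal) auto
  moreover obtain X where X: "\<And>n. X n \<in> cspan (range a)" "X \<longlonglongrightarrow> x"
    using dense closure_sequential[of x "cspan (range a)"] by auto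
  ultimately have Z: "gns_defect \<phi> a (X n) = 0" for n by blast
  have "gns_defect \<phi> a x \<le> 2 * (norm (X n - x))\<^sup>2" for n
  proof -
    have "gns_defect \<phi> a x + gns_defect \<phi> a (X n - (x - X n)) = 2 * gns_defect \<phi> a (x - X n)"
      using gns_defect_parallelogram[OF pos, of a "X n" "x - X n"] Z[of n] by simp
    moreover have "gns_defect \<phi> a (x - X n) \<le> (norm (X n - x))\<^sup>2"
    proof -
      have "gns_defect \<phi> a (x - X n) \<le> Re (\<phi> (star (x - X n) * (x - X n)))"
        by (simp add: gns_defect_def[OF pos])
      also have "\<dots> \<le> (norm (x - X n))\<^sup>2"
        using positive_functional_bound[OF pos, of "x - X n" 1] one by simp
      finally show ?thesis by (simp add: norm_minus_commute)
    qed
    ultimately show ?thesis using gns_defect_nonneg[OF pos, of a "X n - (x - X n)"] by linarith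
  qed
  note bound = this
  have lim: "(\<lambda>n. 2 * (norm (X n - x))\<^sup>2) \<longlonglongrightarrow> 2 * (norm (x - x))\<^sup>2"
    by (intro tendsto_intros X)
  have "gns_defect \<phi> a x \<le> 2 * (norm (x - x))\<^sup>2"
    using bound by (intro LIMSEQ_le_const[OF lim] exI[of _ 0] allI impI)
  then show ?thesis using gns_defect_nonneg[OF pos, of a x] by simp
qed

lemma norm_J: "(norm (J x))\<^sup>2 = Re (\<phi> (star x * x))"
  using gns_defect_zero[of x] by (simp add: gns_defect_def[OF pos])

text \<open>
  Polarisation of the equality of norms.
\<close>

lemma cinner_J: "cinner (J x) (J y) = \<phi> (star x * y)"
proof -
  have re: "Re (cinner (J x) (J y)) = Re (\<phi> (star x * y))" for x y
  proof -
    have "(norm (J (x + y)))\<^sup>2 = (norm (J x))\<^sup>2 + (norm (J y))\<^sup>2 + 2 * inner (J x) (J y)"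
      unfolding clinear_add[OF J_linear] power2_norm_eq_inner
      by (simp add: inner_add_left inner_add_right inner_commute)
    moreover have "Re (\<phi> (star (x + y) * (x + y)))
        = Re (\<phi> (star x * x)) + Re (\<phi> (star y * y)) + 2 * Re (\<phi> (star x * y))"
      using positive_functional_expand[OF pos, of x 1 y] positive_functional_hermitian[OF pos, of y x]
      by (simp add: scaleC_one)
    ultimately show ?thesis unfolding norm_J by (simp add: inner_ell2_def)
  qed
  show ?thesis
  proof (rule complex_eqI)
    have "Re (cinner (J (\<i> *\<^sub>C x)) (J y)) = Re (\<phi> (star (\<i> *\<^sub>C x) * y))" by (rule re)
    then show "Im (cinner (J x) (J y)) = Im (\<phi> (star x * y))"
      by (simp add: clinear_scaleC[OF J_linear] cinner_scaleC_left star_scaleC mult_scaleC_left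
          clinear_scaleC[OF positive_functional_clinear[OF pos]]
          clinear_uminus[OF positive_functional_clinear[OF pos]])
  qed (rule re)
qed

lemma norm_J_mult: "norm (J (x * y)) \<le> norm x * norm (J y)"
proof -
  have "(norm (J (x * y)))\<^sup>2 \<le> (norm x * norm (J y))\<^sup>2"
    unfolding power_mult_distrib norm_J by (rule positive_functional_bound[OF pos])
  then show ?thesis by (rule power2_le_imp_le) simp
qed

definition gns_space :: "ell2 set" where
  "gns_space = closure (range J)"

text \<open>
  The continuous extension of J y \<mapsto> J (x * y), computed along some approximating sequence;
  gns_op_tendsto shows that every such sequence gives the same limit.
\<close>

definition gns_op :: "'c \<Rightarrow> ell2 \<Rightarrow> ell2" where
  "gns_op x \<xi> = lim (\<lambda>n. J (x * (SOME y. (\<lambda>n. J (y n)) \<longlonglongrightarrow> \<xi>) n))"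

lemma gns_op_tendsto:
  assumes "(\<lambda>n. J (y n)) \<longlonglongrightarrow> \<xi>"
  shows "(\<lambda>n. J (x * y n)) \<longlonglongrightarrow> gns_op x \<xi>"
proof -
  define z where "z = (SOME y. (\<lambda>n. J (y n)) \<longlonglongrightarrow> \<xi>)"
  have z: "(\<lambda>n. J (z n)) \<longlonglongrightarrow> \<xi>"
    unfolding z_def by (rule someI[where P = "\<lambda>y. (\<lambda>n. J (y n)) \<longlonglongrightarrow> \<xi>", OF assms])
  have diff: "norm (J (x * s) - J (x * t)) \<le> norm x * norm (J s - J t)" for s t
    using norm_J_mult[of x "s - t"] by (simp add: right_diff_distrib clinear_diff[OF J_linear])
  have "Cauchy (\<lambda>n. J (x * z n))"
  proof (rule CauchyI)
    fix e :: real assume "e > 0"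
    have "e / (norm x + 1) > 0" using \<open>e > 0\<close> by (simp add: add_nonneg_pos)
    then obtain M where M: "\<And>m n. m \<ge> M \<Longrightarrow> n \<ge> M \<Longrightarrow> norm (J (z m) - J (z n)) < e / (norm x + 1)"
      using CauchyD[OF LIMSEQ_imp_Cauchy[OF z]] by blast
    have "norm (J (x * z m) - J (x * z n)) < e" if "m \<ge> M" "n \<ge> M" for m n
    proof -
      have "norm (J (x * z m) - J (x * z n)) \<le> (norm x + 1) * norm (J (z m) - J (z n))"
        using diff[of "z m" "z n"] by (simp add: distrib_right add_increasing2)
      also have "\<dots> < (norm x + 1) * (e / (norm x + 1))"
        using M[OF that] by (intro mult_strict_left_mono) (auto simp: add_nonneg_pos)
      also have "\<dots> = e" by (simp add: add_nonneg_pos less_imp_neq[symmetric])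
      finally show ?thesis .
    qed
    then show "\<exists>M. \<forall>m\<ge>M. \<forall>n\<ge>M. norm (J (x * z m) - J (x * z n)) < e" by blast
  qed
  then have lim: "(\<lambda>n. J (x * z n)) \<longlonglongrightarrow> gns_op x \<xi>"
    unfolding gns_op_def z_def[symmetric] by (simp add: Cauchy_convergent_iff convergent_LIMSEQ_iff)
  have "(\<lambda>n. norm x * norm (J (y n) - J (z n))) \<longlonglongrightarrow> norm x * norm (\<xi> - \<xi>)"
    by (intro tendsto_intros assms z)
  then have "(\<lambda>n. norm x * norm (J (y n) - J (z n))) \<longlonglongrightarrow> 0" by simp
  then have "(\<lambda>n. J (x * y n) - J (x * z n)) \<longlonglongrightarrow> 0"
    by (rule LIMSEQ_norm_boundI) (simp add: diff)
  from tendsto_add[OF this lim] show ?thesis by simp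
qed

lemma gns_space_sequence:
  assumes "\<xi> \<in> gns_space" obtains y where "(\<lambda>n. J (y n)) \<longlonglongrightarrow> \<xi>"
proof -
  obtain X where X: "\<And>n. X n \<in> range J" "X \<longlonglongrightarrow> \<xi>"
    using assms unfolding gns_space_def closure_sequential by blast
  then have "\<forall>n. \<exists>y. X n = J y" by blast
  then obtain y where "\<And>n. X n = J (y n)" by metis
  then have "X = (\<lambda>n. J (y n))" by blast
  with X(2) that show thesis by blast
qed

lemma gns_spaceI:
  assumes "(\<lambda>n. J (y n)) \<longlonglongrightarrow> \<xi>" shows "\<xi> \<in> gns_space"
  unfolding gns_space_def closure_sequential
  by (rule exI[of _ "\<lambda>n. J (y n)"]) (simp add: assms)

text \<open>
  Each algebraic law holds on the range of J and passes to limits.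
\<close>

lemma gns_star_rep: "star_rep gns_space gns_op"
proof -
  \<comment> \<open>All laws are proved together, since they share the approximating sequences of the two
      vectors.\<close>
  have lin: "\<xi> + \<zeta> \<in> gns_space \<and> c *\<^sub>C \<xi> \<in> gns_space \<and> gns_op x \<xi> \<in> gns_space
      \<and> gns_op x (\<xi> + \<zeta>) = gns_op x \<xi> + gns_op x \<zeta> \<and> gns_op x (c *\<^sub>C \<xi>) = c *\<^sub>C gns_op x \<xi>
      \<and> norm (gns_op x \<xi>) \<le> norm x * norm \<xi>
      \<and> gns_op 1 \<xi> = \<xi> \<and> gns_op (x + x') \<xi> = gns_op x \<xi> + gns_op x' \<xi>
      \<and> gns_op (c *\<^sub>C x) \<xi> = c *\<^sub>C gns_op x \<xi> \<and> gns_op (x * x') \<xi> = gns_op x (gns_op x' \<xi>)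
      \<and> cinner (gns_op (star x) \<xi>) \<zeta> = cinner \<xi> (gns_op x \<zeta>)"
    if mem: "\<xi> \<in> gns_space" "\<zeta> \<in> gns_space" for \<xi> \<zeta> x x' c
  proof -
    obtain y where y: "(\<lambda>n. J (y n)) \<longlonglongrightarrow> \<xi>" using mem(1) by (rule gns_space_sequence)
    obtain z where z: "(\<lambda>n. J (z n)) \<longlonglongrightarrow> \<zeta>" using mem(2) by (rule gns_space_sequence)
    note ops = gns_op_tendsto
    have s: "(\<lambda>n. J (y n + z n)) \<longlonglongrightarrow> \<xi> + \<zeta>"
      unfolding clinear_add[OF J_linear] by (intro tendsto_intros y z)
    have c: "(\<lambda>n. J (c *\<^sub>C y n)) \<longlonglongrightarrow> c *\<^sub>C \<xi>"
      unfolding clinear_scaleC[OF J_linear] by (intro tendsto_scaleC_ell2 y)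
    have "gns_op x (\<xi> + \<zeta>) = gns_op x \<xi> + gns_op x \<zeta>"
      using LIMSEQ_unique[OF ops[OF s, of x]] tendsto_add[OF ops[OF y, of x] ops[OF z, of x]]
      by (simp add: distrib_left clinear_add[OF J_linear])
    moreover have "gns_op x (c *\<^sub>C \<xi>) = c *\<^sub>C gns_op x \<xi>"
      using LIMSEQ_unique[OF ops[OF c, of x]] tendsto_scaleC_ell2[OF ops[OF y, of x], of c]
      by (simp add: mult_scaleC_right clinear_scaleC[OF J_linear])
    moreover have "norm (gns_op x \<xi>) \<le> norm x * norm \<xi>"
      by (rule LIMSEQ_le[OF tendsto_norm[OF ops[OF y]] tendsto_mult_left[OF tendsto_norm[OF y]]])
        (use norm_J_mult in blast)
    moreover have "gns_op 1 \<xi> = \<xi>" using LIMSEQ_unique[OF ops[OF y, of 1]] y by simp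
    moreover have "gns_op (x + x') \<xi> = gns_op x \<xi> + gns_op x' \<xi>"
      using LIMSEQ_unique[OF ops[OF y, of "x + x'"]] tendsto_add[OF ops[OF y, of x] ops[OF y, of x']]
      by (simp add: distrib_right clinear_add[OF J_linear])
    moreover have "gns_op (c *\<^sub>C x) \<xi> = c *\<^sub>C gns_op x \<xi>"
      using LIMSEQ_unique[OF ops[OF y, of "c *\<^sub>C x"]] tendsto_scaleC_ell2[OF ops[OF y, of x], of c]
      by (simp add: mult_scaleC_left clinear_scaleC[OF J_linear])
    moreover have "gns_op (x * x') \<xi> = gns_op x (gns_op x' \<xi>)"
      using LIMSEQ_unique[OF ops[OF y, of "x * x'"]] ops[OF ops[OF y, of x'], of x] by (simp add: mult.assoc)
    moreover have "cinner (gns_op (star x) \<xi>) \<zeta> = cinner \<xi> (gns_op x \<zeta>)"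
      using LIMSEQ_unique[OF tendsto_cinner[OF ops[OF y, of "star x"] z]]
        tendsto_cinner[OF y ops[OF z, of x]]
      by (simp add: cinner_J star_mult star_star mult.assoc)
    ultimately show ?thesis using s c ops[OF y, of x] gns_spaceI by simp
  qed
  have "0 \<in> gns_space"
    using gns_spaceI[of "\<lambda>_. 0"] by (simp add: clinear_zero[OF J_linear])
  then have "hilbert_subspace gns_space"
    using lin unfolding hilbert_subspace_def csubspace_def by (auto simp: gns_space_def)
  moreover have "bounded_operator_on gns_space (gns_op x)" for x
    unfolding bounded_operator_on_def using lin by blast
  ultimately show ?thesis unfolding star_rep_def using lin by blast
qed

lemma gns_op_J: "gns_op x (J y) = J (x * y)"
proof -
  have "(\<lambda>_::nat. J (x * y)) \<longlonglongrightarrow> gns_op x (J y)" by (rule gns_op_tendsto) (rule tendsto_const)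
  from LIMSEQ_unique[OF this tendsto_const] show ?thesis .
qed

lemma GNS:
  obtains H \<pi> \<xi> where "star_rep H \<pi>" "\<xi> \<in> H" "H = closure (range (\<lambda>x. \<pi> x \<xi>))"
    "\<And>x. cinner \<xi> (\<pi> x \<xi>) = \<phi> x"
proof
  show "star_rep gns_space gns_op" by (rule gns_star_rep)
  show "J 1 \<in> gns_space" by (rule gns_spaceI) (rule tendsto_const)
  show "gns_space = closure (range (\<lambda>x. gns_op x (J 1)))" by (simp add: gns_op_J gns_space_def)
  show "cinner (J 1) (gns_op x (J 1)) = \<phi> x" for x by (simp add: gns_op_J cinner_J)
qed

end

section \<open>Pure states and irreducible representations\<close>

definition state :: "('a::complex_star_algebra \<Rightarrow> complex) \<Rightarrow> bool" where
  "state \<phi> \<longleftrightarrow> positive_functional \<phi> \<and> \<phi> 1 = 1"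

definition pure_state :: "('a::complex_star_algebra \<Rightarrow> complex) \<Rightarrow> bool" where
  "pure_state \<phi> \<longleftrightarrow> state \<phi> \<and>
     (\<forall>\<psi> \<theta>. \<forall>s\<in>{0<..<1}. state \<psi> \<and> state \<theta> \<and>
        (\<forall>x. \<phi> x = complex_of_real s * \<psi> x + complex_of_real (1 - s) * \<theta> x) \<longrightarrow> \<psi> = \<phi>)"

lemma (in representation) vector_state:
  assumes "x \<in> H" "x \<noteq> 0"
  shows "state (\<lambda>a. cinner x (\<pi> a x) / of_real ((norm x)\<^sup>2))"
proof -
  have p: "positive_functional (\<lambda>a. cinner x (\<pi> a x))" by (rule vector_functional[OF assms(1)])
  have "cinner x (\<pi> (star a * a) x) / of_real ((norm x)\<^sup>2) \<in> \<real>\<^sub>\<ge>\<^sub>0" for a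
    unfolding rep_square[OF assms(1)] of_real_divide[symmetric] by (simp add: complex_nonneg_Reals_iff del: of_real_divide)
  then have "positive_functional (\<lambda>a. cinner x (\<pi> a x) / of_real ((norm x)\<^sup>2))"
    using p unfolding positive_functional_def clinear_def by (simp add: add_divide_distrib)
  then show ?thesis using assms by (simp add: state_def rep_one cinner_self_norm)
qed

lemma (in representation) orthogonal_cyclic:
  assumes "\<xi> \<in> H" "H = closure (range (\<lambda>x. \<pi> x \<xi>))" "z \<in> H" "\<And>x. cinner z (\<pi> x \<xi>) = 0"
  shows "z = 0"
proof -
  obtain X where X: "\<And>n. X n \<in> range (\<lambda>x. \<pi> x \<xi>)" "X \<longlonglongrightarrow> z"
    using assms(3) closure_sequential[of z "range (\<lambda>x. \<pi> x \<xi>)"] unfolding assms(2)[symmetric] by blast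
  have "cinner z (X n) = 0" for n
    using X(1)[of n] assms(4) by fastforce
  then have "(\<lambda>_. 0) \<longlonglongrightarrow> cinner z z"
    using tendsto_cinner[OF tendsto_const[of z] X(2)] by simp
  then have "cinner z z = 0" using LIMSEQ_unique tendsto_const by blast
  then show ?thesis by (simp add: cinner_self_norm)
qed

text \<open>
  Let \<zeta> and \<eta> be the components of the cyclic vector \<xi> in an invariant subspace K
  and in its complement. If both are non-zero, \<phi> is a proper convex combination of their
  vector states, so by purity \<zeta> and \<xi> have proportional functionals. Then \<zeta> = s
  \<xi> because \<xi> is cyclic, and \<xi> lies in K.
\<close>

lemma pure_state_irreducible:
  fixes \<pi> :: "'a::complex_star_algebra \<Rightarrow> ell2 \<Rightarrow> ell2"
  assumes rep: "star_rep H \<pi>" and \<xi>: "\<xi> \<in> H" and cyclic: "H = closure (range (\<lambda>x. \<pi> x \<xi>))"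
    and \<phi>: "\<And>x. cinner \<xi> (\<pi> x \<xi>) = \<phi> x" and pure: "pure_state \<phi>"
  shows "irreducible_rep H \<pi>"
proof -
  interpret representation H \<pi> by unfold_locales (rule rep)
  have "cinner \<xi> \<xi> = 1"
    using \<phi>[of 1] pure \<xi> by (simp add: pure_state_def state_def rep_one)
  then have n1: "norm \<xi> = 1" by (simp add: cinner_self_norm power2_eq_1_iff flip: of_real_power)
      (metis norm_ge_zero not_one_le_zero neg_0_le_iff_le)
  have "K = {0} \<or> K = H"
    if K: "hilbert_subspace K" "K \<subseteq> H" and inv: "\<And>x \<zeta>. \<zeta> \<in> K \<Longrightarrow> \<pi> x \<zeta> \<in> K" for K
  proof -
    have Ks: "csubspace K" and Kc: "closed K" using K(1) by (simp_all add: hilbert_subspace_def)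
    obtain \<zeta> where \<zeta>: "\<zeta> \<in> K" "\<And>z. z \<in> K \<Longrightarrow> cinner z (\<xi> - \<zeta>) = 0"
      using hilbert_projection[OF K(1), of \<xi>] by metis
    define \<eta> where "\<eta> = \<xi> - \<zeta>"
    have \<zeta>H: "\<zeta> \<in> H" using \<zeta> K by blast
    have \<eta>: "\<eta> \<in> H" "\<And>z. z \<in> K \<Longrightarrow> cinner z \<eta> = 0"
      using \<zeta> \<zeta>H \<xi> by (simp_all add: \<eta>_def diff_mem)
    have \<eta>': "cinner z (\<pi> x \<eta>) = 0" if "z \<in> K" for z x
      using rep_star'[of z \<eta> "star x"] \<eta> inv[OF that] that K(2) by (auto simp: star_star)
    have sum: "\<xi> = \<zeta> + \<eta>" by (simp add: \<eta>_def)
    consider "\<zeta> = 0" | "\<eta> = 0" | "\<zeta> \<noteq> 0" "\<eta> \<noteq> 0" by blast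
    then show ?thesis
    proof cases
      case 1
      have "z = 0" if "z \<in> K" for z
        using orthogonal_cyclic[OF \<xi> cyclic] \<eta>'[OF that] that K(2) 1 sum by auto
      then show ?thesis using Ks by (auto simp: csubspace_def)
    next
      case 2
      then have "\<xi> \<in> K" using \<zeta> sum by simp
      then have "H \<subseteq> K" unfolding cyclic using inv Kc by (intro closure_minimal) auto
      then show ?thesis using K(2) by blast
    next
      case 3
      \<comment> \<open>The weight of the vector state of \<zeta> in \<phi>.\<close>
      define s where "s = (norm \<zeta>)\<^sup>2"
      have "(norm \<zeta>)\<^sup>2 + (norm \<eta>)\<^sup>2 = 1"
        using Pythagoras[of \<zeta> \<eta>] \<eta>(2)[OF \<zeta>(1)] n1 sum by simp
      then have s': "(norm \<eta>)\<^sup>2 = 1 - s" by (simp add: s_def)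
      have s: "s \<in> {0<..<1}"
        using 3 s' by (auto simp: s_def) (smt (verit) zero_less_norm_iff zero_less_power2)
      define \<psi> \<theta> where "\<psi> = (\<lambda>a. cinner \<zeta> (\<pi> a \<zeta>) / of_real ((norm \<zeta>)\<^sup>2))"
        and "\<theta> = (\<lambda>a. cinner \<eta> (\<pi> a \<eta>) / of_real ((norm \<eta>)\<^sup>2))"
      have st: "state \<psi>" "state \<theta>"
        unfolding \<psi>_def \<theta>_def using vector_state \<zeta>H \<eta>(1) 3 by blast+
      have cross: "cinner \<zeta> (\<pi> x \<eta>) = 0" "cinner \<eta> (\<pi> x \<zeta>) = 0" for x
        using \<eta>'[OF \<zeta>(1)] \<eta>(2)[OF inv[OF \<zeta>(1)], of x] cinner_commute[of \<eta> "\<pi> x \<zeta>"] by simp_all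
      have "\<phi> x = complex_of_real s * \<psi> x + complex_of_real (1 - s) * \<theta> x" for x
      proof -
        have "\<phi> x = cinner \<zeta> (\<pi> x \<zeta>) + cinner \<eta> (\<pi> x \<eta>)"
          unfolding \<phi>[symmetric] sum
          by (simp add: op_add \<zeta>H \<eta>(1) cinner_add_left cinner_add_right cross)
        moreover have "cinner \<zeta> (\<pi> x \<zeta>) = of_real s * \<psi> x"
          using 3 by (simp add: \<psi>_def s_def)
        moreover have "cinner \<eta> (\<pi> x \<eta>) = of_real (1 - s) * \<theta> x"
          unfolding s'[symmetric] using 3 by (simp add: \<theta>_def)
        ultimately show ?thesis by simp
      qed
      then have "\<psi> = \<phi>" using pure s st unfolding pure_state_def by blast
      have "cinner (\<zeta> - of_real s *\<^sub>C \<xi>) (\<pi> x \<xi>) = 0" for x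
      proof -
        have "cinner \<zeta> (\<pi> x \<zeta>) = of_real s * \<psi> x"
          using s by (simp add: \<psi>_def s_def)
        moreover have "cinner \<zeta> (\<pi> x \<xi>) = cinner \<zeta> (\<pi> x \<zeta>)"
          unfolding sum by (simp add: op_add \<zeta>H \<eta>(1) cinner_add_right cross)
        ultimately show ?thesis
          by (simp add: cinner_diff_left cinner_scaleC_left \<phi> \<open>\<psi> = \<phi>\<close>)
      qed
      then have "\<zeta> - of_real s *\<^sub>C \<xi> = 0"
        by (rule orthogonal_cyclic[OF \<xi> cyclic, rotated]) (simp add: diff_mem scale_mem \<zeta>H \<xi>)
      then have "\<xi> = of_real (1 / s) *\<^sub>C \<zeta>"
        using s by (simp add: scaleC_scaleC scaleC_one flip: of_real_mult)
      then have "\<xi> \<in> K" using Ks \<zeta>(1) by (simp add: csubspace_def)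
      then have "\<eta> \<in> K" using csubspace_diff[OF Ks] \<zeta>(1) by (simp add: \<eta>_def)
      then have "cinner \<eta> \<eta> = 0" by (rule \<eta>)
      then show ?thesis using 3 by (simp add: cinner_self_norm)
    qed
  qed
  moreover have "H \<noteq> {0}" using \<xi> n1 by auto
  ultimately show ?thesis unfolding irreducible_rep_def using rep by blast
qed

text \<open>
  The Banach-Alaoglu argument: the states form a closed subset of a product of discs.
\<close>

lemma compact_states: "compact {\<phi> :: 'c::cstar_algebra \<Rightarrow> complex. state \<phi>}"
proof -
  have "compactin (product_topology (\<lambda>_. euclidean) UNIV) (Pi\<^sub>E UNIV (\<lambda>x :: 'c. cball (0 :: complex) (norm x)))"
    unfolding compactin_PiE by simp
  then have K: "compact (Pi\<^sub>E UNIV (\<lambda>x :: 'c. cball (0 :: complex) (norm x)))"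
    unfolding euclidean_product_topology by simp
  have c: "continuous_on UNIV (\<lambda>\<phi> :: 'c \<Rightarrow> complex. \<phi> x)" for x by simp
  have "{\<phi> :: 'c \<Rightarrow> complex. state \<phi>} = {\<phi>. (\<forall>x y. \<phi> (x + y) = \<phi> x + \<phi> y) \<and> (\<forall>c x. \<phi> (c *\<^sub>C x) = c * \<phi> x)
      \<and> (\<forall>x. \<phi> (star x * x) \<in> \<real>\<^sub>\<ge>\<^sub>0) \<and> \<phi> 1 = 1}"
    by (auto simp: state_def positive_functional_def clinear_def)
  moreover have "closed {\<phi> :: 'c \<Rightarrow> complex. \<phi> x \<in> \<real>\<^sub>\<ge>\<^sub>0}" for x
    using closed_vimage[OF closed_nonneg_Reals_complex c[of x]] by (simp add: vimage_def)
  ultimately have "closed {\<phi> :: 'c \<Rightarrow> complex. state \<phi>}"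
    by (simp, intro closed_Collect_conj closed_Collect_all closed_Collect_eq continuous_intros c)
  moreover have "{\<phi> :: 'c \<Rightarrow> complex. state \<phi>} \<subseteq> Pi\<^sub>E UNIV (\<lambda>x. cball 0 (norm x))"
    using state_norm_le by (auto simp: state_def)
  ultimately show ?thesis using compact_Int_closed[OF K] by (metis Int_absorb1)
qed

lemma state_clinear: "state \<phi> \<Longrightarrow> clinear \<phi>"
  by (simp add: state_def positive_functional_clinear)

lemma state_continuous:
  fixes \<phi> :: "'c::cstar_algebra \<Rightarrow> complex"
  assumes "state \<phi>" "X \<longlonglongrightarrow> l" shows "(\<lambda>n. \<phi> (X n)) \<longlonglongrightarrow> \<phi> l"
proof (rule LIMSEQ_norm_boundI)
  have "(\<lambda>n. norm (X n - l)) \<longlonglongrightarrow> norm (l - l)" by (intro tendsto_intros assms)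
  then show "(\<lambda>n. norm (X n - l)) \<longlonglongrightarrow> 0" by simp
  show "norm (\<phi> (X n) - \<phi> l) \<le> norm (X n - l)" for n
    using state_norm_le[of \<phi> "X n - l"] assms(1) by (simp add: clinear_diff state_clinear) (simp add: state_def)
qed

lemma states_eqI:
  fixes \<phi> \<psi> :: "'c::cstar_algebra \<Rightarrow> complex"
  assumes st: "state \<phi>" "state \<psi>" and dense: "closure (cspan S) = UNIV"
    and eq: "\<And>x. x \<in> S \<Longrightarrow> \<phi> x = \<psi> x"
  shows "\<phi> = \<psi>"
proof
  fix x
  note lin = state_clinear[OF st(1)] state_clinear[OF st(2)]
  have "csubspace {x. \<phi> x = \<psi> x}"
    using lin by (simp add: csubspace_def clinear_zero clinear_add clinear_scaleC)
  then have "cspan S \<subseteq> {x. \<phi> x = \<psi> x}"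
    unfolding cspan_def using eq by (intro hull_minimal) auto
  moreover obtain X where X: "\<And>n. X n \<in> cspan S" "X \<longlonglongrightarrow> x"
    using dense closure_sequential[of x "cspan S"] by auto
  ultimately have eqX: "\<phi> (X n) = \<psi> (X n)" for n by blast
  have "(\<lambda>n. \<psi> (X n)) \<longlonglongrightarrow> \<phi> x" using state_continuous[OF st(1) X(2)] by (simp add: eqX)
  then show "\<phi> x = \<psi> x" using state_continuous[OF st(2) X(2)] LIMSEQ_unique by blast
qed

text \<open>
  The last term measures the strict convexity of the squared modulus.
\<close>

lemma convex_combination_square:
  "(cmod (complex_of_real s * z + complex_of_real (1 - s) * w))\<^sup>2
     = s * (cmod z)\<^sup>2 + (1 - s) * (cmod w)\<^sup>2 - s * (1 - s) * (cmod (z - w))\<^sup>2"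
  unfolding cmod_power2 by (simp add: power2_eq_square algebra_simps)

text \<open>
  A strictly convex function attains its maximum at extreme points only. So take a state
  maximising Re (\<phi> b) + t * G \<phi>, where t > 0 and G is a continuous, strictly convex and
  bounded function on the compact set of states; for small t the maximiser still has Re (\<phi> b)
  > 0.
\<close>

lemma pure_state_exists:
  fixes a :: "nat \<Rightarrow> 'c::cstar_algebra" and \<phi>\<^sub>0 :: "'c \<Rightarrow> complex"
  assumes dense: "closure (cspan (range a)) = UNIV"
    and st: "state \<phi>\<^sub>0" and b: "Re (\<phi>\<^sub>0 b) > 0"
  obtains \<phi> where "pure_state \<phi>" "\<phi> b \<noteq> 0"
proof -
  define S where "S = {\<phi> :: 'c \<Rightarrow> complex. state \<phi>}"
  \<comment> \<open>The weights make the series G converge uniformly on the states, with values at most 2.\<close>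
  define w where "w n = (1/2) ^ n / (1 + norm (a n))\<^sup>2" for n
  define F where "F n \<phi> = w n * (cmod (\<phi> (a n)))\<^sup>2" for n and \<phi> :: "'c \<Rightarrow> complex"
  define G where "G \<phi> = (\<Sum>n. F n \<phi>)" for \<phi>
  \<comment> \<open>Then t * G is at most half of Re (\<phi>0 b).\<close>
  define t where "t = Re (\<phi>\<^sub>0 b) / 4"
  define \<Psi> where "\<Psi> \<phi> = Re (\<phi> b) + t * G \<phi>" for \<phi>
  have "t > 0" using b by (simp add: t_def)
  have wpos: "w n > 0" for n
  proof -
    have "0 < 1 + norm (a n)" by (intro add_pos_nonneg) auto
    then show ?thesis by (simp add: w_def)
  qed
  have F0: "0 \<le> F n \<phi>" for n \<phi> unfolding F_def using wpos[of n] by simp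
  have F: "norm (F n \<phi>) \<le> (1/2) ^ n" if "\<phi> \<in> S" for n \<phi>
  proof -
    have "cmod (\<phi> (a n)) \<le> 1 + norm (a n)"
      using state_norm_le[of \<phi> "a n"] that by (simp add: S_def state_def)
    then have "(cmod (\<phi> (a n)))\<^sup>2 \<le> (1 + norm (a n))\<^sup>2" by (intro power_mono) auto
    then have "F n \<phi> \<le> w n * (1 + norm (a n))\<^sup>2"
      unfolding F_def using wpos[of n] by (intro mult_left_mono) auto
    also have "\<dots> = (1/2) ^ n"
    proof -
      have "1 + norm (a n) > 0" by (intro add_pos_nonneg) auto
      then show ?thesis by (simp add: w_def)
    qed
    finally show ?thesis using F0[of n \<phi>] by simp
  qed
  have geom: "summable (\<lambda>n. (1/2::real) ^ n)" by (simp add: summable_geometric)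
  have Fs: "summable (\<lambda>n. F n \<phi>)" if "\<phi> \<in> S" for \<phi>
    by (rule summable_comparison_test'[OF geom]) (rule F[OF that])
  have G0: "0 \<le> G \<phi>" if "\<phi> \<in> S" for \<phi>
    unfolding G_def by (rule suminf_nonneg[OF Fs[OF that] F0])
  have G2: "G \<phi> \<le> 2" if "\<phi> \<in> S" for \<phi>
  proof -
    have "G \<phi> \<le> (\<Sum>n. (1/2) ^ n)"
      unfolding G_def using F[OF that] by (intro suminf_le Fs geom that) (auto dest: order_trans[OF abs_ge_self])
    then show ?thesis by (simp add: suminf_geometric)
  qed
  have "uniform_limit S (\<lambda>n \<phi>. \<Sum>i<n. F i \<phi>) G sequentially"
    unfolding G_def[abs_def] by (rule Weierstrass_m_test[OF F geom])
  moreover have "continuous_on S (\<lambda>\<phi>. \<Sum>i<n. F i \<phi>)" for n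
    unfolding F_def by (intro continuous_intros continuous_on_subset[OF continuous_on_product_coordinates]) auto
  ultimately have "continuous_on S G"
    by (intro uniform_limit_theorem[where F = sequentially]) auto
  then have "continuous_on S \<Psi>"
    unfolding \<Psi>_def[abs_def]
    by (intro continuous_intros continuous_on_subset[OF continuous_on_product_coordinates]) auto
  moreover have "compact S" unfolding S_def by (rule compact_states)
  moreover have "S \<noteq> {}" using st by (auto simp: S_def)
  ultimately obtain \<phi> where \<phi>: "\<phi> \<in> S" and max: "\<And>\<psi>. \<psi> \<in> S \<Longrightarrow> \<Psi> \<psi> \<le> \<Psi> \<phi>"
    using continuous_attains_sup[of S \<Psi>] by blast
  have "Re (\<phi>\<^sub>0 b) \<le> \<Psi> \<phi>\<^sub>0" using G0[of \<phi>\<^sub>0] st \<open>t > 0\<close> by (simp add: \<Psi>_def S_def)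
  also have "\<dots> \<le> \<Psi> \<phi>" using max st by (simp add: S_def)
  also have "\<dots> \<le> Re (\<phi> b) + t * 2"
    using G2[OF \<phi>] \<open>t > 0\<close> by (simp add: \<Psi>_def)
  finally have "Re (\<phi> b) > 0" using b by (simp add: t_def)
  then have nz: "\<phi> b \<noteq> 0" by auto
  have "\<psi> = \<phi>" if s: "s \<in> {0<..<1}" and S: "state \<psi>" "state \<theta>"
    and comb: "\<And>x. \<phi> x = complex_of_real s * \<psi> x + complex_of_real (1 - s) * \<theta> x" for \<psi> \<theta> s
  proof -
    have \<psi>: "\<psi> \<in> S" and \<theta>: "\<theta> \<in> S" using S by (simp_all add: S_def)
    \<comment> \<open>The loss of convexity of the n-th term between \<psi> and \<theta>; maximality makes every
        D n zero.\<close>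
    define D where "D n = w n * (cmod (\<psi> (a n) - \<theta> (a n)))\<^sup>2" for n
    have FD: "s * (1 - s) * D n = s * F n \<psi> + (1 - s) * F n \<theta> - F n \<phi>" for n
      unfolding F_def D_def comb convex_combination_square by (simp add: algebra_simps)
    have sums: "summable (\<lambda>n. s * F n \<psi> + (1 - s) * F n \<theta> - F n \<phi>)"
      by (intro summable_diff summable_add summable_mult Fs \<psi> \<theta> \<phi>)
    have G_eq: "(\<Sum>n. s * (1 - s) * D n) = s * G \<psi> + (1 - s) * G \<theta> - G \<phi>"
      unfolding FD G_def using Fs[OF \<psi>] Fs[OF \<theta>] Fs[OF \<phi>]
      by (simp add: suminf_diff[symmetric] suminf_add[symmetric] suminf_mult summable_add summable_mult)
    have "s * \<Psi> \<psi> + (1 - s) * \<Psi> \<theta> \<le> \<Psi> \<phi>"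
      using max[OF \<psi>] max[OF \<theta>] s by (intro convex_bound_le) auto
    moreover have "s * Re (\<psi> b) + (1 - s) * Re (\<theta> b) = Re (\<phi> b)" by (simp add: comb)
    ultimately have "t * (\<Sum>n. s * (1 - s) * D n) \<le> 0"
      unfolding G_eq by (simp add: \<Psi>_def algebra_simps)
    then have "(\<Sum>n. s * (1 - s) * D n) \<le> 0" using \<open>t > 0\<close> by (simp add: mult_le_0_iff)
    moreover have nonneg: "0 \<le> s * (1 - s) * D n" for n
      using s wpos[of n] by (simp add: D_def)
    moreover have sumD: "summable (\<lambda>n. s * (1 - s) * D n)" using sums by (simp add: FD)
    ultimately have "(\<Sum>n. s * (1 - s) * D n) = 0"
      using suminf_nonneg by (metis order_antisym)
    then have "\<forall>n. s * (1 - s) * D n = 0"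
      using suminf_eq_zero_iff[OF sumD nonneg] by blast
    then have "s * (1 - s) * D n = 0" for n by blast
    then have "\<psi> (a n) = \<theta> (a n)" for n
      using s wpos[THEN less_imp_neq] by (auto simp: D_def)
    then have "\<psi> (a n) = \<phi> (a n)" for n by (simp add: comb algebra_simps)
    then show "\<psi> = \<phi>" using \<phi> S(1) dense by (intro states_eqI[of _ _ "range a"]) (auto simp: S_def)
  qed
  then have "pure_state \<phi>" using \<phi> unfolding pure_state_def S_def by blast
  then show thesis using nz by (rule that)
qed

text \<open>
  A vector not killed by z gives a state that is positive on star z * z. Replace it by a pure
  state with non-zero value there and take its GNS representation.
\<close>

theorem irreducible_reps_separate:
  fixes a :: "nat \<Rightarrow> 'c::cstar_algebra" and \<rho> :: "'c \<Rightarrow> ell2 \<Rightarrow> ell2"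
  assumes dense: "closure (cspan (range a)) = UNIV"
    and rep: "star_rep H \<rho>" and \<xi>: "\<xi> \<in> H" "\<rho> z \<xi> \<noteq> 0"
  obtains K \<sigma> where "irreducible_rep K \<sigma>" "z \<notin> rep_kernel K \<sigma>"
proof -
  interpret representation H \<rho> by unfold_locales (rule rep)
  have "\<xi> \<noteq> 0" using \<xi> op_zero by auto
  then have "state (\<lambda>x. cinner \<xi> (\<rho> x \<xi>) / of_real ((norm \<xi>)\<^sup>2))"
    using \<xi>(1) by (intro vector_state)
  moreover have "Re (cinner \<xi> (\<rho> (star z * z) \<xi>) / of_real ((norm \<xi>)\<^sup>2)) > 0"
    using \<xi> \<open>\<xi> \<noteq> 0\<close> unfolding rep_square[OF \<xi>(1)] of_real_divide[symmetric] by simp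
  ultimately obtain \<phi> where \<phi>: "pure_state \<phi>" "\<phi> (star z * z) \<noteq> 0"
    by (rule pure_state_exists[OF dense])
  then have "positive_functional \<phi>" "\<phi> 1 = 1" by (simp_all add: pure_state_def state_def)
  then obtain K \<sigma> \<zeta> where \<sigma>: "star_rep K \<sigma>" "\<zeta> \<in> K" "K = closure (range (\<lambda>x. \<sigma> x \<zeta>))"
    "\<And>x. cinner \<zeta> (\<sigma> x \<zeta>) = \<phi> x"
    using GNS[OF _ _ dense] by metis
  interpret \<sigma>: representation K \<sigma> by unfold_locales (rule \<sigma>(1))
  have "irreducible_rep K \<sigma>" by (rule pure_state_irreducible[OF \<sigma> \<phi>(1)])
  moreover have "\<sigma> z \<zeta> \<noteq> 0"
    using \<phi>(2) \<sigma>(4)[of "star z * z"] \<sigma>(2) by (auto simp: \<sigma>.rep_square)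
  then have "z \<notin> rep_kernel K \<sigma>" using \<sigma>(2) by (auto simp: rep_kernel_def)
  ultimately show thesis by (rule that)
qed

section \<open>Countable direct sums of representations\<close>

text \<open>
  The pairing function identifies ell2 with the direct sum of countably many copies of ell2, so
  that a countable direct sum of representations on subspaces of ell2 again acts on a subspace of
  ell2. The maps slice n are the coordinate projections.
\<close>

definition slice :: "nat \<Rightarrow> ell2 \<Rightarrow> ell2" where
  "slice n \<xi> = Abs_ell2 (\<lambda>k. ell2_nth \<xi> (prod_encode (n, k)))"

definition glue :: "(nat \<Rightarrow> ell2) \<Rightarrow> ell2" where
  "glue x = Abs_ell2 (\<lambda>m. ell2_nth (x (fst (prod_decode m))) (snd (prod_decode m)))"

lemma slice_nth: "ell2_nth (slice n \<xi>) k = ell2_nth \<xi> (prod_encode (n, k))"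
proof -
  have "inj (\<lambda>k. prod_encode (n, k))" by (auto intro: injI)
  then have "summable ((\<lambda>m. (cmod (ell2_nth \<xi> m))\<^sup>2) \<circ> (\<lambda>k. prod_encode (n, k)))"
    by (intro summable_reindex ell2_summable) auto
  then show ?thesis unfolding slice_def by (subst ell2_nth_Abs) (simp_all add: comp_def)
qed

lemma slice_eqI: "(\<And>n. slice n \<xi> = slice n \<zeta>) \<Longrightarrow> \<xi> = \<zeta>"
  by (rule ell2_eqI) (metis prod_decode_inverse slice_nth surj_pair)

lemma slice_linear: "clinear (slice n)"
  unfolding clinear_def by (auto intro!: ell2_eqI simp: slice_nth)

lemma slice_cinner: "(\<lambda>n. cinner (slice n \<xi>) (slice n \<zeta>)) sums cinner \<xi> \<zeta>"
proof -
  have cinner_has_sum: "((\<lambda>k. cnj (ell2_nth \<xi> k) * ell2_nth \<zeta> k) has_sum cinner \<xi> \<zeta>) UNIV" for \<xi> \<zeta>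
  proof (rule norm_summable_imp_has_sum)
    show "summable (\<lambda>k. norm (cnj (ell2_nth \<xi> k) * ell2_nth \<zeta> k))"
    proof (rule summable_comparison_test')
      show "summable (\<lambda>n. (cmod (ell2_nth \<xi> n))\<^sup>2 + (cmod (ell2_nth \<zeta> n))\<^sup>2)"
        by (intro summable_add ell2_summable)
    qed (use cmod_mult_le_sq in \<open>simp add: norm_mult\<close>)
    show "(\<lambda>k. cnj (ell2_nth \<xi> k) * ell2_nth \<zeta> k) sums cinner \<xi> \<zeta>"
      unfolding cinner_def by (rule summable_sums[OF summable_cinner])
  qed
  have "((\<lambda>p. cnj (ell2_nth \<xi> (prod_encode p)) * ell2_nth \<zeta> (prod_encode p)) has_sum cinner \<xi> \<zeta>) UNIV"
    using cinner_has_sum[of \<xi> \<zeta>]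
      has_sum_reindex_bij_betw[OF bij_prod_encode, of "\<lambda>k. cnj (ell2_nth \<xi> k) * ell2_nth \<zeta> k"]
    by simp
  then have "((\<lambda>p. cnj (ell2_nth \<xi> (prod_encode p)) * ell2_nth \<zeta> (prod_encode p)) has_sum cinner \<xi> \<zeta>)
      (Sigma UNIV (\<lambda>_. UNIV))" by simp
  then have "((\<lambda>n. cinner (slice n \<xi>) (slice n \<zeta>)) has_sum cinner \<xi> \<zeta>) UNIV"
    by (rule has_sum_SigmaD) (use cinner_has_sum[of "slice _ \<xi>" "slice _ \<zeta>"] in \<open>simp add: slice_nth\<close>)
  then show ?thesis by (rule has_sum_imp_sums)
qed

lemma slice_norm: "(\<lambda>n. (norm (slice n \<xi>))\<^sup>2) sums (norm \<xi>)\<^sup>2"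
  using sums_Re[OF slice_cinner[of \<xi> \<xi>]] by (simp add: cinner_self_norm del: of_real_power)

lemma norm_slice_le: "norm (slice n \<xi>) \<le> norm \<xi>"
proof -
  have "(\<Sum>m\<in>{n}. (norm (slice m \<xi>))\<^sup>2) \<le> (\<Sum>m. (norm (slice m \<xi>))\<^sup>2)"
    using slice_norm by (intro sum_le_suminf) (auto simp: sums_iff)
  then have "(norm (slice n \<xi>))\<^sup>2 \<le> (norm \<xi>)\<^sup>2" using slice_norm by (simp add: sums_iff)
  then show ?thesis by (rule power2_le_imp_le) simp
qed

lemma slice_tendsto:
  assumes "X \<longlonglongrightarrow> l" shows "(\<lambda>k. slice n (X k)) \<longlonglongrightarrow> slice n l"
proof (rule LIMSEQ_norm_boundI)
  have "(\<lambda>k. norm (X k - l)) \<longlonglongrightarrow> norm (l - l)" by (intro tendsto_intros assms)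
  then show "(\<lambda>k. norm (X k - l)) \<longlonglongrightarrow> 0" by simp
  show "norm (slice n (X k) - slice n l) \<le> norm (X k - l)" for k
    using norm_slice_le[of n "X k - l"] by (simp add: clinear_diff[OF slice_linear])
qed

lemma slice_glue:
  assumes "summable (\<lambda>n. (norm (x n))\<^sup>2)"
  shows "slice n (glue x) = x n"
proof -
  define f where "f m = ell2_nth (x (fst (prod_decode m))) (snd (prod_decode m))" for m
  have "summable (\<lambda>m. (cmod (f m))\<^sup>2)"
  proof (rule summableI_nonneg_bounded)
    show "(\<Sum>m<M. (cmod (f m))\<^sup>2) \<le> (\<Sum>n. (norm (x n))\<^sup>2)" for M
    proof -
      have "(\<Sum>m<M. (cmod (f m))\<^sup>2)
          = (\<Sum>p\<in>prod_decode ` {..<M}. (cmod (ell2_nth (x (fst p)) (snd p)))\<^sup>2)"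
        by (subst sum.reindex) (auto simp: f_def inj_prod_decode)
      also have "\<dots> \<le> (\<Sum>p\<in>{..<M} \<times> {..<M}. (cmod (ell2_nth (x (fst p)) (snd p)))\<^sup>2)"
      proof (rule sum_mono2)
        \<comment> \<open>Both components of a pair are at most its code.\<close>
        show "prod_decode ` {..<M} \<subseteq> {..<M} \<times> {..<M}"
        proof
          fix p assume "p \<in> prod_decode ` {..<M}"
          then have "prod_encode p < M" by auto
          then show "p \<in> {..<M} \<times> {..<M}"
            using le_prod_encode_1[of "fst p" "snd p"] le_prod_encode_2[of "snd p" "fst p"] by (cases p) auto
        qed
      qed auto
      also have "\<dots> = (\<Sum>n<M. \<Sum>k<M. (cmod (ell2_nth (x n) k))\<^sup>2)"
        by (simp add: sum.cartesian_product case_prod_unfold)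
      also have "\<dots> \<le> (\<Sum>n<M. (norm (x n))\<^sup>2)"
        by (intro sum_mono ell2_partial_le)
      also have "\<dots> \<le> (\<Sum>n. (norm (x n))\<^sup>2)"
        by (rule sum_le_suminf[OF assms]) auto
      finally show ?thesis .
    qed
  qed simp
  then have "ell2_nth (glue x) m = f m" for m
    unfolding glue_def f_def[symmetric] by (simp add: ell2_nth_Abs)
  then show ?thesis by (intro ell2_eqI) (simp add: slice_nth f_def)
qed

definition direct_sum_space :: "(nat \<Rightarrow> ell2 set) \<Rightarrow> ell2 set" where
  "direct_sum_space K = {\<xi>. \<forall>n. slice n \<xi> \<in> K n}"

definition direct_sum_rep :: "(nat \<Rightarrow> 'c \<Rightarrow> ell2 \<Rightarrow> ell2) \<Rightarrow> 'c \<Rightarrow> ell2 \<Rightarrow> ell2" where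
  "direct_sum_rep \<sigma> x \<xi> = glue (\<lambda>n. \<sigma> n x (slice n \<xi>))"

context
  fixes K :: "nat \<Rightarrow> ell2 set" and \<sigma> :: "nat \<Rightarrow> 'c::cstar_algebra \<Rightarrow> ell2 \<Rightarrow> ell2"
  assumes reps: "\<And>n. star_rep (K n) (\<sigma> n)"
begin

interpretation R: representation "K n" "\<sigma> n" for n
  by unfold_locales (rule reps)

text \<open>
  The summands are bounded by the same constant, the norm of x, because representations of
  C*-algebras are contractive.
\<close>

lemma direct_sum_summable:
  assumes "\<xi> \<in> direct_sum_space K"
  shows "summable (\<lambda>n. (norm (\<sigma> n x (slice n \<xi>)))\<^sup>2)"
    and "(\<Sum>n. (norm (\<sigma> n x (slice n \<xi>)))\<^sup>2) \<le> (norm x * norm \<xi>)\<^sup>2"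
proof -
  have le: "(norm (\<sigma> n x (slice n \<xi>)))\<^sup>2 \<le> (norm x)\<^sup>2 * (norm (slice n \<xi>))\<^sup>2" for n
    using star_rep_contractive[OF reps, of "slice n \<xi>" n x] assms
    unfolding power_mult_distrib[symmetric] by (intro power_mono) (auto simp: direct_sum_space_def)
  have s: "(\<lambda>n. (norm x)\<^sup>2 * (norm (slice n \<xi>))\<^sup>2) sums ((norm x)\<^sup>2 * (norm \<xi>)\<^sup>2)"
    by (rule sums_mult[OF slice_norm])
  show sm: "summable (\<lambda>n. (norm (\<sigma> n x (slice n \<xi>)))\<^sup>2)"
    by (rule summable_comparison_test'[OF sums_summable[OF s], of 0]) (use le in simp)
  show "(\<Sum>n. (norm (\<sigma> n x (slice n \<xi>)))\<^sup>2) \<le> (norm x * norm \<xi>)\<^sup>2"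
    using suminf_le[OF le sm sums_summable[OF s]] s by (simp add: sums_iff power_mult_distrib)
qed

lemma slice_direct_sum_rep:
  "\<xi> \<in> direct_sum_space K \<Longrightarrow> slice n (direct_sum_rep \<sigma> x \<xi>) = \<sigma> n x (slice n \<xi>)"
  unfolding direct_sum_rep_def by (rule slice_glue) (rule direct_sum_summable)

lemma direct_sum_star_rep: "star_rep (direct_sum_space K) (direct_sum_rep \<sigma>)"
proof -
  let ?H = "direct_sum_space K" and ?\<pi> = "direct_sum_rep \<sigma>"
  note sl = slice_direct_sum_rep clinear_add[OF slice_linear] clinear_scaleC[OF slice_linear]
  have Hs: "slice n \<xi> \<in> K n" if "\<xi> \<in> ?H" for \<xi> n using that by (simp add: direct_sum_space_def)
  have sub: "csubspace ?H"
    unfolding csubspace_def direct_sum_space_def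
    by (simp add: clinear_zero[OF slice_linear] sl(2,3) R.zero_mem R.add_mem R.scale_mem)
  have "closed ?H"
  proof (rule closed_sequential_limits[THEN iffD2], intro allI impI)
    fix X l assume X: "(\<forall>k. X k \<in> ?H) \<and> X \<longlonglongrightarrow> l"
    have "slice n l \<in> K n" for n
      using closed_sequentially[OF R.closed[of n], of "\<lambda>k. slice n (X k)" "slice n l"]
        slice_tendsto[of X l n] X Hs by blast
    then show "l \<in> ?H" by (simp add: direct_sum_space_def)
  qed
  then have hilb: "hilbert_subspace ?H" using sub by (simp add: hilbert_subspace_def)
  have add: "\<xi> + \<zeta> \<in> ?H" and scale: "c *\<^sub>C \<xi> \<in> ?H" if "\<xi> \<in> ?H" "\<zeta> \<in> ?H" for \<xi> \<zeta> c
    using sub that by (simp_all add: csubspace_def)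
  have mem: "?\<pi> x \<xi> \<in> ?H" if "\<xi> \<in> ?H" for x \<xi>
    using Hs[OF that] by (simp add: direct_sum_space_def[of K] slice_direct_sum_rep[OF that] R.op_mem)
  have bound: "norm (?\<pi> x \<xi>) \<le> norm x * norm \<xi>" if "\<xi> \<in> ?H" for x \<xi>
  proof -
    have "(norm (?\<pi> x \<xi>))\<^sup>2 = (\<Sum>n. (norm (\<sigma> n x (slice n \<xi>)))\<^sup>2)"
      using slice_norm[of "?\<pi> x \<xi>"] by (simp add: slice_direct_sum_rep[OF that] sums_iff)
    also have "\<dots> \<le> (norm x * norm \<xi>)\<^sup>2" by (rule direct_sum_summable[OF that])
    finally show ?thesis by (rule power2_le_imp_le) simp
  qed
  have "bounded_operator_on ?H (?\<pi> x)" for x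
    unfolding bounded_operator_on_def
  proof (intro conjI ballI allI exI)
    show "?\<pi> x \<xi> \<in> ?H" if "\<xi> \<in> ?H" for \<xi> by (rule mem[OF that])
    show "?\<pi> x (\<xi> + \<zeta>) = ?\<pi> x \<xi> + ?\<pi> x \<zeta>" if "\<xi> \<in> ?H" "\<zeta> \<in> ?H" for \<xi> \<zeta>
      by (rule slice_eqI) (simp add: sl that add R.op_add Hs)
    show "?\<pi> x (c *\<^sub>C \<xi>) = c *\<^sub>C ?\<pi> x \<xi>" if "\<xi> \<in> ?H" for \<xi> c
      by (rule slice_eqI) (simp add: sl that scale[OF that that] R.op_scale Hs)
    show "norm (?\<pi> x \<xi>) \<le> norm x * norm \<xi>" if "\<xi> \<in> ?H" for \<xi> by (rule bound[OF that])
  qed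
  moreover have "?\<pi> 1 \<xi> = \<xi> \<and> (\<forall>x y. ?\<pi> (x + y) \<xi> = ?\<pi> x \<xi> + ?\<pi> y \<xi>)
      \<and> (\<forall>c x. ?\<pi> (c *\<^sub>C x) \<xi> = c *\<^sub>C ?\<pi> x \<xi>) \<and> (\<forall>x y. ?\<pi> (x * y) \<xi> = ?\<pi> x (?\<pi> y \<xi>))
      \<and> (\<forall>\<zeta>\<in>?H. \<forall>x. cinner (?\<pi> (star x) \<xi>) \<zeta> = cinner \<xi> (?\<pi> x \<zeta>))" if "\<xi> \<in> ?H" for \<xi>
  proof (intro conjI allI ballI)
    show "?\<pi> 1 \<xi> = \<xi>" by (rule slice_eqI) (simp add: sl that R.rep_one Hs)
    show "?\<pi> (x + y) \<xi> = ?\<pi> x \<xi> + ?\<pi> y \<xi>" for x y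
      by (rule slice_eqI) (simp add: sl that R.rep_add Hs)
    show "?\<pi> (c *\<^sub>C x) \<xi> = c *\<^sub>C ?\<pi> x \<xi>" for c x
      by (rule slice_eqI) (simp add: sl that R.rep_scale Hs)
    show "?\<pi> (x * y) \<xi> = ?\<pi> x (?\<pi> y \<xi>)" for x y
      by (rule slice_eqI) (simp add: sl that R.rep_mult Hs mem)
    show "cinner (?\<pi> (star x) \<xi>) \<zeta> = cinner \<xi> (?\<pi> x \<zeta>)" if "\<zeta> \<in> ?H" for x \<zeta>
    proof -
      have "(\<lambda>n. cinner (slice n (?\<pi> (star x) \<xi>)) (slice n \<zeta>)) = (\<lambda>n. cinner (slice n \<xi>) (slice n (?\<pi> x \<zeta>)))"
        using \<open>\<xi> \<in> ?H\<close> that by (simp add: sl R.rep_star Hs)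
      then show ?thesis using slice_cinner sums_unique2 by metis
    qed
  qed
  ultimately show ?thesis using hilb unfolding star_rep_def by blast
qed

lemma direct_sum_embed:
  assumes "v \<in> K n"
  obtains \<xi> where "\<xi> \<in> direct_sum_space K" "slice n \<xi> = v" "\<And>m. m \<noteq> n \<Longrightarrow> slice m \<xi> = 0"
proof -
  define x where "x m = (if m = n then v else 0)" for m
  have "summable (\<lambda>m. (norm (x m))\<^sup>2)"
    by (rule summable_finite[of "{n}"]) (auto simp: x_def)
  then have "slice m (glue x) = x m" for m by (rule slice_glue)
  then show thesis
    using assms by (intro that[of "glue x"]) (auto simp: direct_sum_space_def x_def R.zero_mem)
qed

end

lemma norm_single_slice:
  assumes "\<And>m. m \<noteq> n \<Longrightarrow> slice m \<xi> = 0" shows "norm \<xi> = norm (slice n \<xi>)"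
proof -
  have "(\<lambda>m. (norm (slice m \<xi>))\<^sup>2) sums (\<Sum>m\<in>{n}. (norm (slice m \<xi>))\<^sup>2)"
    by (rule sums_finite) (use assms in auto)
  then have "(norm \<xi>)\<^sup>2 = (norm (slice n \<xi>))\<^sup>2" using slice_norm[of \<xi>] sums_unique2 by fastforce
  then show ?thesis by simp
qed

section \<open>Schur orthogonality for compact quantum groups\<close>

lemma sum_mult_delta:
  fixes A :: "nat \<Rightarrow> 'r::semiring_1"
  assumes "l < n"
  shows "(\<Sum>k<n. A k * (if k = l then 1 else 0)) = A l" "(\<Sum>k<n. A k * (if l = k then 1 else 0)) = A l"
    "(\<Sum>k<n. (if k = l then 1 else 0) * A k) = A l" "(\<Sum>k<n. (if l = k then 1 else 0) * A k) = A l"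
proof -
  have "(\<Sum>k<n. A k * (if k = l then 1 else 0)) = (\<Sum>k<n. if k = l then A k else 0)"
    by (rule sum.cong) auto
  then show "(\<Sum>k<n. A k * (if k = l then 1 else 0)) = A l" using assms by simp
  then show "(\<Sum>k<n. A k * (if l = k then 1 else 0)) = A l" by (simp add: eq_commute)
  have "(\<Sum>k<n. (if k = l then 1 else 0) * A k) = (\<Sum>k<n. if k = l then A k else 0)"
    by (rule sum.cong) auto
  then show "(\<Sum>k<n. (if k = l then 1 else 0) * A k) = A l" using assms by simp
  then show "(\<Sum>k<n. (if l = k then 1 else 0) * A k) = A l" by (simp add: eq_commute)
qed

lemma sum_scaleC_delta:
  fixes a :: "nat \<Rightarrow> 'v::complex_vector"
  assumes "l < n"
  shows "(\<Sum>k<n. (if k = l then c else 0) *\<^sub>C a k) = c *\<^sub>C a l"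
    and "(\<Sum>k<n. (if l = k then c else 0) *\<^sub>C a k) = c *\<^sub>C a l"
proof -
  have "(\<Sum>k<n. (if k = l then c else 0) *\<^sub>C a k) = (\<Sum>k<n. if k = l then c *\<^sub>C a k else 0)"
    by (rule sum.cong) auto
  then show "(\<Sum>k<n. (if k = l then c else 0) *\<^sub>C a k) = c *\<^sub>C a l" using assms by simp
  then show "(\<Sum>k<n. (if l = k then c else 0) *\<^sub>C a k) = c *\<^sub>C a l" by (simp add: eq_commute)
qed

text \<open>
  Extends the test of equality of tensors from bilinear forms to bilinear maps.
\<close>

lemma sweedler_tensor_eq:
  fixes g :: "'a::complex_vector \<Rightarrow> 'a \<Rightarrow> 'b::complex_vector"
  assumes "s =\<^sub>\<otimes> t" "\<And>x. clinear (g x)" "\<And>y. clinear (\<lambda>x. g x y)"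
  shows "sweedler g s = sweedler g t"
proof (rule clinear_functionals_eqI)
  fix f :: "'b \<Rightarrow> complex" assume f: "clinear f"
  have "bilinear_form (\<lambda>x y. f (g x y))"
    unfolding bilinear_form_def using assms f by (simp add: clinear_def)
  moreover have "f (sweedler g r) = sweedler (\<lambda>x y. f (g x y)) r" for r
    by (simp add: sweedler_def clinear_sum_list[OF f] comp_def case_prod_unfold)
  ultimately show "f (sweedler g s) = f (sweedler g t)"
    using assms(1) by (simp add: tensor_eq_def)
qed

lemma sweedler_matrix: "sweedler g (map (\<lambda>k. (p k, q k)) [0..<n]) = (\<Sum>k<n. g (p k) (q k))"
  by (simp add: sweedler_def comp_def interv_sum_list_conv_sum_set_nat atLeast0LessThan)

lemma sweedler_product:
  "sweedler g [(a * a', b * b'). (a, b) \<leftarrow> s, (a', b') \<leftarrow> t]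
     = sweedler (\<lambda>a b. sweedler (\<lambda>a' b'. g (a * a') (b * b')) t) s"
  unfolding sweedler_def
  by (induction s) (auto simp: comp_def case_prod_unfold)

text \<open>
  The comultiplication of matrix coefficients, in the form in which it is used: after applying a
  bilinear map.
\<close>

lemma unitary_corep_comult:
  fixes g :: "'a::complex_star_algebra \<Rightarrow> 'a \<Rightarrow> 'b::complex_vector"
  assumes "unitary_corep comult n v" "i < n" "j < n" "\<And>x. clinear (g x)" "\<And>y. clinear (\<lambda>x. g x y)"
  shows "sweedler g (comult (v i j)) = (\<Sum>k<n. g (v i k) (v k j))"
proof -
  have "comult (v i j) =\<^sub>\<otimes> map (\<lambda>k. (v i k, v k j)) [0..<n]"
    using assms(1-3) unfolding unitary_corep_def by blast
  from sweedler_tensor_eq[OF this assms(4,5)] show ?thesis by (simp only: sweedler_matrix)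
qed

lemma unitary_corep_orthonormal:
  assumes "unitary_corep comult n v" "i < n" "j < n"
  shows "(\<Sum>k<n. star (v k i) * v k j) = (if i = j then 1 else 0)"
    and "(\<Sum>k<n. v i k * star (v j k)) = (if i = j then 1 else 0)"
  using assms unfolding unitary_corep_def by blast+

lemma corep_cancel_right:
  assumes "unitary_corep comult n v" "l < n"
  shows "(\<Sum>j<n. (\<Sum>k<n. A k * v k j) * star (v l j)) = A l"
proof -
  have "(\<Sum>j<n. (\<Sum>k<n. A k * v k j) * star (v l j)) = (\<Sum>k<n. A k * (\<Sum>j<n. v k j * star (v l j)))"
    unfolding sum_distrib_left sum_distrib_right mult.assoc by (rule sum.swap)
  also have "\<dots> = (\<Sum>k<n. A k * (if k = l then 1 else 0))"
    by (rule sum.cong) (use assms in \<open>simp_all add: unitary_corep_orthonormal\<close>)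
  finally show ?thesis using assms(2) by (simp only: sum_mult_delta)
qed

lemma corep_cancel_left:
  assumes "unitary_corep comult n v" "r < n"
  shows "(\<Sum>l<n. v r l * (\<Sum>p<n. star (v p l) * A p)) = A r"
proof -
  have "(\<Sum>l<n. v r l * (\<Sum>p<n. star (v p l) * A p)) = (\<Sum>p<n. (\<Sum>l<n. v r l * star (v p l)) * A p)"
    unfolding sum_distrib_left sum_distrib_right mult.assoc by (rule sum.swap)
  also have "\<dots> = (\<Sum>p<n. (if r = p then 1 else 0) * A p)"
    by (rule sum.cong) (use assms in \<open>simp_all add: unitary_corep_orthonormal\<close>)
  finally show ?thesis using assms(2) by (simp only: sum_mult_delta)
qed

lemma scaleC_one_mult: "(c *\<^sub>C 1) * (x::'a::complex_star_algebra) = c *\<^sub>C x"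
  by (simp add: mult_scaleC_left)

subsection \<open>Schur's lemma\<close>

text \<open>
  The definition of irreducibility as a proof rule.
\<close>

lemma irreducible_corep_subspace:
  fixes W :: "(nat \<Rightarrow> complex) set"
  assumes "irreducible_corep comult n v"
    and "\<And>w i. w \<in> W \<Longrightarrow> i \<ge> n \<Longrightarrow> w i = 0" "(\<lambda>_. 0) \<in> W"
    and "\<And>w z. w \<in> W \<Longrightarrow> z \<in> W \<Longrightarrow> (\<lambda>i. w i + z i) \<in> W" "\<And>c w. w \<in> W \<Longrightarrow> (\<lambda>i. c * w i) \<in> W"
    and "\<And>f w. clinear f \<Longrightarrow> w \<in> W \<Longrightarrow> (\<lambda>i. if i < n then \<Sum>j<n. f (v i j) * w j else 0) \<in> W"
  shows "W = {\<lambda>_. 0} \<or> W = {w. \<forall>i\<ge>n. w i = 0}"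
proof -
  have "W \<subseteq> {w. \<forall>i\<ge>n. w i = 0}" using assms(2) by blast
  with assms(1)[unfolded irreducible_corep_def, THEN conjunct2, THEN conjunct2, THEN spec, of W]
  have "(\<lambda>_. 0) \<in> W \<and> (\<forall>w\<in>W. \<forall>z\<in>W. (\<lambda>i. w i + z i) \<in> W) \<and> (\<forall>c. \<forall>w\<in>W. (\<lambda>i. c * w i) \<in> W) \<and>
      (\<forall>f. clinear f \<longrightarrow> (\<forall>w\<in>W. (\<lambda>i. if i < n then \<Sum>j<n. f (v i j) * w j else 0) \<in> W))
      \<longrightarrow> ?thesis" by (rule mp)
  then show ?thesis by (rule mp) (intro conjI ballI allI impI assms(3-6))
qed

text \<open>
  The matrix equation (Y \<otimes> 1) w = u (Y \<otimes> 1).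
\<close>

definition intertwiner ::
  "nat \<Rightarrow> (nat \<Rightarrow> nat \<Rightarrow> 'a::complex_vector) \<Rightarrow> nat \<Rightarrow> (nat \<Rightarrow> nat \<Rightarrow> 'a) \<Rightarrow> (nat \<Rightarrow> nat \<Rightarrow> complex) \<Rightarrow> bool" where
  "intertwiner m w n u Y \<longleftrightarrow>
     (\<forall>r<n. \<forall>j<m. (\<Sum>q<m. Y r q *\<^sub>C w q j) = (\<Sum>l<n. Y l j *\<^sub>C u r l))"

lemma intertwiner_functional:
  assumes "intertwiner m w n u Y" "r < n" "j < m" "clinear f"
  shows "(\<Sum>q<m. Y r q * f (w q j)) = (\<Sum>l<n. Y l j * (f (u r l) :: complex))"
proof -
  have "f (\<Sum>q<m. Y r q *\<^sub>C w q j) = f (\<Sum>l<n. Y l j *\<^sub>C u r l)"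
    using assms by (simp add: intertwiner_def)
  then show ?thesis by (simp add: clinear_sum[OF assms(4)] clinear_scaleC[OF assms(4)])
qed

text \<open>
  The kernel of Y is invariant under w, hence 0 or everything.
\<close>

lemma intertwiner_kernel:
  fixes w u :: "nat \<Rightarrow> nat \<Rightarrow> 'a::complex_star_algebra"
  assumes Y: "intertwiner m w n u Y" and irr: "irreducible_corep comult m w"
  shows "(\<forall>x. (\<forall>r<n. (\<Sum>q<m. Y r q * x q) = 0) \<longrightarrow> (\<forall>q<m. x q = 0)) \<or> (\<forall>r<n. \<forall>q<m. Y r q = 0)"
proof -
  define W where "W = {x. (\<forall>i\<ge>m. x i = 0) \<and> (\<forall>r<n. (\<Sum>q<m. Y r q * x q) = 0)}"
  have "W = {\<lambda>_. 0} \<or> W = {w. \<forall>i\<ge>m. w i = 0}"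
  proof (rule irreducible_corep_subspace[OF irr])
    fix f :: "'a \<Rightarrow> complex" and x assume f: "clinear f" and x: "x \<in> W"
    have "(\<Sum>q<m. Y r q * (\<Sum>j<m. f (w q j) * x j)) = 0" if "r < n" for r
    proof -
      have "(\<Sum>q<m. Y r q * (\<Sum>j<m. f (w q j) * x j)) = (\<Sum>j<m. (\<Sum>q<m. Y r q * f (w q j)) * x j)"
        unfolding sum_distrib_left sum_distrib_right mult.assoc by (rule sum.swap)
      also have "\<dots> = (\<Sum>j<m. (\<Sum>l<n. Y l j * f (u r l)) * x j)"
        using intertwiner_functional[OF Y \<open>r < n\<close> _ f] by simp
      also have "\<dots> = (\<Sum>l<n. f (u r l) * (\<Sum>j<m. Y l j * x j))"
        unfolding sum_distrib_left sum_distrib_right by (subst sum.swap) (simp add: mult_ac)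
      also have "\<dots> = 0" using x by (simp add: W_def)
      finally show ?thesis .
    qed
    then show "(\<lambda>i. if i < m then \<Sum>j<m. f (w i j) * x j else 0) \<in> W" by (simp add: W_def)
  qed (auto simp: W_def distrib_left sum.distrib mult.left_commute simp flip: sum_distrib_left)
  then show ?thesis
  proof
    assume W: "W = {\<lambda>_. 0}"
    have "x q = 0" if x: "\<forall>r<n. (\<Sum>q<m. Y r q * x q) = 0" and "q < m" for x q
    proof -
      have "(\<lambda>i. if i < m then x i else 0) \<in> W" using x by (simp add: W_def)
      then have "(\<lambda>i. if i < m then x i else 0) = (\<lambda>_. 0)" using W by blast
      from fun_cong[OF this, of q] show ?thesis using \<open>q < m\<close> by simp
    qed
    then show ?thesis by blast
  next
    assume W: "W = {w. \<forall>i\<ge>m. w i = 0}"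
    have "Y r q = 0" if "r < n" "q < m" for r q
    proof -
      have "(\<lambda>i. if i = q then 1 else 0) \<in> W" using W \<open>q < m\<close> by auto
      then have "(\<Sum>p<m. Y r p * (if p = q then 1 else 0)) = 0" using \<open>r < n\<close> unfolding W_def by blast
      then show ?thesis using \<open>q < m\<close> by (simp only: sum_mult_delta)
    qed
    then show ?thesis by blast
  qed
qed

text \<open>
  The range of Y is invariant under u, hence everything or 0.
\<close>

lemma intertwiner_range:
  fixes w u :: "nat \<Rightarrow> nat \<Rightarrow> 'a::complex_star_algebra"
  assumes Y: "intertwiner m w n u Y" and irr: "irreducible_corep comult n u"
  shows "(\<forall>z. \<exists>x. \<forall>r<n. z r = (\<Sum>q<m. Y r q * x q)) \<or> (\<forall>r<n. \<forall>q<m. Y r q = 0)"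
proof -
  define W where "W = {z. (\<forall>i\<ge>n. z i = 0) \<and> (\<exists>x. \<forall>r<n. z r = (\<Sum>q<m. Y r q * x q))}"
  have "W = {\<lambda>_. 0} \<or> W = {w. \<forall>i\<ge>n. w i = 0}"
  proof (rule irreducible_corep_subspace[OF irr])
    fix f :: "'a \<Rightarrow> complex" and z assume f: "clinear f" and z: "z \<in> W"
    then obtain x where x: "\<And>r. r < n \<Longrightarrow> z r = (\<Sum>q<m. Y r q * x q)" by (auto simp: W_def)
    have "(\<Sum>l<n. f (u r l) * z l) = (\<Sum>q<m. Y r q * (\<Sum>j<m. f (w q j) * x j))" if "r < n" for r
    proof -
      have "(\<Sum>q<m. Y r q * (\<Sum>j<m. f (w q j) * x j)) = (\<Sum>j<m. (\<Sum>q<m. Y r q * f (w q j)) * x j)"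
        unfolding sum_distrib_left sum_distrib_right mult.assoc by (rule sum.swap)
      also have "\<dots> = (\<Sum>j<m. (\<Sum>l<n. Y l j * f (u r l)) * x j)"
        using intertwiner_functional[OF Y \<open>r < n\<close> _ f] by simp
      also have "\<dots> = (\<Sum>l<n. f (u r l) * (\<Sum>j<m. Y l j * x j))"
        unfolding sum_distrib_left sum_distrib_right by (subst sum.swap) (simp add: mult_ac)
      finally show ?thesis using x by simp
    qed
    then show "(\<lambda>i. if i < n then \<Sum>j<n. f (u i j) * z j else 0) \<in> W"
      unfolding W_def by auto
  next
    show "(\<lambda>_. 0) \<in> W" unfolding W_def by (auto intro: exI[of _ "\<lambda>_. 0"])
  next
    fix z z' assume "z \<in> W" "z' \<in> W"
    then obtain x x' where "\<And>r. r < n \<Longrightarrow> z r = (\<Sum>q<m. Y r q * x q)"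
      "\<And>r. r < n \<Longrightarrow> z' r = (\<Sum>q<m. Y r q * x' q)" "\<forall>i\<ge>n. z i = 0" "\<forall>i\<ge>n. z' i = 0" by (auto simp: W_def)
    then show "(\<lambda>i. z i + z' i) \<in> W"
      unfolding W_def by (auto intro!: exI[of _ "\<lambda>q. x q + x' q"] simp: distrib_left sum.distrib)
  next
    fix c z assume "z \<in> W"
    then obtain x where "\<And>r. r < n \<Longrightarrow> z r = (\<Sum>q<m. Y r q * x q)" "\<forall>i\<ge>n. z i = 0" by (auto simp: W_def)
    then show "(\<lambda>i. c * z i) \<in> W"
      unfolding W_def by (auto intro!: exI[of _ "\<lambda>q. c * x q"] simp: sum_distrib_left mult_ac)
  qed (auto simp: W_def)
  then show ?thesis
  proof
    assume W: "W = {\<lambda>_. 0}"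
    have "Y r q = 0" if "r < n" "q < m" for r q
    proof -
      have "\<forall>r<n. Y r q = (\<Sum>p<m. Y r p * (if p = q then 1 else 0))"
        using \<open>q < m\<close> by (simp add: sum_mult_delta)
      then have "(\<lambda>i. if i < n then Y i q else 0) \<in> W"
        unfolding W_def by (auto intro!: exI[of _ "\<lambda>p. if p = q then 1 else 0"])
      then have "(\<lambda>i. if i < n then Y i q else 0) = (\<lambda>_. 0)" using W by blast
      from fun_cong[OF this, of r] show ?thesis using \<open>r < n\<close> by simp
    qed
    then show ?thesis by blast
  next
    assume W: "W = {w. \<forall>i\<ge>n. w i = 0}"
    have "\<exists>x. \<forall>r<n. z r = (\<Sum>q<m. Y r q * x q)" for z
    proof -
      have "(\<lambda>i. if i < n then z i else 0) \<in> W" using W by simp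
      then show ?thesis by (auto simp: W_def)
    qed
    then show ?thesis by blast
  qed
qed

text \<open>
  A non-zero intertwiner is bijective. Its inverse matrix X shows that the sizes agree, as the
  traces of Y X and X Y are n and m, and then Y is an equivalence.
\<close>

lemma Schur_inequivalent:
  fixes w u :: "nat \<Rightarrow> nat \<Rightarrow> 'a::complex_star_algebra"
  assumes Y: "intertwiner m w n u Y" and irr: "irreducible_corep comult m w" "irreducible_corep comult n u"
    and ineq: "\<not> equivalent_coreps m w n u"
  shows "\<forall>r<n. \<forall>q<m. Y r q = 0"
proof (rule ccontr)
  assume nz: "\<not> ?thesis"
  then have "\<forall>z. \<exists>x. \<forall>r<n. z r = (\<Sum>q<m. Y r q * x q)"
    using intertwiner_range[OF Y irr(2)] by blast
  then have "\<exists>x. \<forall>r<n. (if r = i then 1 else 0) = (\<Sum>q<m. Y r q * x q)" for i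
    by (rule allE[of _ "\<lambda>r. if r = i then 1 else 0"])
  then obtain X' where "\<And>i. \<forall>r<n. (if r = i then 1 else 0) = (\<Sum>q<m. Y r q * X' i q)" by metis
  define X where "X q i = X' i q" for q i
  have YX: "(\<Sum>q<m. Y r q * X q i) = (if r = i then 1 else 0)" if "r < n" for r i
    using \<open>\<And>i. \<forall>r<n. _ r i\<close> that by (simp add: X_def)
  have inj: "\<forall>q<m. x q = 0" if "\<forall>r<n. (\<Sum>q<m. Y r q * x q) = 0" for x
    using intertwiner_kernel[OF Y irr(1)] nz that by blast
  have XY: "(\<Sum>r<n. X p r * Y r j) = (if p = j then 1 else 0)" if "p < m" "j < m" for p j
  proof -
    define x where "x q = (\<Sum>r<n. X q r * Y r j) - (if q = j then 1 else 0)" for q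
    have "(\<Sum>q<m. Y s q * x q) = 0" if "s < n" for s
    proof -
      have "(\<Sum>q<m. Y s q * (\<Sum>r<n. X q r * Y r j)) = (\<Sum>r<n. (\<Sum>q<m. Y s q * X q r) * Y r j)"
        unfolding sum_distrib_left sum_distrib_right mult.assoc by (rule sum.swap)
      also have "\<dots> = (\<Sum>r<n. (if s = r then 1 else 0) * Y r j)" by (simp add: YX that)
      also have "\<dots> = Y s j" by (simp only: sum_mult_delta that)
      finally have 1: "(\<Sum>q<m. Y s q * (\<Sum>r<n. X q r * Y r j)) = Y s j" .
      have "(\<Sum>q<m. Y s q * (if q = j then 1 else 0)) = Y s j" by (simp only: sum_mult_delta \<open>j < m\<close>)
      then show ?thesis unfolding x_def right_diff_distrib sum_subtractf 1 by simp
    qed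
    then have "x p = 0" using inj that by blast
    then show ?thesis by (simp add: x_def)
  qed
  have "complex_of_nat n = (\<Sum>r<n. \<Sum>q<m. Y r q * X q r)" by (simp add: YX)
  also have "\<dots> = (\<Sum>q<m. \<Sum>r<n. X q r * Y r q)" by (subst sum.swap) (simp add: mult.commute)
  also have "\<dots> = complex_of_nat m" by (simp add: XY)
  finally have "n = m" by simp
  then have "equivalent_coreps m w n u"
    using YX XY Y unfolding equivalent_coreps_def intertwiner_def
    by (intro conjI exI[of _ Y] exI[of _ X]) auto
  then show False using ineq by blast
qed

lemma complex_matrix_eigenvector:
  fixes Y :: "nat \<Rightarrow> nat \<Rightarrow> complex"
  assumes "n > 0"
  shows "\<exists>x c. (\<exists>i<n. x i \<noteq> 0) \<and> (\<forall>i<n. (\<Sum>j<n. Y i j * x j) = c * x i)"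
proof -
  define A where "A = mat n n (\<lambda>(i, j). Y i j)"
  have A: "A \<in> carrier_mat n n" by (simp add: A_def)
  have "degree (char_poly A) = n" using degree_monic_char_poly[OF A] by simp
  then have "\<not> constant (poly (char_poly A))" using assms by (simp add: constant_degree)
  then obtain c where "poly (char_poly A) c = 0" using fundamental_theorem_of_algebra by blast
  then have "eigenvalue A c" by (simp add: eigenvalue_root_char_poly[OF A])
  then obtain v where v: "v \<in> carrier_vec n" "v \<noteq> 0\<^sub>v n" "A *\<^sub>v v = c \<cdot>\<^sub>v v"
    unfolding eigenvalue_def eigenvector_def using A by auto
  have "(\<Sum>j<n. Y i j * vec_index v j) = c * vec_index v i" if "i < n" for i
  proof -
    have "vec_index (A *\<^sub>v v) i = (\<Sum>j<n. Y i j * vec_index v j)"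
      using that v(1) by (simp add: A_def scalar_prod_def atLeast0LessThan)
    then show ?thesis using v that by simp
  qed
  moreover have "\<exists>i<n. vec_index v i \<noteq> 0"
    using v(1,2) by (metis carrier_vecD eq_vecI index_zero_vec(1) index_zero_vec(2))
  ultimately show ?thesis by blast
qed

text \<open>
  Subtract an eigenvalue c: the intertwiner Y - c has a non-trivial kernel, so it is 0.
\<close>

lemma Schur_scalar:
  fixes u :: "nat \<Rightarrow> nat \<Rightarrow> 'a::complex_star_algebra"
  assumes Y: "intertwiner n u n u Y" and irr: "irreducible_corep comult n u"
  obtains c where "\<And>r j. r < n \<Longrightarrow> j < n \<Longrightarrow> Y r j = (if r = j then c else 0)"
proof -
  have "n > 0" using irr by (simp add: irreducible_corep_def)
  then obtain x c where x: "\<exists>i<n. x i \<noteq> 0" and eigen: "\<forall>i<n. (\<Sum>j<n. Y i j * x j) = c * x i"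
    using complex_matrix_eigenvector[of n Y] by blast
  define Z where "Z r j = Y r j - (if r = j then c else 0)" for r j
  have "(\<Sum>q<n. Z r q *\<^sub>C u q j) = (\<Sum>l<n. Z l j *\<^sub>C u r l)" if "r < n" "j < n" for r j
  proof -
    have "(\<Sum>q<n. Z r q *\<^sub>C u q j) = (\<Sum>q<n. Y r q *\<^sub>C u q j) - c *\<^sub>C u r j"
      unfolding Z_def complex_vs.scale_left_diff_distrib sum_subtractf
        sum_scaleC_delta(2)[OF that(1), where a = "\<lambda>q. u q j"] ..
    moreover have "(\<Sum>l<n. Z l j *\<^sub>C u r l) = (\<Sum>l<n. Y l j *\<^sub>C u r l) - c *\<^sub>C u r j"
      unfolding Z_def complex_vs.scale_left_diff_distrib sum_subtractf
        sum_scaleC_delta(1)[OF that(2), where a = "\<lambda>l. u r l"] ..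
    ultimately show ?thesis using Y that unfolding intertwiner_def by simp
  qed
  then have "intertwiner n u n u Z" by (simp add: intertwiner_def)
  moreover have "(\<Sum>q<n. Z r q * x q) = 0" if "r < n" for r
  proof -
    have "(\<Sum>q<n. (if r = q then c else 0) * x q) = c * x r"
      using sum_scaleC_delta(2)[OF that, of c x] unfolding scaleC_complex .
    then show ?thesis using eigen that by (simp only: Z_def left_diff_distrib sum_subtractf) simp
  qed
  ultimately have "\<forall>r<n. \<forall>q<n. Z r q = 0"
    using intertwiner_kernel[OF _ irr, of n u Z] x by blast
  then show thesis by (intro that[of c]) (simp add: Z_def)
qed

subsection \<open>Counit, antipode and Haar state on matrix coefficients\<close>

lemma cspan_induct_csubspace:
  assumes "csubspace T" "S \<subseteq> T" shows "cspan S \<subseteq> T"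
  unfolding cspan_def using assms by (simp add: hull_minimal)

context compact_quantum_group
begin

lemma counit_scaleC: "counit (c *\<^sub>C x) = c * counit x"
  using counit_linear by (simp add: clinear_scaleC)

text \<open>
  Applying the counit to the first leg gives the matrix equation \<epsilon>(v) v = v, and v is
  invertible.
\<close>

lemma counit_corep:
  assumes v: "unitary_corep comult n v" and ij: "i < n" "j < n"
  shows "counit (v i j) = (if i = j then 1 else 0)"
proof -
  have row: "(\<Sum>k<n. (counit (v i k) *\<^sub>C 1) * v k l) = v i l" if "l < n" for l
  proof -
    have "sweedler (\<lambda>a b. counit a *\<^sub>C b) (comult (v i l)) = (\<Sum>k<n. counit (v i k) *\<^sub>C v k l)"
      by (rule unitary_corep_comult[OF v ij(1) that])
        (simp_all add: clinear_def clinear_add[OF counit_linear] clinear_scaleC[OF counit_linear]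
          scaleC_add_left scaleC_add_right scaleC_scaleC mult.commute)
    then show ?thesis by (simp add: counit_left scaleC_one_mult)
  qed
  have "counit (v i j) *\<^sub>C 1 = (\<Sum>l<n. (\<Sum>k<n. (counit (v i k) *\<^sub>C 1) * v k l) * star (v j l))"
    by (rule corep_cancel_right[OF v ij(2), symmetric])
  also have "\<dots> = (\<Sum>l<n. v i l * star (v j l))" by (simp add: row)
  also have "\<dots> = (if i = j then 1 else 0)" by (rule unitary_corep_orthonormal[OF v ij])
  finally have "counit (counit (v i j) *\<^sub>C 1) = counit (if i = j then 1 else 0)" by (rule arg_cong)
  then show ?thesis
    by (simp add: counit_scaleC counit_one clinear_zero[OF counit_linear] split: if_splits)
qed

text \<open>
  The antipode of v is a left inverse of the unitary v, hence its adjoint.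
\<close>

lemma antipode_corep:
  assumes v: "unitary_corep comult n v" and ij: "i < n" "j < n"
  shows "antipode (v i j) = star (v j i)"
proof -
  have row: "(\<Sum>k<n. antipode (v i k) * v k l) = (if i = l then 1 else 0)" if "l < n" for l
  proof -
    have "sweedler (\<lambda>a b. antipode a * b) (comult (v i l)) = (\<Sum>k<n. antipode (v i k) * v k l)"
      by (rule unitary_corep_comult[OF v ij(1) that])
        (simp_all add: clinear_def clinear_add[OF antipode_linear] clinear_scaleC[OF antipode_linear]
          distrib_left distrib_right mult_scaleC_left mult_scaleC_right)
    then show ?thesis using counit_corep[OF v ij(1) that]
      by (cases "i = l") (simp_all add: antipode_left scaleC_one)
  qed
  have "antipode (v i j) = (\<Sum>l<n. (\<Sum>k<n. antipode (v i k) * v k l) * star (v j l))"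
    by (rule corep_cancel_right[OF v ij(2), symmetric])
  also have "\<dots> = (\<Sum>l<n. (if i = l then 1 else 0) * star (v j l))" by (simp add: row)
  also have "\<dots> = star (v j i)" by (rule sum_mult_delta[OF ij(1)])
  finally show ?thesis .
qed

text \<open>
  Apply the counit to the equation that the adjoint of v is a left inverse of v; the coefficients
  of unitary corepresentations span.
\<close>

lemma counit_star: "counit (star x) = cnj (counit x)"
proof -
  have "csubspace {x. counit (star x) = cnj (counit x)}"
    using counit_linear
    by (simp add: csubspace_def clinear_zero clinear_add clinear_scaleC star_add star_scaleC)
  moreover have "counit (star (v i j)) = cnj (counit (v i j))"
    if v: "unitary_corep comult n v" and ij: "i < n" "j < n" for n v i j
  proof -
    have "(\<Sum>k<n. star (v k j) * v k i) = (if j = i then 1 else 0)"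
      by (rule unitary_corep_orthonormal[OF v ij(2,1)])
    then have "counit (\<Sum>k<n. star (v k j) * v k i) = (if j = i then 1 else 0)"
      by (simp add: counit_one clinear_zero[OF counit_linear])
    moreover have "counit (\<Sum>k<n. star (v k j) * v k i) = (\<Sum>k<n. counit (star (v k j)) * (if k = i then 1 else 0))"
      unfolding clinear_sum[OF counit_linear] counit_mult
      by (rule sum.cong) (simp_all add: counit_corep[OF v _ ij(1)])
    ultimately show ?thesis
      unfolding sum_mult_delta(1)[OF ij(1)] by (simp add: counit_corep[OF v ij])
  qed
  ultimately have "cspan {v i j |n v i j. unitary_corep comult n v \<and> i < n \<and> j < n}
      \<subseteq> {x. counit (star x) = cnj (counit x)}"
    by (intro cspan_induct_csubspace) auto
  then show ?thesis unfolding spanned by blast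
qed

lemma haar_state: "state haar"
  by (simp add: state_def positive_functional_def haar_linear haar_positive haar_one)

text \<open>
  The star is conjugate-linear, so star is moved from the tensor to the form by conjugating the
  form.
\<close>

lemma comult_star_mult_form:
  assumes u: "unitary_corep comult n u" and w: "unitary_corep comult m w"
    and idx: "k < n" "l < n" "i < m" "j < m" and B: "bilinear_form B"
  shows "sweedler B (comult (star (u k l) * w i j))
    = (\<Sum>p<n. \<Sum>q<m. B (star (u k p) * w i q) (star (u p l) * w q j))"
proof -
  have B1: "clinear (B x)" and B2: "clinear (\<lambda>x. B x y)" for x y
    using B by (simp_all add: bilinear_form_def)
  define C where "C a b = (\<Sum>q<m. B (a * w i q) (b * w q j))" for a b
  have C1: "clinear (C a)" for a
    unfolding C_def clinear_def using B1
    by (simp add: distrib_right mult_scaleC_left clinear_add clinear_scaleC sum.distrib sum_distrib_left)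
  have C2: "clinear (\<lambda>a. C a b)" for b
    unfolding C_def clinear_def using B2
    by (simp add: distrib_right mult_scaleC_left clinear_add[of "\<lambda>x. B x _"]
        clinear_scaleC[of "\<lambda>x. B x _"] sum.distrib sum_distrib_left)
  have "sweedler B (comult (star (u k l) * w i j))
      = sweedler (\<lambda>a b. sweedler (\<lambda>a' b'. B (a * a') (b * b')) (comult (w i j))) (comult (star (u k l)))"
    using sweedler_tensor_eq[OF comult_mult B1 B2] by (simp only: sweedler_product)
  also have "(\<lambda>a b. sweedler (\<lambda>a' b'. B (a * a') (b * b')) (comult (w i j))) = C"
    unfolding C_def
    by (intro ext unitary_corep_comult[OF w idx(3,4)] clinear_mult_left[OF B1] clinear_mult_left[OF B2])
  also have "sweedler C (comult (star (u k l)))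
      = sweedler C (map (\<lambda>(a, b). (star a, star b)) (comult (u k l)))"
    by (rule sweedler_tensor_eq[OF comult_star C1 C2])
  also have "\<dots> = cnj (sweedler (\<lambda>a b. cnj (C (star a) (star b))) (comult (u k l)))"
  proof -
    have "sweedler C (map (\<lambda>(a, b). (star a, star b)) t) = cnj (sweedler (\<lambda>a b. cnj (C (star a) (star b))) t)" for t
      unfolding sweedler_def by (induction t) auto
    then show ?thesis .
  qed
  also have "sweedler (\<lambda>a b. cnj (C (star a) (star b))) (comult (u k l))
      = (\<Sum>p<n. cnj (C (star (u k p)) (star (u p l))))"
    by (intro unitary_corep_comult[OF u idx(1,2)] clinear_conj_star[OF C1] clinear_conj_star[OF C2])
  finally show ?thesis by (simp add: C_def)
qed

lemma comult_star_mult: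
  fixes g :: "'a \<Rightarrow> 'a \<Rightarrow> 'b::complex_vector"
  assumes u: "unitary_corep comult n u" and w: "unitary_corep comult m w"
    and idx: "k < n" "l < n" "i < m" "j < m"
    and g: "\<And>x. clinear (g x)" "\<And>y. clinear (\<lambda>x. g x y)"
  shows "sweedler g (comult (star (u k l) * w i j))
    = (\<Sum>p<n. \<Sum>q<m. g (star (u k p) * w i q) (star (u p l) * w q j))"
proof (rule clinear_functionals_eqI)
  fix f :: "'b \<Rightarrow> complex" assume f: "clinear f"
  have "bilinear_form (\<lambda>x y. f (g x y))"
    unfolding bilinear_form_def using g f by (simp add: clinear_def)
  from comult_star_mult_form[OF u w idx this]
  have "sweedler (\<lambda>x y. f (g x y)) (comult (star (u k l) * w i j))
    = (\<Sum>p<n. \<Sum>q<m. f (g (star (u k p) * w i q) (star (u p l) * w q j)))" .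
  moreover have "f (sweedler g r) = sweedler (\<lambda>x y. f (g x y)) r" for r
    by (simp add: sweedler_def clinear_sum_list[OF f] comp_def case_prod_unfold)
  ultimately show "f (sweedler g (comult (star (u k l) * w i j)))
      = f (\<Sum>p<n. \<Sum>q<m. g (star (u k p) * w i q) (star (u p l) * w q j))"
    by (simp add: clinear_sum[OF f])
qed

text \<open>
  Applying the Haar state to the matrix entries of star u and w averages over the quantum group,
  which produces intertwiners. Right invariance says that the adjoint of u times Y w is Y, and
  multiplying by u gives Y w = u Y.
\<close>

lemma haar_right_intertwiner:
  assumes u: "unitary_corep comult n u" and w: "unitary_corep comult m w" and ki: "k < n" "i < m"
  shows "intertwiner m w n u (\<lambda>p q. haar (star (u k p) * w i q))"
proof -
  define Y where "Y p q = haar (star (u k p) * w i q)" for p q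
  have "(\<Sum>q<m. Y r q *\<^sub>C w q j) = (\<Sum>l<n. Y l j *\<^sub>C u r l)" if rj: "r < n" "j < m" for r j
  proof -
    have inv: "(\<Sum>p<n. star (u p l) * (\<Sum>q<m. Y p q *\<^sub>C w q j)) = Y l j *\<^sub>C 1" if "l < n" for l
    proof -
      have "Y l j *\<^sub>C 1 = sweedler (\<lambda>a b. haar a *\<^sub>C b) (comult (star (u k l) * w i j))"
        by (simp add: Y_def haar_right_invariant)
      also have "\<dots> = (\<Sum>p<n. \<Sum>q<m. Y p q *\<^sub>C (star (u p l) * w q j))"
        unfolding Y_def
        by (rule comult_star_mult[OF u w ki(1) that ki(2) rj(2)])
          (simp_all add: clinear_def clinear_add[OF haar_linear] clinear_scaleC[OF haar_linear]
            scaleC_add_left scaleC_add_right scaleC_scaleC mult.commute)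
      finally show ?thesis by (simp add: sum_distrib_left mult_scaleC_right)
    qed
    have "(\<Sum>q<m. Y r q *\<^sub>C w q j) = (\<Sum>l<n. u r l * (\<Sum>p<n. star (u p l) * (\<Sum>q<m. Y p q *\<^sub>C w q j)))"
      by (rule corep_cancel_left[OF u rj(1), symmetric])
    also have "\<dots> = (\<Sum>l<n. Y l j *\<^sub>C u r l)" by (simp add: inv mult_scaleC_right)
    finally show ?thesis .
  qed
  then show ?thesis by (simp add: intertwiner_def Y_def)
qed

text \<open>
  The Haar inner products of entries of u in the same column. Column 0 is taken, and
  Schur_orthogonality shows that any other gives the same matrix.
\<close>

definition row_gram :: "(nat \<Rightarrow> nat \<Rightarrow> 'a) \<Rightarrow> nat \<Rightarrow> nat \<Rightarrow> complex" where
  "row_gram u k i = haar (star (u k 0) * u i 0)"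

lemma irreducible_unitary: "irreducible_corep comult n u \<Longrightarrow> unitary_corep comult n u"
  and irreducible_pos: "irreducible_corep comult n u \<Longrightarrow> n > 0"
  by (simp_all add: irreducible_corep_def)

text \<open>
  By Schur's lemma the averaged matrix is scalar in the column indices.
\<close>

lemma Schur_orthogonality:
  assumes u: "irreducible_corep comult n u" and idx: "k < n" "l < n" "i < n" "j < n"
  shows "haar (star (u k l) * u i j) = (if l = j then row_gram u k i else 0)"
proof -
  have "intertwiner n u n u (\<lambda>p q. haar (star (u k p) * u i q))"
    using haar_right_intertwiner[OF irreducible_unitary[OF u] irreducible_unitary[OF u]] idx by blast
  then obtain c where c: "\<And>r j. r < n \<Longrightarrow> j < n \<Longrightarrow> haar (star (u k r) * u i j) = (if r = j then c else 0)"
    using Schur_scalar[OF _ u] by metis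
  have "c = row_gram u k i" using c[of 0 0] irreducible_pos[OF u] by (simp add: row_gram_def)
  then show ?thesis using c idx by simp
qed

lemma Schur_orthogonality_inequivalent:
  assumes u: "irreducible_corep comult n u" and w: "irreducible_corep comult m w"
    and ineq: "\<not> equivalent_coreps m w n u" and idx: "k < n" "l < n" "i < m" "j < m"
  shows "haar (star (u k l) * w i j) = 0"
  using Schur_inequivalent[OF haar_right_intertwiner[OF irreducible_unitary[OF u] irreducible_unitary[OF w] idx(1,3)] w u ineq]
    idx by blast

lemma trivial_unitary_corep: "unitary_corep comult 1 (\<lambda>_ _. 1)"
  unfolding unitary_corep_def using comult_one by simp

lemma trivial_irreducible_corep: "irreducible_corep comult 1 (\<lambda>_ _. 1)"
  unfolding irreducible_corep_def
proof (intro conjI allI impI trivial_unitary_corep)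
  fix W :: "(nat \<Rightarrow> complex) set"
  assume W: "W \<subseteq> {w. \<forall>i\<ge>1. w i = 0}"
    and *: "(\<lambda>_. 0) \<in> W \<and> (\<forall>w\<in>W. \<forall>z\<in>W. (\<lambda>i. w i + z i) \<in> W) \<and> (\<forall>c. \<forall>w\<in>W. (\<lambda>i. c * w i) \<in> W) \<and>
      (\<forall>f. clinear f \<longrightarrow> (\<forall>w\<in>W. (\<lambda>i. if i < 1 then \<Sum>j<1. f (1 :: 'a) * w j else 0) \<in> W))"
  show "W = {\<lambda>_. 0} \<or> W = {w. \<forall>i\<ge>1. w i = 0}"
  proof (cases "W = {\<lambda>_. 0}")
    case False
    then obtain w where w: "w \<in> W" "w \<noteq> (\<lambda>_. 0)" using * by blast
    have supp: "\<forall>i\<ge>1. w i = 0" using W w(1) by blast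
    then have w0: "w 0 \<noteq> 0" using w(2) by (metis ext less_one not_le)
    have "z \<in> W" if z: "\<forall>i\<ge>1. z i = 0" for z
    proof -
      have "(\<lambda>i. (z 0 / w 0) * w i) \<in> W" using * w(1) by blast
      moreover have "(\<lambda>i. (z 0 / w 0) * w i) = z"
      proof
        fix i show "(z 0 / w 0) * w i = z i"
          using w0 supp z by (cases "i = 0") auto
      qed
      ultimately show ?thesis by simp
    qed
    then show ?thesis using W by blast
  qed simp
qed simp

text \<open>
  The entrywise star of u is again comultiplicative, so the antipode produces a left inverse of
  it.
\<close>

lemma antipode_star_corep:
  assumes u: "unitary_corep comult n u" and rp: "r < n" "p < n"
  shows "(\<Sum>k<n. antipode (star (u r k)) * star (u k p)) = (if r = p then 1 else 0)"
proof -
  have g: "clinear (\<lambda>b. antipode a * b)" "clinear (\<lambda>a. antipode a * b)" for a b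
    by (simp_all add: clinear_def clinear_add[OF antipode_linear] clinear_scaleC[OF antipode_linear]
        distrib_left distrib_right mult_scaleC_left mult_scaleC_right)
  have z: "(0::nat) < 1" by simp
  have "sweedler (\<lambda>a b. antipode a * b) (comult (star (u r p)))
      = (\<Sum>k<n. antipode (star (u r k)) * star (u k p))"
    using comult_star_mult[OF u trivial_unitary_corep rp z z g] by simp
  then show ?thesis
    using counit_corep[OF u rp] by (cases "r = p") (simp_all add: antipode_left counit_star scaleC_one)
qed

text \<open>
  Left invariance gives (star u) (G v) = G, where star is taken entrywise and v is the transpose
  of u. It is solved for G v with the left inverse of star u provided by the antipode.
\<close>

lemma row_gram_left_invariant:
  assumes u: "irreducible_corep comult n u" and ki: "r < n" "i < n"
  shows "(\<Sum>q<n. row_gram u r q *\<^sub>C u i q) = (\<Sum>k<n. row_gram u k i *\<^sub>C antipode (star (u r k)))"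
proof -
  have uu: "unitary_corep comult n u" and n: "0 < n"
    using u by (rule irreducible_unitary, rule irreducible_pos)
  have inv: "row_gram u k i *\<^sub>C 1 = (\<Sum>p<n. star (u k p) * (\<Sum>q<n. row_gram u p q *\<^sub>C u i q))" if "k < n" for k
  proof -
    have "row_gram u k i *\<^sub>C 1 = sweedler (\<lambda>a b. haar b *\<^sub>C a) (comult (star (u k 0) * u i 0))"
      by (simp add: row_gram_def haar_left_invariant)
    also have "\<dots> = (\<Sum>p<n. \<Sum>q<n. haar (star (u p 0) * u q 0) *\<^sub>C (star (u k p) * u i q))"
      by (rule comult_star_mult[OF uu uu that n ki(2) n])
        (simp_all add: clinear_def clinear_add[OF haar_linear] clinear_scaleC[OF haar_linear]
          scaleC_add_left scaleC_add_right scaleC_scaleC mult.commute)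
    finally show ?thesis by (simp add: sum_distrib_left mult_scaleC_right row_gram_def)
  qed
  have "(\<Sum>k<n. row_gram u k i *\<^sub>C antipode (star (u r k)))
      = (\<Sum>k<n. antipode (star (u r k)) * (row_gram u k i *\<^sub>C 1))"
    by (simp add: mult_scaleC_right)
  also have "\<dots> = (\<Sum>k<n. antipode (star (u r k)) * (\<Sum>p<n. star (u k p) * (\<Sum>q<n. row_gram u p q *\<^sub>C u i q)))"
    by (simp add: inv)
  also have "\<dots> = (\<Sum>p<n. (\<Sum>k<n. antipode (star (u r k)) * star (u k p)) * (\<Sum>q<n. row_gram u p q *\<^sub>C u i q))"
    unfolding sum_distrib_right mult.assoc[symmetric]
    by (subst sum.swap) (simp add: sum_distrib_left mult.assoc)
  also have "\<dots> = (\<Sum>p<n. (if r = p then 1 else 0) * (\<Sum>q<n. row_gram u p q *\<^sub>C u i q))"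
    by (rule sum.cong) (simp_all add: antipode_star_corep[OF uu ki(1)])
  also have "\<dots> = (\<Sum>q<n. row_gram u r q *\<^sub>C u i q)" by (simp only: sum_mult_delta[OF ki(1)])
  finally show ?thesis ..
qed

text \<open>
  The columns of u are orthonormal.
\<close>

lemma row_gram_trace:
  assumes "irreducible_corep comult n u" shows "(\<Sum>k<n. row_gram u k k) = 1"
proof -
  have "(\<Sum>k<n. row_gram u k k) = haar (\<Sum>k<n. star (u k 0) * u k 0)"
    by (simp add: row_gram_def clinear_sum[OF haar_linear])
  also have "(\<Sum>k<n. star (u k 0) * u k 0) = 1"
    using unitary_corep_orthonormal(1)[OF irreducible_unitary[OF assms], of 0 0]
      irreducible_pos[OF assms] by simp
  finally show ?thesis by (simp add: haar_one)
qed

text \<open>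
  By left invariance, the range of the transposed Gram matrix is an invariant subspace for u, and
  it is not 0 since the trace is 1. So the transposed Gram matrix is onto. This amounts to linear
  independence of the coefficients of u, and to faithfulness of the Haar state on their span.
\<close>

lemma row_gram_invertible:
  assumes u: "irreducible_corep comult n u" and i: "i < n"
  obtains z where "\<And>q. q < n \<Longrightarrow> (\<Sum>p<n. z p * row_gram u p q) = (if q = i then 1 else 0)"
proof -
  define W where "W = {x. (\<forall>q\<ge>n. x q = 0) \<and> (\<exists>z. \<forall>q<n. x q = (\<Sum>p<n. z p * row_gram u p q))}"
  have "W = {\<lambda>_. 0} \<or> W = {w. \<forall>i\<ge>n. w i = 0}"
  proof (rule irreducible_corep_subspace[OF u])
    fix f :: "'a \<Rightarrow> complex" and x assume f: "clinear f" and x: "x \<in> W"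
    then obtain z where z: "\<And>q. q < n \<Longrightarrow> x q = (\<Sum>p<n. z p * row_gram u p q)" by (auto simp: W_def)
    define z' where "z' k = (\<Sum>r<n. z r * f (antipode (star (u r k))))" for k
    have "(\<Sum>q<n. f (u i q) * x q) = (\<Sum>k<n. z' k * row_gram u k i)" if "i < n" for i
    proof -
      have "(\<Sum>q<n. f (u i q) * x q) = (\<Sum>r<n. z r * (\<Sum>q<n. row_gram u r q * f (u i q)))"
        using z by (simp add: sum_distrib_left) (subst sum.swap, simp add: mult_ac)
      also have "\<dots> = (\<Sum>r<n. z r * f (\<Sum>q<n. row_gram u r q *\<^sub>C u i q))"
        by (simp add: clinear_sum[OF f] clinear_scaleC[OF f])
      also have "\<dots> = (\<Sum>r<n. z r * (\<Sum>k<n. row_gram u k i * f (antipode (star (u r k)))))"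
        by (rule sum.cong)
          (simp_all add: row_gram_left_invariant[OF u _ that] clinear_sum[OF f] clinear_scaleC[OF f])
      also have "\<dots> = (\<Sum>k<n. z' k * row_gram u k i)"
        unfolding z'_def sum_distrib_left sum_distrib_right by (subst sum.swap) (simp add: mult_ac)
      finally show ?thesis .
    qed
    then show "(\<lambda>i. if i < n then \<Sum>j<n. f (u i j) * x j else 0) \<in> W"
      unfolding W_def by (auto intro!: exI[of _ z'])
  next
    show "(\<lambda>_. 0) \<in> W" unfolding W_def by (auto intro: exI[of _ "\<lambda>_. 0"])
  next
    fix x x' assume "x \<in> W" "x' \<in> W"
    then obtain z z' where "\<And>q. q < n \<Longrightarrow> x q = (\<Sum>p<n. z p * row_gram u p q)"
      "\<And>q. q < n \<Longrightarrow> x' q = (\<Sum>p<n. z' p * row_gram u p q)" "\<forall>i\<ge>n. x i = 0" "\<forall>i\<ge>n. x' i = 0"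
      by (auto simp: W_def)
    then show "(\<lambda>i. x i + x' i) \<in> W"
      unfolding W_def by (auto intro!: exI[of _ "\<lambda>q. z q + z' q"] simp: distrib_right sum.distrib)
  next
    fix c x assume "x \<in> W"
    then obtain z where "\<And>q. q < n \<Longrightarrow> x q = (\<Sum>p<n. z p * row_gram u p q)" "\<forall>i\<ge>n. x i = 0"
      by (auto simp: W_def)
    then show "(\<lambda>i. c * x i) \<in> W"
      unfolding W_def by (auto intro!: exI[of _ "\<lambda>q. c * z q"] simp: sum_distrib_left mult_ac)
  qed (auto simp: W_def)
  moreover have "W \<noteq> {\<lambda>_. 0}"
  proof
    assume W: "W = {\<lambda>_. 0}"
    have "row_gram u k k = 0" if "k < n" for k
    proof -
      have "\<forall>q<n. row_gram u k q = (\<Sum>p<n. (if p = k then 1 else 0) * row_gram u p q)"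
        using \<open>k < n\<close> by (simp add: sum_mult_delta)
      then have "(\<lambda>q. if q < n then row_gram u k q else 0) \<in> W"
        unfolding W_def by (auto intro!: exI[of _ "\<lambda>p. if p = k then 1 else 0"])
      then have "(\<lambda>q. if q < n then row_gram u k q else 0) = (\<lambda>_. 0)" using W by blast
      from fun_cong[OF this, of k] show ?thesis using that by simp
    qed
    then show False using row_gram_trace[OF u] by simp
  qed
  ultimately have "(\<lambda>q. if q = i then 1 else 0) \<in> W" using i by auto
  then obtain z where "\<forall>q<n. (if q = i then 1 else 0) = (\<Sum>p<n. z p * row_gram u p q)"
    unfolding W_def by blast
  then show thesis using that by auto
qed

end

section \<open>Complete reducibility\<close>

text \<open>
  The space C^n inside ell2, so that orthogonal projections and the inner product of ell2 apply to
  corepresentation spaces.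
\<close>

definition coord_space :: "nat \<Rightarrow> ell2 set" where
  "coord_space n = {x. \<forall>i\<ge>n. ell2_nth x i = 0}"

definition coord_vec :: "nat \<Rightarrow> (nat \<Rightarrow> complex) \<Rightarrow> ell2" where
  "coord_vec n f = Abs_ell2 (\<lambda>i. if i < n then f i else 0)"

lemma coord_vec_nth [simp]: "ell2_nth (coord_vec n f) i = (if i < n then f i else 0)"
proof -
  have "summable (\<lambda>i. (cmod (if i < n then f i else 0))\<^sup>2)"
    by (rule summable_finite[of "{..<n}"]) auto
  then show ?thesis unfolding coord_vec_def by (subst ell2_nth_Abs) auto
qed

lemma coord_vec_mem: "coord_vec n f \<in> coord_space n"
  by (simp add: coord_space_def)

lemma coord_space_subspace: "csubspace (coord_space n)"
  by (simp add: csubspace_def coord_space_def)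

lemma cinner_coord_space:
  assumes "x \<in> coord_space n"
  shows "cinner x y = (\<Sum>i<n. cnj (ell2_nth x i) * ell2_nth y i)"
    and "cinner y x = (\<Sum>i<n. cnj (ell2_nth y i) * ell2_nth x i)"
  using assms unfolding cinner_def coord_space_def by (auto intro!: suminf_finite) (meson leI)+

definition orthonormal :: "nat \<Rightarrow> (nat \<Rightarrow> ell2) \<Rightarrow> bool" where
  "orthonormal m b \<longleftrightarrow> (\<forall>k<m. \<forall>l<m. cinner (b k) (b l) = (if k = l then 1 else 0))"

lemma orthonormal_expansion_coefficient:
  assumes "orthonormal m b" "l < m"
  shows "cinner (b l) (\<Sum>k<m. c k *\<^sub>C b k) = c l"
proof -
  have "cinner (b l) (\<Sum>k<m. c k *\<^sub>C b k) = (\<Sum>k<m. c k * (if l = k then 1 else 0))"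
    unfolding cinner_sum_right cinner_scaleC_right
    by (rule sum.cong) (use assms in \<open>simp_all add: orthonormal_def\<close>)
  then show ?thesis using assms(2) by (simp only: sum_mult_delta)
qed

lemma orthonormal_Bessel:
  assumes "orthonormal m b"
  shows "(\<Sum>k<m. (cmod (cinner (b k) x))\<^sup>2) \<le> (norm x)\<^sup>2"
proof -
  define c where "c k = cinner (b k) x" for k
  define p where "p = (\<Sum>k<m. c k *\<^sub>C b k)"
  have sq: "cnj (c k) * c k = of_real ((cmod (c k))\<^sup>2)" for k
    by (simp add: complex_norm_square mult.commute del: of_real_power)
  have "cinner p x = (\<Sum>k<m. cnj (c k) * c k)"
    by (simp add: p_def cinner_sum_left cinner_scaleC_left c_def)
  moreover have "cinner p p = (\<Sum>k<m. cnj (c k) * cinner (b k) p)"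
    by (subst (1) p_def) (simp add: cinner_sum_left cinner_scaleC_left)
  moreover have "cinner (b k) p = c k" if "k < m" for k
    unfolding p_def by (rule orthonormal_expansion_coefficient[OF assms that])
  ultimately have orth: "cinner p (x - p) = 0" by (simp add: cinner_diff_right)
  have "cinner p p = of_real (\<Sum>k<m. (cmod (c k))\<^sup>2)"
    using orth \<open>cinner p x = _\<close> by (simp add: cinner_diff_right sq del: of_real_power)
  then have "(norm p)\<^sup>2 = (\<Sum>k<m. (cmod (c k))\<^sup>2)"
    unfolding cinner_self_norm of_real_eq_iff .
  moreover have "(norm x)\<^sup>2 = (norm p)\<^sup>2 + (norm (x - p))\<^sup>2"
    using Pythagoras[OF orth] by simp
  ultimately show ?thesis by (simp add: c_def)
qed

text \<open>
  Double counting with the standard basis e: the sum of all squared coefficients is m, and by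
  Bessel's inequality it is at most n.
\<close>

lemma orthonormal_card_le:
  assumes "orthonormal m b" "\<And>k. k < m \<Longrightarrow> b k \<in> coord_space n"
  shows "m \<le> n"
proof -
  define e where "e i = coord_vec n (\<lambda>j. if j = i then 1 else 0)" for i
  have bi: "cinner (b k) (e i) = cnj (ell2_nth (b k) i)" if "k < m" "i < n" for k i
  proof -
    have "cinner (b k) (e i) = (\<Sum>j<n. cnj (ell2_nth (b k) j) * (if j = i then 1 else 0))"
      unfolding cinner_coord_space(1)[OF assms(2)[OF that(1)]] e_def by (rule sum.cong) auto
    then show ?thesis using that(2) by (simp only: sum_mult_delta)
  qed
  have ne: "norm (e i) = 1" if "i < n" for i
  proof -
    have "cinner (e i) (e i) = (\<Sum>j<n. (if j = i then 1 else 0) * (if j = i then 1 else 0))"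
      unfolding cinner_coord_space(1)[OF coord_vec_mem[of n "\<lambda>j. if j = i then 1 else 0", folded e_def]]
      by (rule sum.cong) (auto simp: e_def)
    also have "\<dots> = 1" using that by (simp only: sum_mult_delta) simp
    finally have "(norm (e i))\<^sup>2 = 1" unfolding cinner_self_norm by (metis of_real_eq_1_iff)
    then show ?thesis by (simp add: power2_eq_1_iff) (metis norm_ge_zero not_one_le_zero neg_0_le_iff_le)
  qed
  have "real m = (\<Sum>k<m. \<Sum>i<n. (cmod (ell2_nth (b k) i))\<^sup>2)"
  proof -
    have "(\<Sum>i<n. (cmod (ell2_nth (b k) i))\<^sup>2) = 1" if "k < m" for k
    proof -
      have "complex_of_real (\<Sum>i<n. (cmod (ell2_nth (b k) i))\<^sup>2) = cinner (b k) (b k)"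
        unfolding cinner_coord_space(1)[OF assms(2)[OF that]]
        by (simp add: complex_norm_square mult.commute del: of_real_power)
      also have "\<dots> = 1" using assms(1) that by (simp add: orthonormal_def)
      finally show ?thesis by (metis of_real_eq_1_iff)
    qed
    then show ?thesis by simp
  qed
  also have "\<dots> = (\<Sum>i<n. \<Sum>k<m. (cmod (cinner (b k) (e i)))\<^sup>2)"
    by (subst sum.swap) (simp add: bi)
  also have "\<dots> \<le> (\<Sum>i<n. (norm (e i))\<^sup>2)"
    by (intro sum_mono orthonormal_Bessel assms(1))
  also have "\<dots> = real n" by (simp add: ne)
  finally show ?thesis by simp
qed

lemma orthonormal_extend:
  assumes b: "orthonormal m b" and x: "x \<noteq> 0" "\<And>k. k < m \<Longrightarrow> cinner (b k) x = 0"
  shows "orthonormal (Suc m) (b(m := of_real (1 / norm x) *\<^sub>C x))"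
proof -
  have "norm (complex_of_real (1 / norm x) *\<^sub>C x) = 1"
    using x(1) by (simp add: norm_scaleC_ell2 norm_divide)
  then have "cinner (of_real (1 / norm x) *\<^sub>C x) (of_real (1 / norm x) *\<^sub>C x) = 1"
    by (simp only: cinner_self_norm) simp
  moreover have "cinner x (b k) = 0" if "k < m" for k
    using x(2)[OF that] cinner_commute[of x "b k"] by simp
  ultimately show ?thesis
    using b x(2) unfolding orthonormal_def by (auto simp: less_Suc_eq cinner_scaleC_left cinner_scaleC_right)
qed

text \<open>
  An orthonormal family in W of maximal size, as the residual of a vector outside its span would
  extend it.
\<close>

lemma orthonormal_basis_exists:
  assumes W: "csubspace W" "W \<subseteq> coord_space n"
  obtains m b where "orthonormal m b" "\<And>k. k < m \<Longrightarrow> b k \<in> W"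
    "\<And>x. x \<in> W \<Longrightarrow> x = (\<Sum>k<m. cinner (b k) x *\<^sub>C b k)"
proof -
  define M where "M = {m. \<exists>b. orthonormal m b \<and> (\<forall>k<m. b k \<in> W)}"
  have "m \<le> n" if "m \<in> M" for m
    using that orthonormal_card_le W(2) unfolding M_def by blast
  then have fin: "finite M" by (meson finite_nat_set_iff_bounded_le)
  have "0 \<in> M" by (simp add: M_def orthonormal_def)
  then have "Max M \<in> M" using fin by (intro Max_in) auto
  then obtain b where b: "orthonormal (Max M) b" "\<And>k. k < Max M \<Longrightarrow> b k \<in> W" by (auto simp: M_def)
  have "x = (\<Sum>k<Max M. cinner (b k) x *\<^sub>C b k)" if x: "x \<in> W" for x
  proof (rule ccontr)
    assume ne: "x \<noteq> (\<Sum>k<Max M. cinner (b k) x *\<^sub>C b k)"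
    define r where "r = x - (\<Sum>k<Max M. cinner (b k) x *\<^sub>C b k)"
    have "r \<in> W" unfolding r_def
      using W(1) b(2) x by (intro csubspace_diff csubspace_sum) (auto simp: csubspace_def)
    have "orthonormal (Suc (Max M)) (b(Max M := of_real (1 / norm r) *\<^sub>C r))"
    proof (rule orthonormal_extend[OF b(1)])
      show "r \<noteq> 0" using ne by (simp add: r_def)
      show "cinner (b k) r = 0" if "k < Max M" for k
        unfolding r_def cinner_diff_right orthonormal_expansion_coefficient[OF b(1) that] by simp
    qed
    moreover have "\<forall>k<Suc (Max M). (b(Max M := of_real (1 / norm r) *\<^sub>C r)) k \<in> W"
      using b(2) W(1) \<open>r \<in> W\<close> by (auto simp: less_Suc_eq csubspace_def)
    ultimately have "Suc (Max M) \<in> M" unfolding M_def by blast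
    then show False using Max_ge[OF fin] by fastforce
  qed
  with b show thesis by (rule that)
qed

text \<open>
  The operator on C^n obtained by applying the functional f to all entries of v. Invariance of a
  subspace under v means invariance under all slices.
\<close>

definition corep_slice :: "nat \<Rightarrow> (nat \<Rightarrow> nat \<Rightarrow> 'a) \<Rightarrow> ('a \<Rightarrow> complex) \<Rightarrow> ell2 \<Rightarrow> ell2" where
  "corep_slice n v f x = coord_vec n (\<lambda>i. \<Sum>j<n. f (v i j) * ell2_nth x j)"

definition invariant_subspace :: "nat \<Rightarrow> (nat \<Rightarrow> nat \<Rightarrow> 'a::complex_vector) \<Rightarrow> ell2 set \<Rightarrow> bool" where
  "invariant_subspace n v W \<longleftrightarrow> csubspace W \<and> W \<subseteq> coord_space n \<and>
     (\<forall>f. clinear f \<longrightarrow> (\<forall>x\<in>W. corep_slice n v f x \<in> W))"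

text \<open>
  The matrix of v on the span of the orthonormal vectors b, in the basis b.
\<close>

definition compression ::
  "nat \<Rightarrow> (nat \<Rightarrow> nat \<Rightarrow> 'a::complex_vector) \<Rightarrow> (nat \<Rightarrow> ell2) \<Rightarrow> nat \<Rightarrow> nat \<Rightarrow> 'a" where
  "compression n v b k l = (\<Sum>i<n. \<Sum>j<n. (cnj (ell2_nth (b k) i) * ell2_nth (b l) j) *\<^sub>C v i j)"

lemma sum_scaleC_orthonormal:
  assumes "orthonormal m b" "\<And>k. k < m \<Longrightarrow> b k \<in> coord_space n" "k < m" "l < m"
  shows "(\<Sum>t<n. cnj (ell2_nth (b k) t) * ell2_nth (b l) t) = (if k = l then 1 else 0)"
  using assms cinner_coord_space(1)[of "b k" n "b l"] by (simp add: orthonormal_def)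

context compact_quantum_group
begin

context
  fixes n v m b W
  assumes v: "unitary_corep comult n v" and W: "invariant_subspace n v W"
    and b: "orthonormal m b" and bW: "\<And>k. k < m \<Longrightarrow> b k \<in> W"
    and basis: "\<And>x. x \<in> W \<Longrightarrow> x = (\<Sum>k<m. cinner (b k) x *\<^sub>C b k)"
begin

abbreviation (input) "entry k i \<equiv> ell2_nth (b k) i"
abbreviation (input) "block \<equiv> compression n v b"

lemma basis_coord: "k < m \<Longrightarrow> b k \<in> coord_space n"
  using W bW by (auto simp: invariant_subspace_def)

text \<open>
  Invariance of W: v maps the basis vector b l into W, where it is expanded in the basis.
\<close>

lemma compression_column:
  assumes "t < n" "l < m"
  shows "(\<Sum>j<n. entry l j *\<^sub>C v t j) = (\<Sum>p<m. entry p t *\<^sub>C block p l)"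
proof (rule clinear_functionals_eqI)
  fix f :: "'a \<Rightarrow> complex" assume f: "clinear f"
  define y where "y = corep_slice n v f (b l)"
  have "y \<in> W" using W bW[OF assms(2)] f by (simp add: y_def invariant_subspace_def)
  then have "ell2_nth y t = ell2_nth (\<Sum>k<m. cinner (b k) y *\<^sub>C b k) t" using basis by metis
  also have "\<dots> = (\<Sum>k<m. cinner (b k) y * entry k t)"
    by (induction m) simp_all
  also have "\<dots> = (\<Sum>k<m. f (block k l) * entry k t)"
  proof (rule sum.cong)
    fix k assume "k \<in> {..<m}"
    then have "cinner (b k) y = (\<Sum>i<n. cnj (entry k i) * (\<Sum>j<n. f (v i j) * entry l j))"
      by (simp add: cinner_coord_space(1)[OF basis_coord] y_def corep_slice_def)
    also have "\<dots> = f (block k l)"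
      by (simp add: compression_def clinear_sum[OF f] clinear_scaleC[OF f] sum_distrib_left mult_ac)
    finally show "cinner (b k) y * entry k t = f (block k l) * entry k t" by simp
  qed simp
  finally show "f (\<Sum>j<n. entry l j *\<^sub>C v t j) = f (\<Sum>p<m. entry p t *\<^sub>C block p l)"
    using assms(1) by (simp add: y_def corep_slice_def clinear_sum[OF f] clinear_scaleC[OF f] mult.commute)
qed

lemma antipode_compression: "k < m \<Longrightarrow> l < m \<Longrightarrow> antipode (block k l) = star (block l k)"
proof -
  have "antipode (block k l) = (\<Sum>i<n. \<Sum>j<n. (cnj (entry k i) * entry l j) *\<^sub>C star (v j i))"
    by (simp add: compression_def clinear_sum[OF antipode_linear] clinear_scaleC[OF antipode_linear]
        antipode_corep[OF v])
  also have "\<dots> = star (block l k)"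
    unfolding compression_def star_sum star_scaleC by (subst sum.swap) (simp add: mult.commute)
  finally show ?thesis .
qed

text \<open>
  The antipode takes v to its adjoint and the block to its adjoint, so the equation for columns
  turns into one for rows. This is where invariance of W yields invariance of its complement.
\<close>

lemma compression_row:
  assumes "t < n" "l < m"
  shows "(\<Sum>j<n. cnj (entry l j) *\<^sub>C v j t) = (\<Sum>p<m. cnj (entry p t) *\<^sub>C block l p)"
proof -
  have "antipode (\<Sum>j<n. entry l j *\<^sub>C v t j) = antipode (\<Sum>p<m. entry p t *\<^sub>C block p l)"
    by (simp only: compression_column[OF assms])
  then have "(\<Sum>j<n. entry l j *\<^sub>C star (v j t)) = (\<Sum>p<m. entry p t *\<^sub>C star (block l p))"
    using assms by (simp add: clinear_sum[OF antipode_linear] clinear_scaleC[OF antipode_linear]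
        antipode_corep[OF v] antipode_compression)
  then have "star (\<Sum>j<n. entry l j *\<^sub>C star (v j t)) = star (\<Sum>p<m. entry p t *\<^sub>C star (block l p))"
    by (rule arg_cong)
  then show ?thesis by (simp add: star_sum star_scaleC star_star)
qed

text \<open>
  The two unitarity relations follow from those of v by expanding columns, respectively rows, of v
  in the block.
\<close>

lemma compression_unitary: "unitary_corep comult m block"
proof -
  have comult: "comult (block k l) =\<^sub>\<otimes> map (\<lambda>p. (block k p, block p l)) [0..<m]" if kl: "k < m" "l < m" for k l
    unfolding tensor_eq_def
  proof (intro allI impI)
    fix B :: "'a \<Rightarrow> 'a \<Rightarrow> complex" assume B: "bilinear_form B"
    then have B1: "clinear (B x)" and B2: "clinear (\<lambda>x. B x y)" for x y
      by (simp_all add: bilinear_form_def)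
    have "clinear (\<lambda>x. sweedler B (comult x))"
      unfolding clinear_def
    proof (intro conjI allI)
      show "sweedler B (comult (x + y)) = sweedler B (comult x) + sweedler B (comult y)" for x y
        using comult_add[of x y] B by (simp add: tensor_eq_def sweedler_def)
      show "sweedler B (comult (c *\<^sub>C x)) = c *\<^sub>C sweedler B (comult x)" for c x
      proof -
        have "sweedler B (map (\<lambda>(a, b). (c *\<^sub>C a, b)) t) = c * sweedler B t" for t
          unfolding sweedler_def
          by (induction t) (auto simp: distrib_left clinear_scaleC[OF B2])
        then show ?thesis using comult_scaleC[of c x] B by (simp add: tensor_eq_def)
      qed
    qed
    note lin = this
    have "sweedler B (comult (block k l)) = (\<Sum>i<n. \<Sum>j<n. (cnj (entry k i) * entry l j) * (\<Sum>r<n. B (v i r) (v r j)))"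
      unfolding compression_def clinear_sum[OF lin] clinear_scaleC[OF lin]
      by (simp add: unitary_corep_comult[OF v _ _ B1 B2])
    also have "\<dots> = (\<Sum>i<n. cnj (entry k i) * (\<Sum>r<n. B (v i r) (\<Sum>j<n. entry l j *\<^sub>C v r j)))"
    proof (rule sum.cong)
      fix i
      show "(\<Sum>j<n. (cnj (entry k i) * entry l j) * (\<Sum>r<n. B (v i r) (v r j)))
          = cnj (entry k i) * (\<Sum>r<n. B (v i r) (\<Sum>j<n. entry l j *\<^sub>C v r j))"
        unfolding clinear_sum[OF B1] clinear_scaleC[OF B1] sum_distrib_left scaleC_complex
        by (subst sum.swap) (simp add: mult_ac)
    qed simp
    also have "\<dots> = (\<Sum>i<n. cnj (entry k i) * (\<Sum>r<n. B (v i r) (\<Sum>p<m. entry p r *\<^sub>C block p l)))"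
      by (simp add: compression_column kl)
    also have "\<dots> = (\<Sum>p<m. \<Sum>i<n. \<Sum>r<n. (cnj (entry k i) * entry p r) * B (v i r) (block p l))"
    proof -
      have "(\<Sum>i<n. cnj (entry k i) * (\<Sum>r<n. B (v i r) (\<Sum>p<m. entry p r *\<^sub>C block p l)))
          = (\<Sum>i<n. \<Sum>r<n. \<Sum>p<m. (cnj (entry k i) * entry p r) * B (v i r) (block p l))"
        unfolding clinear_sum[OF B1] clinear_scaleC[OF B1] sum_distrib_left scaleC_complex
        by (simp add: mult_ac)
      also have "\<dots> = (\<Sum>i<n. \<Sum>p<m. \<Sum>r<n. (cnj (entry k i) * entry p r) * B (v i r) (block p l))"
        by (intro sum.cong refl sum.swap)
      also have "\<dots> = (\<Sum>p<m. \<Sum>i<n. \<Sum>r<n. (cnj (entry k i) * entry p r) * B (v i r) (block p l))"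
        by (rule sum.swap)
      finally show ?thesis .
    qed
    also have "\<dots> = (\<Sum>p<m. B (block k p) (block p l))"
    proof (rule sum.cong)
      fix p
      have "B (block k p) z = (\<Sum>i<n. \<Sum>r<n. (cnj (entry k i) * entry p r) * B (v i r) z)" for z
        unfolding compression_def clinear_sum[OF B2] clinear_scaleC[OF B2] scaleC_complex ..
      then show "(\<Sum>i<n. \<Sum>r<n. (cnj (entry k i) * entry p r) * B (v i r) (block p l)) = B (block k p) (block p l)" by simp
    qed simp
    finally show "sweedler B (comult (block k l)) = sweedler B (map (\<lambda>p. (block k p, block p l)) [0..<m])"
      by (simp only: sweedler_matrix)
  qed
  have delta: "(if k = l then 1 else 0) *\<^sub>C (1::'a) = (if k = l then 1 else 0)" for k l :: nat
    by (simp add: scaleC_one)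
  have left: "(\<Sum>p<m. star (block p k) * block p l) = (if k = l then 1 else 0)" if kl: "k < m" "l < m" for k l
  proof -
    have "(\<Sum>t<n. star (\<Sum>p<m. entry p t *\<^sub>C block p k) * (\<Sum>q<m. entry q t *\<^sub>C block q l))
        = (\<Sum>t<n. \<Sum>p<m. \<Sum>q<m. (cnj (entry p t) * entry q t) *\<^sub>C (star (block p k) * block q l))"
      by (simp add: star_sum star_scaleC sum_product mult_scaleC_left mult_scaleC_right scaleC_scaleC mult_ac)
    also have "\<dots> = (\<Sum>p<m. \<Sum>q<m. \<Sum>t<n. (cnj (entry p t) * entry q t) *\<^sub>C (star (block p k) * block q l))"
      by (subst sum.swap) (intro sum.cong refl sum.swap)
    also have "\<dots> = (\<Sum>p<m. \<Sum>q<m. (if p = q then 1 else 0) *\<^sub>C (star (block p k) * block q l))"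
      unfolding complex_vs.scale_sum_left[symmetric]
      by (intro sum.cong refl) (simp add: sum_scaleC_orthonormal[OF b basis_coord])
    also have "\<dots> = (\<Sum>p<m. star (block p k) * block p l)"
      by (intro sum.cong refl) (simp add: sum_scaleC_delta scaleC_one)
    finally have 1: "(\<Sum>p<m. star (block p k) * block p l)
        = (\<Sum>t<n. star (\<Sum>p<m. entry p t *\<^sub>C block p k) * (\<Sum>q<m. entry q t *\<^sub>C block q l))" ..
    also have "\<dots> = (\<Sum>t<n. star (\<Sum>i<n. entry k i *\<^sub>C v t i) * (\<Sum>j<n. entry l j *\<^sub>C v t j))"
      by (simp add: compression_column kl)
    also have "\<dots> = (\<Sum>t<n. \<Sum>i<n. \<Sum>j<n. (cnj (entry k i) * entry l j) *\<^sub>C (star (v t i) * v t j))"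
      by (simp add: star_sum star_scaleC sum_product mult_scaleC_left mult_scaleC_right scaleC_scaleC mult_ac)
    also have "\<dots> = (\<Sum>i<n. \<Sum>j<n. (cnj (entry k i) * entry l j) *\<^sub>C (\<Sum>t<n. star (v t i) * v t j))"
      unfolding complex_vs.scale_sum_right by (subst sum.swap) (intro sum.cong refl sum.swap)
    also have "\<dots> = (\<Sum>i<n. \<Sum>j<n. (if i = j then cnj (entry k i) * entry l j else 0) *\<^sub>C 1)"
      by (intro sum.cong refl) (simp add: unitary_corep_orthonormal(1)[OF v])
    also have "\<dots> = (\<Sum>i<n. cnj (entry k i) * entry l i) *\<^sub>C 1"
      unfolding complex_vs.scale_sum_left[symmetric] by simp
    also have "\<dots> = (if k = l then 1 else 0)"
      by (simp add: sum_scaleC_orthonormal[OF b basis_coord kl] scaleC_one)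
    finally show ?thesis .
  qed
  have right: "(\<Sum>p<m. block k p * star (block l p)) = (if k = l then 1 else 0)" if kl: "k < m" "l < m" for k l
  proof -
    have "(\<Sum>t<n. (\<Sum>p<m. cnj (entry p t) *\<^sub>C block k p) * star (\<Sum>q<m. cnj (entry q t) *\<^sub>C block l q))
        = (\<Sum>t<n. \<Sum>p<m. \<Sum>q<m. (cnj (entry p t) * entry q t) *\<^sub>C (block k p * star (block l q)))"
      by (simp add: star_sum star_scaleC sum_product mult_scaleC_left mult_scaleC_right scaleC_scaleC mult_ac)
    also have "\<dots> = (\<Sum>p<m. \<Sum>q<m. \<Sum>t<n. (cnj (entry p t) * entry q t) *\<^sub>C (block k p * star (block l q)))"
      by (subst sum.swap) (intro sum.cong refl sum.swap)
    also have "\<dots> = (\<Sum>p<m. \<Sum>q<m. (if p = q then 1 else 0) *\<^sub>C (block k p * star (block l q)))"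
      unfolding complex_vs.scale_sum_left[symmetric]
      by (intro sum.cong refl) (simp add: sum_scaleC_orthonormal[OF b basis_coord])
    also have "\<dots> = (\<Sum>p<m. block k p * star (block l p))"
      by (intro sum.cong refl) (simp add: sum_scaleC_delta scaleC_one)
    finally have 1: "(\<Sum>p<m. block k p * star (block l p))
        = (\<Sum>t<n. (\<Sum>p<m. cnj (entry p t) *\<^sub>C block k p) * star (\<Sum>q<m. cnj (entry q t) *\<^sub>C block l q))" ..
    also have "\<dots> = (\<Sum>t<n. (\<Sum>i<n. cnj (entry k i) *\<^sub>C v i t) * star (\<Sum>j<n. cnj (entry l j) *\<^sub>C v j t))"
      by (simp add: compression_row kl)
    also have "\<dots> = (\<Sum>t<n. \<Sum>i<n. \<Sum>j<n. (cnj (entry k i) * entry l j) *\<^sub>C (v i t * star (v j t)))"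
      by (simp add: star_sum star_scaleC sum_product mult_scaleC_left mult_scaleC_right scaleC_scaleC mult_ac)
    also have "\<dots> = (\<Sum>i<n. \<Sum>j<n. (cnj (entry k i) * entry l j) *\<^sub>C (\<Sum>t<n. v i t * star (v j t)))"
      unfolding complex_vs.scale_sum_right by (subst sum.swap) (intro sum.cong refl sum.swap)
    also have "\<dots> = (\<Sum>i<n. \<Sum>j<n. (if i = j then cnj (entry k i) * entry l j else 0) *\<^sub>C 1)"
      by (intro sum.cong refl) (simp add: unitary_corep_orthonormal(2)[OF v])
    also have "\<dots> = (\<Sum>i<n. cnj (entry k i) * entry l i) *\<^sub>C 1"
      unfolding complex_vs.scale_sum_left[symmetric] by simp
    also have "\<dots> = (if k = l then 1 else 0)"
      by (simp add: sum_scaleC_orthonormal[OF b basis_coord kl] scaleC_one)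
    finally show ?thesis .
  qed
  show ?thesis unfolding unitary_corep_def using comult left right by blast
qed

text \<open>
  The equation for rows says that pairing a slice of v with a basis vector of W is a combination
  of pairings with basis vectors of W.
\<close>

lemma complement_invariant:
  "invariant_subspace n v {x \<in> coord_space n. \<forall>y\<in>W. cinner y x = 0}"
proof -
  let ?C = "{x \<in> coord_space n. \<forall>y\<in>W. cinner y x = 0}"
  have "csubspace ?C"
    using coord_space_subspace[of n]
    by (simp add: csubspace_def cinner_add_right cinner_scaleC_right)
  moreover have "corep_slice n v f x \<in> ?C" if f: "clinear f" and x: "x \<in> ?C" for f :: "'a \<Rightarrow> complex" and x
  proof -
    have bx: "cinner (b k) (corep_slice n v f x) = 0" if k: "k < m" for k
    proof -
      have "cinner (b k) (corep_slice n v f x) = (\<Sum>i<n. cnj (entry k i) * (\<Sum>j<n. f (v i j) * ell2_nth x j))"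
        by (simp add: cinner_coord_space(1)[OF basis_coord[OF k]] corep_slice_def)
      also have "\<dots> = (\<Sum>j<n. f (\<Sum>i<n. cnj (entry k i) *\<^sub>C v i j) * ell2_nth x j)"
        unfolding clinear_sum[OF f] clinear_scaleC[OF f] sum_distrib_left sum_distrib_right scaleC_complex
        by (subst sum.swap) (simp add: mult_ac)
      also have "\<dots> = (\<Sum>j<n. \<Sum>p<m. f (block k p) * (cnj (entry p j) * ell2_nth x j))"
        by (intro sum.cong refl)
          (simp add: compression_row[OF _ k] clinear_sum[OF f] clinear_scaleC[OF f] sum_distrib_left sum_distrib_right mult_ac)
      also have "\<dots> = (\<Sum>p<m. f (block k p) * cinner (b p) x)"
        by (subst sum.swap) (simp add: cinner_coord_space(1)[OF basis_coord] sum_distrib_left)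
      also have "\<dots> = 0" using x bW by simp
      finally show ?thesis .
    qed
    have "cinner y (corep_slice n v f x) = 0" if "y \<in> W" for y
      by (subst basis[OF that]) (simp add: cinner_sum_left cinner_scaleC_left bx)
    then show ?thesis by (simp add: corep_slice_def coord_vec_mem)
  qed
  ultimately show ?thesis unfolding invariant_subspace_def by blast
qed

end

end

subsection \<open>The basis of matrix coefficients\<close>

lemma clinear_eq_on_cspan:
  assumes "clinear f" "clinear g" "\<And>x. x \<in> S \<Longrightarrow> f x = g x" "x \<in> cspan S"
  shows "f x = g x"
proof -
  have "csubspace {x. f x = g x}"
    using assms(1,2) by (simp add: csubspace_def clinear_zero clinear_add clinear_scaleC)
  from cspan_induct_csubspace[OF this, of S] assms(3,4) show ?thesis by blast
qed

locale irreducible_coreps = compact_quantum_group comult counit antipode haar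
  for comult :: "'a::complex_star_algebra \<Rightarrow> ('a \<times> 'a) list" and counit antipode haar +
  fixes Irr :: "'i set" and N :: "'i \<Rightarrow> nat" and u :: "'i \<Rightarrow> nat \<Rightarrow> nat \<Rightarrow> 'a"
  assumes irr_reps: "irr_representatives comult Irr N u"
begin

lemma irr: "\<alpha> \<in> Irr \<Longrightarrow> irreducible_corep comult (N \<alpha>) (u \<alpha>)"
  and irr_unique: "\<alpha> \<in> Irr \<Longrightarrow> \<beta> \<in> Irr \<Longrightarrow> equivalent_coreps (N \<alpha>) (u \<alpha>) (N \<beta>) (u \<beta>) \<Longrightarrow> \<alpha> = \<beta>"
  and irr_exists: "irreducible_corep comult n v \<Longrightarrow> \<exists>\<alpha>\<in>Irr. equivalent_coreps n v (N \<alpha>) (u \<alpha>)"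
  using irr_reps unfolding irr_representatives_def by blast+

lemma irr_unitary: "\<alpha> \<in> Irr \<Longrightarrow> unitary_corep comult (N \<alpha>) (u \<alpha>)"
  and irr_pos: "\<alpha> \<in> Irr \<Longrightarrow> 0 < N \<alpha>"
  using irr by (simp_all add: irreducible_corep_def)

definition coefficient :: "'i \<times> nat \<times> nat \<Rightarrow> 'a" where
  "coefficient = (\<lambda>(\<alpha>, i, j). u \<alpha> i j)"

abbreviation "index \<equiv> irr_index Irr N"

lemma coefficient_mem: "\<alpha> \<in> Irr \<Longrightarrow> i < N \<alpha> \<Longrightarrow> j < N \<alpha> \<Longrightarrow> u \<alpha> i j \<in> coefficient ` index"
  unfolding coefficient_def irr_index_def by force

lemma csubspace_cspan: "csubspace (cspan S)"
  by (simp add: csubspace_iff_subspace cspan_eq_span)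

lemma cspan_base: "x \<in> S \<Longrightarrow> x \<in> cspan S"
  by (simp add: cspan_eq_span complex_vs.span_base)

lemma cspan_combination:
  "(\<And>k. k \<in> A \<Longrightarrow> x k \<in> cspan S) \<Longrightarrow> (\<Sum>k\<in>A. c k *\<^sub>C x k) \<in> cspan S"
  using csubspace_cspan[of S] by (intro csubspace_sum) (auto simp: csubspace_def)

lemma irreducible_coefficients:
  assumes v: "irreducible_corep comult n v" and ij: "i < n" "j < n"
  shows "v i j \<in> cspan (coefficient ` index)"
proof -
  obtain \<alpha> where \<alpha>: "\<alpha> \<in> Irr" "equivalent_coreps n v (N \<alpha>) (u \<alpha>)" using irr_exists[OF v] by blast
  then obtain X Y where n: "n = N \<alpha>"
    and YX: "\<And>i j. i < n \<Longrightarrow> j < n \<Longrightarrow> (\<Sum>k<n. Y i k * X k j) = (if i = j then 1 else 0 :: complex)"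
    and tw: "\<And>i j. i < n \<Longrightarrow> j < n \<Longrightarrow> (\<Sum>k<n. X i k *\<^sub>C v k j) = (\<Sum>k<n. X k j *\<^sub>C u \<alpha> i k)"
    unfolding equivalent_coreps_def by blast
  have "(\<Sum>p<n. Y i p *\<^sub>C (\<Sum>k<n. X p k *\<^sub>C v k j)) = (\<Sum>k<n. (\<Sum>p<n. Y i p * X p k) *\<^sub>C v k j)"
    unfolding complex_vs.scale_sum_right complex_vs.scale_sum_left scaleC_scaleC by (rule sum.swap)
  also have "\<dots> = (\<Sum>k<n. (if i = k then 1 else 0) *\<^sub>C v k j)"
    by (rule sum.cong) (simp_all add: YX ij)
  also have "\<dots> = v i j" using ij by (simp add: sum_scaleC_delta(2)[where c = 1 and a = "\<lambda>k. v k j"] scaleC_one)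
  finally have "v i j = (\<Sum>p<n. Y i p *\<^sub>C (\<Sum>k<n. X k j *\<^sub>C u \<alpha> p k))"
    using tw ij by simp
  also have "\<dots> \<in> cspan (coefficient ` index)"
    by (intro cspan_combination cspan_base coefficient_mem) (auto simp: \<alpha> simp flip: n)
  finally show ?thesis .
qed

text \<open>
  Complete reducibility by induction on the size: a proper invariant subspace and its complement
  are both smaller, and the coefficients of v are combinations of those of the two blocks.
\<close>

lemma unitary_coefficients:
  assumes "unitary_corep comult n v" "i < n" "j < n"
  shows "v i j \<in> cspan (coefficient ` index)"
  using assms
proof (induction n arbitrary: v i j rule: less_induct)
  case (less n)
  note v = less.prems(1)
  let ?P = "cspan (coefficient ` index)"
  show ?case
  proof (cases "irreducible_corep comult n v")
    case True
    then show ?thesis using less.prems by (intro irreducible_coefficients)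
  next
    case False
    \<comment> \<open>Names for the two sides of the implication in irreducibility, whose negation is then short.\<close>
    define invariant where "invariant W \<longleftrightarrow> (\<lambda>_. 0) \<in> W \<and> (\<forall>w\<in>W. \<forall>z\<in>W. (\<lambda>i. w i + z i) \<in> W) \<and>
        (\<forall>c. \<forall>w\<in>W. (\<lambda>i. c * w i) \<in> W) \<and>
        (\<forall>f. clinear f \<longrightarrow> (\<forall>w\<in>W. (\<lambda>i. if i < n then \<Sum>j<n. f (v i j) * w j else 0) \<in> W))"
      for W :: "(nat \<Rightarrow> complex) set"
    define trivial where "trivial W \<longleftrightarrow> W = {\<lambda>_. 0} \<or> W = {w. \<forall>i\<ge>n. w i = 0}" for W :: "(nat \<Rightarrow> complex) set"
    have "irreducible_corep comult n v \<longleftrightarrow> unitary_corep comult n v \<and> n > 0 \<and>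
        (\<forall>W \<subseteq> {w. \<forall>i\<ge>n. w i = 0}. invariant W \<longrightarrow> trivial W)"
      unfolding irreducible_corep_def invariant_def trivial_def by (rule refl)
    with False v less.prems(2) obtain W0 where W0: "W0 \<subseteq> {w. \<forall>i\<ge>n. w i = 0}"
      and closed: "invariant W0" and proper': "\<not> trivial W0" by auto
    have W0z: "(\<lambda>_. 0) \<in> W0"
      and W0add: "\<And>w z. w \<in> W0 \<Longrightarrow> z \<in> W0 \<Longrightarrow> (\<lambda>i. w i + z i) \<in> W0"
      and W0scale: "\<And>c w. w \<in> W0 \<Longrightarrow> (\<lambda>i. c * w i) \<in> W0"
      and W0inv: "\<And>f w. clinear f \<Longrightarrow> w \<in> W0 \<Longrightarrow> (\<lambda>i. if i < n then \<Sum>j<n. f (v i j) * w j else 0) \<in> W0"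
      and proper: "W0 \<noteq> {\<lambda>_. 0}" "W0 \<noteq> {w. \<forall>i\<ge>n. w i = 0}"
      using closed proper' unfolding invariant_def trivial_def by blast+
    \<comment> \<open>The subspace of C^n, transported into ell2.\<close>
    define W where "W = {x \<in> coord_space n. ell2_nth x \<in> W0}"
    have nth_vec: "ell2_nth (coord_vec n w) = w" if "\<forall>i\<ge>n. w i = 0" for w
      using that by (auto simp: fun_eq_iff)
    have nth0: "ell2_nth 0 = (\<lambda>_. 0)" "ell2_nth (x + y) = (\<lambda>i. ell2_nth x i + ell2_nth y i)"
      "ell2_nth (c *\<^sub>C x) = (\<lambda>i. c * ell2_nth x i)" for x y c by (simp_all add: fun_eq_iff)
    have "csubspace W"
      using W0z W0add W0scale coord_space_subspace[of n]
      by (auto simp: W_def csubspace_def nth0)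
    moreover have "corep_slice n v f x \<in> W" if "clinear f" "x \<in> W" for f x
    proof -
      have "ell2_nth (corep_slice n v f x) = (\<lambda>i. if i < n then \<Sum>j<n. f (v i j) * ell2_nth x j else 0)"
        by (simp add: corep_slice_def fun_eq_iff)
      then show ?thesis using W0inv[OF that(1), of "ell2_nth x"] that(2)
        by (simp add: W_def corep_slice_def coord_vec_mem)
    qed
    ultimately have W: "invariant_subspace n v W"
      by (auto simp: invariant_subspace_def W_def)
    then have Ws: "csubspace W" "W \<subseteq> coord_space n" by (simp_all add: invariant_subspace_def)
    obtain w where w: "w \<in> W" "w \<noteq> 0"
    proof -
      obtain w where w: "w \<in> W0" "w \<noteq> (\<lambda>_. 0)" using proper(1) W0z by blast
      then have "\<forall>i\<ge>n. w i = 0" using W0 by blast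
      from nth_vec[OF this] w have "coord_vec n w \<in> W" "coord_vec n w \<noteq> 0"
        by (auto simp: W_def coord_vec_mem nth0)
      then show thesis by (rule that)
    qed
    obtain z where z: "z \<in> coord_space n" "z \<notin> W"
    proof -
      obtain z where z: "\<forall>i\<ge>n. z i = 0" "z \<notin> W0" using proper(2) W0 by blast
      then have "coord_vec n z \<in> coord_space n" "coord_vec n z \<notin> W"
        by (simp_all add: coord_vec_mem W_def nth_vec)
      then show thesis by (rule that)
    qed
    obtain m b where b: "orthonormal m b" "\<And>k. k < m \<Longrightarrow> b k \<in> W"
      "\<And>x. x \<in> W \<Longrightarrow> x = (\<Sum>k<m. cinner (b k) x *\<^sub>C b k)"
      using orthonormal_basis_exists[OF Ws] by metis
    define C where "C = {x \<in> coord_space n. \<forall>y\<in>W. cinner y x = 0}"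
    have C: "invariant_subspace n v C"
      unfolding C_def by (rule complement_invariant[OF v W b])
    then have Cs: "csubspace C" "C \<subseteq> coord_space n" by (simp_all add: invariant_subspace_def)
    obtain m' c where c: "orthonormal m' c" "\<And>k. k < m' \<Longrightarrow> c k \<in> C"
      "\<And>x. x \<in> C \<Longrightarrow> x = (\<Sum>k<m'. cinner (c k) x *\<^sub>C c k)"
      using orthonormal_basis_exists[OF Cs] by metis
    have residual: "x - (\<Sum>k<m. cinner (b k) x *\<^sub>C b k) \<in> C" if x: "x \<in> coord_space n" for x
    proof -
      let ?p = "\<Sum>k<m. cinner (b k) x *\<^sub>C b k"
      have "?p \<in> W" using b(2) Ws(1) by (intro csubspace_sum) (auto simp: csubspace_def)
      then have "x - ?p \<in> coord_space n"
        using x Ws(2) by (intro csubspace_diff[OF coord_space_subspace]) auto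
      moreover have "cinner y (x - ?p) = 0" if "y \<in> W" for y
      proof -
        have "cinner (b k) (x - ?p) = 0" if "k < m" for k
          unfolding cinner_diff_right orthonormal_expansion_coefficient[OF b(1) that] by simp
        then show ?thesis
          by (subst b(3)[OF that]) (simp add: cinner_sum_left cinner_scaleC_left)
      qed
      ultimately show ?thesis by (simp add: C_def)
    qed
    \<comment> \<open>The residual of z would extend the basis of W, so W has room left in C^n.\<close>
    have "m < n"
    proof -
      define r where "r = z - (\<Sum>k<m. cinner (b k) z *\<^sub>C b k)"
      have "r \<in> C" unfolding r_def by (rule residual[OF z(1)])
      have "(\<Sum>k<m. cinner (b k) z *\<^sub>C b k) \<in> W"
        using b(2) Ws(1) by (intro csubspace_sum) (auto simp: csubspace_def)
      then have "r \<noteq> 0" using z(2) by (auto simp: r_def)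
      moreover have "cinner (b k) r = 0" if "k < m" for k
        using \<open>r \<in> C\<close> b(2)[OF that] by (simp add: C_def)
      ultimately have "orthonormal (Suc m) (b(m := of_real (1 / norm r) *\<^sub>C r))"
        by (rule orthonormal_extend[OF b(1)])
      moreover have "(b(m := of_real (1 / norm r) *\<^sub>C r)) k \<in> coord_space n" if "k < Suc m" for k
        using that b(2)[of k] Ws(2) \<open>r \<in> C\<close> Cs coord_space_subspace[of n]
        by (auto simp: less_Suc_eq csubspace_def)
      ultimately have "Suc m \<le> n" by (rule orthonormal_card_le)
      then show ?thesis by simp
    qed
    \<comment> \<open>The vector w of W would extend the basis of the complement.\<close>
    have "m' < n"
    proof -
      have "cinner (c k) w = 0" if "k < m'" for k
        using c(2)[OF that] w(1) cinner_commute[of "c k" w] by (simp add: C_def)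
      with w(2) have "orthonormal (Suc m') (c(m' := of_real (1 / norm w) *\<^sub>C w))"
        by (rule orthonormal_extend[OF c(1)])
      moreover have "(c(m' := of_real (1 / norm w) *\<^sub>C w)) k \<in> coord_space n" if "k < Suc m'" for k
        using that c(2)[of k] Cs(2) w(1) Ws coord_space_subspace[of n]
        by (auto simp: less_Suc_eq csubspace_def)
      ultimately have "Suc m' \<le> n" by (rule orthonormal_card_le)
      then show ?thesis by simp
    qed
    have columnW: "(\<Sum>j<n. ell2_nth (b l) j *\<^sub>C v i j) \<in> ?P" if l: "l < m" for l
    proof -
      have "(\<Sum>j<n. ell2_nth (b l) j *\<^sub>C v i j) = (\<Sum>p<m. ell2_nth (b p) i *\<^sub>C compression n v b p l)"
        by (rule compression_column[OF v W b less.prems(2) l])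
      also have "\<dots> \<in> ?P"
      proof (rule cspan_combination)
        fix p assume "p \<in> {..<m}"
        then show "compression n v b p l \<in> ?P"
          using less.IH[OF \<open>m < n\<close> compression_unitary[OF v W b], of p l] l by simp
      qed
      finally show ?thesis .
    qed
    have columnC: "(\<Sum>j<n. ell2_nth (c l) j *\<^sub>C v i j) \<in> ?P" if l: "l < m'" for l
    proof -
      have "(\<Sum>j<n. ell2_nth (c l) j *\<^sub>C v i j) = (\<Sum>p<m'. ell2_nth (c p) i *\<^sub>C compression n v c p l)"
        by (rule compression_column[OF v C c less.prems(2) l])
      also have "\<dots> \<in> ?P"
      proof (rule cspan_combination)
        fix p assume "p \<in> {..<m'}"
        then show "compression n v c p l \<in> ?P"
          using less.IH[OF \<open>m' < n\<close> compression_unitary[OF v C c], of p l] l by simp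
      qed
      finally show ?thesis .
    qed
    \<comment> \<open>The j-th column of v is v applied to the j-th standard vector, which is split into its
        components in W and C.\<close>
    define e where "e = coord_vec n (\<lambda>k. if k = j then 1 else 0)"
    define r where "r = e - (\<Sum>k<m. cinner (b k) e *\<^sub>C b k)"
    have "r \<in> C" unfolding r_def e_def by (rule residual[OF coord_vec_mem])
    then have e: "e = (\<Sum>k<m. cinner (b k) e *\<^sub>C b k) + (\<Sum>k<m'. cinner (c k) r *\<^sub>C c k)"
      using c(3)[of r] unfolding r_def by (metis add.commute diff_add_cancel)
    have nth: "ell2_nth e t = (\<Sum>k<m. cinner (b k) e * ell2_nth (b k) t) + (\<Sum>k<m'. cinner (c k) r * ell2_nth (c k) t)" for t
    proof -
      have nth_sum: "ell2_nth (\<Sum>k<q. s k *\<^sub>C a k) t = (\<Sum>k<q. s k * ell2_nth (a k) t)" for q :: nat and s a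
        by (induction q) simp_all
      show ?thesis by (subst e) (simp add: nth_sum)
    qed
    have "v i j = (\<Sum>t<n. ell2_nth e t *\<^sub>C v i t)"
      using sum_scaleC_delta(1)[OF less.prems(3), of 1 "\<lambda>t. v i t"] by (simp add: e_def scaleC_one)
    also have "\<dots> = (\<Sum>k<m. cinner (b k) e *\<^sub>C (\<Sum>t<n. ell2_nth (b k) t *\<^sub>C v i t))
        + (\<Sum>k<m'. cinner (c k) r *\<^sub>C (\<Sum>t<n. ell2_nth (c k) t *\<^sub>C v i t))"
    proof -
      have swap: "(\<Sum>t<n. (\<Sum>k<q. s k * ell2_nth (a k) t) *\<^sub>C v i t)
          = (\<Sum>k<q. s k *\<^sub>C (\<Sum>t<n. ell2_nth (a k) t *\<^sub>C v i t))" for q s a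
        unfolding complex_vs.scale_sum_right complex_vs.scale_sum_left scaleC_scaleC by (rule sum.swap)
      show ?thesis unfolding nth scaleC_add_left sum.distrib swap ..
    qed
    also have "\<dots> \<in> ?P"
    proof -
      have "(\<Sum>k<m. cinner (b k) e *\<^sub>C (\<Sum>t<n. ell2_nth (b k) t *\<^sub>C v i t)) \<in> ?P"
        by (intro cspan_combination columnW) auto
      moreover have "(\<Sum>k<m'. cinner (c k) r *\<^sub>C (\<Sum>t<n. ell2_nth (c k) t *\<^sub>C v i t)) \<in> ?P"
        by (intro cspan_combination columnC) auto
      ultimately show ?thesis using csubspace_cspan[of "coefficient ` index"] unfolding csubspace_def by blast
    qed
    finally show ?thesis .
  qed
qed

theorem coefficients_span: "cspan (coefficient ` index) = UNIV"
proof -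
  have "cspan {v i j |n v i j. unitary_corep comult n v \<and> i < n \<and> j < n} \<subseteq> cspan (coefficient ` index)"
    by (intro cspan_induct_csubspace csubspace_cspan) (use unitary_coefficients in auto)
  then show ?thesis unfolding spanned by blast
qed

lemma coefficient_orthogonality:
  assumes "\<alpha> \<in> Irr" "k < N \<alpha>" "l < N \<alpha>" "\<beta> \<in> Irr" "i < N \<beta>" "j < N \<beta>"
  shows "haar (star (u \<alpha> k l) * u \<beta> i j) = (if \<beta> = \<alpha> \<and> l = j then row_gram (u \<alpha>) k i else 0)"
proof (cases "\<beta> = \<alpha>")
  case True
  then show ?thesis using Schur_orthogonality[OF irr] assms by simp
next
  case False
  then have "\<not> equivalent_coreps (N \<beta>) (u \<beta>) (N \<alpha>) (u \<alpha>)" using irr_unique assms by blast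
  then show ?thesis
    using Schur_orthogonality_inequivalent[OF irr[OF assms(1)] irr[OF assms(4)] _ assms(2,3,5,6)] False by simp
qed

text \<open>
  The dual functional of a coefficient is an inner product with a combination of coefficients in
  the same column, chosen by inverting the Gram matrix of the rows. By the Cauchy-Schwarz
  inequality it vanishes on null vectors of the Haar state.
\<close>

lemma coordinate_functional_exists:
  assumes "q \<in> index"
  shows "\<exists>g. clinear g \<and> (\<forall>p\<in>index. g (coefficient p) = (if p = q then 1 else 0)) \<and>
    (\<forall>x. haar (star x * x) = 0 \<longrightarrow> g x = (0::complex))"
proof -
  obtain \<alpha> i l where q: "q = (\<alpha>, i, l)" "\<alpha> \<in> Irr" "i < N \<alpha>" "l < N \<alpha>"
    using assms by (auto simp: irr_index_def)
  obtain z where z: "\<And>t. t < N \<alpha> \<Longrightarrow> (\<Sum>k<N \<alpha>. z k * row_gram (u \<alpha>) k t) = (if t = i then 1 else 0)"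
    using row_gram_invertible[OF irr[OF q(2)] q(3)] by metis
  define g where "g x = (\<Sum>k<N \<alpha>. z k * haar (star (u \<alpha> k l) * x))" for x
  have "clinear g"
    unfolding g_def clinear_def
    by (simp add: distrib_left mult_scaleC_right clinear_add[OF haar_linear] clinear_scaleC[OF haar_linear]
        sum.distrib sum_distrib_left mult_ac)
  moreover have "g (coefficient p) = (if p = q then 1 else 0)" if pi: "p \<in> index" for p
  proof -
    obtain \<beta> t j where p: "p = (\<beta>, t, j)" "\<beta> \<in> Irr" "t < N \<beta>" "j < N \<beta>"
      using pi by (auto simp: irr_index_def)
    have "g (coefficient p) = (\<Sum>k<N \<alpha>. z k * (if \<beta> = \<alpha> \<and> l = j then row_gram (u \<alpha>) k t else 0))"
      unfolding g_def p coefficient_def prod.case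
      by (intro sum.cong refl) (simp only: coefficient_orthogonality[OF q(2) _ q(4) p(2-4)] lessThan_iff)
    also have "\<dots> = (if p = q then 1 else 0)"
      using z[of t] p by (cases "\<beta> = \<alpha> \<and> l = j") (auto simp: q(1))
    finally show ?thesis .
  qed
  moreover have "g x = 0" if "haar (star x * x) = 0" for x
    using positive_functional_null_left[of haar x] haar_state that by (simp add: g_def state_def)
  ultimately show ?thesis by blast
qed

definition coordinate :: "'i \<times> nat \<times> nat \<Rightarrow> 'a \<Rightarrow> complex" where
  "coordinate q = (if q \<in> index then SOME g. clinear g \<and>
     (\<forall>p\<in>index. g (coefficient p) = (if p = q then 1 else 0)) \<and>
     (\<forall>x. haar (star x * x) = 0 \<longrightarrow> g x = (0::complex)) else (\<lambda>_. 0))"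

lemma coordinate_props:
  shows coordinate_linear: "clinear (coordinate q)"
    and coordinate_coefficient: "p \<in> index \<Longrightarrow> coordinate q (coefficient p) = (if p = q then 1 else 0)"
    and coordinate_null: "haar (star x * x) = 0 \<Longrightarrow> coordinate q x = 0"
    and coordinate_outside: "q \<notin> index \<Longrightarrow> coordinate q x = 0"
proof -
  have "q \<in> index \<Longrightarrow> clinear (coordinate q) \<and>
     (\<forall>p\<in>index. coordinate q (coefficient p) = (if p = q then 1 else 0)) \<and>
     (\<forall>x. haar (star x * x) = 0 \<longrightarrow> coordinate q x = 0)"
    unfolding coordinate_def using someI_ex[OF coordinate_functional_exists[of q]] by simp
  moreover have "q \<notin> index \<Longrightarrow> coordinate q = (\<lambda>_. 0)" by (simp add: coordinate_def)
  ultimately show "clinear (coordinate q)"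
    "p \<in> index \<Longrightarrow> coordinate q (coefficient p) = (if p = q then 1 else 0)"
    "haar (star x * x) = 0 \<Longrightarrow> coordinate q x = 0" "q \<notin> index \<Longrightarrow> coordinate q x = 0"
    by (cases "q \<in> index"; auto simp: clinear_def)+
qed

lemma coordinate_expansion_exists:
  "\<exists>F. finite F \<and> (\<forall>p. p \<notin> F \<longrightarrow> coordinate p x = 0) \<and> x = (\<Sum>p\<in>F. coordinate p x *\<^sub>C coefficient p)"
proof -
  let ?T = "{x. \<exists>F. finite F \<and> (\<forall>p. p \<notin> F \<longrightarrow> coordinate p x = 0) \<and> x = (\<Sum>p\<in>F. coordinate p x *\<^sub>C coefficient p)}"
  have "csubspace ?T"
    unfolding csubspace_def
  proof (intro conjI ballI allI)
    show "0 \<in> ?T" by (auto intro!: exI[of _ "{}"] simp: clinear_zero[OF coordinate_linear])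
  next
    fix x y assume "x \<in> ?T" "y \<in> ?T"
    then obtain F G where F: "finite F" "\<And>p. p \<notin> F \<Longrightarrow> coordinate p x = 0" "x = (\<Sum>p\<in>F. coordinate p x *\<^sub>C coefficient p)"
      and G: "finite G" "\<And>p. p \<notin> G \<Longrightarrow> coordinate p y = 0" "y = (\<Sum>p\<in>G. coordinate p y *\<^sub>C coefficient p)"
      by blast
    have "x = (\<Sum>p\<in>F \<union> G. coordinate p x *\<^sub>C coefficient p)"
      by (subst F(3), rule sum.mono_neutral_left) (use F G in auto)
    moreover have "y = (\<Sum>p\<in>F \<union> G. coordinate p y *\<^sub>C coefficient p)"
      by (subst G(3), rule sum.mono_neutral_left) (use F G in auto)
    ultimately have "x + y = (\<Sum>p\<in>F \<union> G. coordinate p (x + y) *\<^sub>C coefficient p)"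
      by (simp add: clinear_add[OF coordinate_linear] scaleC_add_left sum.distrib)
    moreover have "\<forall>p. p \<notin> F \<union> G \<longrightarrow> coordinate p (x + y) = 0"
      using F(2) G(2) by (simp add: clinear_add[OF coordinate_linear])
    moreover have "finite (F \<union> G)" using F(1) G(1) by simp
    ultimately show "x + y \<in> ?T" by blast
  next
    fix c x assume "x \<in> ?T"
    then obtain F where F: "finite F" "\<And>p. p \<notin> F \<Longrightarrow> coordinate p x = 0" "x = (\<Sum>p\<in>F. coordinate p x *\<^sub>C coefficient p)"
      by blast
    have "c *\<^sub>C x = (\<Sum>p\<in>F. coordinate p (c *\<^sub>C x) *\<^sub>C coefficient p)"
      by (subst F(3)) (simp add: clinear_scaleC[OF coordinate_linear] complex_vs.scale_sum_right scaleC_scaleC)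
    moreover have "\<forall>p. p \<notin> F \<longrightarrow> coordinate p (c *\<^sub>C x) = 0"
      using F(2) by (simp add: clinear_scaleC[OF coordinate_linear])
    ultimately show "c *\<^sub>C x \<in> ?T" using F(1) by blast
  qed
  moreover have "coefficient p \<in> ?T" if "p \<in> index" for p
    using that by (auto intro!: exI[of _ "{p}"] simp: coordinate_coefficient scaleC_one)
  ultimately have "cspan (coefficient ` index) \<subseteq> ?T"
    by (intro cspan_induct_csubspace) auto
  then show ?thesis unfolding coefficients_span by blast
qed

lemma coordinate_finite: "finite {p. coordinate p x \<noteq> 0}"
  using coordinate_expansion_exists[of x] by (metis (mono_tags, lifting) finite_subset mem_Collect_eq subsetI)

lemma coordinate_support: "{p. coordinate p x \<noteq> 0} \<subseteq> index"
  using coordinate_outside by blast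

lemma coordinate_expansion: "x = (\<Sum>p | coordinate p x \<noteq> 0. coordinate p x *\<^sub>C coefficient p)"
proof -
  obtain F where F: "finite F" "\<And>p. p \<notin> F \<Longrightarrow> coordinate p x = 0" "x = (\<Sum>p\<in>F. coordinate p x *\<^sub>C coefficient p)"
    using coordinate_expansion_exists[of x] by blast
  have "(\<Sum>p | coordinate p x \<noteq> 0. coordinate p x *\<^sub>C coefficient p) = (\<Sum>p\<in>F. coordinate p x *\<^sub>C coefficient p)"
    by (rule sum.mono_neutral_left) (use F in auto)
  then show ?thesis using F(3) by simp
qed

lemma pol_coord_eq: "pol_coord Irr N u x = (\<lambda>p. coordinate p x)"
  unfolding pol_coord_def
proof (rule the_equality)
  have triple: "(\<Sum>(\<gamma>, i, j) | c (\<gamma>, i, j) \<noteq> 0. c (\<gamma>, i, j) *\<^sub>C u \<gamma> i j)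
      = (\<Sum>p | c p \<noteq> 0. c p *\<^sub>C coefficient p)" for c
    by (rule sum.cong) (auto simp: coefficient_def)
  show "finite {p. coordinate p x \<noteq> 0} \<and> {p. coordinate p x \<noteq> 0} \<subseteq> index \<and>
    x = (\<Sum>(\<gamma>, i, j) | coordinate (\<gamma>, i, j) x \<noteq> 0. coordinate (\<gamma>, i, j) x *\<^sub>C u \<gamma> i j)"
    using coordinate_finite coordinate_support coordinate_expansion triple[of "\<lambda>p. coordinate p x"] by simp
  fix c :: "'i \<times> nat \<times> nat \<Rightarrow> complex"
  assume c: "finite {p. c p \<noteq> 0} \<and> {p. c p \<noteq> 0} \<subseteq> index \<and>
    x = (\<Sum>(\<gamma>, i, j) | c (\<gamma>, i, j) \<noteq> 0. c (\<gamma>, i, j) *\<^sub>C u \<gamma> i j)"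
  show "c = (\<lambda>p. coordinate p x)"
  proof
    fix q
    have "coordinate q x = (\<Sum>p | c p \<noteq> 0. c p * coordinate q (coefficient p))"
      using c triple[of c]
      by (simp add: clinear_sum[OF coordinate_linear] clinear_scaleC[OF coordinate_linear])
    also have "\<dots> = (\<Sum>p | c p \<noteq> 0. if p = q then c p else 0)"
      by (rule sum.cong) (use c in \<open>auto simp: coordinate_coefficient\<close>)
    also have "\<dots> = c q" using c by simp
    finally show "c q = coordinate q x" ..
  qed
qed

text \<open>
  All coordinates of a null vector vanish.
\<close>

lemma haar_faithful: "haar (star x * x) = 0 \<Longrightarrow> x = 0"
  using coordinate_expansion[of x] coordinate_null[of x] by simp

lemma haar_strictly_positive:
  assumes "x \<noteq> 0" shows "0 < Re (haar (star x * x))"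
proof -
  have p: "positive_functional haar" using haar_state by (simp add: state_def)
  have "Re (haar (star x * x)) \<noteq> 0"
    using positive_functional_square[OF p, of x] haar_faithful assms by (metis complex_eqI zero_complex.sel)
  then show ?thesis using positive_functional_square(1)[OF p, of x] by simp
qed

end

section \<open>Corepresentations of the dual as representations\<close>

lemma bounded_operator_on_combination:
  assumes H: "csubspace H" and F: "finite F" and T: "\<And>p. p \<in> F \<Longrightarrow> bounded_operator_on H (T p)"
  shows "bounded_operator_on H (\<lambda>\<xi>. \<Sum>p\<in>F. c p *\<^sub>C T p \<xi>)"
proof -
  have mem: "T p \<xi> \<in> H" and add: "\<zeta> \<in> H \<Longrightarrow> T p (\<xi> + \<zeta>) = T p \<xi> + T p \<zeta>"
    and scale: "T p (s *\<^sub>C \<xi>) = s *\<^sub>C T p \<xi>" if "p \<in> F" "\<xi> \<in> H" for p \<xi> \<zeta> s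
    using T[OF that(1)] that(2) by (simp_all add: bounded_operator_on_def)
  have "\<exists>K. \<forall>\<xi>\<in>H. norm (T p \<xi>) \<le> K * norm \<xi>" if "p \<in> F" for p
    using T[OF that] unfolding bounded_operator_on_def by blast
  then obtain K where K: "\<And>p \<xi>. p \<in> F \<Longrightarrow> \<xi> \<in> H \<Longrightarrow> norm (T p \<xi>) \<le> K p * norm \<xi>" by metis
  have "norm (\<Sum>p\<in>F. c p *\<^sub>C T p \<xi>) \<le> (\<Sum>p\<in>F. cmod (c p) * K p) * norm \<xi>" if "\<xi> \<in> H" for \<xi>
  proof -
    have "norm (\<Sum>p\<in>F. c p *\<^sub>C T p \<xi>) \<le> (\<Sum>p\<in>F. norm (c p *\<^sub>C T p \<xi>))" by (rule norm_sum)
    also have "\<dots> \<le> (\<Sum>p\<in>F. (cmod (c p) * K p) * norm \<xi>)"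
      using K that by (intro sum_mono) (simp add: norm_scaleC_ell2 mult.assoc mult_left_mono)
    finally show ?thesis by (simp add: sum_distrib_right)
  qed
  moreover have "(\<Sum>p\<in>F. c p *\<^sub>C T p \<xi>) \<in> H" if "\<xi> \<in> H" for \<xi>
    using H mem that by (intro csubspace_sum) (auto simp: csubspace_def)
  moreover have "(\<Sum>p\<in>F. c p *\<^sub>C T p (\<xi> + \<zeta>)) = (\<Sum>p\<in>F. c p *\<^sub>C T p \<xi>) + (\<Sum>p\<in>F. c p *\<^sub>C T p \<zeta>)"
    if "\<xi> \<in> H" "\<zeta> \<in> H" for \<xi> \<zeta>
    by (simp add: add that scaleC_add_right sum.distrib)
  moreover have "(\<Sum>p\<in>F. c p *\<^sub>C T p (s *\<^sub>C \<xi>)) = s *\<^sub>C (\<Sum>p\<in>F. c p *\<^sub>C T p \<xi>)" if "\<xi> \<in> H" for s \<xi>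
    by (simp add: scale that complex_vs.scale_sum_right scaleC_scaleC mult.commute)
  ultimately show ?thesis unfolding bounded_operator_on_def by blast
qed

lemma cinner_sum_sum: "cinner (\<Sum>j\<in>A. f j) (\<Sum>k\<in>B. g k) = (\<Sum>j\<in>A. \<Sum>k\<in>B. cinner (f j) (g k))"
  by (simp only: cinner_sum_left) (simp only: cinner_sum_right)

context irreducible_coreps
begin

lemma coefficient_expansion_sum:
  "(\<Sum>(\<gamma>, i, j) | dual_comult Irr N u (\<gamma>, i, j) (\<alpha>, a, b) (\<beta>, c, d) \<noteq> 0.
      dual_comult Irr N u (\<gamma>, i, j) (\<alpha>, a, b) (\<beta>, c, d) *\<^sub>C V \<gamma> i j \<xi>)
   = (\<Sum>p | coordinate p (u \<beta> c d * u \<alpha> a b) \<noteq> 0.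
      coordinate p (u \<beta> c d * u \<alpha> a b) *\<^sub>C (case p of (\<gamma>, i, j) \<Rightarrow> V \<gamma> i j) \<xi>)"
  by (rule sum.cong) (auto simp: dual_comult_def pol_coord_eq)

text \<open>
  The unitarity relations of u pass to the operators, and the dual comultiplication encodes the
  expansion of the products u \<beta> c d * u \<alpha> a b in the basis of coefficients.
\<close>

theorem star_rep_dual_corep:
  assumes rep: "star_rep H \<pi>"
  shows "dual_corep Irr N u H (\<lambda>\<alpha> i j. \<pi> (u \<alpha> i j))"
proof -
  interpret R: representation H \<pi> by unfold_locales (rule rep)
  have "unitary_block H (N \<alpha>) (\<lambda>i j. \<pi> (u \<alpha> i j))" if \<alpha>: "\<alpha> \<in> Irr" for \<alpha>
    unfolding unitary_block_def
  proof (intro conjI allI impI)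
    show "bounded_operator_on H (\<pi> (u \<alpha> i j))" for i j by (rule R.bounded)
  next
    fix \<zeta> \<eta> assume mem: "\<forall>j<N \<alpha>. \<zeta> j \<in> H \<and> \<eta> j \<in> H"
    have "(\<Sum>i<N \<alpha>. cinner (\<Sum>j<N \<alpha>. \<pi> (u \<alpha> i j) (\<zeta> j)) (\<Sum>j<N \<alpha>. \<pi> (u \<alpha> i j) (\<eta> j)))
        = (\<Sum>i<N \<alpha>. \<Sum>j<N \<alpha>. \<Sum>k<N \<alpha>. cinner (\<zeta> j) (\<pi> (star (u \<alpha> i j) * u \<alpha> i k) (\<eta> k)))"
      unfolding cinner_sum_sum
      by (intro sum.cong refl) (use mem in \<open>simp add: R.rep_star' R.rep_mult R.op_mem\<close>)
    also have "\<dots> = (\<Sum>j<N \<alpha>. \<Sum>k<N \<alpha>. \<Sum>i<N \<alpha>. cinner (\<zeta> j) (\<pi> (star (u \<alpha> i j) * u \<alpha> i k) (\<eta> k)))"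
      by (subst sum.swap) (intro sum.cong refl sum.swap)
    also have "\<dots> = (\<Sum>j<N \<alpha>. \<Sum>k<N \<alpha>. cinner (\<zeta> j) (\<pi> (\<Sum>i<N \<alpha>. star (u \<alpha> i j) * u \<alpha> i k) (\<eta> k)))"
      by (intro sum.cong refl) (use mem in \<open>simp add: R.rep_sum cinner_sum_right\<close>)
    also have "\<dots> = (\<Sum>j<N \<alpha>. \<Sum>k<N \<alpha>. if k = j then cinner (\<zeta> j) (\<eta> j) else 0)"
      by (intro sum.cong refl)
        (use mem in \<open>auto simp: unitary_corep_orthonormal(1)[OF irr_unitary[OF \<alpha>]] R.rep_one R.rep_zero\<close>)
    also have "\<dots> = (\<Sum>j<N \<alpha>. cinner (\<zeta> j) (\<eta> j))" by (rule sum.cong) simp_all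
    finally show "(\<Sum>i<N \<alpha>. cinner (\<Sum>j<N \<alpha>. \<pi> (u \<alpha> i j) (\<zeta> j)) (\<Sum>j<N \<alpha>. \<pi> (u \<alpha> i j) (\<eta> j)))
        = (\<Sum>j<N \<alpha>. cinner (\<zeta> j) (\<eta> j))" .
  next
    fix \<eta> assume mem: "\<forall>j<N \<alpha>. \<eta> j \<in> H"
    define \<zeta> where "\<zeta> j = (\<Sum>k<N \<alpha>. \<pi> (star (u \<alpha> k j)) (\<eta> k))" for j
    have "\<zeta> j \<in> H" for j unfolding \<zeta>_def using mem by (intro R.sum_mem) (simp add: R.op_mem)
    moreover have "(\<Sum>j<N \<alpha>. \<pi> (u \<alpha> i j) (\<zeta> j)) = \<eta> i" if i: "i < N \<alpha>" for i
    proof -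
      have "(\<Sum>j<N \<alpha>. \<pi> (u \<alpha> i j) (\<zeta> j)) = (\<Sum>j<N \<alpha>. \<Sum>k<N \<alpha>. \<pi> (u \<alpha> i j * star (u \<alpha> k j)) (\<eta> k))"
      proof (rule sum.cong)
        fix j
        have "\<pi> (u \<alpha> i j) (\<zeta> j) = (\<Sum>k<N \<alpha>. \<pi> (u \<alpha> i j) (\<pi> (star (u \<alpha> k j)) (\<eta> k)))"
          unfolding \<zeta>_def by (rule R.op_sum) (use mem in \<open>simp add: R.op_mem\<close>)
        also have "\<dots> = (\<Sum>k<N \<alpha>. \<pi> (u \<alpha> i j * star (u \<alpha> k j)) (\<eta> k))"
          by (rule sum.cong) (use mem in \<open>simp_all add: R.rep_mult\<close>)
        finally show "\<pi> (u \<alpha> i j) (\<zeta> j) = (\<Sum>k<N \<alpha>. \<pi> (u \<alpha> i j * star (u \<alpha> k j)) (\<eta> k))" .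
      qed simp
      also have "\<dots> = (\<Sum>k<N \<alpha>. \<pi> (\<Sum>j<N \<alpha>. u \<alpha> i j * star (u \<alpha> k j)) (\<eta> k))"
        by (subst sum.swap) (intro sum.cong refl, use mem in \<open>simp add: R.rep_sum\<close>)
      also have "\<dots> = (\<Sum>k<N \<alpha>. if k = i then \<eta> i else 0)"
        by (intro sum.cong refl)
          (use mem i in \<open>auto simp: unitary_corep_orthonormal(2)[OF irr_unitary[OF \<alpha>]] R.rep_one R.rep_zero\<close>)
      also have "\<dots> = \<eta> i" using i by simp
      finally show ?thesis .
    qed
    ultimately show "\<exists>\<zeta>. (\<forall>j<N \<alpha>. \<zeta> j \<in> H) \<and> (\<forall>i<N \<alpha>. (\<Sum>j<N \<alpha>. \<pi> (u \<alpha> i j) (\<zeta> j)) = \<eta> i)" by blast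
  qed
  moreover have "(\<Sum>(\<gamma>, i, j) | dual_comult Irr N u (\<gamma>, i, j) (\<alpha>, a, b) (\<beta>, c, d) \<noteq> 0.
      dual_comult Irr N u (\<gamma>, i, j) (\<alpha>, a, b) (\<beta>, c, d) *\<^sub>C \<pi> (u \<gamma> i j) \<xi>)
      = \<pi> (u \<beta> c d) (\<pi> (u \<alpha> a b) \<xi>)" if \<xi>: "\<xi> \<in> H" for \<alpha> a b \<beta> c d \<xi>
  proof -
    define x where "x = u \<beta> c d * u \<alpha> a b"
    have "\<pi> x \<xi> = \<pi> (\<Sum>p | coordinate p x \<noteq> 0. coordinate p x *\<^sub>C coefficient p) \<xi>"
      by (simp flip: coordinate_expansion)
    also have "\<dots> = (\<Sum>p | coordinate p x \<noteq> 0. coordinate p x *\<^sub>C (case p of (\<gamma>, i, j) \<Rightarrow> \<pi> (u \<gamma> i j)) \<xi>)"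
      by (simp add: R.rep_sum R.rep_scale \<xi> coefficient_def case_prod_unfold)
    finally show ?thesis
      using coefficient_expansion_sum[where V = "\<lambda>\<gamma> i j. \<pi> (u \<gamma> i j)" and \<alpha> = \<alpha> and a = a and b = b
          and \<beta> = \<beta> and c = c and d = d and \<xi> = \<xi>]
      by (simp only: x_def R.rep_mult[OF \<xi>])
  qed
  ultimately show ?thesis unfolding dual_corep_def using R.hilbert by auto
qed

lemma trivial_coefficient: obtains \<alpha> where "\<alpha> \<in> Irr" "u \<alpha> 0 0 = 1" "N \<alpha> = 1"
proof -
  obtain \<alpha> where \<alpha>: "\<alpha> \<in> Irr" "equivalent_coreps 1 (\<lambda>_ _. 1) (N \<alpha>) (u \<alpha>)"
    using irr_exists[OF trivial_irreducible_corep] by blast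
  then obtain X Y :: "nat \<Rightarrow> nat \<Rightarrow> complex" where "X 0 0 * Y 0 0 = 1" "X 0 0 *\<^sub>C 1 = X 0 0 *\<^sub>C u \<alpha> 0 0"
    unfolding equivalent_coreps_def by auto
  then have "u \<alpha> 0 0 = 1" by (metis complex_vs.scale_left_imp_eq mult_zero_left zero_neq_one)
  moreover have "N \<alpha> = 1" using \<alpha>(2) by (simp add: equivalent_coreps_def)
  ultimately show thesis using \<alpha>(1) that by blast
qed

text \<open>
  Since the coefficients form a basis, V determines a linear map \<pi>, and the corepresentation
  equation says that \<pi> is multiplicative on the basis. Unit and star come from unitarity, as
  shown below.
\<close>

theorem dual_corep_star_rep:
  assumes V: "dual_corep Irr N u H V"
  obtains \<pi> where "star_rep H \<pi>"
    "\<And>\<alpha> i j \<xi>. \<alpha> \<in> Irr \<Longrightarrow> i < N \<alpha> \<Longrightarrow> j < N \<alpha> \<Longrightarrow> \<pi> (u \<alpha> i j) \<xi> = V \<alpha> i j \<xi>"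
proof -
  have H: "hilbert_subspace H" and block: "\<And>\<alpha>. \<alpha> \<in> Irr \<Longrightarrow> unitary_block H (N \<alpha>) (V \<alpha>)"
    using V by (simp_all add: dual_corep_def)
  then have cs: "csubspace H" by (simp add: hilbert_subspace_def)
  then have H0: "0 \<in> H" by (simp add: csubspace_def)
  define op where "op = (\<lambda>(\<alpha>, i, j). V \<alpha> i j)"
  define \<pi> where "\<pi> x \<xi> = (\<Sum>p | coordinate p x \<noteq> 0. coordinate p x *\<^sub>C op p \<xi>)" for x \<xi>
  have superset: "\<pi> x \<xi> = (\<Sum>p\<in>F. coordinate p x *\<^sub>C op p \<xi>)" if "finite F" "{p. coordinate p x \<noteq> 0} \<subseteq> F" for x \<xi> F
    unfolding \<pi>_def by (rule sum.mono_neutral_left) (use that in auto)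
  have lin: "clinear (\<lambda>x. \<pi> x \<xi>)" for \<xi>
    unfolding clinear_def
  proof (intro conjI allI)
    fix x y
    let ?F = "{p. coordinate p x \<noteq> 0} \<union> {p. coordinate p y \<noteq> 0}"
    have "finite ?F" by (simp add: coordinate_finite)
    moreover have "{p. coordinate p (x + y) \<noteq> 0} \<subseteq> ?F" by (auto simp: clinear_add[OF coordinate_linear])
    ultimately show "\<pi> (x + y) \<xi> = \<pi> x \<xi> + \<pi> y \<xi>"
      using superset[of ?F x] superset[of ?F y] superset[of ?F "x + y"]
      by (simp add: clinear_add[OF coordinate_linear] scaleC_add_left sum.distrib)
  next
    fix c x
    have "{p. coordinate p (c *\<^sub>C x) \<noteq> 0} \<subseteq> {p. coordinate p x \<noteq> 0}"
      by (auto simp: clinear_scaleC[OF coordinate_linear])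
    from superset[OF coordinate_finite this] show "\<pi> (c *\<^sub>C x) \<xi> = c *\<^sub>C \<pi> x \<xi>"
      by (simp add: \<pi>_def clinear_scaleC[OF coordinate_linear] complex_vs.scale_sum_right scaleC_scaleC)
  qed
  have coeff: "\<pi> (coefficient p) \<xi> = op p \<xi>" if "p \<in> index" for p \<xi>
    by (subst superset[of "{p}"]) (use that in \<open>auto simp: coordinate_coefficient scaleC_one\<close>)
  have coeff': "\<pi> (u \<alpha> i j) \<xi> = V \<alpha> i j \<xi>" if "\<alpha> \<in> Irr" "i < N \<alpha>" "j < N \<alpha>" for \<alpha> i j \<xi>
    using coeff[of "(\<alpha>, i, j)" \<xi>] that by (simp add: coefficient_def op_def irr_index_def)
  have "bounded_operator_on H (op p)" if "p \<in> index" for p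
    using that block by (auto simp: irr_index_def op_def unitary_block_def)
  then have bounded: "bounded_operator_on H (\<pi> x)" for x
    unfolding \<pi>_def[abs_def]
    by (intro bounded_operator_on_combination[OF cs coordinate_finite]) (use coordinate_support in blast)
  have mem: "\<pi> x \<xi> \<in> H" and vadd: "\<zeta> \<in> H \<Longrightarrow> \<pi> x (\<xi> + \<zeta>) = \<pi> x \<xi> + \<pi> x \<zeta>"
    and vscale: "\<pi> x (s *\<^sub>C \<xi>) = s *\<^sub>C \<pi> x \<xi>" if "\<xi> \<in> H" for x \<xi> \<zeta> s
    using bounded[of x] that by (simp_all add: bounded_operator_on_def)
  have v0: "\<pi> x 0 = 0" for x using vadd[OF H0 H0, of x] by simp
  have vsum: "\<pi> x (\<Sum>k\<in>A. f k) = (\<Sum>k\<in>A. \<pi> x (f k))" if "\<And>k. k \<in> A \<Longrightarrow> f k \<in> H" for x f and A :: "nat set"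
    using that by (induction A rule: infinite_finite_induct) (simp_all add: v0 vadd csubspace_sum[OF cs])
  have everything: "x \<in> cspan (coefficient ` index)" for x by (simp add: coefficients_span)
  have mult0: "\<pi> (coefficient p * coefficient q) \<xi> = \<pi> (coefficient p) (\<pi> (coefficient q) \<xi>)"
    if pq: "p \<in> index" "q \<in> index" and \<xi>: "\<xi> \<in> H" for p q \<xi>
  proof -
    obtain \<beta> c d \<alpha> a b where p: "p = (\<beta>, c, d)" and q: "q = (\<alpha>, a, b)" by (cases p; cases q) auto
    have "(\<Sum>(\<gamma>, i, j) | dual_comult Irr N u (\<gamma>, i, j) (\<alpha>, a, b) (\<beta>, c, d) \<noteq> 0.
           dual_comult Irr N u (\<gamma>, i, j) (\<alpha>, a, b) (\<beta>, c, d) *\<^sub>C V \<gamma> i j \<xi>) = V \<beta> c d (V \<alpha> a b \<xi>)"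
      using V pq \<xi> unfolding dual_corep_def p q by blast
    then have "\<pi> (u \<beta> c d * u \<alpha> a b) \<xi> = V \<beta> c d (V \<alpha> a b \<xi>)"
      unfolding coefficient_expansion_sum by (simp add: \<pi>_def op_def)
    then show ?thesis
      unfolding coeff[OF pq(1)] coeff[OF pq(2)] by (simp add: p q op_def coefficient_def)
  qed
  have mult1: "\<pi> (coefficient p * y) \<xi> = \<pi> (coefficient p) (\<pi> y \<xi>)" if p: "p \<in> index" and \<xi>: "\<xi> \<in> H" for p y \<xi>
  proof (rule clinear_eq_on_cspan[where f = "\<lambda>y. \<pi> (coefficient p * y) \<xi>" and g = "\<lambda>y. \<pi> (coefficient p) (\<pi> y \<xi>)", OF _ _ _ everything])
    show "clinear (\<lambda>y. \<pi> (coefficient p * y) \<xi>)" by (rule clinear_mult_left[OF lin])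
    show "clinear (\<lambda>y. \<pi> (coefficient p) (\<pi> y \<xi>))"
      unfolding clinear_def using clinear_add[OF lin] clinear_scaleC[OF lin] by (simp add: vadd vscale mem \<xi>)
    show "\<pi> (coefficient p * x) \<xi> = \<pi> (coefficient p) (\<pi> x \<xi>)" if "x \<in> coefficient ` index" for x
      using that mult0[OF p _ \<xi>] by blast
  qed
  have mult: "\<pi> (x * y) \<xi> = \<pi> x (\<pi> y \<xi>)" if \<xi>: "\<xi> \<in> H" for x y \<xi>
  proof (rule clinear_eq_on_cspan[where f = "\<lambda>x. \<pi> (x * y) \<xi>" and g = "\<lambda>x. \<pi> x (\<pi> y \<xi>)", OF _ _ _ everything])
    show "clinear (\<lambda>x. \<pi> (x * y) \<xi>)" by (rule clinear_mult_right[OF lin])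
    show "clinear (\<lambda>x. \<pi> x (\<pi> y \<xi>))" by (rule lin)
    show "\<pi> (x * y) \<xi> = \<pi> x (\<pi> y \<xi>)" if "x \<in> coefficient ` index" for x
      using that mult1[OF _ \<xi>] by blast
  qed
  \<comment> \<open>The operator of 1 is idempotent, and isometric as the block of the trivial class; so it is
      the identity.\<close>
  have one: "\<pi> 1 \<xi> = \<xi>" if \<xi>: "\<xi> \<in> H" for \<xi>
  proof -
    obtain \<alpha> where \<alpha>: "\<alpha> \<in> Irr" "u \<alpha> 0 0 = 1" and n1: "N \<alpha> = 1" by (rule trivial_coefficient)
    define \<eta> where "\<eta> = \<pi> 1 \<xi> - \<xi>"
    have \<eta>: "\<eta> \<in> H" unfolding \<eta>_def by (intro csubspace_diff[OF cs] mem \<xi>)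
    have "\<pi> 1 (\<pi> 1 \<xi>) = \<pi> 1 \<xi>" using mult[OF \<xi>, of 1 1] by simp
    moreover have "\<pi> 1 (\<pi> 1 \<xi>) = \<pi> 1 \<eta> + \<pi> 1 \<xi>" using vadd[OF \<eta> \<xi>, of 1] by (simp add: \<eta>_def)
    ultimately have "\<pi> 1 \<eta> = 0" by simp
    have "cinner \<eta> \<eta> = cinner (V \<alpha> 0 0 \<eta>) (V \<alpha> 0 0 \<eta>)"
    proof -
      have "(\<Sum>i<N \<alpha>. cinner (\<Sum>j<N \<alpha>. V \<alpha> i j \<eta>) (\<Sum>j<N \<alpha>. V \<alpha> i j \<eta>)) = (\<Sum>j<N \<alpha>. cinner \<eta> \<eta>)"
        using block[OF \<alpha>(1)] \<eta> unfolding unitary_block_def by (elim conjE allE[of _ "\<lambda>_. \<eta>"]) auto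
      then show ?thesis by (simp add: n1)
    qed
    also have "V \<alpha> 0 0 \<eta> = 0"
      using coeff'[OF \<alpha>(1), of 0 0 \<eta>] irr_pos[OF \<alpha>(1)] \<open>\<pi> 1 \<eta> = 0\<close> \<alpha>(2) by simp
    finally have "\<eta> = 0" by (simp add: cinner_self_norm)
    then show ?thesis by (simp add: \<eta>_def)
  qed
  \<comment> \<open>Solve V \<mu> = \<xi> with \<xi> in position k. Unitarity of u identifies the entries of
      \<mu> with the images of \<xi> under the starred coefficients, and the isometry of V moves
      the inner product back.\<close>
  have star0: "cinner (\<pi> (star (coefficient p)) \<xi>) \<zeta> = cinner \<xi> (\<pi> (coefficient p) \<zeta>)"
    if p: "p \<in> index" and \<xi>: "\<xi> \<in> H" and \<zeta>: "\<zeta> \<in> H" for p \<xi> \<zeta>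
  proof -
    obtain \<alpha> k l where pe: "p = (\<alpha>, k, l)" and \<alpha>: "\<alpha> \<in> Irr" and kl: "k < N \<alpha>" "l < N \<alpha>"
      using p by (auto simp: irr_index_def)
    have iso: "(\<Sum>i<N \<alpha>. cinner (\<Sum>j<N \<alpha>. V \<alpha> i j (\<mu> j)) (\<Sum>j<N \<alpha>. V \<alpha> i j (\<nu> j))) = (\<Sum>j<N \<alpha>. cinner (\<mu> j) (\<nu> j))"
      if "\<forall>j<N \<alpha>. \<mu> j \<in> H \<and> \<nu> j \<in> H" for \<mu> \<nu>
      using block[OF \<alpha>] that unfolding unitary_block_def by blast
    have "\<forall>j<N \<alpha>. (if j = k then \<xi> else 0) \<in> H" using \<xi> H0 by simp
    then have "\<exists>\<mu>. (\<forall>j<N \<alpha>. \<mu> j \<in> H) \<and> (\<forall>i<N \<alpha>. (\<Sum>j<N \<alpha>. V \<alpha> i j (\<mu> j)) = (if i = k then \<xi> else 0))"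
      using block[OF \<alpha>] unfolding unitary_block_def by (elim conjE allE[of _ "\<lambda>j. if j = k then \<xi> else 0"]) blast
    then obtain \<mu> where \<mu>: "\<And>j. j < N \<alpha> \<Longrightarrow> \<mu> j \<in> H"
      "\<And>i. i < N \<alpha> \<Longrightarrow> (\<Sum>j<N \<alpha>. V \<alpha> i j (\<mu> j)) = (if i = k then \<xi> else 0)" by blast
    define \<nu> where "\<nu> j = (if j = l then \<zeta> else 0)" for j
    have Vl: "(\<Sum>j<N \<alpha>. V \<alpha> i j (\<nu> j)) = V \<alpha> i l \<zeta>" if "i < N \<alpha>" for i
    proof -
      have "V \<alpha> i j (\<nu> j) = (if j = l then V \<alpha> i l \<zeta> else 0)" if "j < N \<alpha>" for j
        using coeff'[OF \<alpha> \<open>i < N \<alpha>\<close> that, of 0] v0 by (simp add: \<nu>_def)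
      then show ?thesis using kl(2) by simp
    qed
    have "\<pi> (star (u \<alpha> k l)) \<xi> = (\<Sum>i<N \<alpha>. \<pi> (star (u \<alpha> i l)) (if i = k then \<xi> else 0))"
    proof -
      have "(\<Sum>i<N \<alpha>. \<pi> (star (u \<alpha> i l)) (if i = k then \<xi> else 0)) = (\<Sum>i<N \<alpha>. if i = k then \<pi> (star (u \<alpha> k l)) \<xi> else 0)"
        by (rule sum.cong) (auto simp: v0)
      then show ?thesis using kl(1) by simp
    qed
    also have "\<dots> = (\<Sum>i<N \<alpha>. \<pi> (star (u \<alpha> i l)) (\<Sum>j<N \<alpha>. \<pi> (u \<alpha> i j) (\<mu> j)))"
      by (rule sum.cong) (simp_all add: \<mu>(2)[symmetric] coeff' \<alpha>)
    also have "\<dots> = (\<Sum>i<N \<alpha>. \<Sum>j<N \<alpha>. \<pi> (star (u \<alpha> i l) * u \<alpha> i j) (\<mu> j))"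
    proof (rule sum.cong)
      fix i
      have "\<pi> (star (u \<alpha> i l)) (\<Sum>j<N \<alpha>. \<pi> (u \<alpha> i j) (\<mu> j)) = (\<Sum>j<N \<alpha>. \<pi> (star (u \<alpha> i l)) (\<pi> (u \<alpha> i j) (\<mu> j)))"
        by (rule vsum) (simp add: mem \<mu>(1))
      also have "\<dots> = (\<Sum>j<N \<alpha>. \<pi> (star (u \<alpha> i l) * u \<alpha> i j) (\<mu> j))"
        by (rule sum.cong) (simp_all add: mult \<mu>(1))
      finally show "\<pi> (star (u \<alpha> i l)) (\<Sum>j<N \<alpha>. \<pi> (u \<alpha> i j) (\<mu> j)) = (\<Sum>j<N \<alpha>. \<pi> (star (u \<alpha> i l) * u \<alpha> i j) (\<mu> j))" .
    qed simp
    also have "\<dots> = (\<Sum>j<N \<alpha>. \<pi> (\<Sum>i<N \<alpha>. star (u \<alpha> i l) * u \<alpha> i j) (\<mu> j))"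
      by (subst sum.swap) (simp add: clinear_sum[OF lin])
    also have "\<dots> = (\<Sum>j<N \<alpha>. if j = l then \<mu> l else 0)"
      by (rule sum.cong)
        (auto simp: unitary_corep_orthonormal(1)[OF irr_unitary[OF \<alpha>]] kl one \<mu>(1) clinear_zero[OF lin])
    also have "\<dots> = \<mu> l" using kl(2) by simp
    finally have "cinner (\<pi> (star (u \<alpha> k l)) \<xi>) \<zeta> = (\<Sum>j<N \<alpha>. cinner (\<mu> j) (\<nu> j))"
      using kl(2) by (simp add: \<nu>_def if_distrib[of "cinner _"] cong: if_cong)
    also have "\<dots> = (\<Sum>i<N \<alpha>. cinner (\<Sum>j<N \<alpha>. V \<alpha> i j (\<mu> j)) (\<Sum>j<N \<alpha>. V \<alpha> i j (\<nu> j)))"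
      by (rule iso[symmetric]) (simp add: \<mu>(1) \<nu>_def \<zeta> H0)
    also have "\<dots> = (\<Sum>i<N \<alpha>. if i = k then cinner \<xi> (V \<alpha> k l \<zeta>) else 0)"
      by (rule sum.cong) (simp_all add: \<mu>(2) Vl)
    also have "\<dots> = cinner \<xi> (\<pi> (u \<alpha> k l) \<zeta>)" using kl by (simp add: coeff' \<alpha>)
    finally show ?thesis by (simp add: pe coefficient_def)
  qed
  have star: "cinner (\<pi> (star x) \<xi>) \<zeta> = cinner \<xi> (\<pi> x \<zeta>)" if \<xi>: "\<xi> \<in> H" and \<zeta>: "\<zeta> \<in> H" for x \<xi> \<zeta>
  proof (rule clinear_eq_on_cspan[where f = "\<lambda>x. cinner (\<pi> (star x) \<xi>) \<zeta>" and g = "\<lambda>x. cinner \<xi> (\<pi> x \<zeta>)", OF _ _ _ everything])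
    show "clinear (\<lambda>x. cinner (\<pi> (star x) \<xi>) \<zeta>)"
      unfolding clinear_def using clinear_add[OF lin] clinear_scaleC[OF lin]
      by (simp add: star_add star_scaleC cinner_add_left cinner_scaleC_left)
    show "clinear (\<lambda>x. cinner \<xi> (\<pi> x \<zeta>))"
      unfolding clinear_def using clinear_add[OF lin] clinear_scaleC[OF lin]
      by (simp add: cinner_add_right cinner_scaleC_right)
    show "cinner (\<pi> (star x) \<xi>) \<zeta> = cinner \<xi> (\<pi> x \<zeta>)" if "x \<in> coefficient ` index" for x
      using that star0[OF _ \<xi> \<zeta>] by blast
  qed
  have "star_rep H \<pi>"
    unfolding star_rep_def using H bounded one mult star clinear_add[OF lin] clinear_scaleC[OF lin] by blast
  then show thesis using coeff' by (rule that)
qed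

end

section \<open>Almost invariant vectors\<close>

lemma cinner_Cauchy_Schwarz: "cmod (cinner x y) \<le> norm x * norm y"
proof -
  define c where "c = cinner x y"
  have "(cmod c)\<^sup>2 = inner (c *\<^sub>C x) y"
    by (simp add: inner_ell2_def cinner_scaleC_left cmod_power2 flip: c_def) (simp add: power2_eq_square)
  also have "\<dots> \<le> norm (c *\<^sub>C x) * norm y" by (rule norm_cauchy_schwarz)
  finally have "cmod c * cmod c \<le> cmod c * (norm x * norm y)"
    by (simp add: norm_scaleC_ell2 power2_eq_square mult.assoc)
  then show ?thesis unfolding c_def[symmetric] by (cases "c = 0") auto
qed

lemma sum_rotate: "(\<Sum>r\<in>A. \<Sum>s\<in>B. \<Sum>l\<in>C. F r s l) = (\<Sum>l\<in>C. \<Sum>r\<in>A. \<Sum>s\<in>B. F r s l)"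
proof -
  have "(\<Sum>r\<in>A. \<Sum>s\<in>B. \<Sum>l\<in>C. F r s l) = (\<Sum>r\<in>A. \<Sum>l\<in>C. \<Sum>s\<in>B. F r s l)"
    by (intro sum.cong refl sum.swap)
  also have "\<dots> = (\<Sum>l\<in>C. \<Sum>r\<in>A. \<Sum>s\<in>B. F r s l)" by (rule sum.swap)
  finally show ?thesis .
qed

text \<open>
  The deviation of the entry V \<alpha> i l at \<xi> from the entry of the identity matrix.
\<close>

definition defect :: "('i \<Rightarrow> nat \<Rightarrow> nat \<Rightarrow> ell2 \<Rightarrow> ell2) \<Rightarrow> 'i \<Rightarrow> ell2 \<Rightarrow> nat \<Rightarrow> nat \<Rightarrow> ell2" where
  "defect V \<alpha> \<xi> i l = V \<alpha> i l \<xi> - (if i = l then \<xi> else 0)"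

lemma corep_apply_defect:
  assumes "i < N \<alpha>"
  shows "corep_apply N V \<alpha> \<eta> \<xi> r i - elementary_tensor \<eta> \<xi> r i = (\<Sum>l<N \<alpha>. \<eta> r l *\<^sub>C defect V \<alpha> \<xi> i l)"
proof -
  have "(\<Sum>l<N \<alpha>. \<eta> r l *\<^sub>C (if i = l then \<xi> else 0)) = (\<Sum>l<N \<alpha>. if l = i then \<eta> r i *\<^sub>C \<xi> else 0)"
    by (rule sum.cong) auto
  then show ?thesis using assms
    by (simp add: corep_apply_def elementary_tensor_def defect_def complex_vs.scale_right_diff_distrib sum_subtractf)
qed

context irreducible_coreps
begin

lemma haar_positive_functional: "positive_functional haar"
  using haar_state by (simp add: state_def)

lemma haar_norm_square: "(haar_norm haar x)\<^sup>2 = Re (haar (star x * x))"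
  by (simp add: haar_norm_def positive_functional_square(1)[OF haar_positive_functional])

text \<open>
  By Schur orthogonality only pairs in the same column contribute.
\<close>

lemma tensor_norm_eq:
  assumes \<alpha>: "\<alpha> \<in> Irr"
  shows "tensor_norm haar N u \<alpha> T
    = sqrt (Re (\<Sum>i<N \<alpha>. \<Sum>r<N \<alpha>. \<Sum>s<N \<alpha>. row_gram (u \<alpha>) r s * cinner (T r i) (T s i)))"
proof -
  have "(\<Sum>r<N \<alpha>. \<Sum>i<N \<alpha>. \<Sum>s<N \<alpha>. \<Sum>t<N \<alpha>. haar (star (u \<alpha> r i) * u \<alpha> s t) * cinner (T r i) (T s t))
      = (\<Sum>r<N \<alpha>. \<Sum>i<N \<alpha>. \<Sum>s<N \<alpha>. row_gram (u \<alpha>) r s * cinner (T r i) (T s i))"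
  proof (intro sum.cong refl)
    fix r i s assume "r \<in> {..<N \<alpha>}" "i \<in> {..<N \<alpha>}" "s \<in> {..<N \<alpha>}"
    then have "(\<Sum>t<N \<alpha>. haar (star (u \<alpha> r i) * u \<alpha> s t) * cinner (T r i) (T s t))
        = (\<Sum>t<N \<alpha>. if t = i then row_gram (u \<alpha>) r s * cinner (T r i) (T s i) else 0)"
      by (intro sum.cong refl) (auto simp: Schur_orthogonality[OF irr[OF \<alpha>]])
    then show "(\<Sum>t<N \<alpha>. haar (star (u \<alpha> r i) * u \<alpha> s t) * cinner (T r i) (T s t))
        = row_gram (u \<alpha>) r s * cinner (T r i) (T s i)"
      using \<open>i \<in> _\<close> by simp
  qed
  also have "\<dots> = (\<Sum>i<N \<alpha>. \<Sum>r<N \<alpha>. \<Sum>s<N \<alpha>. row_gram (u \<alpha>) r s * cinner (T r i) (T s i))"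
    by (rule sum.swap)
  finally show ?thesis by (simp add: tensor_norm_def)
qed

text \<open>
  With a l m the combination of the m-th column of u with the coefficients in column l of \<eta>,
  the Haar inner products of these elements are \<delta>(m,m') G l l' for a single Gram matrix G.
  Both squared norms are expressed by G: that of \<eta> is its trace, and that of the tensor pairs
  it with the Gram matrix of the defects. Cauchy-Schwarz is used for the entries of both and then
  for the sum.
\<close>

lemma tensor_norm_defect_le:
  assumes \<alpha>: "\<alpha> \<in> Irr"
  shows "tensor_norm haar N u \<alpha> (\<lambda>r i. corep_apply N V \<alpha> \<eta> \<xi> r i - elementary_tensor \<eta> \<xi> r i)
    \<le> haar_norm haar (isotypic_vector N u \<alpha> \<eta>)
      * sqrt (\<Sum>i<N \<alpha>. \<Sum>l<N \<alpha>. (norm (defect V \<alpha> \<xi> i l))\<^sup>2)"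
proof -
  define n where "n = N \<alpha>"
  have n: "0 < n" using irr_pos[OF \<alpha>] by (simp add: n_def)
  define d where "d i l = defect V \<alpha> \<xi> i l" for i l
  define g where "g r s = row_gram (u \<alpha>) r s" for r s
  define a where "a l m = (\<Sum>r<n. \<eta> r l *\<^sub>C u \<alpha> r m)" for l m
  define G where "G l l' = (\<Sum>r<n. \<Sum>s<n. cnj (\<eta> r l) * \<eta> s l' * g r s)" for l l'
  have haar_a: "haar (star (a l m) * a l' m') = (if m = m' then G l l' else 0)" if "m < n" "m' < n" for l l' m m'
  proof -
    have "haar (star (a l m) * a l' m') = (\<Sum>r<n. \<Sum>s<n. (cnj (\<eta> r l) * \<eta> s l') * haar (star (u \<alpha> r m) * u \<alpha> s m'))"
      by (simp add: a_def star_sum star_scaleC sum_product mult_scaleC_left mult_scaleC_right scaleC_scaleC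
          clinear_sum[OF haar_linear] clinear_scaleC[OF haar_linear] mult_ac)
    also have "\<dots> = (\<Sum>r<n. \<Sum>s<n. (cnj (\<eta> r l) * \<eta> s l') * (if m = m' then g r s else 0))"
      by (intro sum.cong refl)
        (use that in \<open>simp add: Schur_orthogonality[OF irr[OF \<alpha>]] g_def n_def\<close>)
    finally show ?thesis by (simp add: G_def)
  qed
  have G: "G l l' = haar (star (a l 0) * a l' 0)" for l l' using haar_a[OF n n] by simp
  have Gl: "G l l = of_real (Re (G l l))" "0 \<le> Re (G l l)" for l
    using positive_functional_square[OF haar_positive_functional, of "a l 0"] by (simp_all add: G complex_eq_iff)
  have Gle: "cmod (G l l') \<le> sqrt (Re (G l l)) * sqrt (Re (G l' l'))" for l l'
    unfolding real_sqrt_mult[symmetric]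
    by (rule real_le_rsqrt) (use positive_functional_Cauchy_Schwarz[OF haar_positive_functional] G in simp)
  have iso: "isotypic_vector N u \<alpha> \<eta> = (\<Sum>l<n. a l l)"
    unfolding isotypic_vector_def a_def n_def[symmetric] by (rule sum.swap)
  have "haar (star (\<Sum>l<n. a l l) * (\<Sum>l<n. a l l)) = (\<Sum>l<n. \<Sum>l'<n. haar (star (a l l) * a l' l'))"
    by (simp add: star_sum sum_product clinear_sum[OF haar_linear])
  also have "\<dots> = (\<Sum>l<n. \<Sum>l'<n. if l' = l then G l l else 0)"
    by (intro sum.cong refl) (auto simp: haar_a)
  also have "\<dots> = (\<Sum>l<n. G l l)" by (rule sum.cong) auto
  finally have hn: "(haar_norm haar (isotypic_vector N u \<alpha> \<eta>))\<^sup>2 = (\<Sum>l<n. Re (G l l))"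
    by (simp add: haar_norm_square iso)
  define S where "S = (\<Sum>i<n. \<Sum>r<n. \<Sum>s<n. g r s * cinner (\<Sum>l<n. \<eta> r l *\<^sub>C d i l) (\<Sum>l<n. \<eta> s l *\<^sub>C d i l))"
  have inner: "(\<Sum>r<n. \<Sum>s<n. g r s * cinner (\<Sum>l<n. \<eta> r l *\<^sub>C d i l) (\<Sum>l<n. \<eta> s l *\<^sub>C d i l))
      = (\<Sum>l<n. \<Sum>l'<n. G l l' * cinner (d i l) (d i l'))" for i
  proof -
    have "(\<Sum>r<n. \<Sum>s<n. g r s * cinner (\<Sum>l<n. \<eta> r l *\<^sub>C d i l) (\<Sum>l<n. \<eta> s l *\<^sub>C d i l))
        = (\<Sum>r<n. \<Sum>s<n. \<Sum>l<n. \<Sum>l'<n. (cnj (\<eta> r l) * \<eta> s l' * g r s) * cinner (d i l) (d i l'))"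
      unfolding cinner_sum_sum cinner_scaleC_left cinner_scaleC_right sum_distrib_left
      by (simp add: mult_ac)
    also have "\<dots> = (\<Sum>l<n. \<Sum>r<n. \<Sum>s<n. \<Sum>l'<n. (cnj (\<eta> r l) * \<eta> s l' * g r s) * cinner (d i l) (d i l'))"
      by (rule sum_rotate)
    also have "\<dots> = (\<Sum>l<n. \<Sum>l'<n. \<Sum>r<n. \<Sum>s<n. (cnj (\<eta> r l) * \<eta> s l' * g r s) * cinner (d i l) (d i l'))"
      by (intro sum.cong refl sum_rotate)
    also have "\<dots> = (\<Sum>l<n. \<Sum>l'<n. G l l' * cinner (d i l) (d i l'))"
      by (simp add: G_def sum_distrib_right)
    finally show ?thesis .
  qed
  have "Re S \<le> cmod S" by (rule complex_Re_le_cmod)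
  also have "\<dots> \<le> (\<Sum>i<n. \<Sum>l<n. \<Sum>l'<n. (sqrt (Re (G l l)) * norm (d i l)) * (sqrt (Re (G l' l')) * norm (d i l')))"
    unfolding S_def inner
  proof (intro order_trans[OF norm_sum] sum_mono)
    fix i l l'
    have "cmod (G l l' * cinner (d i l) (d i l'))
        \<le> (sqrt (Re (G l l)) * sqrt (Re (G l' l'))) * (norm (d i l) * norm (d i l'))"
      unfolding norm_mult using Gl(2) by (intro mult_mono Gle cinner_Cauchy_Schwarz) auto
    then show "cmod (G l l' * cinner (d i l) (d i l'))
        \<le> (sqrt (Re (G l l)) * norm (d i l)) * (sqrt (Re (G l' l')) * norm (d i l'))"
      by (simp add: mult_ac)
  qed
  also have "\<dots> = (\<Sum>i<n. (\<Sum>l<n. sqrt (Re (G l l)) * norm (d i l))\<^sup>2)"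
    by (simp add: power2_eq_square sum_product)
  also have "\<dots> \<le> (\<Sum>i<n. (\<Sum>l<n. (sqrt (Re (G l l)))\<^sup>2) * (\<Sum>l<n. (norm (d i l))\<^sup>2))"
    by (intro sum_mono Cauchy_Schwarz_ineq_sum)
  also have "\<dots> = (haar_norm haar (isotypic_vector N u \<alpha> \<eta>))\<^sup>2 * (\<Sum>i<n. \<Sum>l<n. (norm (d i l))\<^sup>2)"
    by (simp add: hn Gl(2) sum_distrib_left)
  finally have "sqrt (Re S) \<le> sqrt ((haar_norm haar (isotypic_vector N u \<alpha> \<eta>))\<^sup>2 * (\<Sum>i<n. \<Sum>l<n. (norm (d i l))\<^sup>2))"
    by (rule real_sqrt_le_mono)
  moreover have "0 \<le> haar_norm haar (isotypic_vector N u \<alpha> \<eta>)"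
    by (simp add: haar_norm_def positive_functional_square(1)[OF haar_positive_functional])
  moreover have "tensor_norm haar N u \<alpha> (\<lambda>r i. corep_apply N V \<alpha> \<eta> \<xi> r i - elementary_tensor \<eta> \<xi> r i) = sqrt (Re S)"
    unfolding tensor_norm_eq[OF \<alpha>] S_def g_def d_def n_def
    by (intro arg_cong[of _ _ "\<lambda>z. sqrt (Re z)"] sum.cong refl) (simp add: corep_apply_defect)
  ultimately show ?thesis by (simp add: real_sqrt_mult d_def n_def)
qed

lemma approx_invariantI:
  assumes E: "E \<subseteq> Irr" and \<delta>: "\<delta> > 0" "\<xi> \<noteq> 0"
    and small: "\<And>\<alpha>. \<alpha> \<in> E \<Longrightarrow> (\<Sum>i<N \<alpha>. \<Sum>l<N \<alpha>. (norm (defect V \<alpha> \<xi> i l))\<^sup>2) < \<delta>\<^sup>2 * (norm \<xi>)\<^sup>2"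
  shows "approx_invariant haar N u V E \<delta> \<xi>"
  unfolding approx_invariant_def
proof (intro ballI allI impI)
  fix \<alpha> \<eta> assume \<alpha>: "\<alpha> \<in> E" and nz: "isotypic_vector N u \<alpha> \<eta> \<noteq> 0"
  have pos: "0 < haar_norm haar (isotypic_vector N u \<alpha> \<eta>)"
    using haar_strictly_positive[OF nz] by (simp add: haar_norm_def)
  have "sqrt (\<Sum>i<N \<alpha>. \<Sum>l<N \<alpha>. (norm (defect V \<alpha> \<xi> i l))\<^sup>2) < sqrt ((\<delta> * norm \<xi>)\<^sup>2)"
    using small[OF \<alpha>] by (simp add: power_mult_distrib del: real_sqrt_abs)
  then have "sqrt (\<Sum>i<N \<alpha>. \<Sum>l<N \<alpha>. (norm (defect V \<alpha> \<xi> i l))\<^sup>2) < \<delta> * norm \<xi>"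
    using \<delta> by simp
  from mult_strict_left_mono[OF this pos] tensor_norm_defect_le[of \<alpha> V \<eta> \<xi>] \<alpha> E
  show "tensor_norm haar N u \<alpha> (\<lambda>r i. corep_apply N V \<alpha> \<eta> \<xi> r i - elementary_tensor \<eta> \<xi> r i)
      < \<delta> * haar_norm haar (isotypic_vector N u \<alpha> \<eta>) * norm \<xi>"
    by (auto simp: mult_ac intro: le_less_trans)
qed

text \<open>
  Test with the vector u \<alpha> r0 l, whose defects are those of column l. The row r0 is chosen
  with positive Gram entry, which exists since the trace is 1; the length of the test vector then
  cancels.
\<close>

lemma approx_invariantD:
  assumes inv: "approx_invariant haar N u V E \<delta> \<xi>" and \<alpha>: "\<alpha> \<in> E" "\<alpha> \<in> Irr" and il: "i < N \<alpha>" "l < N \<alpha>"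
  shows "norm (defect V \<alpha> \<xi> i l) < \<delta> * norm \<xi>"
proof -
  define n where "n = N \<alpha>"
  have gram: "row_gram (u \<alpha>) k k = of_real (Re (row_gram (u \<alpha>) k k))" "0 \<le> Re (row_gram (u \<alpha>) k k)" for k
    using positive_functional_square[OF haar_positive_functional, of "u \<alpha> k 0"]
    by (simp_all add: row_gram_def complex_eq_iff)
  have "\<exists>r0<n. 0 < Re (row_gram (u \<alpha>) r0 r0)"
  proof (rule ccontr)
    assume none: "\<not> (\<exists>r0<n. 0 < Re (row_gram (u \<alpha>) r0 r0))"
    have "Re (row_gram (u \<alpha>) k k) = 0" if "k < n" for k
      using that none gram(2)[of k] by fastforce
    then have "Re (\<Sum>k<n. row_gram (u \<alpha>) k k) = 0" by simp
    then show False using row_gram_trace[OF irr[OF \<alpha>(2)]] by (simp add: n_def)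
  qed
  then obtain r0 where r0: "r0 < n" "0 < Re (row_gram (u \<alpha>) r0 r0)" by blast
  define \<gamma> where "\<gamma> = Re (row_gram (u \<alpha>) r0 r0)"
  have \<gamma>: "row_gram (u \<alpha>) r0 r0 = of_real \<gamma>" "\<gamma> > 0" using gram(1)[of r0] r0 by (simp_all add: \<gamma>_def)
  define \<eta> where "\<eta> r m = (if r = r0 \<and> m = l then 1 else 0 :: complex)" for r m
  have iso: "isotypic_vector N u \<alpha> \<eta> = u \<alpha> r0 l"
  proof -
    have "isotypic_vector N u \<alpha> \<eta> = (\<Sum>r<n. if r = r0 then u \<alpha> r0 l else 0)"
      unfolding isotypic_vector_def n_def[symmetric]
    proof (rule sum.cong)
      fix r
      have "(\<Sum>m<n. \<eta> r m *\<^sub>C u \<alpha> r m) = (\<Sum>m<n. if m = l then (if r = r0 then u \<alpha> r0 l else 0) else 0)"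
        by (rule sum.cong) (auto simp: \<eta>_def scaleC_one)
      then show "(\<Sum>m<n. \<eta> r m *\<^sub>C u \<alpha> r m) = (if r = r0 then u \<alpha> r0 l else 0)"
        using il by (simp add: n_def)
    qed simp
    then show ?thesis using r0 by simp
  qed
  have hu: "haar (star (u \<alpha> r0 l) * u \<alpha> r0 l) = of_real \<gamma>"
    using Schur_orthogonality[OF irr[OF \<alpha>(2)], of r0 l r0 l] r0 il \<gamma> by (simp add: n_def)
  then have nz: "isotypic_vector N u \<alpha> \<eta> \<noteq> 0"
    using \<gamma>(2) by (auto simp: iso clinear_zero[OF haar_linear])
  define T where "T r i = corep_apply N V \<alpha> \<eta> \<xi> r i - elementary_tensor \<eta> \<xi> r i" for r i
  have T: "T r i = (if r = r0 then defect V \<alpha> \<xi> i l else 0)" if "i < n" for r i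
  proof -
    have "(\<Sum>m<n. \<eta> r m *\<^sub>C defect V \<alpha> \<xi> i m) = (\<Sum>m<n. if m = l then (if r = r0 then defect V \<alpha> \<xi> i l else 0) else 0)"
      by (rule sum.cong) (auto simp: \<eta>_def scaleC_one)
    then show ?thesis using that il by (simp add: T_def corep_apply_defect n_def)
  qed
  have "tensor_norm haar N u \<alpha> T = sqrt (\<gamma> * (\<Sum>i<n. (norm (defect V \<alpha> \<xi> i l))\<^sup>2))"
  proof -
    have "(\<Sum>r<n. \<Sum>s<n. row_gram (u \<alpha>) r s * cinner (T r i) (T s i)) = of_real (\<gamma> * (norm (defect V \<alpha> \<xi> i l))\<^sup>2)"
      if "i < n" for i
    proof -
      have "(\<Sum>r<n. \<Sum>s<n. row_gram (u \<alpha>) r s * cinner (T r i) (T s i))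
          = (\<Sum>r<n. \<Sum>s<n. if s = r0 then (if r = r0 then of_real (\<gamma> * (norm (defect V \<alpha> \<xi> i l))\<^sup>2) else 0) else 0)"
        by (intro sum.cong refl) (auto simp: T that \<gamma> cinner_self_norm)
      then show ?thesis using r0 by simp
    qed
    then show ?thesis
      unfolding tensor_norm_eq[OF \<alpha>(2)] n_def[symmetric] by (simp add: sum_distrib_left flip: of_real_sum)
  qed
  moreover have "tensor_norm haar N u \<alpha> T < \<delta> * haar_norm haar (isotypic_vector N u \<alpha> \<eta>) * norm \<xi>"
    using inv \<alpha>(1) nz unfolding approx_invariant_def T_def by blast
  moreover have "haar_norm haar (isotypic_vector N u \<alpha> \<eta>) = sqrt \<gamma>"
    by (simp add: haar_norm_def iso hu)
  ultimately have "sqrt \<gamma> * sqrt (\<Sum>i<n. (norm (defect V \<alpha> \<xi> i l))\<^sup>2) < sqrt \<gamma> * (\<delta> * norm \<xi>)"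
    by (simp add: real_sqrt_mult mult_ac)
  then have "sqrt (\<Sum>i<n. (norm (defect V \<alpha> \<xi> i l))\<^sup>2) < \<delta> * norm \<xi>" using \<gamma>(2) by simp
  moreover have "norm (defect V \<alpha> \<xi> i l) \<le> sqrt (\<Sum>i<n. (norm (defect V \<alpha> \<xi> i l))\<^sup>2)"
    using il(1) by (intro real_le_rsqrt member_le_sum[of i "{..<n}" "\<lambda>i. (norm (defect V \<alpha> \<xi> i l))\<^sup>2"])
      (auto simp: n_def)
  ultimately show ?thesis by simp
qed

lemma invariant_vector_iff:
  "invariant_vector Irr N V \<xi> \<longleftrightarrow> (\<forall>\<alpha>\<in>Irr. \<forall>i<N \<alpha>. \<forall>l<N \<alpha>. defect V \<alpha> \<xi> i l = 0)"
proof
  assume inv: "invariant_vector Irr N V \<xi>"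
  show "\<forall>\<alpha>\<in>Irr. \<forall>i<N \<alpha>. \<forall>l<N \<alpha>. defect V \<alpha> \<xi> i l = 0"
  proof (intro ballI allI impI)
    fix \<alpha> i l assume *: "\<alpha> \<in> Irr" "i < N \<alpha>" "l < N \<alpha>"
    define \<eta> where "\<eta> r m = (if m = l then 1 else 0 :: complex)" for r m :: nat
    have "corep_apply N V \<alpha> \<eta> \<xi> i i - elementary_tensor \<eta> \<xi> i i = 0"
      using inv * unfolding invariant_vector_def by simp
    then have "(\<Sum>m<N \<alpha>. \<eta> i m *\<^sub>C defect V \<alpha> \<xi> i m) = 0" using *(2) by (simp add: corep_apply_defect)
    moreover have "(\<Sum>m<N \<alpha>. \<eta> i m *\<^sub>C defect V \<alpha> \<xi> i m) = defect V \<alpha> \<xi> i l"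
      unfolding \<eta>_def using sum_scaleC_delta(1)[OF *(3), of 1 "defect V \<alpha> \<xi> i"] by (simp add: scaleC_one)
    ultimately show "defect V \<alpha> \<xi> i l = 0" by simp
  qed
next
  assume *: "\<forall>\<alpha>\<in>Irr. \<forall>i<N \<alpha>. \<forall>l<N \<alpha>. defect V \<alpha> \<xi> i l = 0"
  show "invariant_vector Irr N V \<xi>"
    unfolding invariant_vector_def
  proof (intro ballI allI impI)
    fix \<alpha> \<eta> r i assume "\<alpha> \<in> Irr" "i < N \<alpha>"
    then have "corep_apply N V \<alpha> \<eta> \<xi> r i - elementary_tensor \<eta> \<xi> r i = 0"
      using * by (simp add: corep_apply_defect)
    then show "corep_apply N V \<alpha> \<eta> \<xi> r i = elementary_tensor \<eta> \<xi> r i" by simp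
  qed
qed

end

section \<open>The trivial point of the spectrum\<close>

lemma unitarily_equivalent_sym:
  assumes rep: "star_rep H \<pi>" and eq: "unitarily_equivalent H \<pi> K \<rho>"
  shows "unitarily_equivalent K \<rho> H \<pi>"
proof -
  interpret representation H \<pi> by unfold_locales (rule rep)
  obtain U where U: "bij_betw U H K"
    and add: "\<And>\<xi> \<zeta>. \<xi> \<in> H \<Longrightarrow> \<zeta> \<in> H \<Longrightarrow> U (\<xi> + \<zeta>) = U \<xi> + U \<zeta>"
    and scale: "\<And>c \<xi>. \<xi> \<in> H \<Longrightarrow> U (c *\<^sub>C \<xi>) = c *\<^sub>C U \<xi>"
    and iso: "\<And>\<xi> \<zeta>. \<xi> \<in> H \<Longrightarrow> \<zeta> \<in> H \<Longrightarrow> cinner (U \<xi>) (U \<zeta>) = cinner \<xi> \<zeta>"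
    and tw: "\<And>x \<xi>. \<xi> \<in> H \<Longrightarrow> U (\<pi> x \<xi>) = \<rho> x (U \<xi>)"
    using eq unfolding unitarily_equivalent_def by blast
  define W where "W = the_inv_into H U"
  have W: "bij_betw W K H" unfolding W_def by (rule bij_betw_the_inv_into[OF U])
  have mem: "W \<zeta> \<in> H" and UW: "U (W \<zeta>) = \<zeta>" if "\<zeta> \<in> K" for \<zeta>
    using that U bij_betwE[OF W] by (auto simp: W_def f_the_inv_into_f_bij_betw)
  have WU: "W (U \<xi>) = \<xi>" if "\<xi> \<in> H" for \<xi>
    using that U by (simp add: W_def the_inv_into_f_f bij_betw_imp_inj_on)
  show ?thesis
    unfolding unitarily_equivalent_def
  proof (intro exI[of _ W] conjI ballI allI W)
    fix \<xi> \<zeta> c x assume \<xi>: "\<xi> \<in> K"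
    show "W (c *\<^sub>C \<xi>) = c *\<^sub>C W \<xi>"
      using WU[of "c *\<^sub>C W \<xi>"] mem[OF \<xi>] by (simp add: scale UW \<xi> scale_mem)
    show "W (\<rho> x \<xi>) = \<pi> x (W \<xi>)"
      using WU[of "\<pi> x (W \<xi>)"] mem[OF \<xi>] by (simp add: tw UW \<xi> op_mem)
    assume \<zeta>: "\<zeta> \<in> K"
    show "W (\<xi> + \<zeta>) = W \<xi> + W \<zeta>"
      using WU[of "W \<xi> + W \<zeta>"] mem[OF \<xi>] mem[OF \<zeta>] by (simp add: add UW \<xi> \<zeta> add_mem)
    show "cinner (W \<xi>) (W \<zeta>) = cinner \<xi> \<zeta>"
      using iso[OF mem[OF \<xi>] mem[OF \<zeta>]] by (simp add: UW \<xi> \<zeta>)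
  qed
qed

lemma unitarily_equivalent_trans:
  assumes "unitarily_equivalent H \<pi> K \<rho>" "unitarily_equivalent K \<rho> L \<sigma>"
  shows "unitarily_equivalent H \<pi> L \<sigma>"
proof -
  obtain U where U: "bij_betw U H K" "\<forall>\<xi>\<in>H. \<forall>\<zeta>\<in>H. U (\<xi> + \<zeta>) = U \<xi> + U \<zeta>"
    "\<forall>c. \<forall>\<xi>\<in>H. U (c *\<^sub>C \<xi>) = c *\<^sub>C U \<xi>" "\<forall>\<xi>\<in>H. \<forall>\<zeta>\<in>H. cinner (U \<xi>) (U \<zeta>) = cinner \<xi> \<zeta>"
    "\<forall>x. \<forall>\<xi>\<in>H. U (\<pi> x \<xi>) = \<rho> x (U \<xi>)"
    using assms(1) unfolding unitarily_equivalent_def by blast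
  obtain W where W: "bij_betw W K L" "\<forall>\<xi>\<in>K. \<forall>\<zeta>\<in>K. W (\<xi> + \<zeta>) = W \<xi> + W \<zeta>"
    "\<forall>c. \<forall>\<xi>\<in>K. W (c *\<^sub>C \<xi>) = c *\<^sub>C W \<xi>" "\<forall>\<xi>\<in>K. \<forall>\<zeta>\<in>K. cinner (W \<xi>) (W \<zeta>) = cinner \<xi> \<zeta>"
    "\<forall>x. \<forall>\<xi>\<in>K. W (\<rho> x \<xi>) = \<sigma> x (W \<xi>)"
    using assms(2) unfolding unitarily_equivalent_def by blast
  have mem: "U \<xi> \<in> K" if "\<xi> \<in> H" for \<xi> using U(1) that by (rule bij_betwE[THEN bspec])
  show ?thesis
    unfolding unitarily_equivalent_def
    by (intro exI[of _ "W \<circ> U"] conjI bij_betw_trans[OF U(1) W(1)]) (simp_all add: U(2-5) W(2-5) mem)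
qed

lemma irrep_equiv_sym:
  assumes "(x, y) \<in> irrep_equiv" shows "(y, x) \<in> irrep_equiv"
proof -
  obtain H \<pi> K \<rho> where xy: "x = (H, \<pi>)" "y = (K, \<rho>)" by (metis surj_pair)
  then have *: "irreducible_rep H \<pi>" "irreducible_rep K \<rho>" "unitarily_equivalent H \<pi> K \<rho>"
    using assms by (simp_all add: irrep_equiv_def)
  then have "star_rep H \<pi>" by (simp add: irreducible_rep_def)
  from unitarily_equivalent_sym[OF this *(3)] * show ?thesis by (simp add: irrep_equiv_def xy)
qed

lemma irrep_equiv_trans:
  assumes "(x, y) \<in> irrep_equiv" "(y, z) \<in> irrep_equiv" shows "(x, z) \<in> irrep_equiv"
proof -
  obtain H \<pi> K \<rho> L \<sigma> where "x = (H, \<pi>)" "y = (K, \<rho>)" "z = (L, \<sigma>)" by (metis surj_pair)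
  then show ?thesis
    using assms unitarily_equivalent_trans[of H \<pi> K \<rho> L \<sigma>] by (simp add: irrep_equiv_def)
qed

lemma irrep_equiv_class_eq:
  assumes "(x, y) \<in> irrep_equiv" "(z, y) \<in> irrep_equiv"
  shows "irrep_equiv `` {x} = irrep_equiv `` {z}"
proof -
  have zx: "(z, x) \<in> irrep_equiv" by (rule irrep_equiv_trans[OF assms(2) irrep_equiv_sym[OF assms(1)]])
  show ?thesis
    using irrep_equiv_trans[OF zx] irrep_equiv_trans[OF irrep_equiv_sym[OF zx]] by auto
qed

text \<open>
  The Hilbert space C as a subspace of ell2.
\<close>

definition scalar_line :: "ell2 set" where
  "scalar_line = range (\<lambda>c. c *\<^sub>C ell2_e0)"

lemma e0_nth: "ell2_nth ell2_e0 n = (if n = 0 then 1 else 0)"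
proof -
  have "summable (\<lambda>n::nat. (cmod (if n = 0 then 1 else 0))\<^sup>2)"
    by (rule summable_finite[of "{0}"]) auto
  then show ?thesis unfolding ell2_e0_def by (subst ell2_nth_Abs) auto
qed

lemma scalar_line_iff: "\<xi> \<in> scalar_line \<longleftrightarrow> \<xi> = ell2_nth \<xi> 0 *\<^sub>C ell2_e0"
  unfolding scalar_line_def by (auto simp: e0_nth)

lemma cinner_e0: "cinner ell2_e0 \<xi> = ell2_nth \<xi> 0"
proof -
  have "ell2_e0 \<in> coord_space 1" by (simp add: coord_space_def e0_nth)
  then show ?thesis by (simp add: cinner_coord_space(1) e0_nth)
qed

lemma norm_e0: "norm ell2_e0 = 1"
proof -
  have "complex_of_real ((norm ell2_e0)\<^sup>2) = 1"
    unfolding cinner_self_norm[symmetric] by (simp add: cinner_e0 e0_nth)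
  then have "(norm ell2_e0)\<^sup>2 = 1" by (metis of_real_eq_1_iff)
  then show ?thesis using norm_ge_zero[of ell2_e0] by (simp add: power2_eq_1_iff)
qed

lemma scalar_line_nth: "\<xi> \<in> scalar_line \<longleftrightarrow> (\<forall>i>0. ell2_nth \<xi> i = 0)"
proof
  assume "\<xi> \<in> scalar_line"
  then show "\<forall>i>0. ell2_nth \<xi> i = 0" by (auto simp: scalar_line_def e0_nth)
next
  assume *: "\<forall>i>0. ell2_nth \<xi> i = 0"
  have "\<xi> = ell2_nth \<xi> 0 *\<^sub>C ell2_e0"
    by (rule ell2_eqI) (use * in \<open>auto simp: e0_nth\<close>)
  then show "\<xi> \<in> scalar_line" by (simp add: scalar_line_iff)
qed

lemma scalar_line_hilbert: "hilbert_subspace scalar_line"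
proof -
  have "csubspace scalar_line" by (simp add: csubspace_def scalar_line_nth)
  moreover have "closed scalar_line"
  proof (rule closed_sequential_limits[THEN iffD2], intro allI impI)
    fix X l assume X: "(\<forall>n. X n \<in> scalar_line) \<and> X \<longlonglongrightarrow> l"
    have "ell2_nth l i = 0" if "i > 0" for i
    proof -
      have "ell2_nth (X n) i = 0" for n using X that by (simp add: scalar_line_nth)
      then have bound: "cmod (ell2_nth l i) \<le> norm (X n - l)" for n
        using ell2_nth_le[of "X n - l" i] by simp
      have "(\<lambda>n. norm (X n - l)) \<longlonglongrightarrow> 0"
        using X by (simp add: LIM_zero tendsto_norm_zero)
      from LIMSEQ_le_const[OF this] bound have "cmod (ell2_nth l i) \<le> 0" by blast
      then show ?thesis by simp
    qed
    then show "l \<in> scalar_line" by (simp add: scalar_line_nth)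
  qed
  ultimately show ?thesis by (simp add: hilbert_subspace_def)
qed

definition star_character :: "('a::complex_star_algebra \<Rightarrow> complex) \<Rightarrow> bool" where
  "star_character f \<longleftrightarrow> clinear f \<and> f 1 = 1 \<and> (\<forall>x y. f (x * y) = f x * f y) \<and> (\<forall>x. f (star x) = cnj (f x))"

lemma star_character_rep:
  assumes f: "star_character f"
  shows "irreducible_rep scalar_line (\<lambda>x \<xi>. f x *\<^sub>C \<xi>)"
proof -
  have cs: "csubspace scalar_line" using scalar_line_hilbert by (simp add: hilbert_subspace_def)
  have "bounded_operator_on scalar_line (\<lambda>\<xi>. c *\<^sub>C \<xi>)" for c
    unfolding bounded_operator_on_def using cs
    by (auto simp: csubspace_def scaleC_add_right scaleC_scaleC mult.commute norm_scaleC_ell2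
        intro!: exI[of _ "cmod c"])
  then have "star_rep scalar_line (\<lambda>x \<xi>. f x *\<^sub>C \<xi>)"
    using f scalar_line_hilbert
    by (simp add: star_rep_def star_character_def scaleC_one scaleC_add_left scaleC_scaleC clinear_add
        clinear_scaleC cinner_scaleC_left cinner_scaleC_right)
  moreover have "ell2_e0 \<in> scalar_line" by (simp add: scalar_line_iff e0_nth scaleC_one)
  moreover have "ell2_e0 \<noteq> 0" using norm_e0 by auto
  moreover have "K = {0} \<or> K = scalar_line" if K: "hilbert_subspace K" "K \<subseteq> scalar_line" for K
  proof (cases "K = {0}")
    case False
    have Ks: "csubspace K" using K by (simp add: hilbert_subspace_def)
    then obtain \<xi> where \<xi>: "\<xi> \<in> K" "\<xi> \<noteq> 0" using False by (auto simp: csubspace_def)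
    define c where "c = ell2_nth \<xi> 0"
    have \<xi>c: "\<xi> = c *\<^sub>C ell2_e0" using \<xi>(1) K(2) scalar_line_iff by (auto simp: c_def)
    then have "c \<noteq> 0" using \<xi>(2) by auto
    have "\<zeta> \<in> K" if "\<zeta> \<in> scalar_line" for \<zeta>
    proof -
      have "\<zeta> = (ell2_nth \<zeta> 0 / c) *\<^sub>C \<xi>"
        using that \<open>c \<noteq> 0\<close> by (subst \<xi>c) (simp add: scaleC_scaleC scalar_line_iff[symmetric])
      then show ?thesis using Ks \<xi>(1) unfolding csubspace_def by metis
    qed
    then show ?thesis using K(2) by blast
  qed simp
  ultimately show ?thesis unfolding irreducible_rep_def by blast
qed

text \<open>
  The line through \<xi> is a closed invariant subspace, so it is all of K, and the unit vector in
  the direction of \<xi> defines the unitary.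
\<close>

lemma character_vector_equivalent:
  fixes \<sigma> :: "'c::cstar_algebra \<Rightarrow> ell2 \<Rightarrow> ell2"
  assumes f: "star_character f" and irr: "irreducible_rep K \<sigma>"
    and \<xi>: "\<xi> \<in> K" "\<xi> \<noteq> 0" "\<And>x. \<sigma> x \<xi> = f x *\<^sub>C \<xi>"
  shows "((scalar_line, \<lambda>x \<xi>. f x *\<^sub>C \<xi>), (K, \<sigma>)) \<in> irrep_equiv"
proof -
  have rep: "star_rep K \<sigma>" using irr by (simp add: irreducible_rep_def)
  interpret representation K \<sigma> by unfold_locales (rule rep)
  define v where "v = complex_of_real (1 / norm \<xi>) *\<^sub>C \<xi>"
  have v: "v \<in> K" "norm v = 1" "\<And>x. \<sigma> x v = f x *\<^sub>C v"
    using \<xi> by (simp_all add: v_def scale_mem norm_scaleC_ell2 norm_divide op_scale scaleC_scaleC mult.commute)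
  define U where "U \<eta> = ell2_nth \<eta> 0 *\<^sub>C v" for \<eta>
  have vv: "cinner v v = 1" by (simp add: cinner_self_norm v)
  define L where "L = U ` scalar_line"
  have L: "L = range (\<lambda>c. c *\<^sub>C v)"
  proof -
    have "c *\<^sub>C v = U (c *\<^sub>C ell2_e0)" for c by (simp add: U_def e0_nth)
    then show ?thesis unfolding L_def scalar_line_def by auto
  qed
  have Lc: "\<zeta> \<in> L \<longleftrightarrow> \<zeta> = cinner v \<zeta> *\<^sub>C v" for \<zeta>
    unfolding L by (auto simp: cinner_scaleC_right vv)
  have "csubspace L"
    using rangeI[of "\<lambda>c. c *\<^sub>C v" 0]
    by (auto simp: csubspace_def L scaleC_scaleC simp flip: scaleC_add_left)
  moreover have "closed L"
  proof (rule closed_sequential_limits[THEN iffD2], intro allI impI)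
    fix X l assume X: "(\<forall>n. X n \<in> L) \<and> X \<longlonglongrightarrow> l"
    have "(\<lambda>n. cinner v (X n) *\<^sub>C v) \<longlonglongrightarrow> cinner v l *\<^sub>C v"
    proof (rule LIMSEQ_norm_boundI)
      show "(\<lambda>n. norm (X n - l)) \<longlonglongrightarrow> 0" using X by (simp add: LIM_zero tendsto_norm_zero)
      show "norm (cinner v (X n) *\<^sub>C v - cinner v l *\<^sub>C v) \<le> norm (X n - l)" for n
      proof -
        have "cinner v (X n) *\<^sub>C v - cinner v l *\<^sub>C v = cinner v (X n - l) *\<^sub>C v"
          by (simp add: cinner_diff_right complex_vs.scale_left_diff_distrib)
        then show ?thesis using cinner_Cauchy_Schwarz[of v "X n - l"] by (simp add: norm_scaleC_ell2 v)
      qed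
    qed
    moreover have "(\<lambda>n. cinner v (X n) *\<^sub>C v) = X" using X Lc by fastforce
    ultimately have "l = cinner v l *\<^sub>C v" using X LIMSEQ_unique by metis
    then show "l \<in> L" by (simp only: Lc[symmetric])
  qed
  ultimately have "hilbert_subspace L" by (simp add: hilbert_subspace_def)
  moreover have "L \<subseteq> K" unfolding L using v(1) by (auto simp: scale_mem)
  moreover have "\<sigma> x \<zeta> \<in> L" if "\<zeta> \<in> L" for x \<zeta>
    using that unfolding L by (auto simp: op_scale v scaleC_scaleC)
  moreover have "L \<noteq> {0}" using v(2) unfolding L by (metis norm_zero rangeI scaleC_one singletonD zero_neq_one)
  ultimately have LK: "L = K" using irr unfolding irreducible_rep_def by blast
  have inj: "inj_on U scalar_line"
  proof (rule inj_onI)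
    fix \<xi> \<zeta> assume *: "\<xi> \<in> scalar_line" "\<zeta> \<in> scalar_line" "U \<xi> = U \<zeta>"
    have "cinner v (U \<xi>) = cinner v (U \<zeta>)" by (simp add: *)
    then have "ell2_nth \<xi> 0 = ell2_nth \<zeta> 0" by (simp add: U_def cinner_scaleC_right vv)
    then show "\<xi> = \<zeta>" using *(1,2) scalar_line_iff by metis
  qed
  have cin: "cinner \<xi> \<zeta> = cnj (ell2_nth \<xi> 0) * ell2_nth \<zeta> 0" if "\<xi> \<in> scalar_line" for \<xi> \<zeta>
  proof -
    have "cinner \<xi> \<zeta> = cinner (ell2_nth \<xi> 0 *\<^sub>C ell2_e0) \<zeta>" using that scalar_line_iff by metis
    then show ?thesis by (simp add: cinner_scaleC_left cinner_e0)
  qed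
  have "unitarily_equivalent scalar_line (\<lambda>x \<xi>. f x *\<^sub>C \<xi>) K \<sigma>"
    unfolding unitarily_equivalent_def
  proof (intro exI[of _ U] conjI ballI allI)
    show "bij_betw U scalar_line K" using inj LK by (simp add: bij_betw_def L_def)
    show "U (\<xi> + \<zeta>) = U \<xi> + U \<zeta>" for \<xi> \<zeta> by (simp add: U_def scaleC_add_left)
    show "U (c *\<^sub>C \<xi>) = c *\<^sub>C U \<xi>" for c \<xi> by (simp add: U_def scaleC_scaleC)
    show "cinner (U \<xi>) (U \<zeta>) = cinner \<xi> \<zeta>" if "\<xi> \<in> scalar_line" for \<xi> \<zeta>
      by (simp add: U_def cinner_scaleC_left cinner_scaleC_right vv cin[OF that])
    show "U (f x *\<^sub>C \<xi>) = \<sigma> x (U \<xi>)" for x \<xi>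
      by (simp add: U_def op_scale v scaleC_scaleC mult.commute)
  qed
  then show ?thesis
    using irr star_character_rep[OF f] unfolding irrep_equiv_def by simp
qed

section \<open>Property (T) and the trivial point\<close>

locale universal_cqg = irreducible_coreps comult counit antipode haar Irr N u
  for comult :: "'a::complex_star_algebra \<Rightarrow> ('a \<times> 'a) list" and counit antipode haar
    and Irr :: "'i set" and N and u +
  fixes \<iota> :: "'a \<Rightarrow> 'c::cstar_algebra"
  assumes countable_Irr: "countable Irr" and universal: "universal_enveloping \<iota>"
begin

lemma iota_linear: "clinear \<iota>"
  and iota_one: "\<iota> 1 = 1"
  and iota_mult: "\<iota> (x * y) = \<iota> x * \<iota> y"
  and iota_star: "\<iota> (star x) = star (\<iota> x)"
  and iota_dense: "closure (range \<iota>) = UNIV"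
  and iota_extend: "star_rep H \<pi> \<Longrightarrow> \<exists>\<rho>. star_rep H \<rho> \<and> (\<forall>x. \<forall>\<xi>\<in>H. \<rho> (\<iota> x) \<xi> = \<pi> x \<xi>)"
  using universal unfolding universal_enveloping_def by blast+

lemma iota_approximate: obtains a where "(\<lambda>n. \<iota> (a n)) \<longlonglongrightarrow> x"
proof -
  obtain X where X: "\<And>n. X n \<in> range \<iota>" "X \<longlonglongrightarrow> x"
    using iota_dense closure_sequential[of x "range \<iota>"] by auto
  then have "\<forall>n. \<exists>a. X n = \<iota> a" by blast
  then obtain a where "\<And>n. X n = \<iota> (a n)" by metis
  then have "X = (\<lambda>n. \<iota> (a n))" by blast
  with X(2) that show thesis by blast
qed

lemma counit_star_character: "star_character counit"
  by (simp add: star_character_def counit_linear counit_one counit_mult counit_star)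

text \<open>
  The counit is a one-dimensional representation of Pol(G). Its extension given by the universal
  property acts on the line by a contractive character f, and density of the image of \<iota>
  makes f the only continuous extension.
\<close>

lemma counit_max_character: "star_character (counit_max counit \<iota>)"
  and counit_max_iota: "counit_max counit \<iota> (\<iota> a) = counit a"
  and counit_max_norm_le: "cmod (counit_max counit \<iota> x) \<le> norm x"
proof -
  have irr: "irreducible_rep scalar_line (\<lambda>x \<xi>. counit x *\<^sub>C \<xi>)"
    by (rule star_character_rep[OF counit_star_character])
  then obtain \<rho> where \<rho>: "star_rep scalar_line \<rho>"
    and ext: "\<And>x \<xi>. \<xi> \<in> scalar_line \<Longrightarrow> \<rho> (\<iota> x) \<xi> = counit x *\<^sub>C \<xi>"
    using iota_extend unfolding irreducible_rep_def by metis
  interpret R: representation scalar_line \<rho> by unfold_locales (rule \<rho>)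
  have e0: "ell2_e0 \<in> scalar_line" by (simp add: scalar_line_iff e0_nth scaleC_one)
  define f where "f x = ell2_nth (\<rho> x ell2_e0) 0" for x
  have \<rho>f: "\<rho> x ell2_e0 = f x *\<^sub>C ell2_e0" for x
    using R.op_mem[OF e0, of x] unfolding f_def scalar_line_iff .
  have lin: "clinear f" by (simp add: clinear_def f_def R.rep_add R.rep_scale e0)
  have mult: "f (x * y) = f x * f y" for x y
  proof -
    have "\<rho> (x * y) ell2_e0 = \<rho> x (f y *\<^sub>C ell2_e0)"
      by (simp only: R.rep_mult[OF e0] \<rho>f[of y])
    also have "\<dots> = (f y * f x) *\<^sub>C ell2_e0"
      by (simp only: R.op_scale[OF e0] \<rho>f[of x] scaleC_scaleC)
    finally have "ell2_nth (\<rho> (x * y) ell2_e0) 0 = f y * f x" by (simp add: e0_nth)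
    then show ?thesis by (simp only: f_def[of "x * y"] mult.commute)
  qed
  have star: "f (star x) = cnj (f x)" for x
  proof -
    have "cinner (\<rho> (star x) ell2_e0) ell2_e0 = cinner ell2_e0 (\<rho> x ell2_e0)" by (rule R.rep_star[OF e0 e0])
    then have "cnj (f (star x)) = f x" by (simp add: \<rho>f cinner_scaleC_left cinner_e0 e0_nth)
    then show ?thesis by (metis complex_cnj_cnj)
  qed
  have bound: "cmod (f x) \<le> norm x" for x
    using star_rep_contractive[OF \<rho> e0, of x] by (simp add: \<rho>f norm_scaleC_ell2 norm_e0)
  have cont: "continuous_on UNIV f"
    unfolding continuous_on_iff
  proof (intro ballI allI impI exI conjI)
    fix x x' :: 'c and e :: real assume "0 < e" "dist x' x < e"
    then show "dist (f x') (f x) < e"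
      using bound[of "x' - x"] by (simp add: dist_norm clinear_diff[OF lin])
  qed
  have ext': "f (\<iota> a) = counit a" for a by (simp add: f_def ext e0 e0_nth)
  have "counit_max counit \<iota> = f"
    unfolding counit_max_def
  proof (rule the_equality)
    show "clinear f \<and> (\<forall>x y. f (x * y) = f x * f y) \<and> (\<forall>x. f (star x) = cnj (f x)) \<and>
      continuous_on UNIV f \<and> (\<forall>a. f (\<iota> a) = counit a)"
      using lin mult star cont ext' by blast
    fix g assume g: "clinear g \<and> (\<forall>x y. g (x * y) = g x * g y) \<and> (\<forall>x. g (star x) = cnj (g x)) \<and>
      continuous_on UNIV g \<and> (\<forall>a. g (\<iota> a) = counit a)"
    show "g = f"
    proof
      fix x obtain a where a: "(\<lambda>n. \<iota> (a n)) \<longlonglongrightarrow> x" by (rule iota_approximate)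
      have "continuous_on UNIV g" using g by blast
      from continuous_on_tendsto_compose[OF this a] have "(\<lambda>n. g (\<iota> (a n))) \<longlonglongrightarrow> g x" by simp
      moreover have "(\<lambda>n. g (\<iota> (a n))) \<longlonglongrightarrow> f x"
        using continuous_on_tendsto_compose[OF cont a] g by (simp add: ext')
      ultimately show "g x = f x" by (rule LIMSEQ_unique)
    qed
  qed
  moreover have "f 1 = 1" using ext'[of 1] by (simp add: iota_one counit_one)
  ultimately show "star_character (counit_max counit \<iota>)" "counit_max counit \<iota> (\<iota> a) = counit a"
    "cmod (counit_max counit \<iota> x) \<le> norm x"
    using lin mult star ext' bound by (simp_all add: star_character_def)
qed

abbreviation "\<chi>\<^sub>0 \<equiv> counit_max counit \<iota>"

lemma chi_linear: "clinear \<chi>\<^sub>0" and chi_one: "\<chi>\<^sub>0 1 = 1" and chi_mult: "\<chi>\<^sub>0 (x * y) = \<chi>\<^sub>0 x * \<chi>\<^sub>0 y"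
  using counit_max_character by (simp_all add: star_character_def)

lemma trivial_rep_eq: "trivial_rep counit \<iota> = (scalar_line, \<lambda>x \<xi>. \<chi>\<^sub>0 x *\<^sub>C \<xi>)"
  by (simp add: trivial_rep_def scalar_line_def)

lemma trivial_rep_irreducible: "irreducible_rep scalar_line (\<lambda>x \<xi>. \<chi>\<^sub>0 x *\<^sub>C \<xi>)"
  by (rule star_character_rep[OF counit_max_character])

lemma trivial_point_spectrum: "trivial_point counit \<iota> \<in> spectrum"
  unfolding trivial_point_def spectrum_def quotient_def trivial_rep_eq
  using trivial_rep_irreducible by (auto simp: irreps_def)

lemma trivial_rep_kernel: "rep_kernel scalar_line (\<lambda>x \<xi>. \<chi>\<^sub>0 x *\<^sub>C \<xi>) = {x. \<chi>\<^sub>0 x = 0}"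
proof -
  have "ell2_e0 \<in> scalar_line" "ell2_e0 \<noteq> 0"
    using norm_e0 by (auto simp: scalar_line_iff e0_nth scaleC_one)
  then show ?thesis unfolding rep_kernel_def by auto
qed

lemma trivial_point_member_kernel:
  assumes "(K, \<sigma>) \<in> trivial_point counit \<iota>" shows "rep_kernel K \<sigma> = {x. \<chi>\<^sub>0 x = 0}"
proof -
  have "irreducible_rep K \<sigma>" and eq: "unitarily_equivalent scalar_line (\<lambda>x \<xi>. \<chi>\<^sub>0 x *\<^sub>C \<xi>) K \<sigma>"
    using assms by (simp_all add: trivial_point_def trivial_rep_eq irrep_equiv_def)
  then have "star_rep K \<sigma>" "star_rep scalar_line (\<lambda>x \<xi>. \<chi>\<^sub>0 x *\<^sub>C \<xi>)"
    using trivial_rep_irreducible by (simp_all add: irreducible_rep_def)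
  from unitarily_equivalent_kernel[OF this(2,1) eq] show ?thesis by (simp only: trivial_rep_kernel)
qed

lemma trivial_point_kernel: "point_kernel (trivial_point counit \<iota>) = {x. \<chi>\<^sub>0 x = 0}"
proof -
  obtain K \<sigma> where "(K, \<sigma>) \<in> trivial_point counit \<iota>" "point_kernel (trivial_point counit \<iota>) = rep_kernel K \<sigma>"
    by (rule spectrum_point[OF trivial_point_spectrum])
  then show ?thesis using trivial_point_member_kernel by simp
qed

lemma invariant_vector_trivial_point:
  assumes D: "D \<in> spectrum" "(K, \<sigma>) \<in> D" and irr: "irreducible_rep K \<sigma>"
    and \<xi>: "\<xi> \<in> K" "\<xi> \<noteq> 0" "\<And>x. \<sigma> x \<xi> = \<chi>\<^sub>0 x *\<^sub>C \<xi>"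
  shows "D = trivial_point counit \<iota>"
proof -
  obtain y where y: "D = irrep_equiv `` {y}" using D(1) by (auto simp: spectrum_def quotient_def)
  then have "(y, (K, \<sigma>)) \<in> irrep_equiv" using D(2) by blast
  moreover have "(trivial_rep counit \<iota>, (K, \<sigma>)) \<in> irrep_equiv"
    unfolding trivial_rep_eq by (rule character_vector_equivalent[OF counit_max_character irr \<xi>])
  ultimately show ?thesis unfolding y trivial_point_def by (rule irrep_equiv_class_eq)
qed

text \<open>
  Separability of the universal C*-algebra, from countability of Irr.
\<close>

lemma coefficients_countable_dense:
  obtains a :: "nat \<Rightarrow> 'c" where "closure (cspan (range a)) = UNIV"
proof -
  let ?S = "\<iota> ` coefficient ` index"
  have "countable index"
  proof -
    have "index \<subseteq> Irr \<times> (UNIV \<times> UNIV)" by (auto simp: irr_index_def)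
    then show ?thesis by (rule countable_subset) (intro countable_SIGMA countable_Irr countableI_type)
  qed
  then have "countable ?S" by simp
  moreover have "?S \<noteq> {}"
  proof -
    obtain \<alpha> where "\<alpha> \<in> Irr" by (rule trivial_coefficient)
    then have "u \<alpha> 0 0 \<in> coefficient ` index" using irr_pos by (intro coefficient_mem) auto
    then show ?thesis by blast
  qed
  ultimately have range: "range (from_nat_into ?S) = ?S" by (intro range_from_nat_into)
  have "csubspace {x. \<iota> x \<in> cspan ?S}"
    using csubspace_cspan[of "coefficient ` index"] complex_vs.subspace_span[of ?S]
    by (simp add: csubspace_def cspan_eq_span complex_vs.subspace_def clinear_zero[OF iota_linear]
        clinear_add[OF iota_linear] clinear_scaleC[OF iota_linear])
  then have "cspan (coefficient ` index) \<subseteq> {x. \<iota> x \<in> cspan ?S}"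
    by (rule cspan_induct_csubspace) (auto simp: cspan_eq_span intro: complex_vs.span_base)
  then have "range \<iota> \<subseteq> cspan ?S" unfolding coefficients_span by auto
  then have "closure (cspan ?S) = UNIV" using closure_mono iota_dense by blast
  then show thesis by (intro that[of "from_nat_into ?S"]) (simp add: range)
qed

lemma killed_by_irreps_imp_zero:
  fixes z :: 'c
  assumes rep: "star_rep H \<rho>" "\<xi> \<in> H"
    and irr: "\<And>D K \<sigma>. D \<in> spectrum \<Longrightarrow> (K, \<sigma>) \<in> D \<Longrightarrow> z \<in> rep_kernel K \<sigma>"
  shows "\<rho> z \<xi> = 0"
proof (rule ccontr)
  assume nz: "\<rho> z \<xi> \<noteq> 0"
  obtain a :: "nat \<Rightarrow> 'c" where dense: "closure (cspan (range a)) = UNIV" by (rule coefficients_countable_dense)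
  obtain K \<sigma> where K: "irreducible_rep K \<sigma>" "z \<notin> rep_kernel K \<sigma>"
    by (rule irreducible_reps_separate[OF dense rep nz])
  have "irrep_equiv `` {(K, \<sigma>)} \<in> spectrum"
    using K(1) by (auto simp: spectrum_def quotient_def irreps_def)
  moreover have "(K, \<sigma>) \<in> irrep_equiv `` {(K, \<sigma>)}"
    using K(1) by (simp add: irrep_equiv_def unitarily_equivalent_refl)
  ultimately show False using irr K(2) by blast
qed

lemma star_rep_iota: "star_rep H \<rho> \<Longrightarrow> star_rep H (\<lambda>x. \<rho> (\<iota> x))"
  unfolding star_rep_def
  by (simp add: iota_one iota_mult iota_star clinear_add[OF iota_linear] clinear_scaleC[OF iota_linear])

lemma counit_u: "\<alpha> \<in> Irr \<Longrightarrow> i < N \<alpha> \<Longrightarrow> l < N \<alpha> \<Longrightarrow> counit (u \<alpha> i l) = (if i = l then 1 else 0)"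
  by (rule counit_corep[OF irr_unitary])

lemma defect_counit:
  assumes "\<alpha> \<in> Irr" "i < N \<alpha>" "l < N \<alpha>"
  shows "defect V \<alpha> \<xi> i l = V \<alpha> i l \<xi> - counit (u \<alpha> i l) *\<^sub>C \<xi>"
  using assms by (simp add: defect_def counit_u scaleC_one)

text \<open>
  The defects compare the action with the counit on the coefficients, which span Pol(G), and the
  image of Pol(G) is dense.
\<close>

lemma invariant_vector_character:
  assumes rep: "star_rep H \<rho>" and \<xi>: "\<xi> \<in> H"
    and inv: "\<And>\<alpha> i l. \<alpha> \<in> Irr \<Longrightarrow> i < N \<alpha> \<Longrightarrow> l < N \<alpha> \<Longrightarrow> defect (\<lambda>\<alpha> i j. \<rho> (\<iota> (u \<alpha> i j))) \<alpha> \<xi> i l = 0"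
  shows "\<rho> x \<xi> = \<chi>\<^sub>0 x *\<^sub>C \<xi>"
proof -
  interpret R: representation H \<rho> by unfold_locales (rule rep)
  have alg: "\<rho> (\<iota> a) \<xi> = counit a *\<^sub>C \<xi>" for a
  proof (rule clinear_eq_on_cspan[where f = "\<lambda>a. \<rho> (\<iota> a) \<xi>" and g = "\<lambda>a. counit a *\<^sub>C \<xi>"])
    show "clinear (\<lambda>a. \<rho> (\<iota> a) \<xi>)"
      by (simp add: clinear_def clinear_add[OF iota_linear] clinear_scaleC[OF iota_linear] R.rep_add R.rep_scale \<xi>)
    show "clinear (\<lambda>a. counit a *\<^sub>C \<xi>)"
      by (simp add: clinear_def clinear_add[OF counit_linear] clinear_scaleC[OF counit_linear] scaleC_add_left scaleC_scaleC)
    show "a \<in> cspan (coefficient ` index)" by (simp add: coefficients_span)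
    show "\<rho> (\<iota> a) \<xi> = counit a *\<^sub>C \<xi>" if "a \<in> coefficient ` index" for a
      using that inv by (auto simp: coefficient_def irr_index_def defect_counit)
  qed
  obtain a where a: "(\<lambda>n. \<iota> (a n)) \<longlonglongrightarrow> x" by (rule iota_approximate)
  have "(\<lambda>n. \<rho> (\<iota> (a n)) \<xi>) \<longlonglongrightarrow> \<rho> x \<xi>" by (rule star_rep_tendsto[OF rep \<xi> a])
  moreover have "(\<lambda>n. \<rho> (\<iota> (a n)) \<xi>) \<longlonglongrightarrow> \<chi>\<^sub>0 x *\<^sub>C \<xi>"
  proof (rule LIMSEQ_norm_boundI)
    have "(\<lambda>n. norm (\<iota> (a n) - x) * norm \<xi>) \<longlonglongrightarrow> norm (x - x) * norm \<xi>" by (intro tendsto_intros a)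
    then show "(\<lambda>n. norm (\<iota> (a n) - x) * norm \<xi>) \<longlonglongrightarrow> 0" by simp
    show "norm (\<rho> (\<iota> (a n)) \<xi> - \<chi>\<^sub>0 x *\<^sub>C \<xi>) \<le> norm (\<iota> (a n) - x) * norm \<xi>" for n
    proof -
      have "\<rho> (\<iota> (a n)) \<xi> - \<chi>\<^sub>0 x *\<^sub>C \<xi> = \<chi>\<^sub>0 (\<iota> (a n) - x) *\<^sub>C \<xi>"
        by (simp add: alg counit_max_iota clinear_diff[OF chi_linear] complex_vs.scale_left_diff_distrib)
      then show ?thesis using counit_max_norm_le by (simp add: norm_scaleC_ell2 mult_right_mono)
    qed
  qed
  ultimately show ?thesis by (rule LIMSEQ_unique)
qed

text \<open>
  The image of an almost invariant vector under an element j that vanishes in all non-trivial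
  irreducible representations is invariant, and it is non-zero if \<epsilon>(j) is not 0.
\<close>

theorem isolated_imp_property_T:
  assumes isolated: "openin jacobson_topology {trivial_point counit \<iota>}"
  shows "dual_property_T haar Irr N u"
  unfolding dual_property_T_def
proof (intro allI impI)
  fix H V assume HV: "dual_corep Irr N u H V \<and> has_almost_invariant_vectors haar Irr N u H V"
  let ?t = "trivial_point counit \<iota>"
  have "jacobson_closure (spectrum - {?t}) = spectrum - {?t}"
    using isolated by (simp add: openin_jacobson jacobson_open_def)
  then have "?t \<notin> jacobson_closure (spectrum - {?t})" by simp
  then have "\<not> (\<Inter>D\<in>spectrum - {?t}. point_kernel D) \<subseteq> point_kernel ?t"
    using trivial_point_spectrum by (simp add: jacobson_closure_def)
  then obtain j where j: "\<And>D. D \<in> spectrum \<Longrightarrow> D \<noteq> ?t \<Longrightarrow> j \<in> point_kernel D" and "\<chi>\<^sub>0 j \<noteq> 0"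
    unfolding trivial_point_kernel by blast
  obtain \<pi> where \<pi>: "star_rep H \<pi>"
    and \<pi>V: "\<And>\<alpha> i l \<xi>. \<alpha> \<in> Irr \<Longrightarrow> i < N \<alpha> \<Longrightarrow> l < N \<alpha> \<Longrightarrow> \<pi> (u \<alpha> i l) \<xi> = V \<alpha> i l \<xi>"
    using dual_corep_star_rep HV by metis
  obtain \<rho> where \<rho>: "star_rep H \<rho>" and \<rho>\<pi>: "\<And>x \<xi>. \<xi> \<in> H \<Longrightarrow> \<rho> (\<iota> x) \<xi> = \<pi> x \<xi>"
    using iota_extend[OF \<pi>] by blast
  interpret P: representation H \<pi> by unfold_locales (rule \<pi>)
  interpret R: representation H \<rho> by unfold_locales (rule \<rho>)
  define \<kappa> where "\<kappa> = cmod (\<chi>\<^sub>0 j)"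
  have "\<kappa> > 0" using \<open>\<chi>\<^sub>0 j \<noteq> 0\<close> by (simp add: \<kappa>_def)
  obtain a0 where "(\<lambda>n. \<iota> (a0 n)) \<longlonglongrightarrow> j" by (rule iota_approximate)
  then obtain n where "norm (\<iota> (a0 n) - j) < \<kappa> / 4" using \<open>\<kappa> > 0\<close> by (metis LIMSEQ_D divide_pos_pos order_refl zero_less_numeral)
  then obtain a where a: "norm (\<iota> a - j) < \<kappa> / 4" by blast
  define F where "F = {p. coordinate p a \<noteq> 0}"
  define c where "c p = coordinate p a" for p
  have F: "finite F" "F \<subseteq> index" and a_sum: "a = (\<Sum>p\<in>F. c p *\<^sub>C coefficient p)"
    unfolding F_def c_def by (rule coordinate_finite coordinate_support coordinate_expansion)+
  obtain \<alpha>0 where \<alpha>0: "\<alpha>0 \<in> Irr" by (rule trivial_coefficient)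
  \<comment> \<open>The class \<alpha>0 makes E non-empty, so that (E, \<delta>)-invariance with its strict
      inequality excludes \<xi> = 0.\<close>
  define E where "E = insert \<alpha>0 (fst ` F)"
  define s where "s = 1 + (\<Sum>p\<in>F. cmod (c p))"
  \<comment> \<open>Three errors have to add up to less than \<kappa>: approximating j by \<iota> a under \<rho>
      and under the counit, and the defects of \<xi> on the coefficients of a.\<close>
  define \<delta> where "\<delta> = \<kappa> / (4 * s)"
  have "s > 0" by (simp add: s_def add_pos_nonneg sum_nonneg)
  then have "\<delta> > 0" using \<open>\<kappa> > 0\<close> by (simp add: \<delta>_def)
  moreover have "finite E" "E \<subseteq> Irr" using F \<alpha>0 by (auto simp: E_def irr_index_def)
  ultimately obtain \<xi> where \<xi>: "\<xi> \<in> H" and inv: "approx_invariant haar N u V E \<delta> \<xi>"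
    using HV unfolding has_almost_invariant_vectors_def by blast
  have small: "norm (defect V \<alpha> \<xi> i l) < \<delta> * norm \<xi>" if "\<alpha> \<in> E" "i < N \<alpha>" "l < N \<alpha>" for \<alpha> i l
    using approx_invariantD[OF inv that(1) _ that(2,3)] that(1) \<open>E \<subseteq> Irr\<close> by blast
  have "0 < \<delta> * norm \<xi>"
    by (rule le_less_trans[OF norm_ge_zero small[of \<alpha>0 0 0]]) (simp_all add: E_def irr_pos[OF \<alpha>0])
  then have "0 < norm \<xi>" using \<open>\<delta> > 0\<close> by (simp add: zero_less_mult_iff)
  have "norm (\<pi> a \<xi> - counit a *\<^sub>C \<xi>) \<le> \<kappa> / 4 * norm \<xi>"
  proof -
    have "\<pi> a \<xi> - counit a *\<^sub>C \<xi> = (\<Sum>p\<in>F. c p *\<^sub>C (\<pi> (coefficient p) \<xi> - counit (coefficient p) *\<^sub>C \<xi>))"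
      by (subst (1 2) a_sum)
        (simp add: P.rep_sum P.rep_scale \<xi> clinear_sum[OF counit_linear] clinear_scaleC[OF counit_linear]
          complex_vs.scale_sum_left complex_vs.scale_right_diff_distrib sum_subtractf scaleC_scaleC)
    also have "norm \<dots> \<le> (\<Sum>p\<in>F. cmod (c p) * (\<delta> * norm \<xi>))"
    proof (rule order_trans[OF norm_sum], rule sum_mono)
      fix p assume p: "p \<in> F"
      obtain \<alpha> i l where pe: "p = (\<alpha>, i, l)" by (cases p)
      then have mem: "\<alpha> \<in> Irr" "i < N \<alpha>" "l < N \<alpha>" using p F(2) by (auto simp: irr_index_def)
      have "\<alpha> \<in> E" using p by (force simp: E_def pe)
      then have "norm (\<pi> (coefficient p) \<xi> - counit (coefficient p) *\<^sub>C \<xi>) \<le> \<delta> * norm \<xi>"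
        using small[of \<alpha> i l] mem by (simp add: pe coefficient_def \<pi>V defect_counit)
      then show "norm (c p *\<^sub>C (\<pi> (coefficient p) \<xi> - counit (coefficient p) *\<^sub>C \<xi>)) \<le> cmod (c p) * (\<delta> * norm \<xi>)"
        by (simp add: norm_scaleC_ell2 mult_left_mono)
    qed
    also have "\<dots> = (\<Sum>p\<in>F. cmod (c p)) * \<delta> * norm \<xi>" by (simp add: sum_distrib_right mult.assoc)
    also have "\<dots> \<le> \<kappa> / 4 * norm \<xi>"
    proof (rule mult_right_mono)
      have "(\<Sum>p\<in>F. cmod (c p)) * \<delta> \<le> s * \<delta>"
        using \<open>\<delta> > 0\<close> by (simp add: s_def mult_right_mono)
      also have "\<dots> = \<kappa> / 4" using \<open>s > 0\<close> by (simp add: \<delta>_def)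
      finally show "(\<Sum>p\<in>F. cmod (c p)) * \<delta> \<le> \<kappa> / 4" .
    qed simp
    finally show ?thesis .
  qed
  moreover have "norm (\<rho> (j - \<iota> a) \<xi>) \<le> \<kappa> / 4 * norm \<xi>"
  proof -
    have "norm (\<rho> (j - \<iota> a) \<xi>) \<le> norm (j - \<iota> a) * norm \<xi>" by (rule star_rep_contractive[OF \<rho> \<xi>])
    also have "\<dots> \<le> \<kappa> / 4 * norm \<xi>"
      using a by (intro mult_right_mono) (simp_all add: norm_minus_commute)
    finally show ?thesis .
  qed
  moreover have "norm (\<chi>\<^sub>0 (\<iota> a - j) *\<^sub>C \<xi>) \<le> \<kappa> / 4 * norm \<xi>"
    unfolding norm_scaleC_ell2 using counit_max_norm_le[of "\<iota> a - j"] a by (intro mult_right_mono) simp_all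
  ultimately have "norm (\<pi> a \<xi> - counit a *\<^sub>C \<xi>) + norm (\<rho> (j - \<iota> a) \<xi>) + norm (\<chi>\<^sub>0 (\<iota> a - j) *\<^sub>C \<xi>)
      \<le> \<kappa> / 4 * norm \<xi> + \<kappa> / 4 * norm \<xi> + \<kappa> / 4 * norm \<xi>"
    by (intro add_mono)
  moreover have "\<rho> j \<xi> - \<chi>\<^sub>0 j *\<^sub>C \<xi> = (\<pi> a \<xi> - counit a *\<^sub>C \<xi>) + \<rho> (j - \<iota> a) \<xi> + \<chi>\<^sub>0 (\<iota> a - j) *\<^sub>C \<xi>"
    by (simp add: R.rep_diff[OF \<xi>] \<rho>\<pi>[OF \<xi>] clinear_diff[OF chi_linear] counit_max_iota
        complex_vs.scale_left_diff_distrib)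
  moreover have "norm (x + y + z) \<le> norm x + norm y + norm z" for x y z :: ell2
    by (intro order_trans[OF norm_triangle_ineq] add_mono norm_triangle_ineq order_refl)
  ultimately have "norm (\<rho> j \<xi> - \<chi>\<^sub>0 j *\<^sub>C \<xi>) \<le> \<kappa> / 4 * norm \<xi> + \<kappa> / 4 * norm \<xi> + \<kappa> / 4 * norm \<xi>"
    by (metis order_trans)
  also have "\<dots> < \<kappa> * norm \<xi>" using \<open>\<kappa> > 0\<close> \<open>0 < norm \<xi>\<close> by simp
  finally have "\<rho> j \<xi> \<noteq> 0" by (auto simp: norm_scaleC_ell2 \<kappa>_def)
  define \<eta> where "\<eta> = \<rho> j \<xi>"
  have \<eta>: "\<eta> \<in> H" "\<eta> \<noteq> 0" using \<xi> \<open>\<rho> j \<xi> \<noteq> 0\<close> by (simp_all add: \<eta>_def R.op_mem)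
  have eigen: "\<rho> x \<eta> = \<chi>\<^sub>0 x *\<^sub>C \<eta>" for x
  proof -
    \<comment> \<open>The kernels are ideals, so z is killed wherever j is, and the counit kills it by
        multiplicativity.\<close>
    define z where "z = x * j - \<chi>\<^sub>0 x *\<^sub>C j"
    have "\<rho> z \<xi> = 0"
    proof (rule killed_by_irreps_imp_zero[OF \<rho> \<xi>])
      fix D K and \<sigma> :: "'c \<Rightarrow> ell2 \<Rightarrow> ell2" assume D: "D \<in> spectrum" "(K, \<sigma>) \<in> D"
      show "z \<in> rep_kernel K \<sigma>"
      proof (cases "D = ?t")
        case True
        then show ?thesis using trivial_point_member_kernel D(2)
          by (simp add: z_def clinear_diff[OF chi_linear] clinear_scaleC[OF chi_linear] chi_mult)
      next
        case False
        then have jK: "j \<in> rep_kernel K \<sigma>" using j[OF D(1)] D(2) by (auto simp: point_kernel_def)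
        have "irreducible_rep K \<sigma>" using D by (auto simp: spectrum_def quotient_def irrep_equiv_def)
        then have rep: "star_rep K \<sigma>" by (simp add: irreducible_rep_def)
        interpret S: representation K \<sigma> by unfold_locales (rule rep)
        show ?thesis
          using rep_kernel_ideal(2)[OF rep jK, of x] jK
          by (simp add: rep_kernel_def z_def S.rep_diff S.rep_scale)
      qed
    qed
    then show ?thesis by (simp add: z_def \<eta>_def R.rep_diff R.rep_scale R.rep_mult \<xi>)
  qed
  have "defect V \<alpha> \<eta> i l = 0" if "\<alpha> \<in> Irr" "i < N \<alpha>" "l < N \<alpha>" for \<alpha> i l
    using eigen[of "\<iota> (u \<alpha> i l)"] that \<eta>(1) by (simp add: defect_counit \<rho>\<pi> \<pi>V counit_max_iota)
  then show "\<exists>\<xi>\<in>H. \<xi> \<noteq> 0 \<and> invariant_vector Irr N V \<xi>"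
    using \<eta> by (auto simp: invariant_vector_iff)
qed

definition total_defect :: "('c \<Rightarrow> ell2 \<Rightarrow> ell2) \<Rightarrow> 'i set \<Rightarrow> ell2 \<Rightarrow> real" where
  "total_defect \<sigma> E \<xi> = (\<Sum>\<alpha>\<in>E. \<Sum>i<N \<alpha>. \<Sum>l<N \<alpha>. (norm (defect (\<lambda>\<alpha> i j. \<sigma> (\<iota> (u \<alpha> i j))) \<alpha> \<xi> i l))\<^sup>2)"

text \<open>
  Suppose that for each n some non-trivial irreducible representation has a vector with total
  defect below 1 / (n + 1) times its squared norm on the first n + 1 classes. These vectors are
  almost invariant in the direct sum. Property (T) yields an invariant vector of the direct sum,
  and a non-zero component of it transforms by the counit, which makes the corresponding summand
  trivial.
\<close>

lemma property_T_uniform_gap: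
  assumes T: "dual_property_T haar Irr N u"
  shows "\<exists>E \<delta>. finite E \<and> E \<subseteq> Irr \<and> \<delta> > 0 \<and>
    (\<forall>D K \<sigma> \<xi>. D \<in> spectrum \<and> D \<noteq> trivial_point counit \<iota> \<and> (K, \<sigma>) \<in> D \<and> irreducible_rep K \<sigma> \<and> \<xi> \<in> K
      \<longrightarrow> \<delta> * (norm \<xi>)\<^sup>2 \<le> total_defect \<sigma> E \<xi>)"
proof (rule ccontr)
  assume no: "\<not> ?thesis"
  have neI: "Irr \<noteq> {}" using trivial_coefficient by blast
  define E where "E n = from_nat_into Irr ` {..n}" for n
  have E: "finite (E n)" "E n \<subseteq> Irr" for n
    using from_nat_into[OF neI] by (auto simp: E_def)
  have "\<exists>D K \<sigma> \<xi>. D \<in> spectrum \<and> D \<noteq> trivial_point counit \<iota> \<and> (K, \<sigma>) \<in> D \<and> irreducible_rep K \<sigma> \<and> \<xi> \<in> K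
      \<and> total_defect \<sigma> (E n) \<xi> < 1 / real (Suc n) * (norm \<xi>)\<^sup>2" for n
  proof -
    have pos: "1 / real (Suc n) > 0" by simp
    have "\<not> (\<forall>D K \<sigma> \<xi>. D \<in> spectrum \<and> D \<noteq> trivial_point counit \<iota> \<and> (K, \<sigma>) \<in> D \<and> irreducible_rep K \<sigma> \<and> \<xi> \<in> K
      \<longrightarrow> 1 / real (Suc n) * (norm \<xi>)\<^sup>2 \<le> total_defect \<sigma> (E n) \<xi>)"
      using no E[of n] pos by blast
    then show ?thesis unfolding not_all not_imp not_le by blast
  qed
  then obtain D K \<sigma> \<xi> where D: "\<And>n. D n \<in> spectrum" "\<And>n. D n \<noteq> trivial_point counit \<iota>"
    "\<And>n. (K n, \<sigma> n) \<in> D n" and irr: "\<And>n. irreducible_rep (K n) (\<sigma> n)" and \<xi>: "\<And>n. \<xi> n \<in> K n"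
    and small: "\<And>n. total_defect (\<sigma> n) (E n) (\<xi> n) < 1 / real (Suc n) * (norm (\<xi> n))\<^sup>2"
    by metis
  have reps: "star_rep (K n) (\<sigma> n)" for n using irr by (simp add: irreducible_rep_def)
  interpret R: representation "K n" "\<sigma> n" for n by unfold_locales (rule reps)
  define H where "H = direct_sum_space K"
  define \<rho> where "\<rho> = direct_sum_rep \<sigma>"
  have \<rho>: "star_rep H \<rho>" unfolding H_def \<rho>_def by (rule direct_sum_star_rep[OF reps])
  define V where "V = (\<lambda>\<alpha> i j. \<rho> (\<iota> (u \<alpha> i j)))"
  have V: "dual_corep Irr N u H V"
    unfolding V_def by (rule star_rep_dual_corep[OF star_rep_iota[OF \<rho>]])
  have slice_defect: "slice n (defect V \<alpha> \<zeta> i l) = defect (\<lambda>\<alpha> i j. \<sigma> n (\<iota> (u \<alpha> i j))) \<alpha> (slice n \<zeta>) i l"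
    if "\<zeta> \<in> H" for n \<alpha> \<zeta> i l
    using that by (simp add: defect_def V_def \<rho>_def H_def clinear_diff[OF slice_linear]
        slice_direct_sum_rep[OF reps] clinear_zero[OF slice_linear])
  have "has_almost_invariant_vectors haar Irr N u H V"
    unfolding has_almost_invariant_vectors_def
  proof (intro allI impI)
    fix F and \<delta> :: real assume F: "finite F \<and> F \<subseteq> Irr \<and> \<delta> > 0"
    have "\<exists>n. F \<subseteq> E n \<and> 1 / real (Suc n) < \<delta>\<^sup>2"
    proof -
      have "\<exists>n. F \<subseteq> E n"
      proof -
        define M where "M = Max (insert 0 (to_nat_on Irr ` F))"
        have "\<alpha> \<in> E M" if "\<alpha> \<in> F" for \<alpha>
        proof -
          have "to_nat_on Irr \<alpha> \<le> M" using F that by (auto simp: M_def)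
          moreover have "from_nat_into Irr (to_nat_on Irr \<alpha>) = \<alpha>"
            using F that countable_Irr by (intro from_nat_into_to_nat_on) auto
          ultimately show ?thesis unfolding E_def by (metis atMost_iff image_eqI)
        qed
        then show ?thesis by blast
      qed
      then obtain m where m: "F \<subseteq> E m" by blast
      obtain k where k: "1 / real (Suc k) < \<delta>\<^sup>2"
        using F nat_approx_posE[of "\<delta>\<^sup>2"] by (metis zero_less_power)
      have "E m \<subseteq> E (max m k)" by (auto simp: E_def)
      moreover have "1 / real (Suc (max m k)) \<le> 1 / real (Suc k)" by (intro divide_left_mono) auto
      ultimately show ?thesis using m k by (meson le_less_trans order_trans)
    qed
    then obtain n where n: "F \<subseteq> E n" "1 / real (Suc n) < \<delta>\<^sup>2" by blast
    obtain \<zeta> where \<zeta>: "\<zeta> \<in> H" "slice n \<zeta> = \<xi> n" "\<And>m. m \<noteq> n \<Longrightarrow> slice m \<zeta> = 0"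
      unfolding H_def using direct_sum_embed[where K = K and \<sigma> = \<sigma> and n = n and v = "\<xi> n", OF reps \<xi>] by metis
    have norm_\<zeta>: "norm \<zeta> = norm (\<xi> n)" by (simp only: norm_single_slice[OF \<zeta>(3)] \<zeta>(2))
    have norm_defect: "norm (defect V \<alpha> \<zeta> i l) = norm (defect (\<lambda>\<alpha> i j. \<sigma> n (\<iota> (u \<alpha> i j))) \<alpha> (\<xi> n) i l)" for \<alpha> i l
    proof -
      have "slice m (defect V \<alpha> \<zeta> i l) = 0" if "m \<noteq> n" for m
        unfolding slice_defect[OF \<zeta>(1)] \<zeta>(3)[OF that] by (simp add: defect_def R.op_zero)
      from norm_single_slice[OF this] show ?thesis by (simp add: slice_defect[OF \<zeta>(1)] \<zeta>(2))
    qed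
    have "0 \<le> total_defect (\<sigma> n) (E n) (\<xi> n)" unfolding total_defect_def by (intro sum_nonneg) simp
    then have "\<xi> n \<noteq> 0" using small[of n] by auto
    have "approx_invariant haar N u V F \<delta> \<zeta>"
    proof (rule approx_invariantI)
      show "F \<subseteq> Irr" "\<delta> > 0" using F by auto
      show "\<zeta> \<noteq> 0" using \<open>\<xi> n \<noteq> 0\<close> norm_\<zeta> by auto
      fix \<alpha> assume \<alpha>: "\<alpha> \<in> F"
      have "(\<Sum>i<N \<alpha>. \<Sum>l<N \<alpha>. (norm (defect V \<alpha> \<zeta> i l))\<^sup>2) \<le> total_defect (\<sigma> n) (E n) (\<xi> n)"
        unfolding total_defect_def norm_defect
        by (rule member_le_sum[of \<alpha> "E n"]) (use \<alpha> n E in \<open>auto intro!: sum_nonneg\<close>)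
      also have "\<dots> < 1 / real (Suc n) * (norm (\<xi> n))\<^sup>2" by (rule small)
      also have "\<dots> \<le> \<delta>\<^sup>2 * (norm \<zeta>)\<^sup>2" unfolding norm_\<zeta> using n(2) by (intro mult_right_mono) auto
      finally show "(\<Sum>i<N \<alpha>. \<Sum>l<N \<alpha>. (norm (defect V \<alpha> \<zeta> i l))\<^sup>2) < \<delta>\<^sup>2 * (norm \<zeta>)\<^sup>2" .
    qed
    then show "\<exists>\<xi>\<in>H. approx_invariant haar N u V F \<delta> \<xi>" using \<zeta>(1) by blast
  qed
  with V T obtain \<zeta> where \<zeta>: "\<zeta> \<in> H" "\<zeta> \<noteq> 0" "invariant_vector Irr N V \<zeta>"
    unfolding dual_property_T_def by blast
  have "\<exists>n. slice n \<zeta> \<noteq> 0"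
    using slice_eqI[of \<zeta> 0] \<zeta>(2) by (auto simp: clinear_zero[OF slice_linear])
  then obtain n where n: "slice n \<zeta> \<noteq> 0" by blast
  have mem: "slice n \<zeta> \<in> K n" using \<zeta>(1) by (simp add: H_def direct_sum_space_def)
  have "\<sigma> n x (slice n \<zeta>) = \<chi>\<^sub>0 x *\<^sub>C slice n \<zeta>" for x
  proof (rule invariant_vector_character[OF reps mem])
    fix \<alpha> i l assume "\<alpha> \<in> Irr" "i < N \<alpha>" "l < N \<alpha>"
    then have "defect V \<alpha> \<zeta> i l = 0" using \<zeta>(3) by (simp add: invariant_vector_iff)
    then show "defect (\<lambda>\<alpha> i j. \<sigma> n (\<iota> (u \<alpha> i j))) \<alpha> (slice n \<zeta>) i l = 0"
      using slice_defect[OF \<zeta>(1), of n \<alpha> i l] by (simp add: clinear_zero[OF slice_linear])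
  qed
  then have "D n = trivial_point counit \<iota>"
    by (rule invariant_vector_trivial_point[OF D(1) D(3) irr mem n])
  then show False using D(2) by blast
qed

text \<open>
  The sum h of the squares star b * b has the total defect as its quadratic form and counit 0. The
  element z = g - k, with k a multiple of h - \<delta>/2 and g its absolute value, is killed where
  k is positive but not by the counit.
\<close>

theorem property_T_imp_isolated:
  assumes T: "dual_property_T haar Irr N u"
  shows "openin jacobson_topology {trivial_point counit \<iota>}"
proof -
  let ?t = "trivial_point counit \<iota>"
  obtain E \<delta> where E: "finite E" "E \<subseteq> Irr" and "\<delta> > 0"
    and gap: "\<forall>D K \<sigma> \<xi>. D \<in> spectrum \<and> D \<noteq> ?t \<and> (K, \<sigma>) \<in> D \<and> irreducible_rep K \<sigma> \<and> \<xi> \<in> K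
      \<longrightarrow> \<delta> * (norm \<xi>)\<^sup>2 \<le> total_defect \<sigma> E \<xi>"
    using property_T_uniform_gap[OF T] by blast
  define b where "b \<alpha> i l = u \<alpha> i l - counit (u \<alpha> i l) *\<^sub>C 1" for \<alpha> i l
  define h where "h = (\<Sum>\<alpha>\<in>E. \<Sum>i<N \<alpha>. \<Sum>l<N \<alpha>. star (b \<alpha> i l) * b \<alpha> i l)"
  have h_star: "star h = h" by (simp add: h_def star_sum star_mult star_star)
  have "counit (b \<alpha> i l) = 0" for \<alpha> i l
    by (simp add: b_def clinear_diff[OF counit_linear] clinear_scaleC[OF counit_linear] counit_one)
  then have h_counit: "counit h = 0" by (simp add: h_def clinear_sum[OF counit_linear] counit_mult)
  have h_rep: "cinner \<xi> (\<sigma> (\<iota> h) \<xi>) = of_real (total_defect \<sigma> E \<xi>)" if rep: "star_rep K \<sigma>" and \<xi>: "\<xi> \<in> K" for K \<sigma> \<xi>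
  proof -
    interpret R: representation K "\<lambda>x. \<sigma> (\<iota> x)" by unfold_locales (rule star_rep_iota[OF rep])
    have "\<sigma> (\<iota> (b \<alpha> i l)) \<xi> = defect (\<lambda>\<alpha> i j. \<sigma> (\<iota> (u \<alpha> i j))) \<alpha> \<xi> i l" if "\<alpha> \<in> E" "i < N \<alpha>" "l < N \<alpha>" for \<alpha> i l
      using that E(2) \<xi> R.rep_diff[OF \<xi>, of "u \<alpha> i l" "counit (u \<alpha> i l) *\<^sub>C 1"]
      by (simp add: b_def defect_counit subset_iff R.rep_scale R.rep_one)
    then show ?thesis
      unfolding h_def total_defect_def R.rep_sum[OF \<xi>] cinner_sum_right of_real_sum
      by (intro sum.cong refl) (simp add: R.rep_square[OF \<xi>] del: of_real_power)
  qed
  define k0 where "k0 = \<iota> h - complex_of_real (\<delta> / 2) *\<^sub>C 1"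
  \<comment> \<open>Scaled so that the norm of k is at most 1, as the absolute value requires.\<close>
  define r where "r = 1 / (norm k0 + 1)"
  have r: "r > 0" by (simp add: r_def add_nonneg_pos)
  define k where "k = complex_of_real r *\<^sub>C k0"
  have k_star: "star k = k" by (simp add: k_def k0_def star_scaleC star_diff h_star flip: iota_star)
  have "norm k = r * norm k0" using r by (simp add: k_def norm_scaleC)
  also have "\<dots> = norm k0 / (norm k0 + 1)" by (simp add: r_def)
  also have "\<dots> \<le> 1" by (simp add: divide_le_eq add_nonneg_pos)
  finally obtain g where g: "norm (1 - g) \<le> 1" "g * g = k * k" "g * k = k * g"
    using cstar_absolute_value[OF k_star] by metis
  define z where "z = g - k"
  have kill: "z \<in> point_kernel D" if D: "D \<in> spectrum" "D \<noteq> ?t" for D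
  proof -
    obtain K \<sigma> where irr: "irreducible_rep K \<sigma>" and mem: "(K, \<sigma>) \<in> D" and ker: "point_kernel D = rep_kernel K \<sigma>"
      by (rule spectrum_point[OF D(1)])
    have rep: "star_rep K \<sigma>" using irr by (simp add: irreducible_rep_def)
    interpret R: representation K \<sigma> by unfold_locales (rule rep)
    have "\<sigma> z \<xi> = 0" if \<xi>: "\<xi> \<in> K" for \<xi>
    proof -
      define w where "w = \<sigma> z \<xi>"
      have w: "w \<in> K" by (simp add: w_def R.op_mem \<xi>)
      \<comment> \<open>On the range of z the operator of g + k is 0, but it is also bounded below by the gap.\<close>
      have "(g + k) * z = 0" using g by (simp add: z_def algebra_simps)
      then have "\<sigma> (g + k) w = 0" using R.rep_mult[OF \<xi>, of "g + k" z] by (simp add: w_def R.rep_zero \<xi>)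
      then have "Re (cinner w (\<sigma> g w)) + Re (cinner w (\<sigma> k w)) = 0"
        by (metis R.rep_add[OF w] cinner_add_right cinner_zero_right plus_complex.sel(1) zero_complex.sel(1))
      moreover have "0 \<le> Re (cinner w (\<sigma> g w))"
      proof -
        have "cmod (cinner w (\<sigma> (1 - g) w)) \<le> norm w * norm (\<sigma> (1 - g) w)" by (rule cinner_Cauchy_Schwarz)
        also have "\<dots> \<le> norm w * (norm (1 - g) * norm w)"
          by (intro mult_left_mono star_rep_contractive[OF rep w]) simp
        also have "\<dots> \<le> norm w * (1 * norm w)" using g(1) by (intro mult_left_mono mult_right_mono) auto
        finally have "Re (cinner w (\<sigma> (1 - g) w)) \<le> (norm w)\<^sup>2"
          using complex_Re_le_cmod order_trans by (fastforce simp: power2_eq_square)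
        then show ?thesis by (simp add: R.rep_diff w R.rep_one cinner_diff_right cinner_self_norm)
      qed
      moreover have "r * (\<delta> / 2) * (norm w)\<^sup>2 \<le> Re (cinner w (\<sigma> k w))"
      proof -
        have "cinner w (\<sigma> k w) = of_real (r * (total_defect \<sigma> E w - \<delta> / 2 * (norm w)\<^sup>2))"
          by (simp add: k_def k0_def R.rep_scale R.rep_diff R.rep_one w cinner_scaleC_right cinner_diff_right
              h_rep[OF rep w] cinner_self_norm)
        then have "Re (cinner w (\<sigma> k w)) = r * (total_defect \<sigma> E w - \<delta> / 2 * (norm w)\<^sup>2)" by simp
        moreover have "\<delta> / 2 * (norm w)\<^sup>2 \<le> total_defect \<sigma> E w - \<delta> / 2 * (norm w)\<^sup>2"
        proof -
          have "\<delta> * (norm w)\<^sup>2 \<le> total_defect \<sigma> E w" using gap D mem irr w by blast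
          then show ?thesis by simp
        qed
        ultimately show ?thesis using r by (simp add: mult.assoc)
      qed
      ultimately have "r * (\<delta> / 2) * (norm w)\<^sup>2 \<le> 0" by simp
      then have "(norm w)\<^sup>2 \<le> 0" using r \<open>\<delta> > 0\<close> by (simp add: mult_le_0_iff)
      then show ?thesis by (simp add: w_def)
    qed
    then show ?thesis by (simp add: ker rep_kernel_def)
  qed
  have nonzero: "\<chi>\<^sub>0 z \<noteq> 0"
  proof
    \<comment> \<open>The counit of k is negative, while that of g lies in the unit disc around 1.\<close>
    assume "\<chi>\<^sub>0 z = 0"
    then have "\<chi>\<^sub>0 g = \<chi>\<^sub>0 k" by (simp add: z_def clinear_diff[OF chi_linear])
    also have "\<dots> = - of_real (r * (\<delta> / 2))"
      by (simp add: k_def k0_def clinear_scaleC[OF chi_linear] clinear_diff[OF chi_linear] chi_one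
          counit_max_iota h_counit)
    finally have "\<chi>\<^sub>0 (1 - g) = of_real (1 + r * (\<delta> / 2))" by (simp add: clinear_diff[OF chi_linear] chi_one)
    then have "cmod (\<chi>\<^sub>0 (1 - g)) = \<bar>1 + r * (\<delta> / 2)\<bar>" by (simp only: norm_of_real)
    moreover have "0 < r * (\<delta> / 2)" using r \<open>\<delta> > 0\<close> by simp
    ultimately show False using counit_max_norm_le[of "1 - g"] g(1) by linarith
  qed
  have "z \<in> (\<Inter>D\<in>spectrum - {?t}. point_kernel D)" using kill by blast
  moreover have "z \<notin> point_kernel ?t" using nonzero by (simp add: trivial_point_kernel)
  ultimately have "\<not> (\<Inter>D\<in>spectrum - {?t}. point_kernel D) \<subseteq> point_kernel ?t" by (meson subsetD)
  then have "?t \<notin> jacobson_closure (spectrum - {?t})" by (simp add: jacobson_closure_def)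
  moreover have "jacobson_closure (spectrum - {?t}) \<subseteq> spectrum" by (auto simp: jacobson_closure_def)
  moreover have "spectrum - {?t} \<subseteq> jacobson_closure (spectrum - {?t})"
    by (rule jacobson_closure_subset) blast
  ultimately have "jacobson_closure (spectrum - {?t}) = spectrum - {?t}" by blast
  then show ?thesis using trivial_point_spectrum by (simp add: openin_jacobson jacobson_open_def)
qed

end

theorem theorem4p9:
  fixes comult :: "'a::complex_star_algebra \<Rightarrow> ('a \<times> 'a) list"
    and counit :: "'a \<Rightarrow> complex"
    and antipode :: "'a \<Rightarrow> 'a"
    and haar :: "'a \<Rightarrow> complex"
    and Irr :: "'i set"
    and N :: "'i \<Rightarrow> nat"
    and u :: "'i \<Rightarrow> nat \<Rightarrow> nat \<Rightarrow> 'a"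
    and \<iota> :: "'a \<Rightarrow> 'c::cstar_algebra"
  assumes "compact_quantum_group comult counit antipode haar"
    and "irr_representatives comult Irr N u"
    and "countable Irr"
    and "universal_enveloping \<iota>"
  shows "dual_property_T haar Irr N u \<longleftrightarrow>
         openin jacobson_topology {trivial_point counit \<iota>}"
proof -
  interpret universal_cqg comult counit antipode haar Irr N u \<iota>
    using assms by (simp add: universal_cqg_def irreducible_coreps_def universal_cqg_axioms_def irreducible_coreps_axioms_def)
  show ?thesis using property_T_imp_isolated isolated_imp_property_T by blast
qed

end
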